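(* Let $\mathcal O$ be a $W$-conjugacy class of $\tilde W$ with $\mathcal O\subseteq\tilde W_G\sigma$ for some $\sigma\in\Omega'$. The following are equivalent: (1) $\mathcal O$ is nice; (2) for some (equivalently, any) $y\in\mathcal O$, $s_H(V_y)=V_y$ for every $H\in\mathfrak H(\nu_y)$ with $H\cap V_y\neq\emptyset$, where $\mathfrak H(\nu_y)=\{H_{\alpha,k}:\alpha\in\Phi,\langle\nu_y,\alpha\rangle=0,k\in\mathbb Z\}$ and $s_H$ is the reflection in $H$; (3) for some (equivalently, any) $y\in\mathcal O$ with $\nu_y=\nu_{\mathcal O}$, the finite part $\bar y$ is a weakly elliptic element of $W_{J_{\mathcal O}}\rtimes\langle\sigma\rangle$.
   Context: Setting: $G$ connected complex reductive, maximal torus, reduced root system $\Phi$ with simple roots $\alpha_i$ ($i\in S_0$), finite Weyl group $W_0$; $Q\subset P$ coroot and coweight lattices; $V=P\otimes\mathbb R$; $\Omega'$ finite group of diagram automorphisms inducing automorphisms of $G$; $\tilde W_G=P\rtimes W_0$, $W=W_G=Q\rtimes W_0$ (Coxeter group with affine simple reflections $S$), $\tilde W=\tilde W_G\rtimes\Omega'=P\rtimes(W_0\rtimes\Omega')$ acting affinely on $V$. $H_{\alpha,k}=\{x:\langle x,\alpha\rangle=k\}$; $\ell$ = number of such hyperplanes separating the fundamental alcove and its image. Newton point $\nu_y=\lambda/n$ if $y^n=t^\lambda$; $\nu_{\mathcal O}$ = dominant $W_0$-conjugate of $\nu_y$ ($y\in\mathcal O$); $V_y=\{v:y(v)=v+\nu_y\}$;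 $J_{\mathcal O}=\{i\in S_0:\langle\nu_{\mathcal O},\alpha_i\rangle=0\}$ (then $\sigma(J_{\mathcal O})=J_{\mathcal O}$). The finite part $\bar y$ is the image of $y$ under $\tilde W=P\rtimes(W_0\rtimes\Omega')\to W_0\rtimes\Omega'$. For a Coxeter group $(W_1,S_1)$ with automorphism group $\Gamma$ preserving $S_1$: supp of $w\gamma$ is $\bigcup_n\gamma^n(\mathrm{supp}(w))$; an element $z$ of $W_1\rtimes\Gamma$ (with $W_1$ finite) is weakly elliptic if for every $W_1$-conjugate $z'$ of $z$, $\mathrm{supp}(z')$ is a union of connected components of the Dynkin diagram of $S_1$ and $z'$ commutes with every element of $S_1-\mathrm{supp}(z')$. Nice: for $\tilde w$ of minimal length in its $W$-conjugacy class, a path from $\tilde w$ is a sequence $(s_1,\dots,s_r)$ in $S$ with $\ell(s_i\cdots s_1\tilde ws_1\cdots s_i)\le\ell(s_{i-1}\cdots s_1\tilde ws_1\cdots s_{i-1})$ for all $i$; with $W_{\tilde w}=\{x\in W:\ell(x^{-1}\tilde wx)=\ell(\tilde w)\}$, the class $\mathcal O$ is nice if for some (equivalently any) minimal length $\tilde w\in\mathcal O$ every $x\in W_{\tilde w}$ is $s_1\cdots s_r$ for some path $(s_1,\dots,s_r)$ from $\tilde w$. *)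

theory Defs
  imports "HOL-Analysis.Analysis"
begin

(* Conventions.
   V is a finite-dimensional real vector space 'v (euclidean_space is used only to get
   finite dimension; the inner product is never used).
   Roots are linear functionals 'v => real; <x,alpha> is written  alpha x.
   cor :: ('v => real) => 'v  is the coroot map alpha |-> alpha^vee.
   Delta is the set of simple roots (playing the role of S_0).
   P is the coweight (cocharacter) lattice, Q the coroot lattice.
   Elements of the extended affine Weyl group are represented as the affine maps V -> V. *)

definition sref :: "((('v::real_vector) \<Rightarrow> real) \<Rightarrow> 'v) \<Rightarrow> ('v \<Rightarrow> real) \<Rightarrow> 'v \<Rightarrow> 'v" where
  "sref cor \<alpha> x = x - (\<alpha> x) *\<^sub>R cor \<alpha>"

definition aref :: "((('v::real_vector) \<Rightarrow> real) \<Rightarrow> 'v) \<Rightarrow> ('v \<Rightarrow> real) \<Rightarrow> int \<Rightarrow> 'v \<Rightarrow> 'v" where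
  "aref cor \<alpha> k x = x - (\<alpha> x - of_int k) *\<^sub>R cor \<alpha>"

definition hyp :: "('v \<Rightarrow> real) \<Rightarrow> int \<Rightarrow> 'v set" where
  "hyp \<alpha> k = {x. \<alpha> x = of_int k}"

definition full_lattice :: "('v::euclidean_space) set \<Rightarrow> bool" where
  "full_lattice L \<longleftrightarrow> (\<exists>B. independent B \<and> span B = UNIV \<and>
      L = {(\<Sum>b\<in>B. of_int (c b) *\<^sub>R b) | c :: 'v \<Rightarrow> int. True})"

definition root_datum ::
  "(('v::euclidean_space) \<Rightarrow> real) set \<Rightarrow> (('v \<Rightarrow> real) \<Rightarrow> 'v) \<Rightarrow> 'v set \<Rightarrow> ('v \<Rightarrow> real) set \<Rightarrow> bool" where
  "root_datum \<Phi> cor P \<Delta> \<longleftrightarrow>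
     finite \<Phi> \<and> (\<forall>\<alpha>\<in>\<Phi>. linear \<alpha>) \<and> inj_on cor \<Phi> \<and>
     (\<forall>\<alpha>\<in>\<Phi>. \<alpha> (cor \<alpha>) = 2) \<and>
     (\<forall>\<alpha>\<in>\<Phi>. \<forall>\<beta>\<in>\<Phi>. \<beta> \<circ> sref cor \<alpha> \<in> \<Phi>) \<and>
     (\<forall>\<alpha>\<in>\<Phi>. sref cor \<alpha> ` (cor ` \<Phi>) = cor ` \<Phi>) \<and>
     (\<forall>\<alpha>\<in>\<Phi>. \<forall>c::real. (\<lambda>x. c * \<alpha> x) \<in> \<Phi> \<longrightarrow> c = 1 \<or> c = -1) \<and>
     full_lattice P \<and> cor ` \<Phi> \<subseteq> P \<and> (\<forall>\<alpha>\<in>\<Phi>. \<forall>x\<in>P. \<alpha> x \<in> \<int>) \<and>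
     \<Delta> \<subseteq> \<Phi> \<and>
     (\<forall>c. (\<forall>x. (\<Sum>\<beta>\<in>\<Delta>. c \<beta> * \<beta> x) = 0) \<longrightarrow> (\<forall>\<beta>\<in>\<Delta>. c \<beta> = (0::real))) \<and>
     (\<forall>\<alpha>\<in>\<Phi>. \<exists>c :: ('v \<Rightarrow> real) \<Rightarrow> nat.
         \<alpha> = (\<lambda>x. \<Sum>\<beta>\<in>\<Delta>. real (c \<beta>) * \<beta> x) \<or> \<alpha> = (\<lambda>x. - (\<Sum>\<beta>\<in>\<Delta>. real (c \<beta>) * \<beta> x)))"

definition ract :: "('v \<Rightarrow> 'v) \<Rightarrow> ('v \<Rightarrow> real) \<Rightarrow> ('v \<Rightarrow> real)" where
  "ract \<tau> \<alpha> = \<alpha> \<circ> inv \<tau>"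

definition diagram_aut ::
  "(('v::euclidean_space) \<Rightarrow> real) set \<Rightarrow> (('v \<Rightarrow> real) \<Rightarrow> 'v) \<Rightarrow> 'v set \<Rightarrow> ('v \<Rightarrow> real) set \<Rightarrow> ('v \<Rightarrow> 'v) \<Rightarrow> bool" where
  "diagram_aut \<Phi> cor P \<Delta> \<sigma> \<longleftrightarrow> linear \<sigma> \<and> bij \<sigma> \<and> \<sigma> ` P = P \<and>
     ract \<sigma> ` \<Phi> = \<Phi> \<and> ract \<sigma> ` \<Delta> = \<Delta> \<and> (\<forall>\<alpha>\<in>\<Phi>. cor (ract \<sigma> \<alpha>) = \<sigma> (cor \<alpha>))"

definition omega_group ::
  "(('v::euclidean_space) \<Rightarrow> real) set \<Rightarrow> (('v \<Rightarrow> real) \<Rightarrow> 'v) \<Rightarrow> 'v set \<Rightarrow> ('v \<Rightarrow> real) set \<Rightarrow> ('v \<Rightarrow> 'v) set \<Rightarrow> bool" where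
  "omega_group \<Phi> cor P \<Delta> \<Omega> \<longleftrightarrow> finite \<Omega> \<and> id \<in> \<Omega> \<and>
     (\<forall>\<sigma>\<in>\<Omega>. \<forall>\<tau>\<in>\<Omega>. \<sigma> \<circ> \<tau> \<in> \<Omega>) \<and> (\<forall>\<sigma>\<in>\<Omega>. inv \<sigma> \<in> \<Omega>) \<and>
     (\<forall>\<sigma>\<in>\<Omega>. diagram_aut \<Phi> cor P \<Delta> \<sigma>)"

(* group generated by a set T of involutions (subgroup of the maps V -> V) *)
inductive_set gen :: "('v \<Rightarrow> 'v) set \<Rightarrow> ('v \<Rightarrow> 'v) set" for T where
  gen_id: "id \<in> gen T"
| gen_step: "f \<in> gen T \<Longrightarrow> t \<in> T \<Longrightarrow> t \<circ> f \<in> gen T"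

definition W0 :: "(('v::real_vector) \<Rightarrow> real) set \<Rightarrow> (('v \<Rightarrow> real) \<Rightarrow> 'v) \<Rightarrow> ('v \<Rightarrow> 'v) set" where
  "W0 \<Phi> cor = gen (sref cor ` \<Phi>)"

definition Qlat :: "(('v::real_vector) \<Rightarrow> real) set \<Rightarrow> (('v \<Rightarrow> real) \<Rightarrow> 'v) \<Rightarrow> 'v set" where
  "Qlat \<Phi> cor = {(\<Sum>\<alpha>\<in>\<Phi>. of_int (c \<alpha>) *\<^sub>R cor \<alpha>) | c :: ('v \<Rightarrow> real) \<Rightarrow> int. True}"

definition Wt where
  "Wt \<Phi> cor P \<Omega> = {(\<lambda>x. w (\<sigma> x) + t) | w \<sigma> t. w \<in> W0 \<Phi> cor \<and> \<sigma> \<in> \<Omega> \<and> t \<in> P}"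

definition WG where
  "WG \<Phi> cor P = {(\<lambda>x. w x + t) | w t. w \<in> W0 \<Phi> cor \<and> t \<in> P}"

definition Waff where
  "Waff \<Phi> cor = {(\<lambda>x. w x + q) | w q. w \<in> W0 \<Phi> cor \<and> q \<in> Qlat \<Phi> cor}"

definition pos_roots :: "('v \<Rightarrow> real) set \<Rightarrow> ('v \<Rightarrow> real) set \<Rightarrow> ('v \<Rightarrow> real) set" where
  "pos_roots \<Phi> \<Delta> = {\<alpha>\<in>\<Phi>. \<exists>c :: ('v \<Rightarrow> real) \<Rightarrow> nat. \<alpha> = (\<lambda>x. \<Sum>\<beta>\<in>\<Delta>. real (c \<beta>) * \<beta> x)}"

definition alcove :: "('v \<Rightarrow> real) set \<Rightarrow> ('v \<Rightarrow> real) set \<Rightarrow> 'v set" where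
  "alcove \<Phi> \<Delta> = {x. \<forall>\<alpha>\<in>pos_roots \<Phi> \<Delta>. 0 < \<alpha> x \<and> \<alpha> x < 1}"

definition len :: "('v \<Rightarrow> real) set \<Rightarrow> ('v \<Rightarrow> real) set \<Rightarrow> ('v \<Rightarrow> 'v) \<Rightarrow> nat" where
  "len \<Phi> \<Delta> y = card {H. \<exists>\<alpha>\<in>\<Phi>. \<exists>k::int. H = hyp \<alpha> k \<and>
      (((\<forall>a\<in>alcove \<Phi> \<Delta>. \<alpha> a < of_int k) \<and> (\<forall>b\<in>y ` alcove \<Phi> \<Delta>. of_int k < \<alpha> b)) \<or>
       ((\<forall>a\<in>alcove \<Phi> \<Delta>. of_int k < \<alpha> a) \<and> (\<forall>b\<in>y ` alcove \<Phi> \<Delta>. \<alpha> b < of_int k)))}"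

(* affine simple reflections: reflections in the walls of the fundamental alcove,
   i.e. affine reflections s_{alpha,k} such that H_{alpha,k} is the only hyperplane
   separating A and s_{alpha,k}(A) *)
definition Saff where
  "Saff \<Phi> cor \<Delta> = {aref cor \<alpha> k | \<alpha> k. \<alpha> \<in> \<Phi> \<and> len \<Phi> \<Delta> (aref cor \<alpha> k) = 1}"

definition conj_seq :: "('v \<Rightarrow> 'v) \<Rightarrow> ('v \<Rightarrow> 'v) list \<Rightarrow> ('v \<Rightarrow> 'v)" where
  "conj_seq w ss = foldl (\<lambda>u s. s \<circ> u \<circ> s) w ss"

definition is_path where
  "is_path \<Phi> cor \<Delta> w ss \<longleftrightarrow> set ss \<subseteq> Saff \<Phi> cor \<Delta> \<and>
     (\<forall>i < length ss. len \<Phi> \<Delta> (conj_seq w (take (Suc i) ss)) \<le> len \<Phi> \<Delta> (conj_seq w (take i ss)))"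

definition min_length_in where
  "min_length_in \<Phi> \<Delta> Cl w \<longleftrightarrow> w \<in> Cl \<and> (\<forall>y\<in>Cl. len \<Phi> \<Delta> w \<le> len \<Phi> \<Delta> y)"

definition Wstab where
  "Wstab \<Phi> cor \<Delta> w = {x \<in> Waff \<Phi> cor. len \<Phi> \<Delta> (inv x \<circ> w \<circ> x) = len \<Phi> \<Delta> w}"

definition nice where
  "nice \<Phi> cor \<Delta> Cl \<longleftrightarrow> (\<exists>w. min_length_in \<Phi> \<Delta> Cl w \<and>
     (\<forall>x\<in>Wstab \<Phi> cor \<Delta> w. \<exists>ss. is_path \<Phi> cor \<Delta> w ss \<and> x = foldr (\<circ>) ss id))"

definition newton :: "(('v::real_vector) \<Rightarrow> 'v) \<Rightarrow> 'v" where
  "newton y = (THE v. \<exists>n>0. \<exists>t. (y ^^ n) = (\<lambda>x. x + t) \<and> v = (1 / real n) *\<^sub>R t)"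

definition nuO where
  "nuO \<Phi> cor \<Delta> Cl = (THE v. (\<forall>\<alpha>\<in>\<Delta>. 0 \<le> \<alpha> v) \<and> (\<exists>y\<in>Cl. \<exists>w\<in>W0 \<Phi> cor. v = w (newton y)))"

definition Vy :: "(('v::real_vector) \<Rightarrow> 'v) \<Rightarrow> 'v set" where
  "Vy y = {v. y v = v + newton y}"

definition JO where
  "JO \<Phi> cor \<Delta> Cl = {\<alpha>\<in>\<Delta>. \<alpha> (nuO \<Phi> cor \<Delta> Cl) = 0}"

definition fin :: "(('v::real_vector) \<Rightarrow> 'v) \<Rightarrow> 'v \<Rightarrow> 'v" where
  "fin y = (\<lambda>x. y x - y 0)"

definition cond2 where
  "cond2 \<Phi> cor y \<longleftrightarrow> (\<forall>\<alpha>\<in>\<Phi>. \<forall>k::int. \<alpha> (newton y) = 0 \<longrightarrow> hyp \<alpha> k \<inter> Vy y \<noteq> {} \<longrightarrow>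
       aref cor \<alpha> k ` Vy y = Vy y)"

definition WJ :: "((('v::real_vector) \<Rightarrow> real) \<Rightarrow> 'v) \<Rightarrow> ('v \<Rightarrow> real) set \<Rightarrow> ('v \<Rightarrow> 'v) set" where
  "WJ cor J = gen (sref cor ` J)"

definition prodw :: "((('v::real_vector) \<Rightarrow> real) \<Rightarrow> 'v) \<Rightarrow> ('v \<Rightarrow> real) list \<Rightarrow> ('v \<Rightarrow> 'v)" where
  "prodw cor ss = foldr (\<lambda>\<alpha> f. sref cor \<alpha> \<circ> f) ss id"

definition reduced_word :: "((('v::real_vector) \<Rightarrow> real) \<Rightarrow> 'v) \<Rightarrow> ('v \<Rightarrow> real) set \<Rightarrow> ('v \<Rightarrow> 'v) \<Rightarrow> ('v \<Rightarrow> real) list \<Rightarrow> bool" where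
  "reduced_word cor J w ss \<longleftrightarrow> set ss \<subseteq> J \<and> prodw cor ss = w \<and>
     (\<forall>ts. set ts \<subseteq> J \<and> prodw cor ts = w \<longrightarrow> length ss \<le> length ts)"

definition supp :: "((('v::real_vector) \<Rightarrow> real) \<Rightarrow> 'v) \<Rightarrow> ('v \<Rightarrow> real) set \<Rightarrow> ('v \<Rightarrow> 'v) \<Rightarrow> ('v \<Rightarrow> real) set" where
  "supp cor J w = {\<alpha>. \<exists>ss. reduced_word cor J w ss \<and> \<alpha> \<in> set ss}"

definition WJsig :: "((('v::real_vector) \<Rightarrow> real) \<Rightarrow> 'v) \<Rightarrow> ('v \<Rightarrow> real) set \<Rightarrow> ('v \<Rightarrow> 'v) \<Rightarrow> ('v \<Rightarrow> 'v) set" where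
  "WJsig cor J \<sigma> = {w \<circ> (\<sigma> ^^ m) | w m. w \<in> WJ cor J}"

definition tsupp :: "((('v::real_vector) \<Rightarrow> real) \<Rightarrow> 'v) \<Rightarrow> ('v \<Rightarrow> real) set \<Rightarrow> ('v \<Rightarrow> 'v) \<Rightarrow> ('v \<Rightarrow> 'v) \<Rightarrow> ('v \<Rightarrow> real) set" where
  "tsupp cor J \<sigma> z = \<Union>{(\<Union>n. ract (\<sigma> ^^ n) ` supp cor J w) | w m. w \<in> WJ cor J \<and> z = w \<circ> (\<sigma> ^^ m)}"

definition dyn_edge where
  "dyn_edge cor J = {(a, b). a \<in> J \<and> b \<in> J \<and> a \<noteq> b \<and> a (cor b) \<noteq> 0}"

definition union_of_components where
  "union_of_components cor J K \<longleftrightarrow> K \<subseteq> J \<and> (\<forall>a\<in>K. \<forall>b. (a, b) \<in> (dyn_edge cor J)\<^sup>* \<longrightarrow> b \<in> K)"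

definition weakly_elliptic :: "((('v::real_vector) \<Rightarrow> real) \<Rightarrow> 'v) \<Rightarrow> ('v \<Rightarrow> real) set \<Rightarrow> ('v \<Rightarrow> 'v) \<Rightarrow> ('v \<Rightarrow> 'v) \<Rightarrow> bool" where
  "weakly_elliptic cor J \<sigma> z \<longleftrightarrow> z \<in> WJsig cor J \<sigma> \<and>
     (\<forall>x\<in>WJ cor J. let z' = x \<circ> z \<circ> inv x; K = tsupp cor J \<sigma> z' in
        union_of_components cor J K \<and> (\<forall>\<alpha>\<in>J - K. z' \<circ> sref cor \<alpha> = sref cor \<alpha> \<circ> z'))"

end

theory Submission
  imports Defs
begin

text \<open>
  Conjugating \<open>w\<close> by \<open>g\<close> has length the number \<open>F\<close> of hyperplanes separating the alcove \<open>g A\<close> from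
  \<open>w g A\<close>, so the class is nice iff the set of alcoves minimizing the displacement \<open>F\<close> is connected
  by galleries.  Writing \<open>z\<close> for the finite part and \<open>V^z\<close> for its fixed space, condition (2) says
  that every root orthogonal to the Newton point is either fixed by \<open>z\<close> or vanishes on \<open>V^z\<close>.

  The displacement does not increase along a geodesic from \<open>C\<close> to \<open>w C\<close> (cyclic shift), hence not
  along the iterates of \<open>T x = (2 x + w x) / 3\<close>, which contract towards the set \<open>V_w\<close>.  Given condition
  (2), take a generic path between two alcoves and apply a high power of \<open>T\<close>: for each root the
  values along the \<open>w\<close>-orbit are then dominated by their lowest frequency, which forces that every
  hyperplane is crossed without increasing \<open>F\<close>.  This gives connectedness.  Conversely the
  hyperplanes violating (2) never separate a minimal alcove from its image, so a gallery of minimal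
  alcoves cannot cross them, whereas a translation commuting with \<open>w\<close> does.

  For (3), the simple roots of \<open>J\<close> fixed by a conjugate \<open>z'\<close> and those vanishing on its fixed space
  are mutually orthogonal, and the latter form the support of \<open>z'\<close>.
\<close>

section \<open>Avoiding countably many hyperplanes\<close>

text \<open>The weights 2/3 and 1/3 of \<open>T\<close> come from its spectrum: a component of
  frequency \<zeta>, a root of unity, is multiplied by (2 + \<zeta>)/3. This is never 0, so
  \<open>T\<close> is invertible and genericity survives all iterates, whereas the midpoint map
  would kill \<zeta> = -1. Its modulus decreases strictly with the distance of \<zeta> from 1, so
  pairs of conjugate frequencies are strictly ordered by their rate of decay. The obstacle is that
  being close to V_w does not settle everything. A root vanishing on V^z is constant on V_w, so V_w
  may lie inside one of its hyperplanes, and there is no drift to tell on which side the image of a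
  nearby point lies. The lowest frequency replaces the drift: where the root takes the value of that
  hyperplane, its values at the image and at the preimage lie on opposite sides, unless the
  frequency is -1, and then the sides are exchanged. In each case the image or the preimage lies
  beyond the wall, so the crossing follows a geodesic. Genericity keeps the leading Fourier
  coefficient away from 0 uniformly along a segment.\<close>

lemma linear_functional_inner:
  fixes f :: "'v::euclidean_space \<Rightarrow> real"
  assumes "linear f"
  shows "f x = (\<Sum>b\<in>Basis. f b *\<^sub>R b) \<bullet> x"
proof -
  have "f x = f (\<Sum>b\<in>Basis. (x \<bullet> b) *\<^sub>R b)" by (simp add: euclidean_representation)
  also have "\<dots> = (\<Sum>b\<in>Basis. (x \<bullet> b) * f b)"
    using assms by (simp add: linear_sum linear_scale)
  also have "\<dots> = (\<Sum>b\<in>Basis. f b *\<^sub>R b) \<bullet> x"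
    by (simp add: inner_sum_left inner_commute[of x] mult.commute[of "f _"])
  finally show ?thesis .
qed

lemma negligible_level_set:
  fixes f :: "'v::euclidean_space \<Rightarrow> real"
  assumes "linear f" "f e \<noteq> 0"
  shows "negligible {x. f x = c}"
proof -
  have "(\<Sum>b\<in>Basis. f b *\<^sub>R b) \<noteq> 0"
    using assms(2) linear_functional_inner[OF assms(1), of e] by (metis inner_zero_left)
  then have "negligible {x. (\<Sum>b\<in>Basis. f b *\<^sub>R b) \<bullet> x = c}"
    by (intro negligible_hyperplane) auto
  moreover have "{x. f x = c} = {x. (\<Sum>b\<in>Basis. f b *\<^sub>R b) \<bullet> x = c}"
    by (rule Collect_cong) (metis linear_functional_inner[OF assms(1)])
  ultimately show ?thesis by simp
qed

text \<open>Hyperplanes have measure zero, so countably many of them cannot cover a nonempty open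
  set. A pair \<open>(f, c)\<close> stands for the level set \<open>f = c\<close>; the genericity
  conditions below are brought into this form.\<close>

lemma generic_point:
  fixes U :: "'v::euclidean_space set" and F :: "(('v \<Rightarrow> real) \<times> real) set"
  assumes "open U" "U \<noteq> {}" "countable F"
    and "\<And>f c. (f, c) \<in> F \<Longrightarrow> linear f \<and> (\<exists>e. f e \<noteq> 0)"
  shows "\<exists>x\<in>U. \<forall>p\<in>F. fst p x \<noteq> snd p"
proof (rule ccontr)
  assume "\<not> ?thesis"
  then have "U \<subseteq> (\<Union>p\<in>F. {x. fst p x = snd p})"
    by (auto simp: split_beta)
  moreover have "negligible (\<Union>p\<in>F. {x. fst p x = snd p})"
  proof -
    have "negligible {x. fst p x = snd p}" if "p \<in> F" for p
      using assms(4)[of "fst p" "snd p"] that negligible_level_set[of "fst p"] by (metis prod.collapse)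
    then show ?thesis
      using assms(3) by (auto intro!: negligible_countable_Union)
  qed
  ultimately have "negligible U" by (rule negligible_subset[rotated])
  then show False using assms(1,2) open_not_negligible by blast
qed

section \<open>Root data\<close>

locale rdatum =
  fixes \<Phi> :: "(('v::euclidean_space) \<Rightarrow> real) set"
    and cor :: "('v \<Rightarrow> real) \<Rightarrow> 'v"
    and P :: "'v set"
    and \<Delta> :: "('v \<Rightarrow> real) set"
  assumes rd: "root_datum \<Phi> cor P \<Delta>"
begin

lemma finite_roots: "finite \<Phi>"
  and linear_root: "\<alpha> \<in> \<Phi> \<Longrightarrow> linear \<alpha>"
  and inj_cor: "inj_on cor \<Phi>"
  and root_cor_self [simp]: "\<alpha> \<in> \<Phi> \<Longrightarrow> \<alpha> (cor \<alpha>) = 2"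
  and root_sref: "\<alpha> \<in> \<Phi> \<Longrightarrow> \<beta> \<in> \<Phi> \<Longrightarrow> \<beta> \<circ> sref cor \<alpha> \<in> \<Phi>"
  and cor_sref: "\<alpha> \<in> \<Phi> \<Longrightarrow> sref cor \<alpha> ` (cor ` \<Phi>) = cor ` \<Phi>"
  and reduced: "\<alpha> \<in> \<Phi> \<Longrightarrow> (\<lambda>x. c * \<alpha> x) \<in> \<Phi> \<Longrightarrow> c = 1 \<or> c = -1"
  and cor_in_P: "\<alpha> \<in> \<Phi> \<Longrightarrow> cor \<alpha> \<in> P"
  and root_P_int: "\<alpha> \<in> \<Phi> \<Longrightarrow> x \<in> P \<Longrightarrow> \<alpha> x \<in> \<int>"
  and simple_root: "\<alpha> \<in> \<Delta> \<Longrightarrow> \<alpha> \<in> \<Phi>"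
proof -
  note r1 = rd[unfolded root_datum_def]
  note r2 = conjunct2[OF r1] note r3 = conjunct2[OF r2] note r4 = conjunct2[OF r3]
  note r5 = conjunct2[OF r4] note r6 = conjunct2[OF r5] note r7 = conjunct2[OF r6]
  note r8 = conjunct2[OF r7] note r9 = conjunct2[OF r8] note r10 = conjunct2[OF r9]
  note r11 = conjunct2[OF r10]
  note a = conjunct1[OF r1] conjunct1[OF r2] conjunct1[OF r3] conjunct1[OF r4] conjunct1[OF r5]
    conjunct1[OF r6] conjunct1[OF r7] conjunct1[OF r9] conjunct1[OF r10] conjunct1[OF r11]
  show "finite \<Phi>" "inj_on cor \<Phi>" by (fact a)+
  show "linear \<alpha>" "\<alpha> (cor \<alpha>) = 2" "sref cor \<alpha> ` (cor ` \<Phi>) = cor ` \<Phi>" "cor \<alpha> \<in> P" if "\<alpha> \<in> \<Phi>"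
    using a(2,4,6,8) that by blast+
  show "\<beta> \<circ> sref cor \<alpha> \<in> \<Phi>" if "\<alpha> \<in> \<Phi>" "\<beta> \<in> \<Phi>" using a(5)[rule_format, OF that] .
  show "c = 1 \<or> c = -1" if "\<alpha> \<in> \<Phi>" "(\<lambda>x. c * \<alpha> x) \<in> \<Phi>" using a(7)[rule_format, OF that] .
  show "\<alpha> x \<in> \<int>" if "\<alpha> \<in> \<Phi>" "x \<in> P" using a(9)[rule_format, OF that] .
  show "\<alpha> \<in> \<Phi>" if "\<alpha> \<in> \<Delta>" using a(10) that by auto
qed

lemma simple_independent:
  assumes "\<And>x. (\<Sum>\<beta>\<in>\<Delta>. m \<beta> * \<beta> x) = 0" "\<beta> \<in> \<Delta>"
  shows "m \<beta> = (0::real)"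
proof -
  have "\<forall>c. (\<forall>x. (\<Sum>\<beta>\<in>\<Delta>. c \<beta> * \<beta> x) = 0) \<longrightarrow> (\<forall>\<beta>\<in>\<Delta>. c \<beta> = (0::real))"
    using rd unfolding root_datum_def by (elim conjE)
  then show ?thesis using assms by blast
qed

lemma root_expansion:
  assumes "\<alpha> \<in> \<Phi>"
  shows "\<exists>c :: ('v \<Rightarrow> real) \<Rightarrow> nat.
    \<alpha> = (\<lambda>x. \<Sum>\<beta>\<in>\<Delta>. real (c \<beta>) * \<beta> x) \<or> \<alpha> = (\<lambda>x. - (\<Sum>\<beta>\<in>\<Delta>. real (c \<beta>) * \<beta> x))"
proof -
  have "\<forall>\<alpha>\<in>\<Phi>. \<exists>c :: ('v \<Rightarrow> real) \<Rightarrow> nat.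
    \<alpha> = (\<lambda>x. \<Sum>\<beta>\<in>\<Delta>. real (c \<beta>) * \<beta> x) \<or> \<alpha> = (\<lambda>x. - (\<Sum>\<beta>\<in>\<Delta>. real (c \<beta>) * \<beta> x))"
    using rd unfolding root_datum_def by (elim conjE)
  then show ?thesis using assms by blast
qed

lemma finite_simple: "finite \<Delta>"
  using finite_roots simple_root by (meson finite_subset subsetI)

lemma cartan_int: "\<alpha> \<in> \<Phi> \<Longrightarrow> \<beta> \<in> \<Phi> \<Longrightarrow> \<beta> (cor \<alpha>) \<in> \<int>"
  using cor_in_P root_P_int by blast

lemma root_lin:
  assumes "\<alpha> \<in> \<Phi>"
  shows "\<alpha> (x + y) = \<alpha> x + \<alpha> y" "\<alpha> (x - y) = \<alpha> x - \<alpha> y" "\<alpha> (- x) = - \<alpha> x"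
    "\<alpha> (c *\<^sub>R x) = c * \<alpha> x" "\<alpha> 0 = 0"
  using linear_root[OF assms]
  by (simp_all add: linear_add linear_diff linear_neg linear_scale linear_0)

lemma root_sum: "\<alpha> \<in> \<Phi> \<Longrightarrow> \<alpha> (\<Sum>i\<in>I. f i) = (\<Sum>i\<in>I. \<alpha> (f i))"
  using linear_root by (simp add: linear_sum)

lemma linear_sref: "\<alpha> \<in> \<Phi> \<Longrightarrow> linear (sref cor \<alpha>)"
  by (intro linearI) (simp_all add: sref_def root_lin algebra_simps)

lemma sref_sref [simp]: "\<alpha> \<in> \<Phi> \<Longrightarrow> sref cor \<alpha> (sref cor \<alpha> x) = x"
  by (simp add: sref_def root_lin scaleR_2 algebra_simps)

lemma sref_comp_sref [simp]: "\<alpha> \<in> \<Phi> \<Longrightarrow> sref cor \<alpha> \<circ> sref cor \<alpha> = id"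
  by (simp add: fun_eq_iff)

lemma bij_sref: "\<alpha> \<in> \<Phi> \<Longrightarrow> bij (sref cor \<alpha>)"
  using o_bij sref_comp_sref by blast

lemma inv_sref: "\<alpha> \<in> \<Phi> \<Longrightarrow> inv (sref cor \<alpha>) = sref cor \<alpha>"
  by (simp add: inv_unique_comp)

lemma root_comp_sref: "\<beta> \<in> \<Phi> \<Longrightarrow> \<beta> (sref cor \<alpha> x) = \<beta> x - \<alpha> x * \<beta> (cor \<alpha>)"
  by (simp add: sref_def root_lin)

lemma sref_fix: "\<alpha> x = 0 \<Longrightarrow> sref cor \<alpha> x = x"
  by (simp add: sref_def)

section \<open>An invariant form and the equivariance of coroots\<close>

definition nrm :: "('v \<Rightarrow> real) \<Rightarrow> real" where
  "nrm \<alpha> = (\<Sum>c\<in>cor ` \<Phi>. (\<alpha> c)\<^sup>2)"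

lemma nrm_pos: "\<alpha> \<in> \<Phi> \<Longrightarrow> 0 < nrm \<alpha>"
proof -
  assume a: "\<alpha> \<in> \<Phi>"
  have "(\<alpha> (cor \<alpha>))\<^sup>2 \<le> nrm \<alpha>"
    unfolding nrm_def using a finite_roots by (intro member_le_sum) auto
  then show ?thesis using a by simp
qed

text \<open>The coroot is, up to a scalar, the image of the root under the map from functionals to
  vectors induced by the invariant form on functionals given by summing over all coroots.\<close>

lemma coroot_form:
  assumes "\<alpha> \<in> \<Phi>"
  shows "(\<Sum>c\<in>cor ` \<Phi>. \<alpha> c *\<^sub>R c) = (nrm \<alpha> / 2) *\<^sub>R cor \<alpha>"
proof -
  let ?s = "sref cor \<alpha>" and ?X = "\<Sum>c\<in>cor ` \<Phi>. \<alpha> c *\<^sub>R c"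
  have inj: "inj_on ?s (cor ` \<Phi>)" using bij_sref[OF assms] bij_is_inj inj_on_subset by blast
  have "?X = (\<Sum>c\<in>?s ` (cor ` \<Phi>). \<alpha> c *\<^sub>R c)" by (simp only: cor_sref[OF assms])
  also have "\<dots> = (\<Sum>c\<in>cor ` \<Phi>. \<alpha> (?s c) *\<^sub>R ?s c)"
    by (subst sum.reindex[OF inj]) simp
  also have "\<dots> = (\<Sum>c\<in>cor ` \<Phi>. (\<alpha> c)\<^sup>2 *\<^sub>R cor \<alpha> - \<alpha> c *\<^sub>R c)"
    by (intro sum.cong refl)
      (simp add: sref_def root_lin assms algebra_simps power2_eq_square)
  also have "\<dots> = nrm \<alpha> *\<^sub>R cor \<alpha> - ?X"
    by (simp add: sum_subtractf nrm_def scaleR_sum_left)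
  finally have "2 *\<^sub>R ?X = nrm \<alpha> *\<^sub>R cor \<alpha>" by (simp add: scaleR_2 algebra_simps)
  then have "(1/2) *\<^sub>R (2 *\<^sub>R ?X) = (1/2) *\<^sub>R (nrm \<alpha> *\<^sub>R cor \<alpha>)" by simp
  then show ?thesis by simp
qed

text \<open>Up to the positive factors \<open>nrm \<alpha> / 2\<close> and
  \<open>nrm \<beta> / 2\<close>, both numbers are the same value of a symmetric form: the sum of
  \<open>\<alpha> c * \<beta> c\<close> over all coroots \<open>c\<close>.\<close>

lemma cartan_zero_sym:
  assumes "\<alpha> \<in> \<Phi>" "\<beta> \<in> \<Phi>"
  shows "\<beta> (cor \<alpha>) = 0 \<longleftrightarrow> \<alpha> (cor \<beta>) = 0"
proof -
  have *: "\<beta> (cor \<alpha>) * (nrm \<alpha> / 2) = (\<Sum>c\<in>cor ` \<Phi>. \<alpha> c * \<beta> c)" if "\<alpha> \<in> \<Phi>" "\<beta> \<in> \<Phi>" for \<alpha> \<beta>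
  proof -
    have "\<beta> (\<Sum>c\<in>cor ` \<Phi>. \<alpha> c *\<^sub>R c) = (\<Sum>c\<in>cor ` \<Phi>. \<alpha> c * \<beta> c)"
      using that by (simp add: root_sum root_lin)
    then show ?thesis using that by (simp add: coroot_form root_lin mult.commute)
  qed
  have "\<beta> (cor \<alpha>) * (nrm \<alpha> / 2) = \<alpha> (cor \<beta>) * (nrm \<beta> / 2)"
    using *[OF assms] *[OF assms(2,1)] by (simp add: mult.commute)
  then have "\<beta> (cor \<alpha>) * (nrm \<alpha> / 2) = 0 \<longleftrightarrow> \<alpha> (cor \<beta>) * (nrm \<beta> / 2) = 0" by simp
  then show ?thesis using nrm_pos[OF assms(1)] nrm_pos[OF assms(2)] by simp
qed

text \<open>By \<open>coroot_form\<close>, \<open>x\<close> is the sum of the vectors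
  \<open>l c *\<^sub>R c\<close> over all coroots \<open>c\<close>, for one linear combination
  \<open>l\<close> of roots. Hence \<open>l x\<close> is a sum of squares; it is 0 because the roots
  kill \<open>x\<close>, so every \<open>l c\<close> is 0.\<close>

lemma coroot_span_radical:
  assumes x: "x \<in> span (cor ` \<Phi>)" and rad: "\<And>\<alpha>. \<alpha> \<in> \<Phi> \<Longrightarrow> \<alpha> x = 0"
  shows "x = 0"
proof -
  have "finite (cor ` \<Phi>)" using finite_roots by simp
  from x[unfolded span_finite[OF this]] obtain r where "x = (\<Sum>c\<in>cor ` \<Phi>. r c *\<^sub>R c)" by auto
  then have xr: "x = (\<Sum>\<alpha>\<in>\<Phi>. r (cor \<alpha>) *\<^sub>R cor \<alpha>)"
    by (simp add: sum.reindex[OF inj_cor])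
  define l where "l v = (\<Sum>\<alpha>\<in>\<Phi>. r (cor \<alpha>) * (2 / nrm \<alpha>) * \<alpha> v)" for v
  have coreq: "cor \<alpha> = (2 / nrm \<alpha>) *\<^sub>R (\<Sum>c\<in>cor ` \<Phi>. \<alpha> c *\<^sub>R c)" if "\<alpha> \<in> \<Phi>" for \<alpha>
    using coroot_form[OF that] nrm_pos[OF that] by simp
  have "x = (\<Sum>\<alpha>\<in>\<Phi>. r (cor \<alpha>) *\<^sub>R (2 / nrm \<alpha>) *\<^sub>R (\<Sum>c\<in>cor ` \<Phi>. \<alpha> c *\<^sub>R c))"
    unfolding xr by (intro sum.cong refl arg_cong2[where f = scaleR] coreq)
  also have "\<dots> = (\<Sum>\<alpha>\<in>\<Phi>. \<Sum>c\<in>cor ` \<Phi>. (r (cor \<alpha>) * (2 / nrm \<alpha>) * \<alpha> c) *\<^sub>R c)"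
    by (simp add: scaleR_sum_right mult.assoc)
  also have "\<dots> = (\<Sum>c\<in>cor ` \<Phi>. l c *\<^sub>R c)"
    by (subst sum.swap) (simp add: l_def scaleR_sum_left)
  finally have xl: "x = (\<Sum>c\<in>cor ` \<Phi>. l c *\<^sub>R c)" .
  have "linear l"
    unfolding l_def
    by (intro linearI) (simp_all add: root_lin algebra_simps sum.distrib sum_distrib_left add_divide_distrib)
  then have "l x = (\<Sum>c\<in>cor ` \<Phi>. (l c)\<^sup>2)"
    by (subst xl) (simp add: linear_sum linear_scale power2_eq_square)
  moreover have "l x = 0" unfolding l_def by (simp add: rad)
  ultimately have "\<forall>c\<in>cor ` \<Phi>. (l c)\<^sup>2 = 0"
    using finite_roots by (simp add: sum_nonneg_eq_0_iff)
  then show "x = 0" unfolding xl by (intro sum.neutral) auto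
qed

text \<open>The datum makes roots and coroots stable under reflections separately, but does not say
  that \<open>cor\<close> is equivariant. Here \<open>c'\<close> and \<open>cor \<gamma>\<close>
  both give reflections with functional \<gamma>, and the composite \<open>h\<close> of these is the
  transvection adding \<open>\<gamma> x *\<^sub>R u\<close>. As precomposition with \<open>h\<close>
  preserves the finite set of roots, every root kills \<open>u\<close>; as \<open>u\<close> lies in
  the span of the coroots, \<open>u = 0\<close>.\<close>

lemma cor_comp_sref:
  assumes a: "\<alpha> \<in> \<Phi>" and b: "\<beta> \<in> \<Phi>"
  shows "cor (\<beta> \<circ> sref cor \<alpha>) = sref cor \<alpha> (cor \<beta>)"
proof -
  define \<gamma> c' u where "\<gamma> = \<beta> \<circ> sref cor \<alpha>" and "c' = sref cor \<alpha> (cor \<beta>)" and "u = c' - cor \<gamma>"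
  have g: "\<gamma> \<in> \<Phi>" using a b root_sref by (simp add: \<gamma>_def)
  have gc: "\<gamma> c' = 2" using a b by (simp add: \<gamma>_def c'_def)
  have gu: "\<gamma> u = 0" using g gc by (simp add: u_def root_lin)
  define h where "h = sref cor \<alpha> \<circ> sref cor \<beta> \<circ> sref cor \<alpha> \<circ> sref cor \<gamma>"
  have h: "h x = x + \<gamma> x *\<^sub>R u" for x
  proof -
    have s: "sref cor \<alpha> (sref cor \<beta> (sref cor \<alpha> v)) = v - \<gamma> v *\<^sub>R c'" for v
    proof -
      have "sref cor \<alpha> (sref cor \<beta> (sref cor \<alpha> v))
          = sref cor \<alpha> (sref cor \<alpha> v - \<gamma> v *\<^sub>R cor \<beta>)" by (simp add: sref_def \<gamma>_def)
      also have "\<dots> = v - \<gamma> v *\<^sub>R c'"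
        using linear_sref[OF a] a by (simp add: linear_diff linear_scale c'_def)
      finally show ?thesis .
    qed
    show ?thesis using g gc
      by (simp add: h_def s) (simp add: sref_def root_lin u_def algebra_simps scaleR_2)
  qed
  have "\<delta> u = 0" if d: "\<delta> \<in> \<Phi>" for \<delta>
  proof (rule ccontr)
    assume nz: "\<delta> u \<noteq> 0"
    have it: "(\<lambda>x. \<delta> x + real k * \<delta> u * \<gamma> x) \<in> \<Phi>" for k
    proof (induction k)
      case (Suc k)
      let ?d = "\<lambda>x. \<delta> x + real k * \<delta> u * \<gamma> x"
      have "?d \<circ> h \<in> \<Phi>"
        unfolding h_def o_assoc using Suc a b g root_sref by auto
      moreover have "?d \<circ> h = (\<lambda>x. \<delta> x + real (Suc k) * \<delta> u * \<gamma> x)"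
        using d g gu by (auto simp: fun_eq_iff h root_lin algebra_simps)
      ultimately show ?case by simp
    qed (use d in simp)
    have "inj (\<lambda>k x. \<delta> x + real k * \<delta> u * \<gamma> x)"
    proof (rule injI)
      fix k l :: nat
      assume "(\<lambda>x. \<delta> x + real k * \<delta> u * \<gamma> x) = (\<lambda>x. \<delta> x + real l * \<delta> u * \<gamma> x)"
      from fun_cong[OF this, of "cor \<gamma>"] show "k = l" using nz g by simp
    qed
    moreover have "range (\<lambda>k x. \<delta> x + real k * \<delta> u * \<gamma> x) \<subseteq> \<Phi>" using it by auto
    ultimately show False using finite_roots by (meson finite_subset range_inj_infinite)
  qed
  moreover have "u \<in> span (cor ` \<Phi>)"
    unfolding u_def c'_def using b g cor_sref[OF a] by (intro span_diff span_base) auto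
  ultimately have "u = 0" using coroot_span_radical by blast
  then show ?thesis by (simp add: u_def c'_def \<gamma>_def)
qed

lemma root_neg:
  assumes "\<alpha> \<in> \<Phi>"
  shows "(\<lambda>x. - \<alpha> x) \<in> \<Phi>" "cor (\<lambda>x. - \<alpha> x) = - cor \<alpha>"
proof -
  have e: "\<alpha> \<circ> sref cor \<alpha> = (\<lambda>x. - \<alpha> x)" using assms by (simp add: fun_eq_iff root_comp_sref)
  show "(\<lambda>x. - \<alpha> x) \<in> \<Phi>" using root_sref[OF assms assms] e by simp
  show "cor (\<lambda>x. - \<alpha> x) = - cor \<alpha>"
    using cor_comp_sref[OF assms assms] e assms by (simp add: sref_def scaleR_2)
qed

lemma root_nonzero: "\<alpha> \<in> \<Phi> \<Longrightarrow> \<exists>e. \<alpha> e \<noteq> 0"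
  using root_cor_self by (metis zero_neq_numeral)

lemma roots_proportional:
  assumes a: "\<alpha> \<in> \<Phi>" and b: "\<beta> \<in> \<Phi>" and van: "\<And>v. \<alpha> v = 0 \<Longrightarrow> \<beta> v = 0"
  shows "\<beta> = \<alpha> \<or> \<beta> = (\<lambda>x. - \<alpha> x)"
proof -
  define c where "c = \<beta> (cor \<alpha>) / 2"
  have e: "\<beta> = (\<lambda>v. c * \<alpha> v)"
  proof
    fix v
    have "\<beta> (v - (\<alpha> v / 2) *\<^sub>R cor \<alpha>) = 0" using a by (intro van) (simp add: root_lin)
    then show "\<beta> v = c * \<alpha> v" using b by (simp add: root_lin c_def)
  qed
  then have "c = 1 \<or> c = -1" using reduced[OF a, of c] b by simp
  then show ?thesis by (auto simp: e)
qed

subsection \<open>Simple and positive roots\<close>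

text \<open>Independence of the simple roots as functionals becomes independence of the vectors
  \<open>r i\<close> representing them; a linear map prescribed on these vectors is then read back
  as a vector.\<close>

lemma simple_dual: "\<exists>v. \<forall>i\<in>\<Delta>. i v = d i"
proof -
  define r where "r i = (\<Sum>b\<in>Basis. i b *\<^sub>R b)" for i :: "'v \<Rightarrow> real"
  have ir: "i x = r i \<bullet> x" if "i \<in> \<Delta>" for i x
    unfolding r_def by (rule linear_functional_inner[OF linear_root[OF simple_root[OF that]]])
  have inj: "inj_on r \<Delta>" by (rule inj_onI, rule ext) (metis ir)
  have "independent (r ` \<Delta>)"
  proof (rule independent_if_scalars_zero)
    show "finite (r ` \<Delta>)" using finite_simple by simp
    fix f x assume s: "(\<Sum>x\<in>r ` \<Delta>. f x *\<^sub>R x) = 0" and "x \<in> r ` \<Delta>"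
    then obtain i where i: "i \<in> \<Delta>" "x = r i" by auto
    have "(\<Sum>\<beta>\<in>\<Delta>. f (r \<beta>) * \<beta> v) = 0" for v
    proof -
      have "(\<Sum>\<beta>\<in>\<Delta>. f (r \<beta>) * \<beta> v) = (\<Sum>\<beta>\<in>\<Delta>. f (r \<beta>) *\<^sub>R r \<beta>) \<bullet> v"
        unfolding inner_sum_left inner_scaleR_left by (intro sum.cong refl arg_cong2[where f = "(*)"] ir)
      also have "(\<Sum>\<beta>\<in>\<Delta>. f (r \<beta>) *\<^sub>R r \<beta>) = 0" using s by (simp add: sum.reindex[OF inj])
      finally show ?thesis by simp
    qed
    then have "f (r i) = 0" using simple_independent[of "\<lambda>i. f (r i)"] i(1) by blast
    then show "f x = 0" using i(2) by simp
  qed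
  from linear_independent_extend[OF this, of "\<lambda>x. d (inv_into \<Delta> r x)"]
  obtain g :: "'v \<Rightarrow> real" where g: "linear g" "\<forall>x\<in>r ` \<Delta>. g x = d (inv_into \<Delta> r x)"
    by blast
  have "i (\<Sum>b\<in>Basis. g b *\<^sub>R b) = d i" if "i \<in> \<Delta>" for i
  proof -
    have "i (\<Sum>b\<in>Basis. g b *\<^sub>R b) = g (r i)"
      unfolding linear_functional_inner[OF g(1), of "r i"] ir[OF that, of "sum _ _"]
      by (rule inner_commute)
    then show ?thesis using g(2) that inj by simp
  qed
  then show ?thesis by blast
qed

text \<open>Fundamental coweights. They are unique only up to vectors killed by all simple roots,
  since the roots need not span the dual space; hence the choice.\<close>

definition om :: "('v \<Rightarrow> real) \<Rightarrow> 'v" where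
  "om j = (SOME v. \<forall>i\<in>\<Delta>. i v = (if i = j then 1 else 0))"

lemma simple_om: "i \<in> \<Delta> \<Longrightarrow> i (om j) = (if i = j then 1 else 0)"
  unfolding om_def using someI_ex[OF simple_dual[of "\<lambda>i. if i = j then 1 else 0"]] by blast

lemma lincomb_om: "j \<in> \<Delta> \<Longrightarrow> (\<Sum>i\<in>\<Delta>. c i * i (om j)) = (c j :: real)"
  using finite_simple by (simp add: simple_om if_distrib cong: if_cong)

lemma root_om:
  assumes "\<beta> \<in> \<Phi>"
  shows "\<beta> x = (\<Sum>j\<in>\<Delta>. \<beta> (om j) * j x)"
proof -
  obtain c :: "('v \<Rightarrow> real) \<Rightarrow> real" where c: "\<beta> = (\<lambda>x. \<Sum>j\<in>\<Delta>. c j * j x)"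
  proof -
    from root_expansion[OF assms] obtain c :: "('v \<Rightarrow> real) \<Rightarrow> nat" where
      "\<beta> = (\<lambda>x. \<Sum>\<beta>\<in>\<Delta>. real (c \<beta>) * \<beta> x) \<or> \<beta> = (\<lambda>x. - (\<Sum>\<beta>\<in>\<Delta>. real (c \<beta>) * \<beta> x))" by blast
    then show ?thesis
      using that[of "\<lambda>i. real (c i)"] that[of "\<lambda>i. - real (c i)"] by (auto simp: sum_negf)
  qed
  have "\<beta> (om j) = c j" if "j \<in> \<Delta>" for j using that by (subst c) (rule lincomb_om)
  then show ?thesis by (subst c) (auto intro: sum.cong)
qed

text \<open>The numbers \<open>\<beta> (om j)\<close> are the coordinates of \<beta> in the simple
  roots (\<open>root_om\<close>), so positivity can be tested without a witness of
  coefficients.\<close>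

definition pos :: "('v \<Rightarrow> real) \<Rightarrow> bool" where
  "pos \<beta> \<longleftrightarrow> \<beta> \<in> \<Phi> \<and> (\<forall>j\<in>\<Delta>. 0 \<le> \<beta> (om j))"

lemma pos_iff: "pos \<beta> \<longleftrightarrow> \<beta> \<in> pos_roots \<Phi> \<Delta>"
proof
  assume p: "pos \<beta>"
  then have b: "\<beta> \<in> \<Phi>" by (simp add: pos_def)
  from root_expansion[OF b] obtain c :: "('v \<Rightarrow> real) \<Rightarrow> nat" where
    c: "\<beta> = (\<lambda>x. \<Sum>\<beta>\<in>\<Delta>. real (c \<beta>) * \<beta> x) \<or> \<beta> = (\<lambda>x. - (\<Sum>\<beta>\<in>\<Delta>. real (c \<beta>) * \<beta> x))" by blast
  then show "\<beta> \<in> pos_roots \<Phi> \<Delta>"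
  proof
    assume n: "\<beta> = (\<lambda>x. - (\<Sum>\<beta>\<in>\<Delta>. real (c \<beta>) * \<beta> x))"
    have "\<beta> (om j) = - real (c j)" if "j \<in> \<Delta>" for j
      using that by (subst n) (simp add: lincomb_om)
    then have "c j = 0" if "j \<in> \<Delta>" for j using p that by (force simp: pos_def)
    then have "\<beta> = (\<lambda>x. 0)" by (subst n) simp
    then show ?thesis using root_nonzero[OF b] by simp
  qed (use b in \<open>auto simp: pos_roots_def\<close>)
next
  assume "\<beta> \<in> pos_roots \<Phi> \<Delta>"
  then obtain c :: "('v \<Rightarrow> real) \<Rightarrow> nat" where b: "\<beta> \<in> \<Phi>"
    and c: "\<beta> = (\<lambda>x. \<Sum>\<beta>\<in>\<Delta>. real (c \<beta>) * \<beta> x)" by (auto simp: pos_roots_def)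
  have "\<beta> (om j) = real (c j)" if "j \<in> \<Delta>" for j using that by (subst c) (rule lincomb_om)
  then show "pos \<beta>" using b by (simp add: pos_def)
qed

lemma pos_or_neg: "\<beta> \<in> \<Phi> \<Longrightarrow> pos \<beta> \<or> pos (\<lambda>x. - \<beta> x)"
proof -
  assume b: "\<beta> \<in> \<Phi>"
  from root_expansion[OF b] obtain c :: "('v \<Rightarrow> real) \<Rightarrow> nat" where
    "\<beta> = (\<lambda>x. \<Sum>\<beta>\<in>\<Delta>. real (c \<beta>) * \<beta> x) \<or> \<beta> = (\<lambda>x. - (\<Sum>\<beta>\<in>\<Delta>. real (c \<beta>) * \<beta> x))" by blast
  then show ?thesis
  proof
    assume "\<beta> = (\<lambda>x. - (\<Sum>\<beta>\<in>\<Delta>. real (c \<beta>) * \<beta> x))"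
    then have "(\<lambda>x. - \<beta> x) = (\<lambda>x. \<Sum>\<beta>\<in>\<Delta>. real (c \<beta>) * \<beta> x)" by simp
    then show ?thesis using root_neg(1)[OF b] unfolding pos_iff pos_roots_def by blast
  qed (use b in \<open>auto simp: pos_iff pos_roots_def\<close>)
qed

lemma pos_not_neg: "pos \<beta> \<Longrightarrow> \<not> pos (\<lambda>x. - \<beta> x)"
proof
  assume p: "pos \<beta>" "pos (\<lambda>x. - \<beta> x)"
  then have "\<beta> (om j) = 0" if "j \<in> \<Delta>" for j using that by (force simp: pos_def)
  then have "\<beta> x = 0" for x using p(1) by (subst root_om) (auto simp: pos_def)
  then show False using root_nonzero p(1) by (auto simp: pos_def)
qed

lemma pos_simple: "j \<in> \<Delta> \<Longrightarrow> pos j"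
  by (simp add: pos_def simple_root simple_om)

text \<open>Reflecting in \<open>j\<close> changes only the \<open>j\<close>-th coordinate. If the
  result were negative, all other coordinates of \<beta> would vanish, and reducedness would leave
  only \<open>j\<close> and its negative.\<close>

lemma pos_sref:
  assumes j: "j \<in> \<Delta>" and b: "pos \<beta>" "\<beta> \<noteq> j"
  shows "pos (\<beta> \<circ> sref cor j)"
proof (rule ccontr)
  assume np: "\<not> pos (\<beta> \<circ> sref cor j)"
  have bP: "\<beta> \<in> \<Phi>" using b by (simp add: pos_def)
  have jP: "j \<in> \<Phi>" using j simple_root by simp
  have "pos (\<lambda>x. - (\<beta> \<circ> sref cor j) x)" using np pos_or_neg root_sref bP jP by blast
  then have neg: "(\<beta> \<circ> sref cor j) (om i) \<le> 0" if "i \<in> \<Delta>" for i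
    using that by (simp add: pos_def)
  have z: "\<beta> (om i) = 0" if "i \<in> \<Delta>" "i \<noteq> j" for i
  proof -
    have "(\<beta> \<circ> sref cor j) (om i) = \<beta> (om i)" using that j bP by (simp add: root_comp_sref simple_om)
    then show ?thesis using neg[of i] b that by (force simp: pos_def)
  qed
  have "\<beta> x = 0" if "j x = 0" for x
  proof -
    have "\<beta> (om i) * i x = 0" if "i \<in> \<Delta>" for i using z[OF that] \<open>j x = 0\<close> by (cases "i = j") auto
    then show ?thesis unfolding root_om[OF bP, of x] by (intro sum.neutral) blast
  qed
  then have "\<beta> = j \<or> \<beta> = (\<lambda>x. - j x)" using roots_proportional[OF jP bP] by blast
  then show False using b pos_not_neg[OF pos_simple[OF j]] by auto
qed

end

section \<open>Weyl group elements as words in reflections\<close>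

context rdatum
begin

text \<open>Covers Weyl group elements and diagram automorphisms at once. Roots are acted on by
  precomposition, which is why equivariance of coroots reads
  \<open>z (cor (\<alpha> \<circ> z)) = cor \<alpha>\<close>.\<close>

definition lin :: "('v \<Rightarrow> 'v) \<Rightarrow> bool" where
  "lin z \<longleftrightarrow> linear z \<and> bij z \<and>
     (\<forall>\<alpha>\<in>\<Phi>. \<alpha> \<circ> z \<in> \<Phi> \<and> \<alpha> \<circ> inv z \<in> \<Phi> \<and> z (cor (\<alpha> \<circ> z)) = cor \<alpha>)"

lemma linD:
  assumes "lin z"
  shows "linear z" "bij z" "\<alpha> \<in> \<Phi> \<Longrightarrow> \<alpha> \<circ> z \<in> \<Phi>" "\<alpha> \<in> \<Phi> \<Longrightarrow> \<alpha> \<circ> inv z \<in> \<Phi>"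
    "\<alpha> \<in> \<Phi> \<Longrightarrow> z (cor (\<alpha> \<circ> z)) = cor \<alpha>"
  using assms by (auto simp: lin_def)

lemma lin_cancel [simp]:
  assumes "lin z"
  shows "z (inv z x) = x" "inv z (z x) = x" "z \<circ> inv z = id" "inv z \<circ> z = id"
  using linD(2)[OF assms] by (auto simp: bij_is_inj bij_is_surj surj_f_inv_f fun_eq_iff)

lemma linear_inv_bij:
  fixes z :: "'a::real_vector \<Rightarrow> 'a"
  assumes "linear z" "bij z"
  shows "linear (inv z)"
proof (rule linearI)
  have [simp]: "z (inv z v) = v" for v using assms(2) by (simp add: bij_is_surj surj_f_inv_f)
  have inj: "inj z" using assms(2) by (rule bij_is_inj)
  show "inv z (a + b) = inv z a + inv z b" for a b
    by (rule injD[OF inj]) (simp add: linear_add[OF assms(1)])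
  show "inv z (c *\<^sub>R a) = c *\<^sub>R inv z a" for c a
    by (rule injD[OF inj]) (simp add: linear_scale[OF assms(1)])
qed

lemma lin_id: "lin id"
  by (simp add: lin_def linear_id inv_id)

lemma lin_comp:
  assumes y: "lin y" and z: "lin z"
  shows "lin (y \<circ> z)"
proof -
  have "linear (y \<circ> z)" using linD(1)[OF y] linD(1)[OF z] linear_compose by blast
  moreover have "bij (y \<circ> z)" using linD(2)[OF y] linD(2)[OF z] bij_comp by blast
  moreover have "\<alpha> \<circ> (y \<circ> z) \<in> \<Phi> \<and> \<alpha> \<circ> inv (y \<circ> z) \<in> \<Phi> \<and> (y \<circ> z) (cor (\<alpha> \<circ> (y \<circ> z))) = cor \<alpha>"
    if a: "\<alpha> \<in> \<Phi>" for \<alpha>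
  proof (intro conjI)
    have e: "\<alpha> \<circ> (y \<circ> z) = \<alpha> \<circ> y \<circ> z" by (simp add: o_assoc)
    show "\<alpha> \<circ> (y \<circ> z) \<in> \<Phi>" unfolding e by (intro linD(3)[OF z] linD(3)[OF y] a)
    have "inv (y \<circ> z) = inv z \<circ> inv y" using linD(2)[OF y] linD(2)[OF z] by (rule o_inv_distrib)
    then have "\<alpha> \<circ> inv (y \<circ> z) = \<alpha> \<circ> inv z \<circ> inv y" by (simp add: o_assoc)
    then show "\<alpha> \<circ> inv (y \<circ> z) \<in> \<Phi>" using linD(4)[OF y] linD(4)[OF z] a by simp
    have "(y \<circ> z) (cor (\<alpha> \<circ> (y \<circ> z))) = y (z (cor ((\<alpha> \<circ> y) \<circ> z)))" by (simp add: o_assoc)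
    also have "\<dots> = y (cor (\<alpha> \<circ> y))"
      using linD(5)[OF z, of "\<alpha> \<circ> y"] linD(3)[OF y a] by (simp only:)
    also have "\<dots> = cor \<alpha>" by (rule linD(5)[OF y a])
    finally show "(y \<circ> z) (cor (\<alpha> \<circ> (y \<circ> z))) = cor \<alpha>" .
  qed
  ultimately show ?thesis by (simp add: lin_def)
qed

lemma lin_cor_inv:
  assumes "lin z" "\<alpha> \<in> \<Phi>"
  shows "z (cor \<alpha>) = cor (\<alpha> \<circ> inv z)"
proof -
  have "\<alpha> \<circ> inv z \<circ> z = \<alpha>" using assms(1) by (simp add: fun_eq_iff)
  then show ?thesis using linD(5)[OF assms(1) linD(4)[OF assms]] by (simp only:)
qed

lemma lin_inv:
  assumes "lin z"
  shows "lin (inv z)"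
  unfolding lin_def
proof (intro conjI ballI)
  show "linear (inv z)" "bij (inv z)"
    using linD(1,2)[OF assms] linear_inv_bij bij_imp_bij_inv by auto
  fix \<alpha> assume a: "\<alpha> \<in> \<Phi>"
  have "inv (inv z) = z" using linD(2)[OF assms] by (rule inv_inv_eq)
  then show "\<alpha> \<circ> inv z \<in> \<Phi>" "\<alpha> \<circ> inv (inv z) \<in> \<Phi>" using assms a linD(3,4) by auto
  show "inv z (cor (\<alpha> \<circ> inv z)) = cor \<alpha>"
    unfolding lin_cor_inv[OF assms a, symmetric] using assms by simp
qed

lemma lin_sref: "\<alpha> \<in> \<Phi> \<Longrightarrow> lin (sref cor \<alpha>)"
  unfolding lin_def inv_sref using linear_sref bij_sref root_sref cor_comp_sref by auto

lemma lin_conj_sref: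
  assumes "lin z" "\<alpha> \<in> \<Phi>"
  shows "z \<circ> sref cor (\<alpha> \<circ> z) = sref cor \<alpha> \<circ> z"
proof
  fix x
  show "(z \<circ> sref cor (\<alpha> \<circ> z)) x = (sref cor \<alpha> \<circ> z) x"
    using linD(5)[OF assms] linD(1)[OF assms(1)]
    by (simp add: sref_def linear_diff linear_scale)
qed

text \<open>Equivariance gives one direction, injectivity of \<open>cor\<close> the other. Stability
  of V_y under a reflection is a matter of the coroot, the linear form of condition (2) speaks of
  the root.\<close>

lemma lin_fix_cor:
  assumes "lin z" "\<alpha> \<in> \<Phi>"
  shows "\<alpha> \<circ> z = \<alpha> \<longleftrightarrow> z (cor \<alpha>) = cor \<alpha>"
proof
  assume "\<alpha> \<circ> z = \<alpha>"
  then show "z (cor \<alpha>) = cor \<alpha>" using linD(5)[OF assms] by simp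
next
  assume "z (cor \<alpha>) = cor \<alpha>"
  then have "cor (\<alpha> \<circ> inv z) = cor \<alpha>" using lin_cor_inv[OF assms] by simp
  then have "\<alpha> \<circ> inv z = \<alpha>" using inj_cor assms linD(4) by (meson inj_onD)
  then show "\<alpha> \<circ> z = \<alpha>" using assms(1) by (metis comp_assoc comp_id lin_cancel(4))
qed

section \<open>Words in reflections and the exchange condition\<close>

lemma prodw_Nil [simp]: "prodw cor [] = id"
  and prodw_Cons [simp]: "prodw cor (\<alpha> # ss) = sref cor \<alpha> \<circ> prodw cor ss"
  by (simp_all add: prodw_def)

lemma prodw_append [simp]: "prodw cor (ss @ ts) = prodw cor ss \<circ> prodw cor ts"
  by (induction ss) (auto simp: o_assoc)

lemma WJ_words: "WJ cor J = {prodw cor ss | ss. set ss \<subseteq> J}"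
proof
  have "f \<in> {prodw cor ss | ss. set ss \<subseteq> J}" if "f \<in> gen (sref cor ` J)" for f
    using that
  proof induction
    case gen_id
    show ?case by (intro CollectI exI[of _ "[]"]) auto
  next
    case (gen_step f t)
    then obtain ss \<alpha> where "f = prodw cor ss" "set ss \<subseteq> J" "\<alpha> \<in> J" "t = sref cor \<alpha>" by blast
    then show ?case by (intro CollectI exI[of _ "\<alpha> # ss"]) auto
  qed
  then show "WJ cor J \<subseteq> {prodw cor ss | ss. set ss \<subseteq> J}" by (auto simp: WJ_def)
  have "prodw cor ss \<in> gen (sref cor ` J)" if "set ss \<subseteq> J" for ss
    using that by (induction ss) (auto intro: gen.intros simp del: o_apply)
  then show "{prodw cor ss | ss. set ss \<subseteq> J} \<subseteq> WJ cor J" by (auto simp: WJ_def)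
qed

lemma WJ_id: "id \<in> WJ cor J"
  by (simp add: WJ_def gen.gen_id)

lemma WJ_sref: "\<alpha> \<in> J \<Longrightarrow> sref cor \<alpha> \<in> WJ cor J"
  unfolding WJ_words by (intro CollectI exI[of _ "[\<alpha>]"]) auto

lemma WJ_comp: "f \<in> WJ cor J \<Longrightarrow> g \<in> WJ cor J \<Longrightarrow> f \<circ> g \<in> WJ cor J"
  unfolding WJ_words
proof -
  assume "f \<in> {prodw cor ss |ss. set ss \<subseteq> J}" "g \<in> {prodw cor ss |ss. set ss \<subseteq> J}"
  then obtain ss ts where "f = prodw cor ss" "g = prodw cor ts" "set (ss @ ts) \<subseteq> J" by auto
  then show "f \<circ> g \<in> {prodw cor ss |ss. set ss \<subseteq> J}"
    by (intro CollectI exI[of _ "ss @ ts"]) auto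
qed

lemma prodw_rev:
  assumes "set ss \<subseteq> \<Phi>"
  shows "prodw cor ss \<circ> prodw cor (rev ss) = id"
  using assms
proof (induction ss)
  case (Cons \<alpha> ss)
  have "prodw cor (\<alpha> # ss) \<circ> prodw cor (rev (\<alpha> # ss))
      = sref cor \<alpha> \<circ> (prodw cor ss \<circ> prodw cor (rev ss)) \<circ> sref cor \<alpha>"
    by (simp add: o_assoc)
  then show ?case using Cons by (simp add: fun_eq_iff)
qed simp

lemma inv_prodw:
  assumes "set ss \<subseteq> \<Phi>"
  shows "inv (prodw cor ss) = prodw cor (rev ss)"
  using prodw_rev[OF assms] prodw_rev[of "rev ss"] assms by (simp add: inv_unique_comp)

lemma WJ_inv: "J \<subseteq> \<Phi> \<Longrightarrow> f \<in> WJ cor J \<Longrightarrow> inv f \<in> WJ cor J"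
  unfolding WJ_words
proof -
  assume J: "J \<subseteq> \<Phi>" and "f \<in> {prodw cor ss |ss. set ss \<subseteq> J}"
  then obtain ss where "f = prodw cor ss" "set ss \<subseteq> J" by auto
  then show "inv f \<in> {prodw cor ss |ss. set ss \<subseteq> J}"
    using J by (intro CollectI exI[of _ "rev ss"]) (auto intro: inv_prodw)
qed

lemma lin_prodw: "set ss \<subseteq> \<Phi> \<Longrightarrow> lin (prodw cor ss)"
  by (induction ss) (auto intro: lin_id lin_comp lin_sref simp del: o_apply)

lemma lin_WJ: "J \<subseteq> \<Phi> \<Longrightarrow> w \<in> WJ cor J \<Longrightarrow> lin w"
  unfolding WJ_words using lin_prodw by auto

lemma W0_eq: "W0 \<Phi> cor = WJ cor \<Phi>"
  by (simp add: W0_def WJ_def)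

lemma lin_W0: "w \<in> W0 \<Phi> cor \<Longrightarrow> lin w"
  unfolding W0_eq by (rule lin_WJ) auto

lemma simple_subset: "\<Delta> \<subseteq> \<Phi>"
  using simple_root by auto

text \<open>Follow the root \<open>j\<close> through the letters of \<open>ss\<close> from right to
  left. By \<open>pos_sref\<close> a positive root turns negative under a simple reflection
  \<open>s\<close> only if it equals \<open>s\<close>. At that letter the reflection in
  \<open>j\<close>, moved to the left past the later letters, becomes the reflection in
  \<open>s\<close> and cancels it.\<close>

lemma exchange:
  assumes "set ss \<subseteq> \<Delta>" "j \<in> \<Delta>" "\<not> pos (j \<circ> prodw cor (rev ss))"
  shows "\<exists>ts. set ts \<subseteq> set ss \<and> length ts < length ss \<and> prodw cor (ss @ [j]) = prodw cor ts"
  using assms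
proof (induction ss)
  case Nil
  then show ?case using pos_simple by simp
next
  case (Cons s ss)
  let ?z = "prodw cor (rev ss)"
  show ?case
  proof (cases "pos (j \<circ> ?z)")
    case False
    have "set ss \<subseteq> \<Delta>" using Cons.prems(1) by simp
    from Cons.IH[OF this Cons.prems(2) False]
    obtain ts where "set ts \<subseteq> set ss" "length ts < length ss" "prodw cor (ss @ [j]) = prodw cor ts"
      by blast
    then show ?thesis by (intro exI[of _ "s # ts"]) auto
  next
    case True
    have sP: "s \<in> \<Phi>" "set ss \<subseteq> \<Phi>" "j \<in> \<Phi>" using Cons.prems simple_root by auto
    have "\<not> pos ((j \<circ> ?z) \<circ> sref cor s)" using Cons.prems(3) by (simp add: comp_def)
    then have "j \<circ> ?z = s" using pos_sref[OF _ True] Cons.prems(1) by auto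
    moreover have "lin ?z" using sP by (intro lin_prodw) auto
    ultimately have c: "?z \<circ> sref cor s = sref cor j \<circ> ?z" using lin_conj_sref sP(3) by metis
    have zz: "prodw cor ss \<circ> ?z = id" "?z \<circ> prodw cor ss = id"
      using prodw_rev[of ss] prodw_rev[of "rev ss"] sP by auto
    have "prodw cor ss \<circ> (?z \<circ> sref cor s) \<circ> prodw cor ss
        = prodw cor ss \<circ> (sref cor j \<circ> ?z) \<circ> prodw cor ss" by (simp only: c)
    then have "(prodw cor ss \<circ> ?z) \<circ> sref cor s \<circ> prodw cor ss
        = prodw cor ss \<circ> sref cor j \<circ> (?z \<circ> prodw cor ss)" by (simp only: o_assoc)
    then have "sref cor s \<circ> prodw cor ss = prodw cor ss \<circ> sref cor j" by (simp only: zz id_comp comp_id)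
    then have "prodw cor ((s # ss) @ [j]) = sref cor s \<circ> (sref cor s \<circ> prodw cor ss)"
      by (simp add: o_assoc)
    also have "\<dots> = prodw cor ss" using sP by (simp add: o_assoc)
    finally show ?thesis by (intro exI[of _ ss]) auto
  qed
qed

lemma reduced_word_pos:
  assumes J: "J \<subseteq> \<Delta>" and r: "reduced_word cor J w (ss @ [j])"
  shows "pos (j \<circ> prodw cor (rev ss))"
proof (rule ccontr)
  assume "\<not> ?thesis"
  moreover have "set ss \<subseteq> J" "j \<in> J" "prodw cor (ss @ [j]) = w" using r by (auto simp: reduced_word_def)
  ultimately obtain ts where "set ts \<subseteq> set ss" "length ts < length ss" "w = prodw cor ts"
    using exchange[of ss j] J by auto
  then show False using r \<open>set ss \<subseteq> J\<close> unfolding reduced_word_def by fastforce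
qed

lemma reduced_word_exists:
  assumes "w \<in> WJ cor J"
  shows "\<exists>ss. reduced_word cor J w ss"
proof -
  let ?P = "\<lambda>ss. set ss \<subseteq> J \<and> prodw cor ss = w"
  obtain ts where "?P ts" using assms unfolding WJ_words by auto
  then have "?P (arg_min length ?P) \<and> (\<forall>ss. ?P ss \<longrightarrow> length (arg_min length ?P) \<le> length ss)"
    by (rule arg_min_nat_lemma)
  then show ?thesis unfolding reduced_word_def by blast
qed

lemma reduced_word_prefix:
  assumes "reduced_word cor J w (ss @ [j])"
  shows "reduced_word cor J (prodw cor ss) ss"
  unfolding reduced_word_def
proof (intro conjI allI impI)
  show "set ss \<subseteq> J" using assms by (auto simp: reduced_word_def)
  fix ts assume ts: "set ts \<subseteq> J \<and> prodw cor ts = prodw cor ss"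
  then have "prodw cor (ts @ [j]) = w" "set (ts @ [j]) \<subseteq> J" using assms by (auto simp: reduced_word_def)
  then have "length (ss @ [j]) \<le> length (ts @ [j])" using assms unfolding reduced_word_def by blast
  then show "length ss \<le> length ts" by simp
qed simp

section \<open>Dominant vectors and parabolic subgroups\<close>

lemma sref_om: "j \<in> \<Delta> \<Longrightarrow> j \<noteq> i \<Longrightarrow> sref cor j (om i) = om i"
  by (rule sref_fix) (simp add: simple_om)

lemma prodw_om: "set ss \<subseteq> \<Delta> \<Longrightarrow> i \<notin> set ss \<Longrightarrow> prodw cor ss (om i) = om i"
  by (induction ss) (auto simp: sref_om)

lemma WJ_om: "J \<subseteq> \<Delta> \<Longrightarrow> w \<in> WJ cor J \<Longrightarrow> i \<notin> J \<Longrightarrow> w (om i) = om i"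
  unfolding WJ_words using prodw_om by blast

lemma prodw_fix: "(\<And>j. j \<in> set ss \<Longrightarrow> j v = 0) \<Longrightarrow> prodw cor ss v = v"
  by (induction ss) (auto simp: sref_fix)

lemma dominant_conj:
  assumes J: "J \<subseteq> \<Delta>" and "reduced_word cor J w ss"
    and v: "\<And>j. j \<in> J \<Longrightarrow> 0 \<le> j v" and wv: "\<And>j. j \<in> J \<Longrightarrow> 0 \<le> j (w v)"
  shows "w v = v \<and> (\<forall>j\<in>set ss. j v = 0)"
  using assms(2) wv
proof (induction ss arbitrary: w rule: rev_induct)
  case Nil
  then show ?case by (auto simp: reduced_word_def)
next
  case (snoc j ss)
  have w: "w = prodw cor ss \<circ> sref cor j" and ssJ: "set ss \<subseteq> J" and jJ: "j \<in> J"
    using snoc.prems(1) by (auto simp: reduced_word_def)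
  have jP: "j \<in> \<Phi>" "set ss \<subseteq> \<Phi>" using jJ ssJ J simple_root by auto
  let ?g = "j \<circ> prodw cor (rev ss)"
  have g: "pos ?g" using reduced_word_pos[OF J snoc.prems(1)] .
  have "prodw cor (rev ss) (prodw cor ss x) = x" for x
    using prodw_rev[of "rev ss"] jP by (simp add: fun_eq_iff)
  then have gw: "?g (w v) = - j v" using jP by (simp add: w root_comp_sref)
  have "0 \<le> ?g (om i) * i (w v)" if "i \<in> \<Delta>" for i
  proof (cases "i \<in> J")
    case True
    then show ?thesis using g snoc.prems(2) that by (simp add: pos_def)
  next
    case False
    then have "prodw cor (rev ss) (om i) = om i" using ssJ J by (intro prodw_om) auto
    then show ?thesis using False jJ J by (auto simp: simple_om)
  qed
  then have "0 \<le> (\<Sum>i\<in>\<Delta>. ?g (om i) * i (w v))" by (rule sum_nonneg)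
  also have "\<dots> = ?g (w v)" using g unfolding pos_def by (intro root_om[symmetric]) (elim conjunct1)
  finally have "0 \<le> ?g (w v)" .
  then have jv: "j v = 0" using gw v[OF jJ] by simp
  then have e: "w v = prodw cor ss v" by (simp add: w sref_fix)
  have "prodw cor ss v = v \<and> (\<forall>j\<in>set ss. j v = 0)"
    by (rule snoc.IH[OF reduced_word_prefix[OF snoc.prems(1)]]) (use snoc.prems(2) e in simp)
  then show ?case using e jv by simp
qed

text \<open>A reduced word of the inverse ending in \<open>j\<close> would make
  \<open>j \<circ> w\<close> the negative of a positive root, so only the empty word is
  left.\<close>

lemma WJ_pos_id:
  assumes J: "J \<subseteq> \<Delta>" and w: "w \<in> WJ cor J" and p: "\<And>j. j \<in> J \<Longrightarrow> pos (j \<circ> w)"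
  shows "w = id"
proof -
  have JP: "J \<subseteq> \<Phi>" using J simple_root by auto
  obtain ss where ss: "reduced_word cor J (inv w) ss" using reduced_word_exists WJ_inv[OF JP w] by blast
  show ?thesis
  proof (cases ss rule: rev_exhaust)
    case Nil
    then have "inv w = id" using ss by (auto simp: reduced_word_def)
    then show ?thesis using lin_cancel(3)[OF lin_WJ[OF JP w]] by simp
  next
    case (snoc ts j)
    have jP: "j \<in> J" "j \<in> \<Phi>" "set ts \<subseteq> \<Phi>" using ss JP by (auto simp: reduced_word_def snoc)
    have "inv w = prodw cor ss" using ss by (simp add: reduced_word_def)
    then have "w = inv (prodw cor ss)" using linD(2)[OF lin_WJ[OF JP w]] by (metis inv_inv_eq)
    also have "\<dots> = prodw cor (rev ss)" using jP by (intro inv_prodw) (auto simp: snoc)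
    also have "\<dots> = sref cor j \<circ> prodw cor (rev ts)" by (simp add: snoc)
    finally have "j \<circ> w = (\<lambda>x. - (j \<circ> prodw cor (rev ts)) x)"
      using jP by (simp add: fun_eq_iff root_comp_sref)
    moreover have "pos (j \<circ> prodw cor (rev ts))" using reduced_word_pos[OF J] ss snoc by blast
    ultimately show ?thesis using p[OF jP(1)] pos_not_neg by metis
  qed
qed

text \<open>Descent on the number of positive roots that are negative at \<open>v\<close>:
  reflecting in \<open>j\<close> with \<open>j v < 0\<close> permutes the other positive roots and
  removes \<open>j\<close> from the count.\<close>

lemma dominant_exists:
  assumes J: "J \<subseteq> \<Delta>"
  shows "\<exists>w\<in>WJ cor J. \<forall>j\<in>J. 0 \<le> j (w v)"
proof (induction "card {\<beta>. pos \<beta> \<and> \<beta> v < 0}" arbitrary: v rule: less_induct)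
  case less
  show ?case
  proof (cases "\<forall>j\<in>J. 0 \<le> j v")
    case True
    then show ?thesis by (intro bexI[of _ id]) (auto intro: WJ_id)
  next
    case False
    then obtain j where j: "j \<in> J" "j v < 0" by (auto simp: not_le)
    have jD: "j \<in> \<Delta>" "j \<in> \<Phi>" using j J simple_root by auto
    let ?A = "\<lambda>v. {\<beta>. pos \<beta> \<and> \<beta> v < 0}" and ?v = "sref cor j v"
    have fin: "finite (?A v)" for v by (rule finite_subset[OF _ finite_roots]) (auto simp: pos_def)
    have inj: "inj_on (\<lambda>\<beta>. \<beta> \<circ> sref cor j) (?A ?v)"
    proof (rule inj_onI)
      fix \<beta> \<gamma> assume "\<beta> \<circ> sref cor j = \<gamma> \<circ> sref cor j"
      then have "(\<beta> \<circ> sref cor j) (sref cor j x) = (\<gamma> \<circ> sref cor j) (sref cor j x)" for x by simp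
      then show "\<beta> = \<gamma>" using jD by (intro ext) simp
    qed
    have "(\<lambda>\<beta>. \<beta> \<circ> sref cor j) ` ?A ?v \<subseteq> ?A v - {j}"
    proof
      fix \<gamma> assume "\<gamma> \<in> (\<lambda>\<beta>. \<beta> \<circ> sref cor j) ` ?A ?v"
      then obtain \<beta> where b: "pos \<beta>" "\<beta> ?v < 0" and g: "\<gamma> = \<beta> \<circ> sref cor j" by auto
      have "j ?v > 0" using jD j by (simp add: root_comp_sref)
      then have "\<beta> \<noteq> j" using b by auto
      then have "pos \<gamma>" using pos_sref[OF jD(1) b(1)] g by simp
      moreover have "\<gamma> \<noteq> j"
      proof
        assume "\<gamma> = j"
        have "\<beta> = (\<lambda>x. - j x)"
        proof
          fix x
          have "\<beta> x = \<gamma> (sref cor j x)" using jD g by simp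
          also have "\<dots> = - j x" using jD \<open>\<gamma> = j\<close> by (simp add: root_comp_sref)
          finally show "\<beta> x = - j x" .
        qed
        then show False using b(1) pos_not_neg[OF pos_simple[OF jD(1)]] by simp
      qed
      ultimately show "\<gamma> \<in> ?A v - {j}" using b g by simp
    qed
    then have "card (?A ?v) \<le> card (?A v - {j})"
      using card_inj_on_le[OF inj] fin by auto
    also have "\<dots> < card (?A v)"
      by (rule card_Diff1_less) (use fin j pos_simple[OF jD(1)] in auto)
    finally have "card (?A ?v) < card (?A v)" .
    from less[OF this] obtain w where w: "w \<in> WJ cor J" "\<forall>i\<in>J. 0 \<le> i (w ?v)" by blast
    have "w \<circ> sref cor j \<in> WJ cor J" using w(1) j(1) WJ_comp WJ_sref by blast
    then show ?thesis using w(2) by (intro bexI[of _ "w \<circ> sref cor j"]) auto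
  qed
qed

text \<open>Take a point of the hyperplane \<beta> = 0 on no other root hyperplane and move it to a
  \<open>J\<close>-dominant point. The transported root vanishes there and its coordinates all have
  one sign, so some simple root of \<open>J\<close> vanishes there too; genericity identifies the
  two up to sign.\<close>

lemma root_conj_simple:
  assumes J: "J \<subseteq> \<Delta>" and b: "\<beta> \<in> \<Phi>" and sup: "\<And>i. i \<in> \<Delta> - J \<Longrightarrow> \<beta> (om i) = 0"
  shows "\<exists>w\<in>WJ cor J. \<beta> \<circ> w \<in> J"
proof -
  have JP: "J \<subseteq> \<Phi>" using J simple_root by auto
  define N where "N = \<Phi> - {\<beta>, (\<lambda>x. - \<beta> x)}"
  \<comment> \<open>The hyperplane is itself negligible, so genericity is imposed on the whole space
    and carried over by the projection \<open>h\<close> along \<open>cor \<beta>\<close>.\<close>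
  define h where "h x = x - (\<beta> x / 2) *\<^sub>R cor \<beta>" for x
  have bh: "\<beta> (h x) = 0" for x using b by (simp add: h_def root_lin)
  have hfix: "h v = v" if "\<beta> v = 0" for v using that by (simp add: h_def)
  have hlin: "linear h"
    by (intro linearI) (simp_all add: h_def root_lin[OF b] algebra_simps add_divide_distrib)
  have "\<exists>x\<in>UNIV. \<forall>p\<in>(\<lambda>\<gamma>. (\<gamma> \<circ> h, 0::real)) ` N. fst p x \<noteq> snd p"
  proof (rule generic_point)
    show "countable ((\<lambda>\<gamma>. (\<gamma> \<circ> h, 0::real)) ` N)"
      using finite_roots by (auto simp: N_def intro: countable_finite)
    fix f and c :: real assume "(f, c) \<in> (\<lambda>\<gamma>. (\<gamma> \<circ> h, 0)) ` N"
    then obtain \<gamma> where g: "\<gamma> \<in> \<Phi>" "\<gamma> \<noteq> \<beta>" "\<gamma> \<noteq> (\<lambda>x. - \<beta> x)" "f = \<gamma> \<circ> h" by (auto simp: N_def)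
    have "linear f" using g hlin linear_root linear_compose by blast
    moreover obtain v where "\<beta> v = 0" "\<gamma> v \<noteq> 0" using roots_proportional[OF b g(1)] g(2,3) by blast
    ultimately show "linear f \<and> (\<exists>e. f e \<noteq> 0)" using g(4) hfix by (metis comp_apply)
  qed auto
  then obtain x where x: "\<And>\<gamma>. \<gamma> \<in> N \<Longrightarrow> \<gamma> (h x) \<noteq> 0" by auto
  define u where "u = h x"
  obtain w where w: "w \<in> WJ cor J" and dom: "\<And>j. j \<in> J \<Longrightarrow> 0 \<le> j (w u)"
    using dominant_exists[OF J] by metis
  have lw: "lin w" using lin_WJ[OF JP w] .
  define \<gamma> where "\<gamma> = \<beta> \<circ> inv w"
  have gP: "\<gamma> \<in> \<Phi>" using linD(4)[OF lw b] by (simp add: \<gamma>_def)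
  have gJ: "\<gamma> (om i) = 0" if "i \<in> \<Delta> - J" for i
    using sup[OF that] WJ_om[OF J WJ_inv[OF JP w], of i] that by (simp add: \<gamma>_def)
  have g0: "\<gamma> (w u) = 0" using bh lw by (simp add: \<gamma>_def u_def)
  have "\<exists>j\<in>J. j (w u) = 0"
  proof -
    obtain j where j: "j \<in> \<Delta>" "\<gamma> (om j) \<noteq> 0"
      using root_om[OF gP] root_nonzero[OF gP] by (metis (no_types, lifting) mult_zero_left sum.neutral)
    then have jJ: "j \<in> J" using gJ by blast
    have z: "(\<Sum>i\<in>\<Delta>. \<gamma> (om i) * i (w u)) = 0" using root_om[OF gP, of "w u"] g0 by simp
    have "\<gamma> (om j) * j (w u) = 0"
    proof (cases "pos \<gamma>")
      case True
      have "0 \<le> \<gamma> (om i) * i (w u)" if "i \<in> \<Delta>" for i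
        using True that dom[of i] gJ[of i] by (cases "i \<in> J") (auto simp: pos_def)
      then show ?thesis using z j(1) finite_simple by (simp add: sum_nonneg_eq_0_iff)
    next
      case False
      then have "pos (\<lambda>x. - \<gamma> x)" using pos_or_neg[OF gP] by simp
      then have "0 \<le> - (\<gamma> (om i) * i (w u))" if "i \<in> \<Delta>" for i
        using that dom[of i] gJ[of i] by (cases "i \<in> J") (auto simp: pos_def mult_nonpos_nonneg)
      moreover have "(\<Sum>i\<in>\<Delta>. - (\<gamma> (om i) * i (w u))) = 0" using z by (simp add: sum_negf)
      ultimately have "- (\<gamma> (om j) * j (w u)) = 0"
        using j(1) finite_simple sum_nonneg_eq_0_iff[of \<Delta> "\<lambda>i. - (\<gamma> (om i) * i (w u))"] by blast
      then show ?thesis by simp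
    qed
    then show ?thesis using j(2) jJ by auto
  qed
  then obtain j where j: "j \<in> J" "j (w u) = 0" by auto
  have jP: "j \<in> \<Phi>" using j JP by auto
  have "j \<circ> w \<notin> N" using x[of "j \<circ> w"] j(2) by (auto simp: u_def)
  then have "j \<circ> w = \<beta> \<or> j \<circ> w = (\<lambda>x. - \<beta> x)" using linD(3)[OF lw jP] by (auto simp: N_def)
  then show ?thesis
  proof
    assume e: "j \<circ> w = \<beta>"
    have "\<beta> \<circ> inv w = j" using lw by (simp add: e[symmetric] fun_eq_iff)
    then show ?thesis using WJ_inv[OF JP w] j(1) by (intro bexI[of _ "inv w"]) auto
  next
    assume e: "j \<circ> w = (\<lambda>x. - \<beta> x)"
    have "\<beta> (inv w x) = - j x" for x using fun_cong[OF e, of "inv w x"] lw by simp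
    then have "\<beta> \<circ> (inv w \<circ> sref cor j) = j" using jP by (simp add: fun_eq_iff root_comp_sref)
    then show ?thesis using WJ_comp[OF WJ_inv[OF JP w] WJ_sref[OF j(1)]] j(1)
      by (intro bexI[of _ "inv w \<circ> sref cor j"]) auto
  qed
qed

lemma W0_simple: "W0 \<Phi> cor = WJ cor \<Delta>"
proof
  have s: "sref cor \<beta> \<in> WJ cor \<Delta>" if b: "\<beta> \<in> \<Phi>" for \<beta>
  proof -
    obtain w where w: "w \<in> WJ cor \<Delta>" "\<beta> \<circ> w \<in> \<Delta>" using root_conj_simple[of \<Delta> \<beta>] b by auto
    have lw: "lin w" using lin_WJ[OF simple_subset w(1)] .
    have "sref cor \<beta> = sref cor \<beta> \<circ> w \<circ> inv w" using lw by (simp add: fun_eq_iff)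
    also have "\<dots> = w \<circ> sref cor (\<beta> \<circ> w) \<circ> inv w" by (simp only: lin_conj_sref[OF lw b])
    also have "\<dots> \<in> WJ cor \<Delta>"
      by (intro WJ_comp WJ_sref WJ_inv simple_subset w)
    finally show ?thesis .
  qed
  have "prodw cor ss \<in> WJ cor \<Delta>" if "set ss \<subseteq> \<Phi>" for ss
    using that by (induction ss) (auto intro!: WJ_id WJ_comp s simp del: o_apply)
  then show "W0 \<Phi> cor \<subseteq> WJ cor \<Delta>" unfolding W0_eq by (subst WJ_words) auto
  show "WJ cor \<Delta> \<subseteq> W0 \<Phi> cor" unfolding W0_eq WJ_words using simple_subset by auto
qed

lemma W0_pos_id: "w \<in> W0 \<Phi> cor \<Longrightarrow> (\<And>j. j \<in> \<Delta> \<Longrightarrow> pos (j \<circ> w)) \<Longrightarrow> w = id"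
  by (rule WJ_pos_id[OF subset_refl]) (simp_all add: W0_simple)

lemma lin_power: "lin z \<Longrightarrow> lin (z ^^ n)"
  by (induction n) (auto intro: lin_id lin_comp simp del: o_apply)

lemma diagram_autD:
  assumes "diagram_aut \<Phi> cor P \<Delta> \<sigma>"
  shows "lin \<sigma>" "j \<in> \<Delta> \<Longrightarrow> j \<circ> \<sigma> \<in> \<Delta>" "j \<in> \<Delta> \<Longrightarrow> j \<circ> inv \<sigma> \<in> \<Delta>"
proof -
  have b: "bij \<sigma>" "linear \<sigma>" and im: "ract \<sigma> ` \<Phi> = \<Phi>" "ract \<sigma> ` \<Delta> = \<Delta>"
    and c: "\<And>\<alpha>. \<alpha> \<in> \<Phi> \<Longrightarrow> cor (ract \<sigma> \<alpha>) = \<sigma> (cor \<alpha>)"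
    using assms unfolding diagram_aut_def by simp_all
  have i: "inv \<sigma> (\<sigma> x) = x" for x using b(1) by (simp add: bij_is_inj)
  have cancel: "ract \<sigma> \<beta> \<circ> \<sigma> = \<beta>" for \<beta> by (simp add: ract_def fun_eq_iff i)
  show "j \<circ> \<sigma> \<in> \<Delta>" if "j \<in> \<Delta>"
  proof -
    have "j \<in> ract \<sigma> ` \<Delta>" unfolding im(2) by (rule that)
    then obtain i where i: "i \<in> \<Delta>" "j = ract \<sigma> i" by (rule imageE)
    show ?thesis unfolding i(2) cancel by (rule i(1))
  qed
  show "j \<circ> inv \<sigma> \<in> \<Delta>" if "j \<in> \<Delta>"
  proof -
    have "ract \<sigma> j \<in> \<Delta>" using that im(2) by blast
    then show ?thesis by (simp only: ract_def)
  qed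
  show "lin \<sigma>" unfolding lin_def
  proof (intro conjI ballI b)
    fix \<alpha> assume a: "\<alpha> \<in> \<Phi>"
    have "\<alpha> \<in> ract \<sigma> ` \<Phi>" unfolding im(1) by (rule a)
    then obtain \<beta> where be: "\<beta> \<in> \<Phi>" "\<alpha> = ract \<sigma> \<beta>" by (rule imageE)
    show "\<alpha> \<circ> \<sigma> \<in> \<Phi>" unfolding be(2) cancel by (rule be(1))
    have "ract \<sigma> \<alpha> \<in> \<Phi>" using a im(1) by blast
    then show "\<alpha> \<circ> inv \<sigma> \<in> \<Phi>" by (simp only: ract_def)
    show "\<sigma> (cor (\<alpha> \<circ> \<sigma>)) = cor \<alpha>" unfolding be(2) cancel c[OF be(1)] ..
  qed
qed

end

section \<open>Affine roots and separating hyperplanes\<close>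

context rdatum
begin

definition AR :: "('v \<Rightarrow> real) set" where
  "AR = {(\<lambda>x. \<alpha> x - of_int k) | \<alpha> k. \<alpha> \<in> \<Phi>}"

text \<open>Integral values of the roots on the translation part are what makes \<open>y\<close>
  permute the affine roots; the extended affine Weyl group consists of such maps.\<close>

definition aff :: "('v \<Rightarrow> 'v) \<Rightarrow> bool" where
  "aff y \<longleftrightarrow> (\<exists>z t. lin z \<and> (\<forall>\<alpha>\<in>\<Phi>. \<alpha> t \<in> \<int>) \<and> y = (\<lambda>x. z x + t))"

text \<open>Each hyperplane separating \<open>x\<close> from \<open>x'\<close> is represented by exactly one element of \<open>S x x'\<close>:
  of the two affine roots vanishing on it, the one that is negative at \<open>x\<close>.\<close>

definition S :: "'v \<Rightarrow> 'v \<Rightarrow> ('v \<Rightarrow> real) set" where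
  "S x x' = {a \<in> AR. a x < 0 \<and> 0 < a x'}"

definition reg :: "'v \<Rightarrow> bool" where
  "reg x \<longleftrightarrow> (\<forall>a\<in>AR. a x \<noteq> 0)"

text \<open>The root is recovered from the affine root as its linear part
  \<open>\<lambda>v. a v - a 0\<close>, so the reflection depends on the function \<open>a\<close>
  alone.\<close>

definition rf :: "('v \<Rightarrow> real) \<Rightarrow> 'v \<Rightarrow> 'v" where
  "rf a x = x - a x *\<^sub>R cor (\<lambda>v. a v - a 0)"

lemma AR_I: "\<alpha> \<in> \<Phi> \<Longrightarrow> (\<lambda>x. \<alpha> x - of_int k) \<in> AR"
  by (auto simp: AR_def)

lemma AR_E:
  assumes "a \<in> AR"
  obtains \<alpha> k where "\<alpha> \<in> \<Phi>" "a = (\<lambda>x. \<alpha> x - of_int k)"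
  using assms by (auto simp: AR_def)

lemma AR_neg: "a \<in> AR \<Longrightarrow> (\<lambda>x. - a x) \<in> AR"
proof -
  assume "a \<in> AR"
  then obtain \<alpha> k where a: "\<alpha> \<in> \<Phi>" "a = (\<lambda>x. \<alpha> x - of_int k)" by (rule AR_E)
  have "(\<lambda>x. - a x) = (\<lambda>x. (\<lambda>x. - \<alpha> x) x - of_int (- k))" by (simp add: a(2))
  then show ?thesis using AR_I[OF root_neg(1)[OF a(1)], of "- k"] by simp
qed

lemma AR_affine:
  assumes "a \<in> AR"
  shows "a ((1 - t) *\<^sub>R x + t *\<^sub>R y) = (1 - t) * a x + t * a y"
proof -
  obtain \<alpha> k where a: "\<alpha> \<in> \<Phi>" "a = (\<lambda>x. \<alpha> x - of_int k)" using assms by (rule AR_E)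
  show ?thesis by (simp add: a(2) root_lin[OF a(1)] algebra_simps)
qed

lemma affI: "lin z \<Longrightarrow> (\<And>\<alpha>. \<alpha> \<in> \<Phi> \<Longrightarrow> \<alpha> t \<in> \<int>) \<Longrightarrow> aff (\<lambda>x. z x + t)"
  unfolding aff_def by blast

lemma affE:
  assumes "aff y"
  obtains z t where "lin z" "\<And>\<alpha>. \<alpha> \<in> \<Phi> \<Longrightarrow> \<alpha> t \<in> \<int>" "y = (\<lambda>x. z x + t)"
  using assms unfolding aff_def by blast

lemma aff_bij: "aff y \<Longrightarrow> bij y"
proof -
  assume "aff y"
  then obtain z t where z: "lin z" "y = (\<lambda>x. z x + t)" by (rule affE)
  have "bij ((\<lambda>x. x + t) \<circ> z)"
    using linD(2)[OF z(1)] bij_plus_right[of t] by (intro bij_comp)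
  then show ?thesis by (simp add: z(2) comp_def)
qed

lemma aff_cancel [simp]:
  assumes "aff y"
  shows "y (inv y x) = x" "inv y (y x) = x" "y \<circ> inv y = id" "inv y \<circ> y = id"
  using aff_bij[OF assms] by (auto simp: bij_is_inj bij_is_surj surj_f_inv_f fun_eq_iff)

lemma aff_id: "aff id"
  using affI[OF lin_id, of 0] by (simp add: id_def root_lin)

lemma aff_comp:
  assumes "aff y" "aff w"
  shows "aff (y \<circ> w)"
proof -
  obtain z t where z: "lin z" "\<And>\<alpha>. \<alpha> \<in> \<Phi> \<Longrightarrow> \<alpha> t \<in> \<int>" "y = (\<lambda>x. z x + t)"
    using assms(1) by (rule affE) blast
  obtain z' t' where z': "lin z'" "\<And>\<alpha>. \<alpha> \<in> \<Phi> \<Longrightarrow> \<alpha> t' \<in> \<int>" "w = (\<lambda>x. z' x + t')"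
    using assms(2) by (rule affE) blast
  have "\<alpha> (z t' + t) \<in> \<int>" if a: "\<alpha> \<in> \<Phi>" for \<alpha>
    using z'(2)[OF linD(3)[OF z(1) a]] z(2)[OF a] root_lin(1)[OF a] by simp
  then have "aff (\<lambda>x. (z \<circ> z') x + (z t' + t))" using lin_comp[OF z(1) z'(1)] by (intro affI)
  moreover have "y \<circ> w = (\<lambda>x. (z \<circ> z') x + (z t' + t))"
    by (simp add: z(3) z'(3) fun_eq_iff linear_add[OF linD(1)[OF z(1)]])
  ultimately show ?thesis by simp
qed

lemma aff_inv:
  assumes "aff y"
  shows "aff (inv y)"
proof -
  obtain z t where z: "lin z" "\<And>\<alpha>. \<alpha> \<in> \<Phi> \<Longrightarrow> \<alpha> t \<in> \<int>" "y = (\<lambda>x. z x + t)"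
    using assms by (rule affE) blast
  note li = linD(1)[OF lin_inv[OF z(1)]]
  have "\<alpha> (- inv z t) \<in> \<int>" if a: "\<alpha> \<in> \<Phi>" for \<alpha>
    using z(2)[OF linD(4)[OF z(1) a]] root_lin(3)[OF a] by simp
  then have "aff (\<lambda>x. inv z x + (- inv z t))" using lin_inv[OF z(1)] by (intro affI)
  moreover have "inv y = (\<lambda>x. inv z x + (- inv z t))"
    by (rule inv_unique_comp)
      (use z(1) in \<open>simp_all add: z(3) fun_eq_iff linear_add[OF li] linear_add[OF linD(1)[OF z(1)]]
        linear_neg[OF linD(1)[OF z(1)]] linear_diff[OF linD(1)[OF z(1)]]\<close>)
  ultimately show ?thesis by simp
qed

lemma aff_AR:
  assumes "aff y" "a \<in> AR"
  shows "a \<circ> y \<in> AR"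
proof -
  obtain z t where z: "lin z" "\<And>\<alpha>. \<alpha> \<in> \<Phi> \<Longrightarrow> \<alpha> t \<in> \<int>" "y = (\<lambda>x. z x + t)"
    using assms(1) by (rule affE) blast
  obtain \<alpha> k where a: "\<alpha> \<in> \<Phi>" "a = (\<lambda>x. \<alpha> x - of_int k)" using assms(2) by (rule AR_E)
  obtain m where m: "\<alpha> t = of_int m" using z(2)[OF a(1)] by (rule Ints_cases)
  have "a \<circ> y = (\<lambda>x. (\<alpha> \<circ> z) x - of_int (k - m))"
    by (simp add: a(2) z(3) fun_eq_iff root_lin(1)[OF a(1)] m)
  also have "\<dots> \<in> AR" by (rule AR_I[OF linD(3)[OF z(1) a(1)]])
  finally show ?thesis .
qed

lemma aff_reg: "aff y \<Longrightarrow> reg x \<Longrightarrow> reg (y x)"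
  unfolding reg_def using aff_AR by force

lemma aff_affine:
  assumes "aff y"
  shows "y ((1 - t) *\<^sub>R x + t *\<^sub>R x') = (1 - t) *\<^sub>R y x + t *\<^sub>R y x'"
proof -
  obtain z c where z: "lin z" "y = (\<lambda>x. z x + c)" using assms by (rule affE)
  show ?thesis
    unfolding z(2) linear_add[OF linD(1)[OF z(1)]] linear_scale[OF linD(1)[OF z(1)]]
    by (simp add: algebra_simps)
qed

lemma finite_S: "finite (S x x')"
proof (rule finite_subset)
  let ?f = "\<lambda>(\<alpha>, k) x. \<alpha> x - real_of_int k"
  show "S x x' \<subseteq> ?f ` (SIGMA \<alpha>:\<Phi>. {\<lfloor>\<alpha> x\<rfloor>..\<lceil>\<alpha> x'\<rceil>})"
  proof
    fix a assume "a \<in> S x x'"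
    then have *: "a \<in> AR" "a x < 0" "0 < a x'" by (auto simp: S_def)
    obtain \<alpha> k where a: "\<alpha> \<in> \<Phi>" "a = (\<lambda>x. \<alpha> x - of_int k)" using *(1) by (rule AR_E)
    have "\<alpha> x < of_int k" "of_int k < \<alpha> x'" using *(2,3) a(2) by simp_all
    then have "\<lfloor>\<alpha> x\<rfloor> \<le> k" "k \<le> \<lceil>\<alpha> x'\<rceil>" by linarith+
    then show "a \<in> ?f ` (SIGMA \<alpha>:\<Phi>. {\<lfloor>\<alpha> x\<rfloor>..\<lceil>\<alpha> x'\<rceil>})"
      using a by (intro image_eqI[of _ _ "(\<alpha>, k)"]) auto
  qed
  show "finite (?f ` (SIGMA \<alpha>:\<Phi>. {\<lfloor>\<alpha> x\<rfloor>..\<lceil>\<alpha> x'\<rceil>}))"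
    using finite_roots by (intro finite_imageI finite_SigmaI) auto
qed

lemma S_aff:
  assumes "aff y"
  shows "S (y x) (y x') = (\<lambda>a. a \<circ> inv y) ` S x x'"
proof
  show "(\<lambda>a. a \<circ> inv y) ` S x x' \<subseteq> S (y x) (y x')"
    using assms aff_AR[OF aff_inv] by (auto simp: S_def)
  show "S (y x) (y x') \<subseteq> (\<lambda>a. a \<circ> inv y) ` S x x'"
  proof
    fix a assume "a \<in> S (y x) (y x')"
    then have "a \<circ> y \<in> S x x'" "a = (a \<circ> y) \<circ> inv y"
      using assms aff_AR[OF assms] by (auto simp: S_def fun_eq_iff)
    from this(2,1) show "a \<in> (\<lambda>a. a \<circ> inv y) ` S x x'" by (rule image_eqI)
  qed
qed

lemma inj_comp_inv:
  fixes X :: "('v \<Rightarrow> real) set"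
  assumes y: "aff y"
  shows "inj_on (\<lambda>a. a \<circ> inv y) X"
proof (rule inj_onI)
  fix a b :: "'v \<Rightarrow> real" assume "a \<circ> inv y = b \<circ> inv y"
  then have "(a \<circ> inv y) (y x) = (b \<circ> inv y) (y x)" for x by simp
  then show "a = b" using y by (intro ext) simp
qed

lemma card_S_aff: "aff y \<Longrightarrow> card (S (y x) (y x')) = card (S x x')"
  unfolding S_aff by (rule card_image[OF inj_comp_inv])

lemma S_neg: "S x' x = (\<lambda>a v. - a v) ` S x x'"
proof
  show "(\<lambda>a v. - a v) ` S x x' \<subseteq> S x' x" using AR_neg by (auto simp: S_def)
  show "S x' x \<subseteq> (\<lambda>a v. - a v) ` S x x'"
  proof
    fix a assume "a \<in> S x' x"
    then have "(\<lambda>v. - a v) \<in> S x x'" using AR_neg by (auto simp: S_def)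
    then show "a \<in> (\<lambda>a v. - a v) ` S x x'" by (intro image_eqI[of _ _ "\<lambda>v. - a v"]) auto
  qed
qed

lemma card_S_sym: "card (S x' x) = card (S x x')"
proof -
  have "inj_on (\<lambda>(a :: 'v \<Rightarrow> real) v. - a v) (S x x')" by (auto simp: inj_on_def fun_eq_iff)
  then show ?thesis unfolding S_neg[of x' x] by (rule card_image)
qed

lemma S_triangle:
  assumes "reg y"
  shows "card (S x z) \<le> card (S x y) + card (S y z)"
proof -
  have "S x z \<subseteq> S x y \<union> S y z" using assms by (fastforce simp: S_def reg_def)
  then have "card (S x z) \<le> card (S x y \<union> S y z)" using finite_S by (intro card_mono) auto
  also have "\<dots> \<le> card (S x y) + card (S y z)" by (rule card_Un_le)
  finally show ?thesis .
qed

text \<open>The hypothesis says that \<open>y\<close> lies on a geodesic from \<open>x\<close> to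
  \<open>z\<close>: a hyperplane separating \<open>y\<close> from \<open>z\<close> but not
  \<open>x\<close> from \<open>z\<close> would, with the opposite sign, separate \<open>x\<close>
  from \<open>y\<close> and contradict it.\<close>

lemma S_split:
  assumes x: "reg x" and y: "reg y" and sub: "S x y \<subseteq> S x z"
  shows "S x z = S x y \<union> S y z" "S x y \<inter> S y z = {}" "card (S x z) = card (S x y) + card (S y z)"
proof -
  have "a \<in> S x z" if a: "a \<in> S y z" for a
  proof (rule ccontr)
    assume n: "a \<notin> S x z"
    have a': "a \<in> AR" "a y < 0" "0 < a z" using a by (auto simp: S_def)
    then have "0 < a x" using n x by (force simp: S_def reg_def)
    then have "(\<lambda>v. - a v) \<in> S x y" using a' AR_neg by (auto simp: S_def)
    then show False using sub a' by (auto simp: S_def)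
  qed
  then show 1: "S x z = S x y \<union> S y z" using sub y by (fastforce simp: S_def reg_def)
  show 2: "S x y \<inter> S y z = {}" by (auto simp: S_def)
  show "card (S x z) = card (S x y) + card (S y z)"
    unfolding 1 using 2 finite_S by (intro card_Un_disjoint) auto
qed

lemma S_empty_sign:
  assumes "reg x" "reg x'" "S x x' = {}" "a \<in> AR"
  shows "a x < 0 \<longleftrightarrow> a x' < 0" "0 < a x \<longleftrightarrow> 0 < a x'"
proof -
  have "S x' x = {}" using assms(3) by (simp add: S_neg[of x' x])
  moreover have "a x \<noteq> 0" "a x' \<noteq> 0" using assms by (auto simp: reg_def)
  moreover have "a \<notin> S x x'" using assms by simp
  ultimately show "a x < 0 \<longleftrightarrow> a x' < 0" "0 < a x \<longleftrightarrow> 0 < a x'"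
    using assms(4) unfolding S_def by (auto simp: not_less)
qed

text \<open>For regular points \<open>S x x' = {}\<close> means that they lie in one alcove. Alcoves
  are mostly handled through such representatives, which may be exchanged freely.\<close>

lemma S_cong:
  assumes "reg x" "reg x'" "S x x' = {}"
  shows "S x z = S x' z" "S z x = S z x'"
  using S_empty_sign[OF assms] by (auto simp: S_def)

subsection \<open>Affine reflections\<close>

lemma rf_AR:
  assumes "\<alpha> \<in> \<Phi>"
  shows "rf (\<lambda>x. \<alpha> x - of_int k) = aref cor \<alpha> k"
  by (simp add: rf_def aref_def fun_eq_iff root_lin[OF assms])

lemma aref_eq: "\<alpha> \<in> \<Phi> \<Longrightarrow> aref cor \<alpha> k x = sref cor \<alpha> x + of_int k *\<^sub>R cor \<alpha>"
  by (simp add: aref_def sref_def algebra_simps)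

lemma aff_rf:
  assumes "a \<in> AR"
  shows "aff (rf a)"
proof -
  obtain \<alpha> k where a: "\<alpha> \<in> \<Phi>" "a = (\<lambda>x. \<alpha> x - of_int k)" using assms by (rule AR_E)
  have "aff (\<lambda>x. sref cor \<alpha> x + of_int k *\<^sub>R cor \<alpha>)"
    by (rule affI[OF lin_sref[OF a(1)]]) (use a(1) cartan_int in \<open>simp add: root_lin\<close>)
  then show ?thesis unfolding a(2) rf_AR[OF a(1)] by (simp add: aref_eq[OF a(1), abs_def])
qed

lemma rf_value:
  assumes "a \<in> AR"
  shows "a (rf a x) = - a x"
proof -
  obtain \<alpha> k where a: "\<alpha> \<in> \<Phi>" "a = (\<lambda>x. \<alpha> x - of_int k)" using assms by (rule AR_E)
  show ?thesis unfolding a(2) rf_AR[OF a(1)] by (simp add: aref_def root_lin[OF a(1)] a(1))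
qed

lemma rf_fix: "a x = 0 \<Longrightarrow> rf a x = x"
  by (simp add: rf_def)

lemma rf_rf [simp]: "a \<in> AR \<Longrightarrow> rf a (rf a x) = x"
  using rf_value[of a x] by (simp add: rf_def[of a "rf a x"]) (simp add: rf_def)

lemma rf_neg:
  assumes "a \<in> AR"
  shows "rf (\<lambda>x. - a x) = rf a"
proof -
  obtain \<alpha> k where a: "\<alpha> \<in> \<Phi>" "a = (\<lambda>x. \<alpha> x - of_int k)" using assms by (rule AR_E)
  have e: "(\<lambda>v. - a v - - a 0) = (\<lambda>v. - \<alpha> v)" "(\<lambda>v. a v - a 0) = \<alpha>"
    by (simp_all add: a(2) root_lin[OF a(1)])
  show ?thesis unfolding rf_def[abs_def] e root_neg(2)[OF a(1)] by simp
qed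

lemma rf_conj:
  assumes "aff y" "a \<in> AR"
  shows "y \<circ> rf (a \<circ> y) = rf a \<circ> y"
proof -
  obtain z t where z: "lin z" "y = (\<lambda>x. z x + t)" using assms(1) by (rule affE)
  obtain \<alpha> k where a: "\<alpha> \<in> \<Phi>" "a = (\<lambda>x. \<alpha> x - of_int k)" using assms(2) by (rule AR_E)
  have e: "(\<lambda>v. (a \<circ> y) v - (a \<circ> y) 0) = \<alpha> \<circ> z" "(\<lambda>v. a v - a 0) = \<alpha>"
    by (simp_all add: a(2) z(2) root_lin[OF a(1)] fun_eq_iff linear_0[OF linD(1)[OF z(1)]])
  have "y (x - c *\<^sub>R cor (\<alpha> \<circ> z)) = y x - c *\<^sub>R cor \<alpha>" for x c
    by (simp add: z(2) linear_diff[OF linD(1)[OF z(1)]] linear_scale[OF linD(1)[OF z(1)]]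
        linD(5)[OF z(1) a(1)])
  then show ?thesis unfolding rf_def[abs_def] e by (simp add: fun_eq_iff)
qed

text \<open>The point \<open>u\<close> lies on the hyperplane of \<open>a\<close> and on no other,
  and \<open>x\<close> is so close to \<open>u\<close> that no hyperplane off \<open>u\<close>
  separates them. The reflection fixes \<open>u\<close>, so it moves \<open>x\<close> to a point
  equally close, and only \<open>a\<close> can separate the two.\<close>

lemma single_reflection:
  assumes a: "a \<in> AR" "a u = 0" "a x < 0"
    and only: "\<And>b. b \<in> AR \<Longrightarrow> b u = 0 \<Longrightarrow> b = a \<or> b = (\<lambda>v. - a v)"
    and near: "\<And>b. b \<in> AR \<Longrightarrow> 0 < b u \<Longrightarrow> 0 < b x"
  shows "S x (rf a x) = {a}"
proof
  show "{a} \<subseteq> S x (rf a x)" using a rf_value[OF a(1)] by (simp add: S_def)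
  show "S x (rf a x) \<subseteq> {a}"
  proof
    fix b assume "b \<in> S x (rf a x)"
    then have b: "b \<in> AR" "b x < 0" "0 < b (rf a x)" by (auto simp: S_def)
    show "b \<in> {a}"
    proof (cases "b u = 0")
      case True
      then show ?thesis using only[OF b(1)] b(2) a(3) by auto
    next
      case False
      have "\<not> 0 < b u" using near[OF b(1)] b(2) by auto
      then have "b u < 0" using False by simp
      then have "0 < (\<lambda>v. - (b \<circ> rf a) v) u" using rf_fix[of a u] a(2) by simp
      then have "0 < (\<lambda>v. - (b \<circ> rf a) v) x"
        using near[OF AR_neg[OF aff_AR[OF aff_rf[OF a(1)] b(1)]]] by simp
      then show ?thesis using b(3) by simp
    qed
  qed
qed

subsection \<open>The fundamental alcove\<close>

lemma alcove_AR:
  assumes "x \<in> alcove \<Phi> \<Delta>" "x' \<in> alcove \<Phi> \<Delta>" "a \<in> AR"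
  shows "a x \<noteq> 0" "a x < 0 \<longleftrightarrow> a x' < 0"
proof -
  obtain \<alpha> k where a: "\<alpha> \<in> \<Phi>" "a = (\<lambda>x. \<alpha> x - of_int k)" using assms(3) by (rule AR_E)
  have "a x \<noteq> 0 \<and> (a x < 0 \<longleftrightarrow> a x' < 0)"
  proof (cases "pos \<alpha>")
    case True
    then have b: "0 < \<alpha> x" "\<alpha> x < 1" "0 < \<alpha> x'" "\<alpha> x' < 1"
      using assms by (auto simp: alcove_def pos_iff)
    have "k \<le> 0 \<or> 1 \<le> k" by linarith
    then have "real_of_int k \<le> 0 \<or> 1 \<le> real_of_int k" by simp
    then show ?thesis using b unfolding a(2) by linarith
  next
    case False
    then have "pos (\<lambda>x. - \<alpha> x)" using pos_or_neg[OF a(1)] by simp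
    then have "(\<lambda>x. - \<alpha> x) \<in> pos_roots \<Phi> \<Delta>" by (simp only: pos_iff)
    from bspec[OF assms(1)[unfolded alcove_def, simplified] this]
      bspec[OF assms(2)[unfolded alcove_def, simplified] this]
    have b: "0 < - \<alpha> x" "- \<alpha> x < 1" "0 < - \<alpha> x'" "- \<alpha> x' < 1" by simp_all
    have "0 \<le> k \<or> k \<le> -1" by linarith
    then have "0 \<le> real_of_int k \<or> real_of_int k \<le> -1" by linarith
    then show ?thesis using b unfolding a(2) by linarith
  qed
  then show "a x \<noteq> 0" "a x < 0 \<longleftrightarrow> a x' < 0" by auto
qed

lemma alcove_reg: "x \<in> alcove \<Phi> \<Delta> \<Longrightarrow> reg x"
  using alcove_AR(1) by (auto simp: reg_def)

lemma alcove_same: "x \<in> alcove \<Phi> \<Delta> \<Longrightarrow> x' \<in> alcove \<Phi> \<Delta> \<Longrightarrow> S x x' = {}"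
  using alcove_AR(2)[of x x'] by (force simp: S_def)

text \<open>The vector \<open>r\<close> has value 1 on all simple roots, so positive roots take
  their heights on it, and \<open>M\<close> exceeds all of these.\<close>

lemma alcove_nonempty: "alcove \<Phi> \<Delta> \<noteq> {}"
proof -
  obtain r where r: "\<forall>i\<in>\<Delta>. i r = 1" using simple_dual[of "\<lambda>_. 1"] by auto
  define M where "M = 1 + (\<Sum>\<alpha>\<in>\<Phi>. \<bar>\<alpha> r\<bar>)"
  have M: "\<bar>\<alpha> r\<bar> < M" if "\<alpha> \<in> \<Phi>" for \<alpha>
  proof -
    have "\<bar>\<alpha> r\<bar> \<le> (\<Sum>\<alpha>\<in>\<Phi>. \<bar>\<alpha> r\<bar>)" using that finite_roots by (intro member_le_sum) auto
    then show ?thesis by (simp add: M_def)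
  qed
  have Mp: "0 < M" by (auto simp: M_def intro!: add_pos_nonneg sum_nonneg)
  have "0 < \<alpha> ((1 / M) *\<^sub>R r) \<and> \<alpha> ((1 / M) *\<^sub>R r) < 1" if p: "pos \<alpha>" for \<alpha>
  proof -
    have aP: "\<alpha> \<in> \<Phi>" using p by (simp add: pos_def)
    have ar: "\<alpha> r = (\<Sum>j\<in>\<Delta>. \<alpha> (om j))" unfolding root_om[OF aP, of r] by (intro sum.cong) (use r in auto)
    have "\<alpha> r \<noteq> 0"
    proof
      assume "\<alpha> r = 0"
      then have "(\<Sum>j\<in>\<Delta>. \<alpha> (om j)) = 0" using ar by linarith
      then have "\<alpha> (om j) = 0" if "j \<in> \<Delta>" for j
        using p that finite_simple sum_nonneg_eq_0_iff[of \<Delta> "\<lambda>j. \<alpha> (om j)"] unfolding pos_def by blast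
      then have "\<alpha> v = 0" for v unfolding root_om[OF aP, of v] by (intro sum.neutral ballI) simp
      then show False using root_nonzero[OF aP] by simp
    qed
    moreover have "0 \<le> \<alpha> r" unfolding ar using p by (intro sum_nonneg) (simp add: pos_def)
    ultimately show ?thesis unfolding root_lin(4)[OF aP] using M[OF aP] Mp by simp
  qed
  then have "(1 / M) *\<^sub>R r \<in> alcove \<Phi> \<Delta>" by (simp add: alcove_def pos_iff)
  then show ?thesis by auto
qed

lemma open_alcove: "open (alcove \<Phi> \<Delta>)"
proof -
  have "alcove \<Phi> \<Delta> = (\<Inter>\<alpha>\<in>pos_roots \<Phi> \<Delta>. {x. 0 < \<alpha> x} \<inter> {x. \<alpha> x < 1})"
    by (auto simp: alcove_def)
  moreover have "open ({x. 0 < \<alpha> x} \<inter> {x. \<alpha> x < 1})" if "\<alpha> \<in> pos_roots \<Phi> \<Delta>" for \<alpha>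
  proof -
    have "continuous_on UNIV \<alpha>"
      using that linear_root by (intro linear_continuous_on linear_conv_bounded_linear[THEN iffD1])
        (auto simp: pos_roots_def)
    then show ?thesis by (intro open_Int open_Collect_less) auto
  qed
  moreover have "finite (pos_roots \<Phi> \<Delta>)"
    by (rule finite_subset[OF _ finite_roots]) (auto simp: pos_roots_def)
  ultimately show ?thesis by (simp add: open_INT)
qed

definition a0 :: 'v where "a0 = (SOME x. x \<in> alcove \<Phi> \<Delta>)"

lemma a0: "a0 \<in> alcove \<Phi> \<Delta>"
  unfolding a0_def using alcove_nonempty by (metis ex_in_conv someI_ex)

lemma reg_a0 [simp]: "reg a0"
  by (rule alcove_reg[OF a0])

text \<open>By reducedness a hyperplane determines its affine root up to sign. Thus counting
  hyperplanes, as \<open>len\<close> does, agrees with counting elements of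
  \<open>S\<close>.\<close>

lemma AR_zero_set:
  assumes a: "a \<in> AR" and b: "b \<in> AR" and z: "{x. a x = 0} = {x. b x = 0}"
  shows "b = a \<or> b = (\<lambda>x. - a x)"
proof -
  obtain \<alpha> k where a': "\<alpha> \<in> \<Phi>" "a = (\<lambda>x. \<alpha> x - of_int k)" using a by (rule AR_E)
  obtain \<beta> l where b': "\<beta> \<in> \<Phi>" "b = (\<lambda>x. \<beta> x - of_int l)" using b by (rule AR_E)
  define p where "p = (real_of_int k / 2) *\<^sub>R cor \<alpha>"
  have ap: "\<alpha> p = k" using a'(1) by (simp add: p_def root_lin)
  have "p \<in> {x. b x = 0}" unfolding z[symmetric] by (simp add: a'(2) ap)
  then have bp: "\<beta> p = l" by (simp add: b'(2))
  have "\<beta> v = 0" if "\<alpha> v = 0" for v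
  proof -
    have "p + v \<in> {x. b x = 0}" unfolding z[symmetric]
      by (simp add: a'(2) root_lin[OF a'(1)] ap that)
    then show ?thesis by (simp add: b'(2) root_lin[OF b'(1)] bp)
  qed
  then have "\<beta> = \<alpha> \<or> \<beta> = (\<lambda>x. - \<alpha> x)" by (rule roots_proportional[OF a'(1) b'(1)])
  then show ?thesis
  proof
    assume "\<beta> = \<alpha>"
    then show ?thesis using ap bp by (simp add: a'(2) b'(2))
  next
    assume e: "\<beta> = (\<lambda>x. - \<alpha> x)"
    then have "real_of_int l = - real_of_int k" using ap bp by simp
    then show ?thesis by (simp add: a'(2) b'(2) e fun_eq_iff)
  qed
qed

lemma alcove_sign:
  assumes "a \<in> AR"
  shows "(\<forall>x\<in>alcove \<Phi> \<Delta>. a x < 0) \<longleftrightarrow> a a0 < 0" "(\<forall>x\<in>alcove \<Phi> \<Delta>. 0 < a x) \<longleftrightarrow> 0 < a a0"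
proof -
  have e: "a x < 0 \<longleftrightarrow> a a0 < 0" "0 < a x \<longleftrightarrow> 0 < a a0" if "x \<in> alcove \<Phi> \<Delta>" for x
    using alcove_AR[OF that a0 assms] alcove_AR(1)[OF a0 a0 assms] by linarith+
  show "(\<forall>x\<in>alcove \<Phi> \<Delta>. a x < 0) \<longleftrightarrow> a a0 < 0"
    by (rule iffI, erule bspec[OF _ a0], rule ballI, simp only: e)
  show "(\<forall>x\<in>alcove \<Phi> \<Delta>. 0 < a x) \<longleftrightarrow> 0 < a a0"
    by (rule iffI, erule bspec[OF _ a0], rule ballI, simp only: e)
qed

lemma alcoves_separated:
  assumes y: "aff y" and a: "a \<in> AR"
  shows "(\<forall>x\<in>alcove \<Phi> \<Delta>. a x < 0) \<and> (\<forall>b\<in>y ` alcove \<Phi> \<Delta>. 0 < a b) \<longleftrightarrow> a \<in> S a0 (y a0)"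
proof -
  have "(\<forall>b\<in>y ` alcove \<Phi> \<Delta>. 0 < a b) \<longleftrightarrow> (\<forall>x\<in>alcove \<Phi> \<Delta>. 0 < (a \<circ> y) x)" by simp
  then show ?thesis unfolding alcove_sign[OF a] alcove_sign[OF aff_AR[OF y a]] by (simp add: S_def a)
qed

lemma len_eq:
  assumes y: "aff y"
  shows "len \<Phi> \<Delta> y = card (S a0 (y a0))"
proof -
  let ?Q = "\<lambda>(\<alpha> :: 'v \<Rightarrow> real) k. ((\<forall>a\<in>alcove \<Phi> \<Delta>. \<alpha> a < of_int k) \<and> (\<forall>b\<in>y ` alcove \<Phi> \<Delta>. of_int k < \<alpha> b)) \<or>
       ((\<forall>a\<in>alcove \<Phi> \<Delta>. of_int k < \<alpha> a) \<and> (\<forall>b\<in>y ` alcove \<Phi> \<Delta>. \<alpha> b < of_int k))"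
  have Q: "?Q \<alpha> k \<longleftrightarrow> (\<lambda>x. \<alpha> x - of_int k) \<in> S a0 (y a0) \<or> (\<lambda>x. - (\<alpha> x - of_int k)) \<in> S a0 (y a0)"
    if "\<alpha> \<in> \<Phi>" for \<alpha> k
    using alcoves_separated[OF y AR_I[OF that, of k]] alcoves_separated[OF y AR_neg[OF AR_I[OF that, of k]]]
    by simp
  have h: "hyp \<alpha> k = {x. \<alpha> x - real_of_int k = 0}" for \<alpha> :: "'v \<Rightarrow> real" and k
    by (auto simp: hyp_def)
  have "{H. \<exists>\<alpha>\<in>\<Phi>. \<exists>k::int. H = hyp \<alpha> k \<and> ?Q \<alpha> k} = (\<lambda>a. {x. a x = 0}) ` S a0 (y a0)" (is "?L = ?R")
  proof
    show "?L \<subseteq> ?R"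
    proof
      fix H assume "H \<in> ?L"
      then obtain \<alpha> k where a: "\<alpha> \<in> \<Phi>" "H = hyp \<alpha> k" "?Q \<alpha> k" by (elim CollectE bexE exE conjE)
      from a(3)[unfolded Q[OF a(1)]] show "H \<in> ?R"
      proof
        assume "(\<lambda>x. \<alpha> x - of_int k) \<in> S a0 (y a0)"
        then show "H \<in> ?R" unfolding a(2) h by (rule image_eqI[rotated]) simp
      next
        assume "(\<lambda>x. - (\<alpha> x - of_int k)) \<in> S a0 (y a0)"
        then show "H \<in> ?R" unfolding a(2) h by (rule image_eqI[rotated]) auto
      qed
    qed
    show "?R \<subseteq> ?L"
    proof
      fix H assume "H \<in> ?R"
      then obtain a where a: "H = {x. a x = 0}" "a \<in> S a0 (y a0)" by (rule imageE)
      then have "a \<in> AR" by (simp add: S_def)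
      then obtain \<alpha> k where ak: "\<alpha> \<in> \<Phi>" "a = (\<lambda>x. \<alpha> x - of_int k)" by (rule AR_E)
      have "?Q \<alpha> k" unfolding Q[OF ak(1)] using a(2) ak(2) by simp
      moreover have "H = hyp \<alpha> k" unfolding h a(1) ak(2) ..
      ultimately show "H \<in> ?L" by (intro CollectI bexI[OF _ ak(1)] exI[of _ k] conjI)
    qed
  qed
  moreover have "inj_on (\<lambda>a. {x. a x = 0}) (S a0 (y a0))"
  proof (rule inj_onI)
    fix a b assume ab: "a \<in> S a0 (y a0)" "b \<in> S a0 (y a0)" "{x. a x = 0} = {x. b x = 0}"
    then have "b = a \<or> b = (\<lambda>x. - a x)" by (intro AR_zero_set) (simp_all add: S_def)
    then show "a = b" using ab(1,2) by (auto simp: S_def)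
  qed
  ultimately show ?thesis unfolding len_def by (simp add: card_image)
qed

lemma Saff_E:
  assumes "s \<in> Saff \<Phi> cor \<Delta>"
  obtains a where "a \<in> AR" "s = rf a" "S a0 (s a0) = {a}"
proof -
  obtain \<alpha> k where a: "\<alpha> \<in> \<Phi>" "s = aref cor \<alpha> k" "len \<Phi> \<Delta> s = 1"
    using assms unfolding Saff_def by (elim CollectE exE conjE) simp
  define b where "b = (\<lambda>x. \<alpha> x - of_int k)"
  have b: "b \<in> AR" "s = rf b" unfolding b_def rf_AR[OF a(1)] by (rule AR_I[OF a(1)], rule a(2))
  have "aff s" using aff_rf[OF b(1)] b(2) by simp
  then have "card (S a0 (s a0)) = 1" using a(3) len_eq by simp
  then obtain c where c: "S a0 (s a0) = {c}" by (rule card_1_singletonE)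
  have "b a0 \<noteq> 0" using b(1) reg_a0 by (simp add: reg_def)
  then consider "b a0 < 0" | "0 < b a0" by linarith
  then show ?thesis
  proof cases
    case 1
    then have "b \<in> S a0 (s a0)" using rf_value[OF b(1), of a0] b by (simp add: S_def)
    then have "S a0 (s a0) = {b}" using c by simp
    then show ?thesis by (rule that[OF b])
  next
    case 2
    then have "(\<lambda>x. - b x) \<in> S a0 (s a0)"
      using rf_value[OF b(1), of a0] b AR_neg[OF b(1)] by (simp add: S_def)
    then have "S a0 (s a0) = {\<lambda>x. - b x}" using c by simp
    moreover have "s = rf (\<lambda>x. - b x)" using rf_neg[OF b(1)] b(2) by simp
    ultimately show ?thesis by (intro that[OF AR_neg[OF b(1)]])
  qed
qed

lemma Saff_I:
  assumes "a \<in> AR" "S a0 (rf a a0) = {a}"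
  shows "rf a \<in> Saff \<Phi> cor \<Delta>"
proof -
  obtain \<alpha> k where a: "\<alpha> \<in> \<Phi>" "a = (\<lambda>x. \<alpha> x - of_int k)" using assms(1) by (rule AR_E)
  have "len \<Phi> \<Delta> (rf a) = 1" using len_eq[OF aff_rf[OF assms(1)]] assms(2) by simp
  moreover have "rf a = aref cor \<alpha> k" unfolding a(2) by (rule rf_AR[OF a(1)])
  ultimately show ?thesis using a(1) unfolding Saff_def by (intro CollectI exI conjI) auto
qed

lemma aff_Saff: "s \<in> Saff \<Phi> cor \<Delta> \<Longrightarrow> aff s"
  by (erule Saff_E) (simp add: aff_rf)

end

section \<open>Galleries and words\<close>

context rdatum
begin

lemma regD: "reg x \<Longrightarrow> a \<in> AR \<Longrightarrow> a x \<noteq> 0"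
  unfolding reg_def by (erule (1) bspec)

lemma root_combination_nonzero:
  assumes "\<alpha> \<in> \<Phi>" "\<beta> \<in> \<Phi>" "\<beta> \<noteq> \<alpha>" "\<beta> \<noteq> (\<lambda>x. - \<alpha> x)"
  shows "\<exists>e. \<beta> e - c * \<alpha> e \<noteq> 0"
proof -
  have "\<exists>v. \<alpha> v = 0 \<and> \<beta> v \<noteq> 0"
  proof (rule ccontr)
    assume "\<nexists>v. \<alpha> v = 0 \<and> \<beta> v \<noteq> 0"
    then have "\<beta> v = 0" if "\<alpha> v = 0" for v using that by auto
    from roots_proportional[OF assms(1,2) this] show False using assms(3,4) by simp
  qed
  then obtain v where "\<alpha> v = 0" "\<beta> v \<noteq> 0" by blast
  then show ?thesis by (intro exI[of _ v]) simp
qed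

text \<open>Two affine roots \<open>a\<close>, \<open>b\<close> separating \<open>x'\<close> from \<open>x\<close> vanish at the same point of the segment
  exactly when \<open>a x' * b x = b x' * a x\<close>.\<close>

lemma generic_crossings:
  "\<exists>x'\<in>alcove \<Phi> \<Delta>. \<forall>a\<in>S a0 x. \<forall>b\<in>S a0 x. a \<noteq> b \<longrightarrow> a x' * b x \<noteq> b x' * a x"
proof -
  define G where "G = (\<lambda>(a :: 'v \<Rightarrow> real, b :: 'v \<Rightarrow> real).
    (\<lambda>v. (a v - a 0) * b x - (b v - b 0) * a x, b 0 * a x - a 0 * b x))"
  define I where "I = {(a, b). a \<in> S a0 x \<and> b \<in> S a0 x \<and> (\<lambda>v. a v - a 0) \<noteq> (\<lambda>v. b v - b 0)}"
  have "\<exists>x'\<in>alcove \<Phi> \<Delta>. \<forall>p\<in>G ` I. fst p x' \<noteq> snd p"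
  proof (rule generic_point[OF open_alcove alcove_nonempty])
    have "I \<subseteq> S a0 x \<times> S a0 x" by (auto simp: I_def)
    then show "countable (G ` I)" using finite_S[of a0 x]
      by (intro countable_finite finite_imageI) (rule finite_subset, auto)
    fix f and c :: real assume "(f, c) \<in> G ` I"
    then obtain p where p: "(f, c) = G p" "p \<in> I" by (rule imageE)
    obtain a b where pab: "p = (a, b)" by (cases p)
    have ab: "a \<in> S a0 x" "b \<in> S a0 x" "(\<lambda>v. a v - a 0) \<noteq> (\<lambda>v. b v - b 0)"
      using p(2) unfolding pab I_def by simp_all
    have f: "f = (\<lambda>v. (a v - a 0) * b x - (b v - b 0) * a x)"
      using p(1) unfolding pab G_def by simp
    have abR: "a \<in> AR" "b \<in> AR" using ab by (simp_all add: S_def)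
    obtain \<alpha> k where al: "\<alpha> \<in> \<Phi>" "a = (\<lambda>x. \<alpha> x - of_int k)" using abR(1) by (rule AR_E)
    obtain \<beta> l where be: "\<beta> \<in> \<Phi>" "b = (\<lambda>x. \<beta> x - of_int l)" using abR(2) by (rule AR_E)
    have f': "f = (\<lambda>v. \<alpha> v * b x - \<beta> v * a x)"
      unfolding f al(2) be(2) by (simp add: root_lin(5)[OF al(1)] root_lin(5)[OF be(1)])
    have ne: "\<beta> \<noteq> \<alpha>"
    proof
      assume "\<beta> = \<alpha>"
      then have "(\<lambda>v. a v - a 0) = (\<lambda>v. b v - b 0)" by (simp add: al(2) be(2))
      then show False using ab(3) by contradiction
    qed
    have px: "0 < a x" "0 < b x" using ab by (auto simp: S_def)
    have "linear f" unfolding f'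
      by (intro linearI) (simp_all add: root_lin[OF al(1)] root_lin[OF be(1)] algebra_simps)
    moreover have "\<exists>e. f e \<noteq> 0"
    proof (cases "\<beta> = (\<lambda>x. - \<alpha> x)")
      case True
      have "f (cor \<alpha>) = 2 * b x + 2 * a x" unfolding f' True using al(1) by simp
      then show ?thesis using px by (intro exI[of _ "cor \<alpha>"]) simp
    next
      case False
      obtain e where e: "\<beta> e - (b x / a x) * \<alpha> e \<noteq> 0"
        using root_combination_nonzero[OF al(1) be(1) ne False] by blast
      have "f e = - a x * (\<beta> e - (b x / a x) * \<alpha> e)" unfolding f' using px by (simp add: field_simps)
      then show ?thesis using e px by (intro exI[of _ e]) simp
    qed
    ultimately show "linear f \<and> (\<exists>e. f e \<noteq> 0)" by blast
  qed
  then obtain x' where x': "x' \<in> alcove \<Phi> \<Delta>" and g: "\<And>p. p \<in> I \<Longrightarrow> fst (G p) x' \<noteq> snd (G p)" by blast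
  have "a x' * b x \<noteq> b x' * a x" if ab: "a \<in> S a0 x" "b \<in> S a0 x" "a \<noteq> b" for a b
  proof (cases "(a, b) \<in> I")
    case True
    from g[OF True] show ?thesis by (auto simp: G_def algebra_simps)
  next
    case False
    then have "(\<lambda>v. a v - a 0) = (\<lambda>v. b v - b 0)" using ab by (simp add: I_def)
    then have e: "a v = b v + (a 0 - b 0)" for v
      using fun_cong[OF \<open>(\<lambda>v. a v - a 0) = (\<lambda>v. b v - b 0)\<close>, of v] by simp
    have "a 0 - b 0 \<noteq> 0"
    proof
      assume "a 0 - b 0 = 0"
      then have "a v = b v" for v using e[of v] by simp
      then show False using ab(3) by blast
    qed
    moreover have "b x' < 0" "0 < b x"
      using ab(2) alcove_AR(2)[OF x' a0, of b] by (auto simp: S_def)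
    moreover have "a x' * b x - b x' * a x = (a 0 - b 0) * (b x - b x')"
      unfolding e[of x] e[of x'] by (simp add: algebra_simps)
    ultimately show ?thesis by auto
  qed
  then show ?thesis using x' by blast
qed

text \<open>On the segment from a generic point \<open>x'\<close> of the fundamental alcove to
  \<open>x\<close>, the separating hyperplanes are met one at a time. The first one is therefore a
  wall of the alcove, by \<open>single_reflection\<close> at the meeting point
  \<open>u\<close>.\<close>

lemma wall_exists:
  assumes x: "reg x" and ne: "S a0 x \<noteq> {}"
  obtains a where "a \<in> S a0 x" "rf a \<in> Saff \<Phi> cor \<Delta>" "S a0 (rf a a0) = {a}"
proof -
  obtain x' where x': "x' \<in> alcove \<Phi> \<Delta>"
    and gen: "\<And>a b. a \<in> S a0 x \<Longrightarrow> b \<in> S a0 x \<Longrightarrow> a \<noteq> b \<Longrightarrow> a x' * b x \<noteq> b x' * a x"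
    using generic_crossings[of x] by blast
  have rx': "reg x'" and s0: "S a0 x' = {}" using alcove_reg[OF x'] alcove_same[OF a0 x'] by auto
  have Sx: "S a0 x = S x' x" using S_cong(1)[OF reg_a0 rx' s0] .
  \<comment> \<open>The parameter of the segment at which \<open>a\<close> vanishes;
    \<open>bu'\<close> below expresses values at \<open>u\<close> through differences of such
    parameters.\<close>
  define r where "r a = - a x' / (a x - a x')" for a :: "'v \<Rightarrow> real"
  obtain a where a: "a \<in> S a0 x" and min: "\<And>b. b \<in> S a0 x \<Longrightarrow> r a \<le> r b"
    using finite_has_minimal[of "r ` S a0 x"] ne finite_S[of a0 x]
    by (metis (no_types, lifting) arg_min_if_finite(1) arg_min_least)
  have sg: "b \<in> AR" "b x' < 0" "0 < b x" if "b \<in> S a0 x" for b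
    using that unfolding Sx by (auto simp: S_def)
  define u where "u = (1 - r a) *\<^sub>R x' + r a *\<^sub>R x"
  have r01: "0 < r a" "r a < 1" using sg[OF a] by (auto simp: r_def field_simps)
  have bu: "b u = (1 - r a) * b x' + r a * b x" if "b \<in> AR" for b
    unfolding u_def by (rule AR_affine[OF that])
  have bu': "b u = (b x - b x') * (r a - r b)" if "b \<in> S a0 x" for b
  proof -
    have "b x - b x' \<noteq> 0" using sg[OF that] by simp
    then have "(b x - b x') * r b = - b x'" by (simp add: r_def)
    then show ?thesis using bu[OF sg(1)[OF that]] by (simp add: algebra_simps)
  qed
  have au: "a u = 0" using bu'[OF a] by simp
  have in_S: "b \<in> S a0 x" if b: "b \<in> AR" "b x' < 0" "0 \<le> b u" for b
  proof -
    have "(1 - r a) * b x' < 0" using b(2) r01 by (simp add: mult_pos_neg)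
    then have "0 < r a * b x" using bu[OF b(1)] b(3) by linarith
    then have "0 < b x" using r01 by (simp add: zero_less_mult_iff)
    then show ?thesis unfolding Sx using b by (simp add: S_def)
  qed
  have eq: "b = a" if b: "b \<in> S a0 x" "b u = 0" for b
  proof (rule ccontr)
    assume "b \<noteq> a"
    have "b x - b x' \<noteq> 0" "a x - a x' \<noteq> 0" using sg[OF b(1)] sg[OF a] by auto
    moreover from this(1) have "r a = r b" using bu'[OF b(1)] b(2) by simp
    ultimately have "a x' * (b x - b x') = b x' * (a x - a x')" by (simp add: r_def field_simps)
    then have "a x' * b x = b x' * a x" by (simp add: algebra_simps)
    then show False using gen[OF a b(1)] \<open>b \<noteq> a\<close> by blast
  qed
  have single: "S x' (rf a x') = {a}"
  proof (rule single_reflection[OF sg(1)[OF a] au sg(2)[OF a]])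
    fix b assume b: "b \<in> AR" "b u = 0"
    have "b x' \<noteq> 0" by (rule regD[OF rx' b(1)])
    then consider "b x' < 0" | "- b x' < 0" by linarith
    then show "b = a \<or> b = (\<lambda>v. - a v)"
    proof cases
      case 1
      then show ?thesis using eq in_S b by simp
    next
      case 2
      then have "(\<lambda>v. - b v) = a" using eq in_S AR_neg[OF b(1)] b by simp
      then have "(\<lambda>v. - a v) = b" by (simp add: fun_eq_iff) (metis add.inverse_inverse)
      then show ?thesis by simp
    qed
  next
    fix b assume b: "b \<in> AR" "0 < b u"
    show "0 < b x'"
    proof (rule ccontr)
      assume "\<not> 0 < b x'"
      then have "b x' < 0" using regD[OF rx' b(1)] by simp
      then have bS: "b \<in> S a0 x" using in_S b by simp
      then have "0 < b x - b x'" using sg[OF bS] by simp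
      moreover have "r a - r b \<le> 0" using min[OF bS] by simp
      ultimately have "b u \<le> 0" unfolding bu'[OF bS] by (simp add: mult_nonneg_nonpos)
      then show False using b(2) by simp
    qed
  qed
  have ra: "aff (rf a)" using aff_rf[OF sg(1)[OF a]] .
  have "S (rf a a0) (rf a x') = {}" using s0 S_aff[OF ra] by simp
  then have "S x' (rf a a0) = {a}"
    using single S_cong(2)[OF aff_reg[OF ra reg_a0] aff_reg[OF ra rx']] by simp
  then have "S a0 (rf a a0) = {a}" using S_cong(1)[OF reg_a0 rx' s0] by simp
  then show ?thesis using that[OF a] Saff_I[OF sg(1)[OF a]] by simp
qed

lemma step_crossing:
  assumes g: "aff g" and s: "S a0 (s a0) = {a}"
  shows "S (g a0) (g (s a0)) = {a \<circ> inv g}"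
  unfolding S_aff[OF g] s by simp

lemma gallery_step:
  assumes g: "aff g" and x: "reg x" and ne: "S (g a0) x \<noteq> {}"
  obtains s b where "s \<in> Saff \<Phi> cor \<Delta>" "b \<in> S (g a0) x" "S (g a0) (g (s a0)) = {b}"
proof -
  have gx: "g (inv g x) = x" using g by simp
  have e: "S (g a0) x = (\<lambda>a. a \<circ> inv g) ` S a0 (inv g x)" using S_aff[OF g, of a0 "inv g x"] gx by simp
  then have "S a0 (inv g x) \<noteq> {}" using ne by auto
  then obtain a where a: "a \<in> S a0 (inv g x)" "rf a \<in> Saff \<Phi> cor \<Delta>" "S a0 (rf a a0) = {a}"
    using wall_exists[OF aff_reg[OF aff_inv[OF g] x]] by blast
  show ?thesis
  proof (rule that[OF a(2)])
    show "a \<circ> inv g \<in> S (g a0) x" unfolding e using a(1) by (rule imageI)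
    show "S (g a0) (g (rf a a0)) = {a \<circ> inv g}" by (rule step_crossing[OF g, of "rf a" a, OF a(3)])
  qed
qed

text \<open>The product that occurs in \<open>nice\<close>. Its prefixes carry the fundamental
  alcove to the successive alcoves of a gallery.\<close>

definition pw :: "('v \<Rightarrow> 'v) list \<Rightarrow> 'v \<Rightarrow> 'v" where
  "pw ss = foldr (\<circ>) ss id"

lemma pw_Nil [simp]: "pw [] = id"
  and pw_Cons [simp]: "pw (s # ss) = s \<circ> pw ss"
  by (simp_all add: pw_def)

lemma pw_append: "pw (ss @ ts) = pw ss \<circ> pw ts"
  by (induction ss) (simp_all add: o_assoc)

lemma pw_snoc: "pw (ss @ [s]) = pw ss \<circ> s"
  by (simp add: pw_append)

lemma aff_pw: "set ss \<subseteq> Saff \<Phi> cor \<Delta> \<Longrightarrow> aff (pw ss)"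
proof (induction ss)
  case Nil
  show ?case by (simp only: pw_Nil aff_id)
next
  case (Cons s ss)
  then show ?case unfolding pw_Cons by (intro aff_comp[OF aff_Saff]) simp_all
qed

lemma Saff_involution: "s \<in> Saff \<Phi> cor \<Delta> \<Longrightarrow> s \<circ> s = id"
proof -
  assume "s \<in> Saff \<Phi> cor \<Delta>"
  then obtain a where "a \<in> AR" "s = rf a" by (rule Saff_E)
  then show ?thesis by (simp add: fun_eq_iff)
qed

lemma pw_rev: "set ss \<subseteq> Saff \<Phi> cor \<Delta> \<Longrightarrow> pw ss \<circ> pw (rev ss) = id"
proof (induction ss)
  case (Cons s ss)
  have "pw (s # ss) \<circ> pw (rev (s # ss)) = s \<circ> (pw ss \<circ> pw (rev ss)) \<circ> s"
    by (simp add: pw_append o_assoc)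
  also have "pw ss \<circ> pw (rev ss) = id" using Cons.prems by (intro Cons.IH) simp
  also have "s \<circ> id \<circ> s = s \<circ> s" by simp
  also have "s \<circ> s = id" using Cons.prems by (intro Saff_involution) simp
  finally show ?case .
qed simp

lemma inv_pw: "set ss \<subseteq> Saff \<Phi> cor \<Delta> \<Longrightarrow> inv (pw ss) = pw (rev ss)"
  using pw_rev[of ss] pw_rev[of "rev ss"] by (intro inv_unique_comp) simp_all

lemma reach_alcove:
  assumes "reg x"
  shows "\<exists>ss. set ss \<subseteq> Saff \<Phi> cor \<Delta> \<and> S (pw ss a0) x = {}"
proof -
  have "\<exists>ss. set ss \<subseteq> Saff \<Phi> cor \<Delta> \<and> S (pw ss a0) x = {}"
    if "card (S (pw ts a0) x) = n" "set ts \<subseteq> Saff \<Phi> cor \<Delta>" for n ts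
    using that
  proof (induction n arbitrary: ts rule: less_induct)
    case (less n)
    note g = aff_pw[OF less.prems(2)]
    show ?case
    proof (cases "S (pw ts a0) x = {}")
      case True
      then show ?thesis using less.prems(2) by blast
    next
      case False
      then obtain s b where s: "s \<in> Saff \<Phi> cor \<Delta>" "b \<in> S (pw ts a0) x" "S (pw ts a0) (pw ts (s a0)) = {b}"
        using gallery_step[OF g assms] by blast
      have "card (S (pw ts a0) x) = 1 + card (S (pw ts (s a0)) x)"
        using S_split(3)[OF aff_reg[OF g reg_a0] aff_reg[OF g aff_reg[OF aff_Saff[OF s(1)] reg_a0]], of x] s
        by simp
      then have "card (S (pw (ts @ [s]) a0) x) < n" using less.prems(1) by (simp add: pw_snoc)
      from less.IH[OF this refl] show ?thesis using less.prems(2) s(1) by simp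
    qed
  qed
  from this[of "[]", OF refl] show ?thesis by simp
qed

lemma first_switch:
  assumes "X []" "\<not> X ts"
  shows "\<exists>us t vs. ts = us @ t # vs \<and> X us \<and> \<not> X (us @ [t])"
  using assms(2)
proof (induction ts rule: rev_induct)
  case (snoc t ts)
  show ?case
  proof (cases "X ts")
    case True
    then show ?thesis using snoc.prems by blast
  next
    case False
    then show ?thesis using snoc.IH by fastforce
  qed
qed (use assms(1) in simp)

text \<open>A closed gallery that starts through the wall \<open>a\<close> must recross it, at a
  letter \<open>t\<close> after a prefix \<open>s # us\<close>. The hyperplane crossed there is
  \<open>a\<close> with the opposite sign, so the prefix conjugates \<open>t\<close> to
  \<open>s\<close>, and the two letters cancel.\<close>

lemma deletion:
  assumes "set ss \<subseteq> Saff \<Phi> cor \<Delta>" "S a0 (pw ss a0) = {}"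
  shows "pw ss = id"
  using assms
proof (induction "length ss" arbitrary: ss rule: less_induct)
  case less
  show ?case
  proof (cases ss)
    case Nil
    then show ?thesis by simp
  next
    case (Cons s ts)
    have sS: "s \<in> Saff \<Phi> cor \<Delta>" using less.prems(1) Cons by simp
    then obtain a where a: "a \<in> AR" "s = rf a" "S a0 (s a0) = {a}" by (rule Saff_E)
    have a0n: "a a0 < 0" "0 < a (s a0)" using a(3) by (auto simp: S_def)
    have "a (pw ss a0) < 0"
      using S_empty_sign(1)[OF reg_a0 aff_reg[OF aff_pw[OF less.prems(1)] reg_a0] less.prems(2) a(1)] a0n by simp
    then have "0 < a (pw (s # []) a0)" "\<not> 0 < a (pw (s # ts) a0)" using a0n Cons by simp_all
    from first_switch[of "\<lambda>us. 0 < a (pw (s # us) a0)", OF this]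
    obtain us t vs where ts: "ts = us @ t # vs"
      and u: "0 < a (pw (s # us) a0)" "\<not> 0 < a (pw (s # us @ [t]) a0)"
      by (elim exE conjE) (rule that)
    define g where "g = pw (s # us)"
    have tS: "t \<in> Saff \<Phi> cor \<Delta>" and us: "set (s # us) \<subseteq> Saff \<Phi> cor \<Delta>" and vs: "set vs \<subseteq> Saff \<Phi> cor \<Delta>"
      using less.prems(1) Cons ts by auto
    have g: "aff g" unfolding g_def by (rule aff_pw[OF us])
    obtain b where b: "b \<in> AR" "t = rf b" "S a0 (t a0) = {b}" using tS by (rule Saff_E)
    have gt: "pw (s # us @ [t]) = g \<circ> t" using pw_snoc[of "s # us" t] by (simp add: g_def)
    have "a (g (t a0)) \<noteq> 0" by (rule regD[OF aff_reg[OF g aff_reg[OF aff_Saff[OF tS] reg_a0]] a(1)])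
    moreover have "0 < a (g a0)" "\<not> 0 < a (g (t a0))" using u unfolding gt g_def by simp_all
    ultimately have "(\<lambda>v. - a v) \<in> S (g a0) (g (t a0))"
      unfolding S_def using AR_neg[OF a(1)] by simp
    then have "(\<lambda>v. - a v) = b \<circ> inv g" using step_crossing[OF g, of t b, OF b(3)] by simp
    then have "b = (\<lambda>v. - a v) \<circ> g" using g by (simp add: fun_eq_iff)
    then have "g \<circ> t = rf (\<lambda>v. - a v) \<circ> g" unfolding b(2) using rf_conj[OF g AR_neg[OF a(1)]] by simp
    also have "\<dots> = s \<circ> s \<circ> pw us" unfolding rf_neg[OF a(1)] by (simp add: a(2)[symmetric] g_def o_assoc)
    also have "\<dots> = pw us" using Saff_involution[OF sS] by simp
    finally have gtu: "g \<circ> t = pw us" .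
    have "pw ss = pw (s # us @ [t]) \<circ> pw vs" using Cons ts by (simp add: pw_append o_assoc)
    also have "\<dots> = pw (us @ vs)" unfolding gt gtu by (simp add: pw_append)
    finally have e: "pw ss = pw (us @ vs)" .
    have "pw (us @ vs) = id"
    proof (rule less.hyps)
      show "length (us @ vs) < length ss" using Cons ts by simp
      show "set (us @ vs) \<subseteq> Saff \<Phi> cor \<Delta>" using us vs by simp
      show "S a0 (pw (us @ vs) a0) = {}" using less.prems(2) e by simp
    qed
    then show ?thesis using e by simp
  qed
qed

text \<open>There are infinitely many affine roots, but for each root \<beta> the integers below
  \<open>\<beta> u\<close> are all at most \<open>\<lceil>\<beta> u\<rceil> - 1\<close>, so one
  strict inequality per root suffices.\<close>

lemma nearby_sign:
  "\<forall>\<^sub>F \<delta> in at_right 0. \<forall>b\<in>AR. 0 < b u \<longrightarrow> 0 < b (u + \<delta> *\<^sub>R d)"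
proof -
  have "\<forall>\<^sub>F \<delta> in at_right 0. \<forall>\<beta>\<in>\<Phi>. of_int (\<lceil>\<beta> u\<rceil> - 1) < \<beta> u + \<delta> * \<beta> d"
  proof (rule eventually_ball_finite[OF finite_roots], intro ballI)
    fix \<beta> assume "\<beta> \<in> \<Phi>"
    have "((\<lambda>\<delta>. \<beta> u + \<delta> * \<beta> d) \<longlongrightarrow> \<beta> u + 0 * \<beta> d) (at_right 0)"
      by (intro tendsto_intros)
    moreover have "real_of_int (\<lceil>\<beta> u\<rceil> - 1) < \<beta> u + 0 * \<beta> d" by linarith
    ultimately show "\<forall>\<^sub>F \<delta> in at_right 0. of_int (\<lceil>\<beta> u\<rceil> - 1) < \<beta> u + \<delta> * \<beta> d"
      by (rule order_tendstoD(1))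
  qed
  then show ?thesis
  proof (rule eventually_mono, intro ballI impI)
    fix \<delta> b assume h: "\<forall>\<beta>\<in>\<Phi>. of_int (\<lceil>\<beta> u\<rceil> - 1) < \<beta> u + \<delta> * \<beta> d" and b: "b \<in> AR" "0 < b u"
    obtain \<beta> k where bk: "\<beta> \<in> \<Phi>" "b = (\<lambda>x. \<beta> x - of_int k)" using b(1) by (rule AR_E)
    have "real_of_int k < \<beta> u" using b(2) unfolding bk(2) by simp
    then have "k \<le> \<lceil>\<beta> u\<rceil> - 1" by linarith
    then have "real_of_int k \<le> of_int (\<lceil>\<beta> u\<rceil> - 1)" by simp
    also have "\<dots> < \<beta> u + \<delta> * \<beta> d" using h bk(1) by blast
    finally show "0 < b (u + \<delta> *\<^sub>R d)" unfolding bk(2) by (simp add: root_lin[OF bk(1)])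
  qed
qed

lemma hyperplane_generic:
  assumes a: "a \<in> AR"
  shows "\<exists>u. a u = 0 \<and> (\<forall>b\<in>AR. b u = 0 \<longrightarrow> b = a \<or> b = (\<lambda>v. - a v))"
proof -
  obtain \<alpha> k where ak: "\<alpha> \<in> \<Phi>" "a = (\<lambda>x. \<alpha> x - of_int k)" using a by (rule AR_E)
  define h where "h x = x - (a x / 2) *\<^sub>R cor \<alpha>" for x
  have ah: "a (h x) = 0" for x
    unfolding h_def ak(2) using ak(1) by (simp add: root_lin[OF ak(1)] diff_divide_distrib)
  define N where "N = \<Phi> - {\<alpha>, (\<lambda>x. - \<alpha> x)}"
  \<comment> \<open>With \<open>h\<close> the projection onto the hyperplane along the coroot,
    \<open>\<beta> (h x) = l\<close> says that the functional in the first component has the value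
    in the second.\<close>
  define G where "G = (\<lambda>(\<beta> :: 'v \<Rightarrow> real, l :: int). (\<lambda>x. \<beta> x - (\<beta> (cor \<alpha>) / 2) * \<alpha> x,
      of_int l - (\<beta> (cor \<alpha>) / 2) * of_int k))"
  have "\<exists>x\<in>UNIV. \<forall>p\<in>G ` (N \<times> UNIV). fst p x \<noteq> snd p"
  proof (rule generic_point)
    have "countable N" using finite_roots by (intro countable_finite) (simp add: N_def)
    then show "countable (G ` (N \<times> UNIV))" by (intro countable_image countable_SIGMA) auto
    fix f and c :: real assume "(f, c) \<in> G ` (N \<times> UNIV)"
    then obtain p where p: "(f, c) = G p" "p \<in> N \<times> UNIV" by (rule imageE)
    obtain \<beta> l where pb: "p = (\<beta>, l)" by (cases p)
    have b: "\<beta> \<in> \<Phi>" "\<beta> \<noteq> \<alpha>" "\<beta> \<noteq> (\<lambda>x. - \<alpha> x)" using p(2) unfolding pb N_def by simp_all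
    have f: "f = (\<lambda>x. \<beta> x - (\<beta> (cor \<alpha>) / 2) * \<alpha> x)" using p(1) unfolding pb G_def by simp
    have "linear f" unfolding f
      by (intro linearI) (simp_all add: root_lin[OF ak(1)] root_lin[OF b(1)] algebra_simps)
    then show "linear f \<and> (\<exists>e. f e \<noteq> 0)"
      unfolding f using root_combination_nonzero[OF ak(1) b] by blast
  qed auto
  then obtain x where x: "\<And>p. p \<in> N \<times> UNIV \<Longrightarrow> fst (G p) x \<noteq> snd (G p)" by blast
  have "b = a \<or> b = (\<lambda>v. - a v)" if b: "b \<in> AR" "b (h x) = 0" for b
  proof -
    obtain \<beta> l where bl: "\<beta> \<in> \<Phi>" "b = (\<lambda>x. \<beta> x - of_int l)" using b(1) by (rule AR_E)
    have v: "\<beta> (h x) = of_int l" using b(2) unfolding bl(2) by simp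
    have hv: "\<beta> (h x) = \<beta> x - ((\<alpha> x - of_int k) / 2) * \<beta> (cor \<alpha>)"
      unfolding h_def ak(2) by (simp only: root_lin[OF bl(1)])
    have "fst (G (\<beta>, l)) x = snd (G (\<beta>, l))"
      using v unfolding hv G_def by (simp add: field_simps)
    then have "\<beta> \<notin> N" using x[of "(\<beta>, l)"] by blast
    then have "\<beta> = \<alpha> \<or> \<beta> = (\<lambda>x. - \<alpha> x)" using bl(1) by (simp add: N_def)
    then show ?thesis
    proof
      assume e: "\<beta> = \<alpha>"
      have "\<alpha> (h x) = of_int k" using ah unfolding ak(2) by simp
      then have "l = k" using v e by simp
      then show ?thesis unfolding bl(2) ak(2) e by simp
    next
      assume e: "\<beta> = (\<lambda>x. - \<alpha> x)"
      have "\<alpha> (h x) = of_int k" using ah unfolding ak(2) by simp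
      then have "real_of_int l = - of_int k" using v e by simp
      then show ?thesis unfolding bl(2) ak(2) e by simp
    qed
  qed
  then show ?thesis using ah by blast
qed

text \<open>Near a generic point \<open>u\<close> of the hyperplane there is a regular point
  \<open>x\<close> separated from its mirror image by \<open>a\<close> alone. A word
  \<open>p\<close> reaching the alcove of \<open>x\<close> turns \<open>a\<close> into a wall
  \<open>c\<close> of the fundamental alcove, and the reflection in \<open>a\<close> is the
  conjugate by \<open>p\<close> of the one in \<open>c\<close>.\<close>

lemma reflection_word:
  assumes a: "a \<in> AR"
  shows "\<exists>ss. set ss \<subseteq> Saff \<Phi> cor \<Delta> \<and> rf a = pw ss"
proof -
  obtain u where u: "a u = 0" and only: "\<And>b. b \<in> AR \<Longrightarrow> b u = 0 \<Longrightarrow> b = a \<or> b = (\<lambda>v. - a v)"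
    using hyperplane_generic[OF a] by blast
  obtain \<alpha> k where ak: "\<alpha> \<in> \<Phi>" "a = (\<lambda>x. \<alpha> x - of_int k)" using a by (rule AR_E)
  have "\<forall>\<^sub>F \<delta> in at_right 0. (\<forall>b\<in>AR. 0 < b u \<longrightarrow> 0 < b (u + \<delta> *\<^sub>R (- cor \<alpha>))) \<and> 0 < \<delta>"
    by (intro eventually_conj nearby_sign) (simp add: eventually_at_right_less)
  from eventually_happens'[OF trivial_limit_at_right_real this]
  obtain \<delta> :: real where d': "\<forall>b\<in>AR. 0 < b u \<longrightarrow> 0 < b (u + \<delta> *\<^sub>R (- cor \<alpha>))" and d: "0 < \<delta>"
    by blast
  define x where "x = u + \<delta> *\<^sub>R (- cor \<alpha>)"
  have ax: "a x < 0"
  proof -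
    have "a x = a u - 2 * \<delta>" using ak(1) unfolding ak(2) x_def by (simp add: root_lin[OF ak(1)])
    then show ?thesis using u d by simp
  qed
  have near: "\<And>b. b \<in> AR \<Longrightarrow> 0 < b u \<Longrightarrow> 0 < b x" unfolding x_def using d' by blast
  have "reg x"
    unfolding reg_def
  proof
    fix b assume b: "b \<in> AR"
    consider "0 < b u" | "0 < (\<lambda>v. - b v) u" | "b u = 0" by (simp add: neg_less_0_iff_less) linarith
    then show "b x \<noteq> 0"
    proof cases
      case 1
      then show ?thesis using near[OF b] by simp
    next
      case 2
      then show ?thesis using near[OF AR_neg[OF b]] by simp
    next
      case 3
      then show ?thesis using only[OF b] ax by auto
    qed
  qed
  then obtain ss where ss: "set ss \<subseteq> Saff \<Phi> cor \<Delta>" "S (pw ss a0) x = {}" using reach_alcove by blast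
  define p where "p = pw ss"
  have p: "aff p" unfolding p_def by (rule aff_pw[OF ss(1)])
  have rp: "reg (p a0)" by (rule aff_reg[OF p reg_a0])
  have ra: "aff (rf a)" by (rule aff_rf[OF a])
  have single: "S x (rf a x) = {a}" by (rule single_reflection[where u = u, OF a u ax]) (fact only, fact near)
  have "S (p a0) (rf a x) = {a}" using S_cong(1)[OF rp \<open>reg x\<close>] ss(2) single by (simp add: p_def)
  moreover have "S (rf a (p a0)) (rf a x) = {}" using ss(2) by (simp add: S_aff[OF ra] p_def)
  ultimately have spa: "S (p a0) (rf a (p a0)) = {a}"
    using S_cong(2)[OF aff_reg[OF ra rp] aff_reg[OF ra \<open>reg x\<close>]] by simp
  define c where "c = a \<circ> p"
  have c: "c \<in> AR" unfolding c_def by (rule aff_AR[OF p a])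
  have pc: "p \<circ> rf c = rf a \<circ> p" unfolding c_def by (rule rf_conj[OF p a])
  have "p (rf c a0) = rf a (p a0)" using fun_cong[OF pc, of a0] by simp
  then have "(\<lambda>a. a \<circ> inv p) ` S a0 (rf c a0) = {a}" using spa S_aff[OF p, of a0 "rf c a0"] by simp
  moreover have "c \<in> S a0 (rf c a0)"
  proof -
    have "a (p a0) < 0" using spa by (auto simp: S_def)
    then show ?thesis using c rf_value[OF c] by (simp add: S_def c_def)
  qed
  ultimately have "card (S a0 (rf c a0)) = 1"
    using card_image[OF inj_comp_inv[OF p], of "S a0 (rf c a0)"] by simp
  then obtain e where "S a0 (rf c a0) = {e}" by (rule card_1_singletonE)
  then have "S a0 (rf c a0) = {c}" using \<open>c \<in> S a0 (rf c a0)\<close> by simp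
  then have cS: "rf c \<in> Saff \<Phi> cor \<Delta>" by (rule Saff_I[OF c])
  have "rf a = rf a \<circ> p \<circ> inv p" using p by (simp add: fun_eq_iff)
  also have "\<dots> = pw ss \<circ> rf c \<circ> pw (rev ss)" unfolding pc[symmetric] using inv_pw[OF ss(1)] by (simp add: p_def)
  also have "\<dots> = pw (ss @ [rf c] @ rev ss)" by (simp add: pw_append o_assoc)
  finally show ?thesis using ss(1) cS by (intro exI[of _ "ss @ [rf c] @ rev ss"]) simp
qed

section \<open>The affine Weyl group as the group of words\<close>

definition words :: "('v \<Rightarrow> 'v) set" where
  "words = {pw ss | ss. set ss \<subseteq> Saff \<Phi> cor \<Delta>}"

lemma words_id: "id \<in> words"
  unfolding words_def by (intro CollectI exI[of _ "[]"]) simp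

lemma words_comp: "f \<in> words \<Longrightarrow> g \<in> words \<Longrightarrow> f \<circ> g \<in> words"
proof -
  assume "f \<in> words" "g \<in> words"
  then obtain ss ts where "f = pw ss" "g = pw ts" "set (ss @ ts) \<subseteq> Saff \<Phi> cor \<Delta>"
    unfolding words_def by auto
  then show ?thesis unfolding words_def by (intro CollectI exI[of _ "ss @ ts"]) (simp add: pw_append)
qed

lemma words_inv: "f \<in> words \<Longrightarrow> inv f \<in> words"
proof -
  assume "f \<in> words"
  then obtain ss where "f = pw ss" "set ss \<subseteq> Saff \<Phi> cor \<Delta>" unfolding words_def by auto
  then show ?thesis unfolding words_def by (intro CollectI exI[of _ "rev ss"]) (simp add: inv_pw)
qed

lemma words_Saff: "s \<in> Saff \<Phi> cor \<Delta> \<Longrightarrow> s \<in> words"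
  unfolding words_def by (intro CollectI exI[of _ "[s]"]) simp

lemma words_aref: "\<alpha> \<in> \<Phi> \<Longrightarrow> aref cor \<alpha> k \<in> words"
  using reflection_word[OF AR_I, of \<alpha> k] rf_AR[of \<alpha> k] unfolding words_def by auto

lemma words_aff: "f \<in> words \<Longrightarrow> aff f"
  unfolding words_def by (auto intro: aff_pw)

lemma words_cor_translation: "\<alpha> \<in> \<Phi> \<Longrightarrow> (\<lambda>x. x + of_int n *\<^sub>R cor \<alpha>) \<in> words"
proof -
  assume a: "\<alpha> \<in> \<Phi>"
  have "aref cor \<alpha> n \<circ> aref cor \<alpha> 0 = (\<lambda>x. x + of_int n *\<^sub>R cor \<alpha>)"
    using a by (simp add: fun_eq_iff aref_def root_lin[OF a] algebra_simps scaleR_2)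
  then show ?thesis using words_comp[OF words_aref[OF a] words_aref[OF a]] by metis
qed

lemma words_Q_translation:
  assumes "q \<in> Qlat \<Phi> cor"
  shows "(\<lambda>x. x + q) \<in> words"
proof -
  obtain c :: "('v \<Rightarrow> real) \<Rightarrow> int" where q: "q = (\<Sum>\<alpha>\<in>\<Phi>. of_int (c \<alpha>) *\<^sub>R cor \<alpha>)"
    using assms unfolding Qlat_def by auto
  have "(\<lambda>x. x + (\<Sum>\<alpha>\<in>F. of_int (c \<alpha>) *\<^sub>R cor \<alpha>)) \<in> words" if "finite F" "F \<subseteq> \<Phi>" for F
    using that
  proof (induction F rule: finite_induct)
    case empty
    then show ?case using words_id by (simp add: id_def)
  next
    case (insert \<alpha> F)
    let ?t = "\<Sum>\<alpha>\<in>F. of_int (c \<alpha>) *\<^sub>R cor \<alpha>"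
    have "(\<lambda>x. x + (\<Sum>\<alpha>\<in>insert \<alpha> F. of_int (c \<alpha>) *\<^sub>R cor \<alpha>)) = (\<lambda>x. x + of_int (c \<alpha>) *\<^sub>R cor \<alpha>) \<circ> (\<lambda>x. x + ?t)"
      using insert by (simp add: fun_eq_iff algebra_simps)
    moreover have "(\<lambda>x. x + of_int (c \<alpha>) *\<^sub>R cor \<alpha>) \<circ> (\<lambda>x. x + ?t) \<in> words"
      using insert by (intro words_comp words_cor_translation) auto
    ultimately show ?case by (simp only:)
  qed
  from this[OF finite_roots subset_refl] show ?thesis unfolding q .
qed

lemma Qlat_zero: "0 \<in> Qlat \<Phi> cor"
  unfolding Qlat_def by (intro CollectI exI[of _ "\<lambda>_. 0"]) simp

lemma Qlat_add_cor:
  assumes "q \<in> Qlat \<Phi> cor" "\<alpha> \<in> \<Phi>"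
  shows "q + of_int n *\<^sub>R cor \<alpha> \<in> Qlat \<Phi> cor"
proof -
  obtain c :: "('v \<Rightarrow> real) \<Rightarrow> int" where q: "q = (\<Sum>\<alpha>\<in>\<Phi>. of_int (c \<alpha>) *\<^sub>R cor \<alpha>)"
    using assms(1) unfolding Qlat_def by auto
  have "q + of_int n *\<^sub>R cor \<alpha> = (\<Sum>\<beta>\<in>\<Phi>. of_int (c \<beta>) *\<^sub>R cor \<beta> + (if \<beta> = \<alpha> then of_int n *\<^sub>R cor \<beta> else 0))"
    using assms(2) finite_roots by (simp add: q sum.distrib)
  also have "\<dots> = (\<Sum>\<beta>\<in>\<Phi>. of_int (c \<beta> + (if \<beta> = \<alpha> then n else 0)) *\<^sub>R cor \<beta>)"
    by (intro sum.cong) (auto simp: algebra_simps)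
  finally show ?thesis
    unfolding Qlat_def by (intro CollectI exI[of _ "\<lambda>\<beta>. c \<beta> + (if \<beta> = \<alpha> then n else 0)"]) simp
qed

lemma Qlat_root_int: "q \<in> Qlat \<Phi> cor \<Longrightarrow> \<alpha> \<in> \<Phi> \<Longrightarrow> \<alpha> q \<in> \<int>"
  unfolding Qlat_def using cartan_int
  by (auto simp: root_sum root_lin intro!: Ints_sum Ints_mult)

lemma Waff_aref_comp:
  assumes "f \<in> Waff \<Phi> cor" "\<alpha> \<in> \<Phi>"
  shows "aref cor \<alpha> k \<circ> f \<in> Waff \<Phi> cor"
proof -
  obtain w q where f: "f = (\<lambda>x. w x + q)" "w \<in> W0 \<Phi> cor" "q \<in> Qlat \<Phi> cor"
    using assms(1) unfolding Waff_def by blast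
  obtain m where m: "\<alpha> q = of_int m" using Qlat_root_int[OF f(3) assms(2)] by (rule Ints_cases)
  have "(aref cor \<alpha> k \<circ> f) = (\<lambda>x. (sref cor \<alpha> \<circ> w) x + (q + of_int (k - m) *\<^sub>R cor \<alpha>))"
    by (simp add: fun_eq_iff f(1) aref_def sref_def root_lin[OF assms(2)] m algebra_simps)
  moreover have "sref cor \<alpha> \<circ> w \<in> W0 \<Phi> cor"
    using f(2) assms(2) unfolding W0_eq by (intro WJ_comp WJ_sref)
  ultimately show ?thesis unfolding Waff_def using Qlat_add_cor[OF f(3) assms(2), of "k - m"] by blast
qed

lemma Waff_words: "Waff \<Phi> cor = words"
proof
  show "words \<subseteq> Waff \<Phi> cor"
  proof
    fix f assume "f \<in> words"
    then obtain ss where ss: "f = pw ss" "set ss \<subseteq> Saff \<Phi> cor \<Delta>" unfolding words_def by auto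
    have "pw ss \<in> Waff \<Phi> cor" using ss(2)
    proof (induction ss)
      case Nil
      have "id = (\<lambda>x::'v. id x + 0)" by (simp add: fun_eq_iff)
      moreover have "id \<in> W0 \<Phi> cor" unfolding W0_eq by (rule WJ_id)
      ultimately show ?case unfolding pw_Nil Waff_def using Qlat_zero by blast
    next
      case (Cons s ss)
      obtain a where a: "a \<in> AR" "s = rf a" using Cons.prems Saff_E by (metis list.set_intros(1) subsetD)
      obtain \<alpha> k where ak: "\<alpha> \<in> \<Phi>" "a = (\<lambda>x. \<alpha> x - of_int k)" using a(1) by (rule AR_E)
      show ?case unfolding pw_Cons a(2) ak(2) rf_AR[OF ak(1)]
        using Cons by (intro Waff_aref_comp ak(1)) simp
    qed
    then show "f \<in> Waff \<Phi> cor" by (simp only: ss(1))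
  qed
  show "Waff \<Phi> cor \<subseteq> words"
  proof
    fix f assume "f \<in> Waff \<Phi> cor"
    then obtain w q where f: "f = (\<lambda>x. w x + q)" "w \<in> W0 \<Phi> cor" "q \<in> Qlat \<Phi> cor"
      unfolding Waff_def by blast
    have "prodw cor ss \<in> words" if "set ss \<subseteq> \<Phi>" for ss
      using that
    proof (induction ss)
      case Nil
      show ?case unfolding prodw_Nil by (rule words_id)
    next
      case (Cons \<alpha> ss)
      have "sref cor \<alpha> = aref cor \<alpha> 0" by (simp add: sref_def aref_def fun_eq_iff)
      then show ?case unfolding prodw_Cons using Cons by (intro words_comp) (auto intro: words_aref)
    qed
    then have "w \<in> words" using f(2) unfolding W0_eq WJ_words by auto
    then have "(\<lambda>x. x + q) \<circ> w \<in> words" using words_Q_translation[OF f(3)] by (intro words_comp)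
    then show "f \<in> words" by (simp add: f(1) comp_def)
  qed
qed

text \<open>Simple transitivity on alcoves, from \<open>deletion\<close>; it is why galleries can be
  recorded as sequences of group elements.\<close>

lemma words_unique:
  assumes "g \<in> words" "h \<in> words" "S (g a0) (h a0) = {}"
  shows "g = h"
proof -
  have g: "aff g" by (rule words_aff[OF assms(1)])
  have "inv g \<circ> h \<in> words" by (intro words_comp words_inv assms)
  then obtain ss where ss: "inv g \<circ> h = pw ss" "set ss \<subseteq> Saff \<Phi> cor \<Delta>" unfolding words_def by auto
  have "h a0 = g ((inv g \<circ> h) a0)" using g by simp
  then have "S (g a0) (g ((inv g \<circ> h) a0)) = {}" using assms(3) by simp
  then have "S a0 (pw ss a0) = {}" unfolding ss(1) S_aff[OF g] by simp
  then have "inv g \<circ> h = id" using deletion[OF ss(2)] ss(1) by simp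
  then have "g \<circ> (inv g \<circ> h) = g" by simp
  then show ?thesis using g by (simp add: o_assoc)
qed

end

section \<open>Averaging periodic sequences\<close>

text \<open>The effect of \<open>T\<close> on the oscillating part of a root along an orbit
  (\<open>osc_T\<close>). On Fourier coefficients it is multiplication by
  \<open>lam n j\<close>.\<close>

definition avg :: "(nat \<Rightarrow> real) \<Rightarrow> nat \<Rightarrow> real" where
  "avg b i = (2 * b i + b (Suc i)) / 3"

definition rt :: "nat \<Rightarrow> nat \<Rightarrow> complex" where
  "rt n j = cis (2 * pi * real j / real n)"

definition dft :: "nat \<Rightarrow> (nat \<Rightarrow> real) \<Rightarrow> nat \<Rightarrow> complex" where
  "dft n b j = (\<Sum>i<n. of_real (b i) * cnj (rt n j) ^ i)"

definition lam :: "nat \<Rightarrow> nat \<Rightarrow> complex" where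
  "lam n j = (2 + rt n j) / 3"

lemma rt_power_n: "0 < n \<Longrightarrow> rt n j ^ n = 1"
proof -
  assume n: "0 < n"
  have "rt n j ^ n = cis (real n * (2 * pi * real j / real n))" unfolding rt_def by (rule Complex.DeMoivre)
  also have "real n * (2 * pi * real j / real n) = 2 * pi * real j" using n by simp
  also have "cis (2 * pi * real j) = 1" by (intro cis_multiple_2pi) simp
  finally show ?thesis .
qed

lemma norm_rt [simp]: "cmod (rt n j) = 1"
  by (simp add: rt_def)

lemma rt_cnj_mult [simp]: "cnj (rt n j) * rt n j = 1" "rt n j * cnj (rt n j) = 1"
  by (simp_all add: rt_def cis_cnj cis_mult)

lemma rt_complement: "0 < n \<Longrightarrow> j \<le> n \<Longrightarrow> rt n (n - j) = cnj (rt n j)"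
proof -
  assume n: "0 < n" "j \<le> n"
  have "2 * pi * real (n - j) / real n = 2 * pi + - (2 * pi * real j / real n)"
    using n by (simp add: of_nat_diff field_simps)
  then have "rt n (n - j) = cis (2 * pi) * cis (- (2 * pi * real j / real n))"
    unfolding rt_def by (simp only: cis_mult)
  also have "cis (2 * pi) = 1" by (simp add: complex_eq_iff)
  finally show ?thesis by (simp add: rt_def cis_cnj)
qed

text \<open>Replacing \<open>k\<close> by \<open>n - k\<close> if necessary, which keeps the cosine,
  brings both angles into the interval from 0 to pi, where the cosine decreases.\<close>

lemma cos_le_strict:
  assumes "0 < n" "j < k" "k < n - j"
  shows "cos (2 * pi * real k / real n) < cos (2 * pi * real j / real n)"
proof (cases "2 * k \<le> n")
  case True
  have "real (2 * k) \<le> real n" using True by (simp only: of_nat_le_iff)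
  then have "2 * pi * real k / real n \<le> pi" using assms(1) by (simp add: field_simps)
  moreover have "2 * pi * real j / real n < 2 * pi * real k / real n"
    using assms by (simp add: divide_strict_right_mono)
  moreover have "0 \<le> 2 * pi * real j / real n" by simp
  ultimately show ?thesis by (intro cos_monotone_0_pi)
next
  case False
  have kn: "k < n" using assms(3) by simp
  have "real n < real (2 * k)" using False by (simp only: of_nat_less_iff)
  then have "2 * pi * real (n - k) / real n \<le> pi"
    using assms(1) kn by (simp add: field_simps of_nat_diff)
  moreover have "2 * pi * real j / real n < 2 * pi * real (n - k) / real n"
    using assms kn by (intro divide_strict_right_mono) auto
  moreover have "0 \<le> 2 * pi * real j / real n" by simp
  ultimately have "cos (2 * pi * real (n - k) / real n) < cos (2 * pi * real j / real n)"
    by (intro cos_monotone_0_pi)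
  moreover have "cos (2 * pi * real (n - k) / real n) = cos (2 * pi * real k / real n)"
    using arg_cong[OF rt_complement[of n k], of Re] assms(1) kn by (simp add: rt_def)
  ultimately show ?thesis by simp
qed

lemma norm_lam: "(cmod (lam n j))\<^sup>2 = (5 + 4 * cos (2 * pi * real j / real n)) / 9"
proof -
  let ?c = "cos (2 * pi * real j / real n)" and ?s = "sin (2 * pi * real j / real n)"
  have "(cmod (lam n j))\<^sup>2 = (cmod (2 + rt n j))\<^sup>2 / 9"
    unfolding lam_def by (simp add: norm_divide power_divide)
  also have "(cmod (2 + rt n j))\<^sup>2 = (2 + ?c)\<^sup>2 + ?s\<^sup>2" by (simp add: cmod_power2 rt_def)
  also have "\<dots> = 4 + 4 * ?c + (?s\<^sup>2 + ?c\<^sup>2)" by (simp add: power2_eq_square algebra_simps)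
  finally show ?thesis by simp
qed

lemma norm_lam_pos: "0 < cmod (lam n j)"
proof -
  have "- 1 \<le> cos (2 * pi * real j / real n)" by (rule cos_ge_minus_one)
  then have "0 < 5 + 4 * cos (2 * pi * real j / real n)" by linarith
  then have "0 < (5 + 4 * cos (2 * pi * real j / real n)) / 9" by (rule divide_pos_pos) simp
  then have "0 < (cmod (lam n j))\<^sup>2" unfolding norm_lam .
  then show ?thesis by simp
qed

lemma norm_lam_less:
  assumes "0 < n" "j < k" "k < n - j"
  shows "cmod (lam n k) < cmod (lam n j)"
proof (rule power_less_imp_less_base)
  show "(cmod (lam n k))\<^sup>2 < (cmod (lam n j))\<^sup>2" unfolding norm_lam using cos_le_strict[OF assms] by simp
qed simp

lemma lam_0: "lam n 0 = 1"
  by (simp add: lam_def rt_def)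

lemma rt_orthogonal:
  assumes "i < n" "k < n"
  shows "(\<Sum>j<n. cnj (rt n j) ^ i * rt n j ^ k) = (if i = k then of_nat n else 0)"
proof -
  have n: "0 < n" using assms by simp
  define x where "x = 2 * pi * (real k - real i) / real n"
  have "cnj (rt n j) ^ i * rt n j ^ k = cis x ^ j" for j
    unfolding rt_def cis_cnj Complex.DeMoivre cis_mult x_def
    by (rule arg_cong[of _ _ cis]) (simp add: diff_divide_distrib algebra_simps)
  then have s: "(\<Sum>j<n. cnj (rt n j) ^ i * rt n j ^ k) = (\<Sum>j<n. cis x ^ j)" by simp
  show ?thesis
  proof (cases "i = k")
    case True
    then show ?thesis unfolding s by (simp add: x_def)
  next
    case False
    have "cis x ^ n = cis (2 * pi * of_int (int k - int i))"
      unfolding Complex.DeMoivre x_def using n by simp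
    also have "\<dots> = 1" by (rule cis_multiple_2pi) simp
    finally have p1: "cis x ^ n = 1" .
    have ne: "cis x \<noteq> 1"
    proof
      assume "cis x = 1"
      then have "cos x = 1" by (simp add: complex_eq_iff)
      then obtain m :: int where "x = of_int m * 2 * pi" by (auto simp: cos_one_2pi_int)
      then have "2 * pi * (real k - real i) = 2 * pi * (of_int m * real n)"
        using n by (simp add: x_def field_simps)
      then have "real k - real i = of_int m * real n" by simp
      then have "of_int (int k - int i) = (of_int (m * int n) :: real)" by simp
      then have e: "int k - int i = m * int n" by (simp only: of_int_eq_iff)
      have "\<bar>m * int n\<bar> < int n" using assms unfolding e[symmetric] by linarith
      then have "\<bar>m\<bar> * int n < 1 * int n" by (simp add: abs_mult)
      then have "\<bar>m\<bar> < 1" by (simp only: mult_less_cancel_right)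
      then show False using e False by simp
    qed
    show ?thesis unfolding s using False geometric_sum[OF ne, of n] p1 by simp
  qed
qed

locale periodic =
  fixes n :: nat
  assumes n_pos: "0 < n"
begin

definition per :: "(nat \<Rightarrow> real) \<Rightarrow> bool" where
  "per b \<longleftrightarrow> (\<forall>i. b (i + n) = b i)"

lemma perD: "per b \<Longrightarrow> b (i + n) = b i"
  by (simp add: per_def)

lemma per_avg: "per b \<Longrightarrow> per (avg b)"
  unfolding per_def avg_def by (metis add_Suc)

lemma per_avg_pow: "per b \<Longrightarrow> per ((avg ^^ m) b)"
  by (induction m) (auto intro: per_avg)

lemma dft_inverse:
  assumes "k < n"
  shows "(\<Sum>j<n. dft n b j * rt n j ^ k) = of_nat n * of_real (b k)"
proof -
  have "(\<Sum>j<n. dft n b j * rt n j ^ k) = (\<Sum>j<n. \<Sum>i<n. of_real (b i) * (cnj (rt n j) ^ i * rt n j ^ k))"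
    by (simp add: dft_def sum_distrib_right mult.assoc)
  also have "\<dots> = (\<Sum>i<n. of_real (b i) * (\<Sum>j<n. cnj (rt n j) ^ i * rt n j ^ k))"
    by (subst sum.swap) (simp add: sum_distrib_left)
  also have "\<dots> = (\<Sum>i<n. of_real (b i) * (if i = k then of_nat n else 0))"
    using assms by (intro sum.cong refl) (simp add: rt_orthogonal)
  also have "\<dots> = (\<Sum>i<n. if i = k then of_real (b k) * of_nat n else 0)"
    by (intro sum.cong) auto
  also have "\<dots> = of_nat n * of_real (b k)" using assms by simp
  finally show ?thesis .
qed

lemma dft_shift:
  assumes "per b"
  shows "dft n (\<lambda>i. b (Suc i)) j = rt n j * dft n b j"
proof -
  define f where "f i = of_real (b i) * cnj (rt n j) ^ i" for i
  have fn: "f n = f 0"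
    using perD[OF assms, of 0] rt_power_n[OF n_pos, of j]
    by (simp add: f_def flip: complex_cnj_power)
  have "(\<Sum>i<n. f (Suc i)) = (\<Sum>i<n. f i)"
  proof -
    have "f 0 + (\<Sum>i<n. f (Suc i)) = (\<Sum>i<Suc n. f i)" by (simp add: sum.lessThan_Suc_shift del: sum.lessThan_Suc)
    also have "\<dots> = (\<Sum>i<n. f i) + f n" by simp
    finally show ?thesis using fn by simp
  qed
  moreover have "of_real (b (Suc i)) * cnj (rt n j) ^ i = rt n j * f (Suc i)" for i
  proof -
    have "rt n j * f (Suc i) = of_real (b (Suc i)) * cnj (rt n j) ^ i * (cnj (rt n j) * rt n j)"
      by (simp add: f_def del: rt_cnj_mult)
    then show ?thesis by simp
  qed
  ultimately have "dft n (\<lambda>i. b (Suc i)) j = rt n j * (\<Sum>i<n. f i)"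
    unfolding dft_def by (simp add: sum_distrib_left[symmetric])
  then show ?thesis by (simp add: dft_def f_def)
qed

lemma dft_avg: "per b \<Longrightarrow> dft n (avg b) j = lam n j * dft n b j"
proof -
  assume p: "per b"
  have "dft n (avg b) j = (2 * dft n b j + dft n (\<lambda>i. b (Suc i)) j) / 3"
    unfolding dft_def avg_def
    by (simp add: sum_distrib_left sum_divide_distrib add_divide_distrib sum.distrib algebra_simps)
  then show ?thesis by (simp add: dft_shift[OF p] lam_def algebra_simps)
qed

lemma dft_avg_pow: "per b \<Longrightarrow> dft n ((avg ^^ m) b) j = lam n j ^ m * dft n b j"
  by (induction m) (simp_all add: dft_avg per_avg_pow)

lemma avg_pow_eq:
  assumes "per b" "k < n"
  shows "of_nat n * of_real ((avg ^^ m) b k) = (\<Sum>j<n. lam n j ^ m * dft n b j * rt n j ^ k)"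
  using dft_inverse[OF assms(2), of "(avg ^^ m) b"] by (simp add: dft_avg_pow[OF assms(1)])

text \<open>A vanishing sum removes frequency 0, and every other multiplier has modulus below that
  of frequency 0, which is 1.\<close>

lemma avg_tendsto_0:
  assumes p: "per b" and s: "(\<Sum>i<n. b i) = 0" and k: "k < n"
  shows "(\<lambda>m. (avg ^^ m) b k) \<longlonglongrightarrow> 0"
proof -
  have "(\<lambda>m. \<Sum>j<n. lam n j ^ m * dft n b j * rt n j ^ k) \<longlonglongrightarrow> (\<Sum>j<n. 0)"
  proof (rule tendsto_sum)
    fix j assume j: "j \<in> {..<n}"
    show "(\<lambda>m. lam n j ^ m * dft n b j * rt n j ^ k) \<longlonglongrightarrow> 0"
    proof (cases "j = 0")
      case True
      have "dft n b 0 = of_real (\<Sum>i<n. b i)" by (simp add: dft_def rt_def)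
      then show ?thesis using True s by simp
    next
      case False
      then have "cmod (lam n j) < cmod (lam n 0)" using j by (intro norm_lam_less) auto
      then have "(\<lambda>m. lam n j ^ m) \<longlonglongrightarrow> 0" by (intro LIMSEQ_power_zero) (simp add: lam_0)
      then show ?thesis by (intro tendsto_mult_left_zero)
    qed
  qed
  then have "(\<lambda>m. of_real (real n * (avg ^^ m) b k) :: complex) \<longlonglongrightarrow> of_real 0"
    by (simp add: avg_pow_eq[OF p k, symmetric])
  then have "(\<lambda>m. real n * (avg ^^ m) b k) \<longlonglongrightarrow> 0" by (simp only: tendsto_of_real_iff)
  then have "(\<lambda>m. (1 / real n) * (real n * (avg ^^ m) b k)) \<longlonglongrightarrow> (1 / real n) * 0"
    by (rule tendsto_mult_left)
  then show ?thesis using n_pos by simp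
qed

lemma dft_complement: "0 < j \<Longrightarrow> j < n \<Longrightarrow> dft n b (n - j) = cnj (dft n b j)"
  unfolding dft_def using n_pos by (simp add: rt_complement)

lemma lam_complement: "j < n \<Longrightarrow> lam n (n - j) = cnj (lam n j)"
  unfolding lam_def using n_pos by (simp add: rt_complement)

text \<open>The sequence is real, so its coefficients at \<open>j\<close> and \<open>n - j\<close>
  are conjugate. Hence with the frequencies below \<open>j0\<close> those above
  \<open>n - j0\<close> are missing too, and the pair \<open>j0\<close>, \<open>n - j0\<close>,
  distinct as \<open>2 * j0 < n\<close>, contributes twice a real part.\<close>

lemma avg_split:
  assumes p: "per b" and j0: "0 < j0" "2 * j0 < n" and z: "\<And>j. j < j0 \<Longrightarrow> dft n b j = 0" and k: "k < n"
  shows "\<bar>real n * (avg ^^ m) b k - 2 * Re (lam n j0 ^ m * dft n b j0 * rt n j0 ^ k)\<bar>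
    \<le> (\<Sum>j\<in>{j0<..<n - j0}. cmod (lam n j) ^ m * cmod (dft n b j))"
proof -
  define f where "f j = lam n j ^ m * dft n b j * rt n j ^ k" for j
  have f0: "f j = 0" if "j < j0 \<or> n - j0 < j" "j < n" for j
  proof (cases "j < j0")
    case True
    then show ?thesis by (simp add: f_def z)
  next
    case False
    then have "dft n b (n - (n - j)) = cnj (dft n b (n - j))" using that j0 by (intro dft_complement) auto
    moreover have "n - (n - j) = j" "n - j < j0" using that j0 False by auto
    ultimately show ?thesis by (simp add: f_def z)
  qed
  have "f (n - j0) = cnj (f j0)"
    using j0 n_pos unfolding f_def by (simp add: dft_complement lam_complement rt_complement)
  then have pair: "f j0 + f (n - j0) = of_real (2 * Re (f j0))" by (simp add: complex_add_cnj)
  have "(\<Sum>j<n. f j) = (\<Sum>j\<in>{j0..n - j0}. f j)"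
    using f0 j0 by (intro sum.mono_neutral_right) auto
  also have "{j0..n - j0} = insert j0 (insert (n - j0) {j0<..<n - j0})" using j0 by auto
  also have "(\<Sum>j\<in>\<dots>. f j) = f j0 + f (n - j0) + (\<Sum>j\<in>{j0<..<n - j0}. f j)"
    using j0 by (simp add: add.assoc)
  finally have e: "of_real (real n * (avg ^^ m) b k - 2 * Re (f j0)) = (\<Sum>j\<in>{j0<..<n - j0}. f j)"
    using avg_pow_eq[OF p k, of m] pair by (simp add: f_def)
  have "\<bar>real n * (avg ^^ m) b k - 2 * Re (f j0)\<bar> = cmod (\<Sum>j\<in>{j0<..<n - j0}. f j)"
    unfolding e[symmetric] by (rule norm_of_real[symmetric])
  also have "\<dots> \<le> (\<Sum>j\<in>{j0<..<n - j0}. cmod (f j))" by (rule norm_sum)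
  also have "\<dots> = (\<Sum>j\<in>{j0<..<n - j0}. cmod (lam n j) ^ m * cmod (dft n b j))"
    by (simp add: f_def norm_mult norm_power)
  finally show ?thesis unfolding f_def .
qed

lemma dft_mix: "dft n (\<lambda>i. (1 - s) * b i + s * b' i) j = of_real (1 - s) * dft n b j + of_real s * dft n b' j"
  unfolding dft_def by (simp add: sum_distrib_left sum.distrib[symmetric] algebra_simps)

lemma per_mix: "per b \<Longrightarrow> per b' \<Longrightarrow> per (\<lambda>i. (1 - s) * b i + s * b' i)"
  by (simp add: per_def)

text \<open>\<open>\<bar>Im (cnj c * c')\<bar>\<close> is twice the area of the triangle with
  vertices 0, \<open>c\<close>, \<open>c'\<close>; divided by the side from \<open>c\<close> to
  \<open>c'\<close> it is the distance of 0 from the line through them. This bounds the leading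
  coefficient from below uniformly along a segment.\<close>

lemma segment_away_from_0:
  fixes c c' :: complex
  assumes "s \<in> {0..1}"
  shows "\<bar>Im (cnj c * c')\<bar> \<le> cmod (of_real (1 - s) * c + of_real s * c') * cmod (c' - c)"
proof -
  let ?d = "of_real (1 - s) * c + of_real s * c'"
  have "Im (cnj c * c') = Im (cnj ?d * (c' - c))" by (simp add: algebra_simps)
  then have "\<bar>Im (cnj c * c')\<bar> \<le> cmod (cnj ?d * (c' - c))" by (simp only: abs_Im_le_cmod)
  then show ?thesis by (simp only: norm_mult complex_mod_cnj)
qed

text \<open>Here \<open>X\<close>, \<open>Y\<close> are the real and imaginary parts of the leading
  coefficient, and \<open>c\<close>, \<open>s\<close> the cosine and sine of its frequency.
  Vanishing at index 0 makes \<open>X\<close> small, so the values at the two neighbouring indices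
  are governed by \<open>- Y * s\<close> and \<open>Y * s\<close>.\<close>

lemma opposite_signs:
  fixes B1 B2 X Y c s e :: real
  assumes "\<bar>B1 - 2 * (X * c - Y * s)\<bar> \<le> e" "\<bar>B2 - 2 * (X * c + Y * s)\<bar> \<le> e"
    and "\<bar>2 * X\<bar> \<le> e" "\<bar>c\<bar> \<le> 1" "e < \<bar>Y * s\<bar>"
  shows "B1 * B2 < 0"
proof -
  have "\<bar>2 * X\<bar> * \<bar>c\<bar> \<le> e * 1" using assms(3,4) by (intro mult_mono) auto
  then have "\<bar>2 * (X * c)\<bar> \<le> e" by (simp add: abs_mult)
  then have q: "2 * (X * c) \<le> e" "- (2 * (X * c)) \<le> e" by (simp_all only: abs_le_iff)
  have B: "B1 \<le> 2 * (X * c) - 2 * (Y * s) + e" "2 * (X * c) - 2 * (Y * s) - e \<le> B1"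
    "B2 \<le> 2 * (X * c) + 2 * (Y * s) + e" "2 * (X * c) + 2 * (Y * s) - e \<le> B2"
    using assms(1,2) unfolding abs_le_iff by (simp_all add: algebra_simps)
  consider "e < Y * s" | "e < - (Y * s)" using assms(5) by linarith
  then show ?thesis
  proof cases
    case 1
    then have "B1 < 0" "0 < B2" using B q by linarith+
    then show ?thesis by (simp add: mult_neg_pos)
  next
    case 2
    then have "0 < B1" "B2 < 0" using B q by linarith+
    then show ?thesis by (simp add: mult_pos_neg)
  qed
qed

text \<open>If the frequencies below \<open>j0\<close> are absent, then after many averaging steps the frequency
  \<open>j0\<close> dominates; a sequence \<open>cos (i \<theta> + \<phi>)\<close> with \<open>0 < \<theta> < \<pi>\<close> that vanishes at \<open>0\<close> takes opposite
  signs at \<open>1\<close> and \<open>-1\<close>.\<close>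

lemma dominant_frequency:
  assumes b: "per b" "per b'" and j0: "0 < j0" "2 * j0 < n"
    and z: "\<And>j. j < j0 \<Longrightarrow> dft n b j = 0" "\<And>j. j < j0 \<Longrightarrow> dft n b' j = 0"
    and I: "Im (cnj (dft n b j0) * dft n b' j0) \<noteq> 0"
  shows "\<forall>\<^sub>F m in sequentially. \<forall>s\<in>{0..1}. (avg ^^ m) (\<lambda>i. (1 - s) * b i + s * b' i) 0 = 0 \<longrightarrow>
    (avg ^^ m) (\<lambda>i. (1 - s) * b i + s * b' i) 1 * (avg ^^ m) (\<lambda>i. (1 - s) * b i + s * b' i) (n - 1) < 0"
proof -
  let ?J = "{j0<..<n - j0}"
  define c c' r where "c = dft n b j0" and "c' = dft n b' j0" and "r = cmod (lam n j0)"
  have r: "0 < r" unfolding r_def by (rule norm_lam_pos)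
  define \<theta> where "\<theta> = 2 * pi * real j0 / real n"
  have th: "0 < \<theta>" "\<theta> < pi"
  proof -
    have "real (2 * j0) < real n" using j0(2) by (simp only: of_nat_less_iff)
    then show "\<theta> < pi" using n_pos by (simp add: \<theta>_def field_simps)
    show "0 < \<theta>" using j0(1) n_pos by (simp add: \<theta>_def)
  qed
  have sin: "0 < sin \<theta>" using th by (intro sin_gt_zero)
  have cc: "c' - c \<noteq> 0"
  proof
    assume "c' - c = 0"
    then have "Im (cnj c * c') = 0" by simp
    then show False using I by (simp add: c_def c'_def)
  qed
  define d where "d = \<bar>Im (cnj c * c')\<bar> / cmod (c' - c)"
  have d: "0 < d" using I cc by (simp add: d_def c_def c'_def)
  define E where "E m = (\<Sum>j\<in>?J. (cmod (lam n j) / r) ^ m * (cmod (dft n b j) + cmod (dft n b' j)))" for m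
  have "E \<longlonglongrightarrow> (\<Sum>j\<in>?J. 0)"
    unfolding E_def
  proof (rule tendsto_sum)
    fix j assume "j \<in> ?J"
    then have "cmod (lam n j) < r" unfolding r_def using n_pos by (intro norm_lam_less) auto
    then have "(\<lambda>m. (cmod (lam n j) / r) ^ m) \<longlonglongrightarrow> 0" using r by (intro LIMSEQ_power_zero) simp
    then show "(\<lambda>m. (cmod (lam n j) / r) ^ m * (cmod (dft n b j) + cmod (dft n b' j))) \<longlonglongrightarrow> 0"
      by (intro tendsto_mult_left_zero)
  qed
  \<comment> \<open>\<open>E m\<close> is the error of keeping only the frequency \<open>j0\<close>,
    in units of \<open>r ^ m\<close>. As the value at 0 vanishes, the real part of the leading term
    is at most \<open>E m / 2\<close> in these units, so its imaginary part is at least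
    \<open>d - E m / 2\<close>; the inequality reached here says that this times
    \<open>sin \<theta>\<close> exceeds \<open>E m\<close>.\<close>
  then have "(\<lambda>m. E m + E m / 2 * sin \<theta>) \<longlonglongrightarrow> 0 + 0 / 2 * sin \<theta>" by (intro tendsto_intros) simp_all
  then have "\<forall>\<^sub>F m in sequentially. E m + E m / 2 * sin \<theta> < d * sin \<theta>"
    using d sin by (intro order_tendstoD(2)) auto
  then show ?thesis
  proof (rule eventually_mono, intro ballI impI)
    fix m s assume Em: "E m + E m / 2 * sin \<theta> < d * sin \<theta>" and s: "s \<in> {0..(1::real)}"
    let ?b = "\<lambda>i. (1 - s) * b i + s * b' i"
    assume b0: "(avg ^^ m) ?b 0 = 0"
    define Z where "Z = lam n j0 ^ m * dft n ?b j0"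
    have R: "\<bar>real n * (avg ^^ m) ?b k - 2 * Re (Z * rt n j0 ^ k)\<bar> \<le> E m * r ^ m" if k: "k < n" for k
    proof -
      have "\<bar>real n * (avg ^^ m) ?b k - 2 * Re (Z * rt n j0 ^ k)\<bar>
        \<le> (\<Sum>j\<in>?J. cmod (lam n j) ^ m * cmod (dft n ?b j))"
        unfolding Z_def
        by (rule avg_split[OF per_mix[OF b] j0 _ k]) (simp add: dft_mix z)
      also have "\<dots> \<le> (\<Sum>j\<in>?J. cmod (lam n j) ^ m * (cmod (dft n b j) + cmod (dft n b' j)))"
      proof (intro sum_mono mult_left_mono)
        fix j
        have "cmod (dft n ?b j) \<le> cmod (of_real (1 - s) * dft n b j) + cmod (of_real s * dft n b' j)"
          unfolding dft_mix by (rule norm_triangle_ineq)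
        also have "\<dots> \<le> 1 * cmod (dft n b j) + 1 * cmod (dft n b' j)"
          unfolding norm_mult norm_of_real using s by (intro add_mono mult_right_mono) auto
        finally show "cmod (dft n ?b j) \<le> cmod (dft n b j) + cmod (dft n b' j)" by simp
      qed simp
      also have "\<dots> = E m * r ^ m"
        unfolding E_def sum_distrib_right using r by (intro sum.cong refl) (simp add: power_divide)
      finally show ?thesis .
    qed
    define X Y where "X = Re Z" and "Y = Im Z"
    have "\<bar>2 * X\<bar> \<le> E m * r ^ m" using R[OF n_pos] b0 by (simp add: X_def)
    have Zb: "d * r ^ m \<le> cmod Z"
    proof -
      have "d \<le> cmod (dft n ?b j0)"
      proof -
        have "dft n ?b j0 = of_real (1 - s) * c + of_real s * c'" unfolding dft_mix c_def c'_def ..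
        then have "\<bar>Im (cnj c * c')\<bar> \<le> cmod (dft n ?b j0) * cmod (c' - c)"
          using segment_away_from_0[OF s, of c c'] by simp
        moreover have "0 < cmod (c' - c)" using cc by simp
        ultimately show ?thesis unfolding d_def by (simp only: pos_divide_le_eq)
      qed
      then have "r ^ m * d \<le> r ^ m * cmod (dft n ?b j0)" using r by (intro mult_left_mono) auto
      then show ?thesis by (simp add: Z_def norm_mult norm_power r_def mult.commute)
    qed
    have rt0: "rt n j0 = cis \<theta>" by (simp add: rt_def \<theta>_def)
    have z1: "Re (Z * rt n j0 ^ 1) = X * cos \<theta> - Y * sin \<theta>" by (simp add: rt0 X_def Y_def)
    have "rt n j0 ^ (n - 1) = cnj (rt n j0)"
    proof -
      have "rt n j0 ^ (n - 1) * rt n j0 = 1"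
        using rt_power_n[OF n_pos, of j0] n_pos by (metis Suc_diff_1 power_Suc2)
      then have "rt n j0 ^ (n - 1) * rt n j0 * cnj (rt n j0) = cnj (rt n j0)" by simp
      then show ?thesis by (simp only: mult.assoc rt_cnj_mult mult_1_right)
    qed
    then have z2: "Re (Z * rt n j0 ^ (n - 1)) = X * cos \<theta> + Y * sin \<theta>" by (simp add: rt0 X_def Y_def)
    have n1: "1 < n" using j0 by simp
    have big: "E m * r ^ m < \<bar>Y * sin \<theta>\<bar>"
    proof -
      have "cmod Z \<le> \<bar>X\<bar> + \<bar>Y\<bar>" unfolding X_def Y_def by (rule cmod_le)
      then have "d * r ^ m - E m * r ^ m / 2 \<le> \<bar>Y\<bar>" using Zb \<open>\<bar>2 * X\<bar> \<le> E m * r ^ m\<close> by simp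
      then have "(d * r ^ m - E m * r ^ m / 2) * sin \<theta> \<le> \<bar>Y\<bar> * sin \<theta>" using sin by (intro mult_right_mono) auto
      moreover have "(E m + E m / 2 * sin \<theta>) * r ^ m < (d * sin \<theta>) * r ^ m"
        using Em r by (intro mult_strict_right_mono) auto
      ultimately show ?thesis using sin by (simp add: abs_mult algebra_simps)
    qed
    have "(real n * (avg ^^ m) ?b 1) * (real n * (avg ^^ m) ?b (n - 1)) < 0"
    proof (rule opposite_signs[where X = X and Y = Y and c = "cos \<theta>" and s = "sin \<theta>" and e = "E m * r ^ m"])
      show "\<bar>real n * (avg ^^ m) ?b 1 - 2 * (X * cos \<theta> - Y * sin \<theta>)\<bar> \<le> E m * r ^ m"
        using R[OF n1] unfolding z1 .
      show "\<bar>real n * (avg ^^ m) ?b (n - 1) - 2 * (X * cos \<theta> + Y * sin \<theta>)\<bar> \<le> E m * r ^ m"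
        using R[of "n - 1"] n_pos unfolding z2 by simp
    qed (use \<open>\<bar>2 * X\<bar> \<le> E m * r ^ m\<close> big in auto)
    then have "(real n * real n) * ((avg ^^ m) ?b 1 * (avg ^^ m) ?b (n - 1)) < 0" by (simp add: mult_ac)
    moreover have "0 < real n * real n" using n_pos by simp
    ultimately show "(avg ^^ m) ?b 1 * (avg ^^ m) ?b (n - 1) < 0"
      by (simp only: mult_less_0_iff) linarith
  qed
qed

end

section \<open>The dynamics of a finite-order affine transformation\<close>

lemma newton_eq:
  fixes f :: "'a::real_vector \<Rightarrow> 'a"
  assumes k: "0 < k" "f ^^ k = (\<lambda>x. x + r)"
  shows "newton f = (1 / real k) *\<^sub>R r"
  unfolding newton_def
proof (rule the_equality)
  show "\<exists>m>0. \<exists>s. f ^^ m = (\<lambda>x. x + s) \<and> (1 / real k) *\<^sub>R r = (1 / real m) *\<^sub>R s" using k by blast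
  fix v assume "\<exists>m>0. \<exists>s. f ^^ m = (\<lambda>x. x + s) \<and> v = (1 / real m) *\<^sub>R s"
  then obtain m s where m: "0 < m" "f ^^ m = (\<lambda>x. x + s)" "v = (1 / real m) *\<^sub>R s" by blast
  have it: "((\<lambda>x. x + u) ^^ i) x = x + real i *\<^sub>R u" for u x :: 'a and i
    by (induction i) (simp_all add: algebra_simps)
  have "(f ^^ m) ^^ k = (f ^^ k) ^^ m" by (simp add: funpow_mult mult.commute)
  then have "((\<lambda>x. x + s) ^^ k) 0 = ((\<lambda>x. x + r) ^^ m) 0" unfolding m(2) k(2) by simp
  then have "real k *\<^sub>R s = real m *\<^sub>R r" by (simp add: it)
  then have "(1 / (real m * real k)) *\<^sub>R (real k *\<^sub>R s) = (1 / (real m * real k)) *\<^sub>R (real m *\<^sub>R r)" by simp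
  then show "v = (1 / real k) *\<^sub>R r" using m(1) k(1) by (simp add: m(3))
qed

text \<open>A single element of the class: \<open>z\<close> is its linear part, into which the
  diagram automorphism is absorbed, and \<open>n\<close> is a period of \<open>z\<close>.\<close>

locale twisted = rdatum \<Phi> cor P \<Delta>
  for \<Phi> :: "(('v::euclidean_space) \<Rightarrow> real) set" and cor :: "('v \<Rightarrow> real) \<Rightarrow> 'v" and P \<Delta> +
  fixes z :: "'v \<Rightarrow> 'v" and t :: 'v and n :: nat
  assumes lin_z: "lin z" and n_pos': "0 < n" and z_n: "z ^^ n = id"
    and t_int: "\<And>\<alpha>. \<alpha> \<in> \<Phi> \<Longrightarrow> \<alpha> t \<in> \<int>"
begin

sublocale periodic n
  using n_pos' by unfold_locales

definition y :: "'v \<Rightarrow> 'v" where "y = (\<lambda>x. z x + t)"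

text \<open>By \<open>ypow\<close>, \<open>n\<close> steps of \<open>y\<close> are the translation
  by the sum of the \<open>(z ^^ i) t\<close>, so this is the Newton point
  (\<open>newton_y\<close>).\<close>

definition nu :: 'v where "nu = (1 / real n) *\<^sub>R (\<Sum>i<n. (z ^^ i) t)"

text \<open>The mean of the orbit over one period with the drift removed. It lies in V_y by
  \<open>y_pr\<close>.\<close>

definition pr :: "'v \<Rightarrow> 'v" where "pr x = (1 / real n) *\<^sub>R (\<Sum>i<n. (y ^^ i) x - real i *\<^sub>R nu)"

definition T :: "'v \<Rightarrow> 'v" where "T x = (2 / 3) *\<^sub>R x + (1 / 3) *\<^sub>R y x"

text \<open>The last summand in \<open>root_ypow\<close>: along an orbit a root is a constant, plus
  a linear drift, plus this periodic term of mean zero.\<close>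

definition osc :: "('v \<Rightarrow> real) \<Rightarrow> 'v \<Rightarrow> nat \<Rightarrow> real" where
  "osc \<alpha> x i = \<alpha> ((z ^^ i) (x - pr x))"

lemma aff_y: "aff y"
  unfolding y_def by (rule affI[OF lin_z t_int])

lemma y_app: "y x = z x + t"
  by (simp add: y_def)

lemma linear_z: "linear z"
  by (rule linD(1)[OF lin_z])

lemma linear_zpow: "linear (z ^^ i)"
  by (rule linD(1)[OF lin_power[OF lin_z]])

lemma ypow: "(y ^^ i) x = (z ^^ i) x + (\<Sum>j<i. (z ^^ j) t)"
proof (induction i)
  case (Suc i)
  have "(y ^^ Suc i) x = z ((z ^^ i) x + (\<Sum>j<i. (z ^^ j) t)) + t" by (simp add: Suc y_app)
  also have "\<dots> = z ((z ^^ i) x) + (\<Sum>j<i. z ((z ^^ j) t)) + t"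
    by (simp only: linear_add[OF linear_z] linear_sum[OF linear_z])
  also have "\<dots> = (z ^^ Suc i) x + (\<Sum>j<Suc i. (z ^^ j) t)"
    by (simp add: sum.lessThan_Suc_shift del: sum.lessThan_Suc)
  finally show ?case .
qed simp

lemma n_nu: "real n *\<^sub>R nu = (\<Sum>i<n. (z ^^ i) t)"
  using n_pos by (simp add: nu_def)

lemma y_n: "(y ^^ n) x = x + real n *\<^sub>R nu"
  by (simp add: ypow z_n n_nu)

lemma cyclic_sum: "(\<Sum>i<n. f (Suc i)) = (\<Sum>i<n. f i)" if "f n = f 0" for f :: "nat \<Rightarrow> 'b::real_vector"
proof -
  have "f 0 + (\<Sum>i<n. f (Suc i)) = (\<Sum>i<Suc n. f i)"
    by (simp add: sum.lessThan_Suc_shift del: sum.lessThan_Suc)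
  also have "\<dots> = (\<Sum>i<n. f i) + f n" by simp
  finally show ?thesis using that by (simp add: add.commute)
qed

lemma z_nu: "z nu = nu"
proof -
  have "z (\<Sum>i<n. (z ^^ i) t) = (\<Sum>i<n. (z ^^ Suc i) t)" by (simp add: linear_sum[OF linear_z])
  also have "\<dots> = (\<Sum>i<n. (z ^^ i) t)" by (rule cyclic_sum) (simp add: z_n)
  finally show ?thesis unfolding nu_def linear_scale[OF linear_z] by simp
qed

lemma zpow_fix: "z v = v \<Longrightarrow> (z ^^ i) v = v"
  by (induction i) simp_all

lemma ypow_diff: "(y ^^ i) x - (y ^^ i) x' = (z ^^ i) (x - x')"
  by (simp add: ypow linear_diff[OF linear_zpow])

lemma newton_y: "newton y = nu"
proof -
  have "y ^^ n = (\<lambda>x. x + real n *\<^sub>R nu)" by (rule ext) (rule y_n)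
  from newton_eq[OF n_pos this] show ?thesis using n_pos by simp
qed

lemma y_pr: "y (pr x) = pr x + nu"
proof -
  define f where "f i = (y ^^ i) x - real i *\<^sub>R nu" for i
  have fy: "z (f i) + t = f (Suc i) + nu" for i
    by (simp add: f_def linear_diff[OF linear_z] linear_scale[OF linear_z] z_nu y_app algebra_simps)
  have "f n = f 0" by (simp add: f_def y_n)
  then have s: "(\<Sum>i<n. f (Suc i)) = (\<Sum>i<n. f i)" by (rule cyclic_sum)
  have "y (pr x) = (1 / real n) *\<^sub>R (\<Sum>i<n. z (f i)) + (1 / real n) *\<^sub>R (\<Sum>i<n. t)"
    using n_pos
    by (simp add: y_app pr_def f_def linear_scale[OF linear_z] linear_sum[OF linear_z] sum_constant_scaleR)
  also have "\<dots> = (1 / real n) *\<^sub>R (\<Sum>i<n. f (Suc i) + nu)"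
    by (simp only: scaleR_add_right[symmetric] sum.distrib[symmetric] fy)
  also have "\<dots> = (1 / real n) *\<^sub>R (\<Sum>i<n. f i) + nu"
    using n_pos by (simp add: sum.distrib s scaleR_add_right sum_constant_scaleR)
  finally show ?thesis by (simp add: pr_def f_def)
qed

lemma ypow_pr: "(y ^^ i) (pr x) = pr x + real i *\<^sub>R nu"
proof (induction i)
  case (Suc i)
  have "(y ^^ Suc i) (pr x) = z (pr x + real i *\<^sub>R nu) + t" by (simp add: Suc y_app)
  also have "\<dots> = y (pr x) + real i *\<^sub>R nu"
    by (simp add: linear_add[OF linear_z] linear_scale[OF linear_z] z_nu y_app)
  finally show ?case by (simp add: y_pr algebra_simps)
qed simp

lemma root_ypow:
  assumes "\<alpha> \<in> \<Phi>"
  shows "\<alpha> ((y ^^ i) x) = \<alpha> (pr x) + real i * \<alpha> nu + osc \<alpha> x i"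
proof -
  have "(y ^^ i) x = pr x + real i *\<^sub>R nu + (z ^^ i) (x - pr x)"
    using ypow_diff[of i x "pr x"] by (simp add: ypow_pr algebra_simps)
  then show ?thesis by (simp add: osc_def root_lin[OF assms])
qed

lemma per_osc: "per (osc \<alpha> x)"
  unfolding per_def osc_def by (simp add: funpow_add z_n)

lemma sum_osc:
  assumes "\<alpha> \<in> \<Phi>"
  shows "(\<Sum>i<n. osc \<alpha> x i) = 0"
proof -
  have "real n *\<^sub>R pr x = (\<Sum>i<n. (y ^^ i) x - real i *\<^sub>R nu)" using n_pos by (simp add: pr_def)
  then have "\<alpha> (real n *\<^sub>R pr x) = (\<Sum>i<n. \<alpha> (pr x) + osc \<alpha> x i)"
    by (simp add: root_sum[OF assms] root_ypow[OF assms] root_lin[OF assms])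
  then show ?thesis by (simp add: sum.distrib root_lin[OF assms])
qed

lemma T_convex: "T x = (1 - 1 / 3) *\<^sub>R x + (1 / 3) *\<^sub>R y x"
  by (simp add: T_def)

lemma aff_ypow: "aff (y ^^ i)"
  by (induction i) (auto simp: aff_id aff_y intro: aff_comp simp del: o_apply id_apply)

lemma ypow_T: "(y ^^ i) (T x) = (2 / 3) *\<^sub>R (y ^^ i) x + (1 / 3) *\<^sub>R (y ^^ Suc i) x"
  using aff_affine[OF aff_ypow, of i "1 / 3" x "y x"] by (simp add: T_def funpow_swap1)

lemma pr_T: "pr (T x) = pr x + (1 / 3) *\<^sub>R nu"
proof -
  define f where "f i = (y ^^ i) x - real i *\<^sub>R nu" for i
  have "f n = f 0" by (simp add: f_def y_n)
  then have s: "(\<Sum>i<n. f (Suc i)) = (\<Sum>i<n. f i)" by (rule cyclic_sum)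
  have "(y ^^ i) (T x) - real i *\<^sub>R nu = (2 / 3) *\<^sub>R f i + (1 / 3) *\<^sub>R f (Suc i) + (1 / 3) *\<^sub>R nu" for i
  proof -
    define N where "N = real i *\<^sub>R nu"
    have "(2 / 3) *\<^sub>R N + (1 / 3) *\<^sub>R N = N" by (simp add: scaleR_left_distrib[symmetric])
    then have "- ((2 / 3) *\<^sub>R N) - (1 / 3) *\<^sub>R N = - N" by (metis diff_conv_add_uminus minus_add_distrib)
    moreover have "real (Suc i) *\<^sub>R nu = N + nu" by (simp add: N_def algebra_simps)
    ultimately show ?thesis
      unfolding ypow_T f_def N_def[symmetric] by (simp add: scaleR_diff_right scaleR_add_right)
  qed
  then have "(\<Sum>i<n. (y ^^ i) (T x) - real i *\<^sub>R nu)
      = (2 / 3) *\<^sub>R (\<Sum>i<n. f i) + (1 / 3) *\<^sub>R (\<Sum>i<n. f (Suc i)) + (\<Sum>i<n. (1 / 3) *\<^sub>R nu)"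
    by (simp add: sum.distrib scaleR_sum_right)
  also have "\<dots> = (\<Sum>i<n. f i) + real n *\<^sub>R ((1 / 3) *\<^sub>R nu)"
    by (simp add: s sum_constant_scaleR scaleR_left_distrib[symmetric])
  finally show ?thesis using n_pos by (simp add: pr_def f_def scaleR_add_right)
qed

lemma osc_T:
  assumes "\<alpha> \<in> \<Phi>"
  shows "osc \<alpha> (T x) = avg (osc \<alpha> x)"
proof
  fix i
  have "\<alpha> ((y ^^ i) (T x)) = (2 / 3) * \<alpha> ((y ^^ i) x) + (1 / 3) * \<alpha> ((y ^^ Suc i) x)"
    unfolding ypow_T by (simp add: root_lin[OF assms])
  then have "\<alpha> (pr x) + (1 / 3) * \<alpha> nu + real i * \<alpha> nu + osc \<alpha> (T x) i
      = (2 / 3) * (\<alpha> (pr x) + real i * \<alpha> nu + osc \<alpha> x i)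
        + (1 / 3) * (\<alpha> (pr x) + real (Suc i) * \<alpha> nu + osc \<alpha> x (Suc i))"
    unfolding root_ypow[OF assms] pr_T by (simp add: root_lin[OF assms])
  then show "osc \<alpha> (T x) i = avg (osc \<alpha> x) i" by (simp add: avg_def field_simps)
qed

lemma osc_Tpow: "\<alpha> \<in> \<Phi> \<Longrightarrow> osc \<alpha> ((T ^^ m) x) = (avg ^^ m) (osc \<alpha> x)"
  by (induction m) (simp_all add: osc_T)

lemma pr_Tpow: "pr ((T ^^ m) x) = pr x + (real m / 3) *\<^sub>R nu"
  by (induction m) (simp_all add: pr_T algebra_simps add_divide_distrib)

lemma T_affine: "T ((1 - s) *\<^sub>R x + s *\<^sub>R x') = (1 - s) *\<^sub>R T x + s *\<^sub>R T x'"
  unfolding T_def aff_affine[OF aff_y] by (simp add: scaleR_add_right mult.commute)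

lemma Tpow_affine: "(T ^^ m) ((1 - s) *\<^sub>R x + s *\<^sub>R x') = (1 - s) *\<^sub>R (T ^^ m) x + s *\<^sub>R (T ^^ m) x'"
  by (induction m) (simp_all add: T_affine)

lemma pr_affine: "pr ((1 - s) *\<^sub>R x + s *\<^sub>R x') = (1 - s) *\<^sub>R pr x + s *\<^sub>R pr x'"
proof -
  have "(y ^^ i) ((1 - s) *\<^sub>R x + s *\<^sub>R x') - real i *\<^sub>R nu
      = (1 - s) *\<^sub>R ((y ^^ i) x - real i *\<^sub>R nu) + s *\<^sub>R ((y ^^ i) x' - real i *\<^sub>R nu)" for i
    unfolding aff_affine[OF aff_ypow] by (simp add: algebra_simps)
  then have "(\<Sum>i<n. (y ^^ i) ((1 - s) *\<^sub>R x + s *\<^sub>R x') - real i *\<^sub>R nu)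
      = (1 - s) *\<^sub>R (\<Sum>i<n. (y ^^ i) x - real i *\<^sub>R nu) + s *\<^sub>R (\<Sum>i<n. (y ^^ i) x' - real i *\<^sub>R nu)"
    by (simp only: sum.distrib scaleR_sum_right)
  then show ?thesis unfolding pr_def by (simp add: scaleR_add_right)
qed

lemma osc_affine:
  assumes "\<alpha> \<in> \<Phi>"
  shows "osc \<alpha> ((1 - s) *\<^sub>R x + s *\<^sub>R x') = (\<lambda>i. (1 - s) * osc \<alpha> x i + s * osc \<alpha> x' i)"
proof
  fix i
  have "(1 - s) *\<^sub>R x + s *\<^sub>R x' - pr ((1 - s) *\<^sub>R x + s *\<^sub>R x') = (1 - s) *\<^sub>R (x - pr x) + s *\<^sub>R (x' - pr x')"
    unfolding pr_affine by (simp add: algebra_simps)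
  then show "osc \<alpha> ((1 - s) *\<^sub>R x + s *\<^sub>R x') i = (1 - s) * osc \<alpha> x i + s * osc \<alpha> x' i"
    unfolding osc_def
    by (simp only: linear_add[OF linear_zpow] linear_scale[OF linear_zpow] root_lin[OF assms])
qed

text \<open>By periodicity the index -1 of the preimage may be read as \<open>n - 1\<close>; the
  drift of a full period is subtracted.\<close>

lemma root_inv_y:
  assumes "\<alpha> \<in> \<Phi>"
  shows "\<alpha> (inv y u) = \<alpha> (pr u) - \<alpha> nu + osc \<alpha> u (n - 1)"
proof -
  have "(y ^^ (n - 1)) u = (y ^^ (n - 1)) (y (inv y u))" using aff_y by simp
  also have "\<dots> = (y ^^ Suc (n - 1)) (inv y u)" by (simp add: funpow_swap1)
  also have "\<dots> = inv y u + real n *\<^sub>R nu" using n_pos by (simp only: Suc_diff_1 y_n)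
  finally have "\<alpha> ((y ^^ (n - 1)) u) = \<alpha> (inv y u) + real n * \<alpha> nu" by (simp add: root_lin[OF assms])
  moreover have "real (n - 1) = real n - 1" using n_pos by (simp add: of_nat_diff)
  ultimately show ?thesis by (simp add: root_ypow[OF assms] algebra_simps)
qed

lemma root_pr: "\<alpha> \<in> \<Phi> \<Longrightarrow> \<alpha> u = \<alpha> (pr u) + osc \<alpha> u 0"
  using root_ypow[of \<alpha> 0 u] by simp

lemma root_y: "\<alpha> \<in> \<Phi> \<Longrightarrow> \<alpha> (y u) = \<alpha> (pr u) + \<alpha> nu + osc \<alpha> u 1"
  using root_ypow[of \<alpha> 1 u] by simp

lemma per_mod: "per b \<Longrightarrow> b k = b (k mod n)"
proof -
  assume b: "per b"
  have "b (i + j * n) = b i" for i j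
  proof (induction j)
    case (Suc j)
    have "b (i + Suc j * n) = b ((i + j * n) + n)" by (simp add: algebra_simps)
    then show ?case using perD[OF b] Suc by simp
  qed simp
  from this[of "k mod n" "k div n"] show ?thesis by simp
qed

lemma osc_small:
  assumes "\<alpha> \<in> \<Phi>" "0 < \<eta>"
  shows "\<forall>\<^sub>F m in sequentially. \<bar>osc \<alpha> ((T ^^ m) x) k\<bar> < \<eta>"
proof -
  have "(\<lambda>m. (avg ^^ m) (osc \<alpha> x) (k mod n)) \<longlonglongrightarrow> 0"
    by (rule avg_tendsto_0[OF per_osc sum_osc[OF assms(1)]]) (use n_pos in simp)
  moreover have "(avg ^^ m) (osc \<alpha> x) (k mod n) = osc \<alpha> ((T ^^ m) x) k" for m
    unfolding osc_Tpow[OF assms(1)] by (rule per_mod[symmetric]) (rule per_avg_pow[OF per_osc])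
  ultimately have "(\<lambda>m. osc \<alpha> ((T ^^ m) x) k) \<longlonglongrightarrow> 0" by simp
  from tendstoD[OF this assms(2)] show ?thesis by (simp add: dist_real_def)
qed

lemma osc_small_segment:
  assumes "\<alpha> \<in> \<Phi>" "0 < \<eta>"
  shows "\<forall>\<^sub>F m in sequentially. \<forall>s\<in>{0..1}. \<bar>osc \<alpha> ((1 - s) *\<^sub>R (T ^^ m) x + s *\<^sub>R (T ^^ m) x') k\<bar> < \<eta>"
  using eventually_conj[OF osc_small[OF assms, of x k] osc_small[OF assms, of x' k]]
proof (rule eventually_mono, intro ballI)
  fix m s assume h: "\<bar>osc \<alpha> ((T ^^ m) x) k\<bar> < \<eta> \<and> \<bar>osc \<alpha> ((T ^^ m) x') k\<bar> < \<eta>" and s: "s \<in> {0..(1::real)}"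
  let ?a = "osc \<alpha> ((T ^^ m) x) k" and ?b = "osc \<alpha> ((T ^^ m) x') k"
  have "\<bar>(1 - s) * ?a + s * ?b\<bar> \<le> (1 - s) * \<bar>?a\<bar> + s * \<bar>?b\<bar>"
    using s abs_triangle_ineq[of "(1 - s) * ?a" "s * ?b"] by (simp add: abs_mult)
  also have "\<dots> < \<eta>" using h s by (intro convex_bound_lt) auto
  finally show "\<bar>osc \<alpha> ((1 - s) *\<^sub>R (T ^^ m) x + s *\<^sub>R (T ^^ m) x') k\<bar> < \<eta>"
    unfolding osc_affine[OF assms(1)] .
qed

section \<open>Frequencies of a root along an orbit\<close>

definition cond2' :: bool where
  "cond2' \<longleftrightarrow> (\<forall>\<alpha>\<in>\<Phi>. \<alpha> nu = 0 \<longrightarrow> \<alpha> \<circ> z = \<alpha> \<or> (\<forall>v. z v = v \<longrightarrow> \<alpha> v = 0))"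

definition van :: "('v \<Rightarrow> real) \<Rightarrow> bool" where
  "van \<alpha> \<longleftrightarrow> \<alpha> \<in> \<Phi> \<and> (\<forall>v. z v = v \<longrightarrow> \<alpha> v = 0)"

text \<open>The Fourier coefficient is viewed as a function of the vector \<open>e\<close>. It is
  linear over the reals, so genericity can be demanded of it.\<close>

definition L :: "('v \<Rightarrow> real) \<Rightarrow> nat \<Rightarrow> 'v \<Rightarrow> complex" where
  "L \<alpha> j e = dft n (\<lambda>i. \<alpha> ((z ^^ i) e)) j"

definition j0 :: "('v \<Rightarrow> real) \<Rightarrow> nat" where
  "j0 \<alpha> = (LEAST j. \<exists>e. L \<alpha> j e \<noteq> 0)"

lemma van_root: "van \<alpha> \<Longrightarrow> \<alpha> \<in> \<Phi>"
  by (simp add: van_def)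

lemma z_pr_diff: "z (pr x - pr x') = pr x - pr x'"
proof -
  have "z (pr x - pr x') = y (pr x) - y (pr x')" by (simp add: y_app linear_diff[OF linear_z])
  then show ?thesis by (simp add: y_pr)
qed

lemma van_pr: "van \<alpha> \<Longrightarrow> \<alpha> (pr x) = \<alpha> (pr x')"
proof -
  assume v: "van \<alpha>"
  then have "\<alpha> (pr x - pr x') = 0" using z_pr_diff by (simp add: van_def)
  then show ?thesis by (simp add: root_lin[OF van_root[OF v]])
qed

text \<open>Such a root is constant on V_y, so the moving base point \<open>pr x\<close> may be
  replaced by \<open>pr 0\<close>, which makes the coefficients affine in \<open>x\<close>.\<close>

lemma van_osc:
  assumes "van \<alpha>"
  shows "osc \<alpha> x i = \<alpha> ((z ^^ i) (x - pr 0))"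
proof -
  note a = van_root[OF assms]
  have "x - pr 0 = (x - pr x) + (pr x - pr 0)" by simp
  then have "(z ^^ i) (x - pr 0) = (z ^^ i) (x - pr x) + (pr x - pr 0)"
    by (metis linear_add[OF linear_zpow] zpow_fix[OF z_pr_diff])
  then show ?thesis using van_pr[OF assms, of x 0] by (simp add: osc_def root_lin[OF a])
qed

lemma dft_osc: "van \<alpha> \<Longrightarrow> dft n (osc \<alpha> x) j = L \<alpha> j (x - pr 0)"
proof -
  assume "van \<alpha>"
  then have "osc \<alpha> x = (\<lambda>i. \<alpha> ((z ^^ i) (x - pr 0)))" by (intro ext van_osc)
  then show ?thesis by (simp add: L_def)
qed

lemma linear_L:
  assumes "\<alpha> \<in> \<Phi>"
  shows "L \<alpha> j (x + x') = L \<alpha> j x + L \<alpha> j x'" "L \<alpha> j (x - x') = L \<alpha> j x - L \<alpha> j x'"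
    "L \<alpha> j (c *\<^sub>R x) = of_real c * L \<alpha> j x"
  unfolding L_def dft_def
  by (simp_all add: linear_add[OF linear_zpow] linear_diff[OF linear_zpow] linear_scale[OF linear_zpow]
      root_lin[OF assms] sum.distrib sum_subtractf sum_distrib_left algebra_simps)

lemma L_z: "L \<alpha> j (z e) = rt n j * L \<alpha> j e"
proof -
  have "per (\<lambda>i. \<alpha> ((z ^^ i) e))" by (simp add: per_def funpow_add z_n)
  from dft_shift[OF this, of j] show ?thesis unfolding L_def by (simp add: funpow_swap1)
qed

lemma L_inverse: "k < n \<Longrightarrow> (\<Sum>j<n. L \<alpha> j e * rt n j ^ k) = of_nat n * of_real (\<alpha> ((z ^^ k) e))"
  unfolding L_def by (rule dft_inverse)

text \<open>Frequency 0 is absent because its coefficient is the value of the root at the sum of the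
  \<open>(z ^^ i) e\<close>, a vector fixed by \<open>z\<close>. Conjugation exchanges
  \<open>j\<close> and \<open>n - j\<close>, so the least frequency is at most
  \<open>n / 2\<close>.\<close>

lemma j0_facts:
  assumes v: "van \<alpha>"
  shows "\<exists>e. L \<alpha> (j0 \<alpha>) e \<noteq> 0" "j < j0 \<alpha> \<Longrightarrow> L \<alpha> j e = 0" "0 < j0 \<alpha>" "2 * j0 \<alpha> \<le> n" "j0 \<alpha> < n"
proof -
  note a = van_root[OF v]
  obtain e where e: "\<alpha> e \<noteq> 0" using root_nonzero[OF a] by blast
  have "\<exists>j<n. L \<alpha> j e \<noteq> 0"
  proof (rule ccontr)
    assume "\<not> (\<exists>j<n. L \<alpha> j e \<noteq> 0)"
    then have "(\<Sum>j<n. L \<alpha> j e * rt n j ^ 0) = 0" by (intro sum.neutral) auto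
    then have "complex_of_nat n * of_real (\<alpha> e) = 0" using L_inverse[OF n_pos, of \<alpha> e] by simp
    then show False using e n_pos by simp
  qed
  then obtain j1 where j1: "j1 < n" "L \<alpha> j1 e \<noteq> 0" by blast
  then show nz: "\<exists>e. L \<alpha> (j0 \<alpha>) e \<noteq> 0"
    unfolding j0_def by (intro LeastI[of "\<lambda>j. \<exists>e. L \<alpha> j e \<noteq> 0" j1]) blast
  have "j0 \<alpha> \<le> j1" unfolding j0_def using j1(2) by (intro Least_le) blast
  then show jn: "j0 \<alpha> < n" using j1(1) by simp
  show small: "L \<alpha> j e = 0" if "j < j0 \<alpha>" for j e
    using not_less_Least[OF that[unfolded j0_def]] by blast
  show pos: "0 < j0 \<alpha>"
  proof (rule ccontr)
    assume "\<not> 0 < j0 \<alpha>"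
    then obtain e where "L \<alpha> 0 e \<noteq> 0" using nz by auto
    moreover have "L \<alpha> 0 e = of_real (\<alpha> (\<Sum>i<n. (z ^^ i) e))"
      by (simp add: L_def dft_def rt_def root_sum[OF a])
    moreover have "z (\<Sum>i<n. (z ^^ i) e) = (\<Sum>i<n. (z ^^ i) e)"
    proof -
      have "z (\<Sum>i<n. (z ^^ i) e) = (\<Sum>i<n. (z ^^ Suc i) e)" by (simp add: linear_sum[OF linear_z])
      also have "\<dots> = (\<Sum>i<n. (z ^^ i) e)" by (rule cyclic_sum) (simp add: z_n)
      finally show ?thesis .
    qed
    ultimately show False using v by (simp add: van_def)
  qed
  show "2 * j0 \<alpha> \<le> n"
  proof (rule ccontr)
    assume "\<not> 2 * j0 \<alpha> \<le> n"
    then have "L \<alpha> (n - j0 \<alpha>) e = 0" for e by (intro small) simp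
    then have "L \<alpha> (j0 \<alpha>) e = 0" for e using dft_complement[OF pos jn] unfolding L_def by simp
    then show False using nz by blast
  qed
qed

text \<open>If the least frequency is \<open>n / 2\<close>, conjugation excludes the larger ones as
  well, and the sequence is a multiple of the powers of -1.\<close>

lemma half_frequency:
  assumes v: "van \<alpha>" and h: "2 * j0 \<alpha> = n"
  shows "\<alpha> (z e) = - \<alpha> e"
proof -
  note j = j0_facts[OF v]
  have zero: "L \<alpha> i e = 0" if "i < n" "i \<noteq> j0 \<alpha>" for i
  proof (cases "i < j0 \<alpha>")
    case True
    then show ?thesis by (rule j(2))
  next
    case False
    then have "L \<alpha> (n - i) e = 0" using that h by (intro j(2)) auto
    then have "dft n (\<lambda>k. \<alpha> ((z ^^ k) e)) (n - (n - i)) = 0"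
      using that False h j(3) dft_complement[of "n - i" "\<lambda>k. \<alpha> ((z ^^ k) e)"] unfolding L_def by simp
    then show ?thesis using that unfolding L_def by simp
  qed
  have val: "of_nat n * of_real (\<alpha> ((z ^^ k) e)) = L \<alpha> (j0 \<alpha>) e * rt n (j0 \<alpha>) ^ k" if "k < n" for k
  proof -
    have "(\<Sum>i<n. L \<alpha> i e * rt n i ^ k) = (\<Sum>i<n. if i = j0 \<alpha> then L \<alpha> (j0 \<alpha>) e * rt n (j0 \<alpha>) ^ k else 0)"
      by (intro sum.cong refl) (use zero in auto)
    also have "\<dots> = L \<alpha> (j0 \<alpha>) e * rt n (j0 \<alpha>) ^ k" using j(5) by simp
    finally show ?thesis using L_inverse[OF that, of \<alpha> e] by simp
  qed
  have "rt n (j0 \<alpha>) = - 1"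
  proof -
    have "2 * pi * real (j0 \<alpha>) / real n = pi"
    proof -
      have "real n = 2 * real (j0 \<alpha>)" using h by (metis of_nat_mult of_nat_numeral)
      then show ?thesis using j(3) by simp
    qed
    then show ?thesis by (simp add: rt_def)
  qed
  moreover have "1 < n" using h j(3) by simp
  ultimately have "of_nat n * of_real (\<alpha> (z e)) = - (of_nat n * of_real (\<alpha> e) :: complex)"
    using val[of 1] val[of 0] by simp
  then have "complex_of_real (real n * \<alpha> (z e)) = complex_of_real (- (real n * \<alpha> e))" by simp
  then have "real n * \<alpha> (z e) = - (real n * \<alpha> e)" by (simp only: of_real_eq_iff)
  then have "real n * \<alpha> (z e) = real n * (- \<alpha> e)" by simp
  then show ?thesis using n_pos by (simp only: mult_cancel_left) simp
qed

text \<open>Applying \<open>z\<close> multiplies the coefficient by a root of unity that is not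
  real, so its values cannot all lie on one real line.\<close>

lemma rotation_nonreal:
  assumes v: "van \<alpha>" and h: "2 * j0 \<alpha> < n" and c: "c \<noteq> 0"
  shows "\<exists>e. Im (c * L \<alpha> (j0 \<alpha>) e) \<noteq> 0"
proof -
  note j = j0_facts[OF v]
  obtain e where e: "L \<alpha> (j0 \<alpha>) e \<noteq> 0" using j(1) by blast
  have sin: "0 < Im (rt n (j0 \<alpha>))"
  proof -
    have "real (2 * j0 \<alpha>) < real n" using h by (simp only: of_nat_less_iff)
    then have "2 * pi * real (j0 \<alpha>) / real n < pi" using n_pos by (simp add: field_simps)
    moreover have "0 < 2 * pi * real (j0 \<alpha>) / real n" using j(3) n_pos by simp
    ultimately show ?thesis unfolding rt_def by (simp add: sin_gt_zero)
  qed
  show ?thesis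
  proof (cases "Im (c * L \<alpha> (j0 \<alpha>) e) = 0")
    case True
    have "c * L \<alpha> (j0 \<alpha>) (z e) = rt n (j0 \<alpha>) * (c * L \<alpha> (j0 \<alpha>) e)" by (simp add: L_z)
    moreover have "Im (r * w) = Im r * Re w" if "Im w = 0" for r w using that by simp
    ultimately have "Im (c * L \<alpha> (j0 \<alpha>) (z e)) = Im (rt n (j0 \<alpha>)) * Re (c * L \<alpha> (j0 \<alpha>) e)"
      using True by metis
    moreover have "Re (c * L \<alpha> (j0 \<alpha>) e) \<noteq> 0"
    proof
      assume "Re (c * L \<alpha> (j0 \<alpha>) e) = 0"
      then have "c * L \<alpha> (j0 \<alpha>) e = 0" using True by (simp only: complex_eq_iff) simp
      then show False using e c by simp
    qed
    ultimately show ?thesis using sin by (intro exI[of _ "z e"]) simp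
  qed blast
qed

lemma integer_gap: "\<exists>\<eta>>0. \<forall>k::int. \<bar>real_of_int k - c\<bar> < \<eta> \<longrightarrow> real_of_int k = c"
proof (cases "c \<in> \<int>")
  case True
  then obtain l where l: "c = of_int l" by (rule Ints_cases)
  show ?thesis
  proof (intro exI[of _ 1] conjI allI impI)
    fix k :: int assume "\<bar>real_of_int k - c\<bar> < 1"
    then have "k = l" unfolding l by linarith
    then show "real_of_int k = c" by (simp add: l)
  qed simp
next
  case False
  define \<eta> where "\<eta> = min (c - of_int \<lfloor>c\<rfloor>) (of_int \<lfloor>c\<rfloor> + 1 - c)"
  have "of_int \<lfloor>c\<rfloor> \<noteq> c" using False by (metis Ints_of_int)
  then have "0 < c - of_int \<lfloor>c\<rfloor>" "0 < of_int \<lfloor>c\<rfloor> + 1 - c" by linarith+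
  then have "0 < \<eta>" unfolding \<eta>_def by (simp only: min_less_iff_conj)
  moreover have "real_of_int k = c" if "\<bar>real_of_int k - c\<bar> < \<eta>" for k :: int
  proof -
    have "real_of_int \<lfloor>c\<rfloor> < of_int k" "real_of_int k < of_int \<lfloor>c\<rfloor> + 1"
      using that unfolding \<eta>_def by linarith+
    then have "\<lfloor>c\<rfloor> < k" "k < \<lfloor>c\<rfloor> + 1" by linarith+
    then show ?thesis by linarith
  qed
  ultimately show ?thesis by blast
qed

text \<open>Three situations in which the wall can be crossed next to \<open>u\<close> without
  raising \<open>F\<close>: \<open>y u\<close> and \<open>inv y u\<close> lie on opposite sides, so
  one of them lies ahead (\<open>cross_toward\<close>); \<open>y\<close> preserves the wall and its
  sides (\<open>cross_fixed\<close>); or \<open>y\<close> exchanges the sides, and the image lies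
  ahead.\<close>

definition harmless :: "('v \<Rightarrow> real) \<Rightarrow> 'v \<Rightarrow> bool" where
  "harmless a u \<longleftrightarrow> (a u = 0 \<longrightarrow> a (y u) * a (inv y u) < 0 \<or> a \<circ> y = a \<or> a \<circ> y = (\<lambda>v. - a v))"

text \<open>An invariant root has the same value on all \<open>(z ^^ i) t\<close>, so
  \<open>\<alpha> t = \<alpha> nu = 0\<close>.\<close>

lemma root_y_const:
  assumes "\<alpha> \<in> \<Phi>" "\<alpha> nu = 0" "\<alpha> \<circ> z = \<alpha>"
  shows "\<alpha> (y v) = \<alpha> v"
proof -
  have zi: "\<alpha> ((z ^^ i) t) = \<alpha> t" for i
  proof (induction i)
    case (Suc i)
    have "\<alpha> ((z ^^ Suc i) t) = (\<alpha> \<circ> z) ((z ^^ i) t)" by simp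
    then show ?case using Suc assms(3) by simp
  qed simp
  have "real n * \<alpha> nu = \<alpha> (\<Sum>i<n. (z ^^ i) t)"
    by (simp only: n_nu[symmetric] root_lin[OF assms(1)])
  also have "\<dots> = real n * \<alpha> t" by (simp add: root_sum[OF assms(1)] zi)
  finally have "\<alpha> t = 0" using assms(2) n_pos by simp
  moreover have "\<alpha> (z v) = \<alpha> v" using fun_cong[OF assms(3), of v] by simp
  ultimately show ?thesis by (simp add: y_app root_lin[OF assms(1)])
qed

text \<open>The drift moves \<open>y u\<close> and \<open>inv y u\<close> off the hyperplane by
  \<open>\<alpha> nu\<close> in opposite directions. Each displacement involves two oscillation
  terms, hence the bound by half of the drift.\<close>

lemma harmless_transverse:
  assumes "\<alpha> \<in> \<Phi>" "\<alpha> nu \<noteq> 0"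
  shows "\<forall>\<^sub>F m in sequentially. \<forall>s\<in>{0..1}. \<forall>k::int.
    harmless (\<lambda>v. \<alpha> v - of_int k) ((1 - s) *\<^sub>R (T ^^ m) x + s *\<^sub>R (T ^^ m) x')"
proof -
  have e: "0 < \<bar>\<alpha> nu\<bar> / 2" using assms(2) by simp
  note small = osc_small_segment[OF assms(1) e, of x x']
  show ?thesis
    using eventually_conj[OF small[of 0] eventually_conj[OF small[of 1] small[of "n - 1"]]]
  proof (rule eventually_mono, intro ballI allI)
    fix m s and k :: int
    let ?u = "(1 - s) *\<^sub>R (T ^^ m) x + s *\<^sub>R (T ^^ m) x'"
    assume h: "(\<forall>s\<in>{0..1}. \<bar>osc \<alpha> ((1 - s) *\<^sub>R (T ^^ m) x + s *\<^sub>R (T ^^ m) x') 0\<bar> < \<bar>\<alpha> nu\<bar> / 2) \<and>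
       (\<forall>s\<in>{0..1}. \<bar>osc \<alpha> ((1 - s) *\<^sub>R (T ^^ m) x + s *\<^sub>R (T ^^ m) x') 1\<bar> < \<bar>\<alpha> nu\<bar> / 2) \<and>
       (\<forall>s\<in>{0..1}. \<bar>osc \<alpha> ((1 - s) *\<^sub>R (T ^^ m) x + s *\<^sub>R (T ^^ m) x') (n - 1)\<bar> < \<bar>\<alpha> nu\<bar> / 2)"
      and s: "s \<in> {0..(1::real)}"
    have o: "\<bar>osc \<alpha> ?u 0\<bar> < \<bar>\<alpha> nu\<bar> / 2" "\<bar>osc \<alpha> ?u 1\<bar> < \<bar>\<alpha> nu\<bar> / 2" "\<bar>osc \<alpha> ?u (n - 1)\<bar> < \<bar>\<alpha> nu\<bar> / 2"
      using h s by blast+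
    have "(\<alpha> (y ?u) - k) * (\<alpha> (inv y ?u) - k) < 0" if "\<alpha> ?u - k = 0"
    proof -
      have p: "\<alpha> (pr ?u) = k - osc \<alpha> ?u 0" using that root_pr[OF assms(1), of ?u] by simp
      have 1: "\<alpha> (y ?u) - k = \<alpha> nu + (osc \<alpha> ?u 1 - osc \<alpha> ?u 0)"
        unfolding root_y[OF assms(1)] p by simp
      have 2: "\<alpha> (inv y ?u) - k = - \<alpha> nu + (osc \<alpha> ?u (n - 1) - osc \<alpha> ?u 0)"
        unfolding root_inv_y[OF assms(1)] p by simp
      show ?thesis
      proof (cases "0 < \<alpha> nu")
        case True
        then have "0 < \<alpha> (y ?u) - k" "\<alpha> (inv y ?u) - k < 0" unfolding 1 2 using o by linarith+
        then show ?thesis by (rule mult_pos_neg)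
      next
        case False
        then have "\<alpha> (y ?u) - k < 0" "0 < \<alpha> (inv y ?u) - k" unfolding 1 2 using o assms(2) by linarith+
        then show ?thesis by (rule mult_neg_pos)
      qed
    qed
    then show "harmless (\<lambda>v. \<alpha> v - of_int k) ?u" unfolding harmless_def by blast
  qed
qed

text \<open>The root has the constant value \<open>c\<close> on V_y. Once its oscillation is below
  the gap between \<open>c\<close> and all other integers, only the hyperplane with
  \<open>k = c\<close> can meet the segment. There either \<open>y\<close> reverses the root, or
  \<open>dominant_frequency\<close> puts image and preimage on opposite sides.\<close>

lemma harmless_vanishing:
  assumes v: "van \<alpha>" and nu: "\<alpha> nu = 0"
    and gen: "2 * j0 \<alpha> < n \<Longrightarrow> Im (cnj (L \<alpha> (j0 \<alpha>) (x - pr 0)) * L \<alpha> (j0 \<alpha>) (x' - pr 0)) \<noteq> 0"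
  shows "\<forall>\<^sub>F m in sequentially. \<forall>s\<in>{0..1}. \<forall>k::int.
    harmless (\<lambda>v. \<alpha> v - of_int k) ((1 - s) *\<^sub>R (T ^^ m) x + s *\<^sub>R (T ^^ m) x')"
proof -
  note a = van_root[OF v] and j = j0_facts[OF v]
  define c where "c = \<alpha> (pr 0)"
  have pc: "\<alpha> (pr u) = c" for u unfolding c_def by (rule van_pr[OF v])
  obtain \<eta> where eta: "0 < \<eta>" "\<And>k::int. \<bar>real_of_int k - c\<bar> < \<eta> \<Longrightarrow> real_of_int k = c"
    using integer_gap[of c] by blast
  note small = osc_small_segment[OF a eta(1), of x x' 0]
  show ?thesis
  proof (cases "2 * j0 \<alpha> = n")
    case True
    show ?thesis using small
    proof (rule eventually_mono, intro ballI allI)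
      fix m s and k :: int
      let ?u = "(1 - s) *\<^sub>R (T ^^ m) x + s *\<^sub>R (T ^^ m) x'"
      assume h: "\<forall>s\<in>{0..1}. \<bar>osc \<alpha> ((1 - s) *\<^sub>R (T ^^ m) x + s *\<^sub>R (T ^^ m) x') 0\<bar> < \<eta>"
        and s: "s \<in> {0..(1::real)}"
      have "(\<lambda>v. \<alpha> v - of_int k) \<circ> y = (\<lambda>v. - (\<alpha> v - of_int k))" if "\<alpha> ?u - of_int k = 0"
      proof -
        have o: "\<bar>osc \<alpha> ?u 0\<bar> < \<eta>" using h s by blast
        have "real_of_int k - c = osc \<alpha> ?u 0" using that root_pr[OF a, of ?u] pc by simp
        then have kc: "real_of_int k = c" using eta(2)[of k] o by simp
        have "\<alpha> (y (pr 0)) = c" unfolding y_pr by (simp add: root_lin[OF a] nu c_def)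
        then have "- c + \<alpha> t = c"
          using half_frequency[OF v True, of "pr 0"] by (simp add: y_app root_lin[OF a] c_def)
        then show ?thesis using half_frequency[OF v True] kc
          by (simp add: fun_eq_iff y_app root_lin[OF a])
      qed
      then show "harmless (\<lambda>v. \<alpha> v - of_int k) ?u" unfolding harmless_def by blast
    qed
  next
    case False
    then have h: "2 * j0 \<alpha> < n" using j(4) by simp
    have "\<forall>\<^sub>F m in sequentially. \<forall>s\<in>{0..1}.
      (avg ^^ m) (\<lambda>i. (1 - s) * osc \<alpha> x i + s * osc \<alpha> x' i) 0 = 0 \<longrightarrow>
      (avg ^^ m) (\<lambda>i. (1 - s) * osc \<alpha> x i + s * osc \<alpha> x' i) 1 *
      (avg ^^ m) (\<lambda>i. (1 - s) * osc \<alpha> x i + s * osc \<alpha> x' i) (n - 1) < 0"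
      by (rule dominant_frequency[OF per_osc per_osc j(3) h])
        (simp_all only: dft_osc[OF v] j(2) gen[OF h] not_False_eq_True)
    from eventually_conj[OF this small] show ?thesis
    proof (rule eventually_mono, intro ballI allI)
      fix m s and k :: int
      let ?u = "(1 - s) *\<^sub>R (T ^^ m) x + s *\<^sub>R (T ^^ m) x'"
      let ?b = "(avg ^^ m) (\<lambda>i. (1 - s) * osc \<alpha> x i + s * osc \<alpha> x' i)"
      assume h: "(\<forall>s\<in>{0..1}.
        (avg ^^ m) (\<lambda>i. (1 - s) * osc \<alpha> x i + s * osc \<alpha> x' i) 0 = 0 \<longrightarrow>
        (avg ^^ m) (\<lambda>i. (1 - s) * osc \<alpha> x i + s * osc \<alpha> x' i) 1 *
        (avg ^^ m) (\<lambda>i. (1 - s) * osc \<alpha> x i + s * osc \<alpha> x' i) (n - 1) < 0) \<and>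
        (\<forall>s\<in>{0..1}. \<bar>osc \<alpha> ((1 - s) *\<^sub>R (T ^^ m) x + s *\<^sub>R (T ^^ m) x') 0\<bar> < \<eta>)"
        and s: "s \<in> {0..(1::real)}"
      have b: "?b = osc \<alpha> ?u"
        unfolding osc_affine[OF a, symmetric] osc_Tpow[OF a, symmetric] Tpow_affine ..
      have o: "\<bar>osc \<alpha> ?u 0\<bar> < \<eta>" and d: "?b 0 = 0 \<longrightarrow> ?b 1 * ?b (n - 1) < 0" using h s by blast+
      have "(\<alpha> (y ?u) - k) * (\<alpha> (inv y ?u) - k) < 0" if "\<alpha> ?u - of_int k = 0"
      proof -
        have e: "real_of_int k - c = osc \<alpha> ?u 0" using that root_pr[OF a, of ?u] pc by simp
        then have kc: "real_of_int k = c" using eta(2)[of k] o by simp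
        then have "osc \<alpha> ?u 0 = 0" using e by simp
        then have "osc \<alpha> ?u 1 * osc \<alpha> ?u (n - 1) < 0" using d unfolding b by blast
        moreover have "\<alpha> (y ?u) - k = osc \<alpha> ?u 1" unfolding root_y[OF a] pc nu kc by simp
        moreover have "\<alpha> (inv y ?u) - k = osc \<alpha> ?u (n - 1)" unfolding root_inv_y[OF a] pc nu kc by simp
        ultimately show ?thesis by (simp only:)
      qed
      then show "harmless (\<lambda>v. \<alpha> v - of_int k) ?u" unfolding harmless_def by blast
    qed
  qed
qed

lemma eventually_harmless:
  assumes c2: "cond2'"
    and gen: "\<And>\<alpha>. van \<alpha> \<Longrightarrow> 2 * j0 \<alpha> < n \<Longrightarrow>
      Im (cnj (L \<alpha> (j0 \<alpha>) (x - pr 0)) * L \<alpha> (j0 \<alpha>) (x' - pr 0)) \<noteq> 0"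
  shows "\<forall>\<^sub>F m in sequentially. \<forall>s\<in>{0..1}. \<forall>a\<in>AR. harmless a ((1 - s) *\<^sub>R (T ^^ m) x + s *\<^sub>R (T ^^ m) x')"
proof -
  have "\<forall>\<^sub>F m in sequentially. \<forall>\<alpha>\<in>\<Phi>. \<forall>s\<in>{0..1}. \<forall>k::int.
    harmless (\<lambda>v. \<alpha> v - of_int k) ((1 - s) *\<^sub>R (T ^^ m) x + s *\<^sub>R (T ^^ m) x')"
  proof (rule eventually_ball_finite[OF finite_roots], rule ballI)
    fix \<alpha> assume a: "\<alpha> \<in> \<Phi>"
    consider "\<alpha> nu \<noteq> 0" | "\<alpha> nu = 0" "\<alpha> \<circ> z = \<alpha>" | "\<alpha> nu = 0" "van \<alpha>"
      using c2 a unfolding cond2'_def van_def by blast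
    then show "\<forall>\<^sub>F m in sequentially. \<forall>s\<in>{0..1}. \<forall>k::int.
      harmless (\<lambda>v. \<alpha> v - of_int k) ((1 - s) *\<^sub>R (T ^^ m) x + s *\<^sub>R (T ^^ m) x')"
    proof cases
      case 1
      then show ?thesis by (rule harmless_transverse[OF a])
    next
      case 2
      have "(\<lambda>v. \<alpha> v - real_of_int k) \<circ> y = (\<lambda>v. \<alpha> v - of_int k)" for k
        using root_y_const[OF a 2] by (simp add: fun_eq_iff)
      then show ?thesis unfolding harmless_def by simp
    next
      case 3
      then show ?thesis using gen by (intro harmless_vanishing)
    qed
  qed
  then show ?thesis
  proof (rule eventually_mono, intro ballI)
    fix m s a
    assume h: "\<forall>\<alpha>\<in>\<Phi>. \<forall>s\<in>{0..1}. \<forall>k::int.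
      harmless (\<lambda>v. \<alpha> v - of_int k) ((1 - s) *\<^sub>R (T ^^ m) x + s *\<^sub>R (T ^^ m) x')"
      and s: "s \<in> {0..(1::real)}" and a: "a \<in> AR"
    obtain \<alpha> k where ak: "\<alpha> \<in> \<Phi>" "a = (\<lambda>x. \<alpha> x - of_int k)" using a by (rule AR_E)
    show "harmless a ((1 - s) *\<^sub>R (T ^^ m) x + s *\<^sub>R (T ^^ m) x')"
      unfolding ak(2) using h ak(1) s by blast
  qed
qed

end

section \<open>Connectedness of the sublevel sets of the displacement function\<close>

context twisted
begin

definition F :: "'v \<Rightarrow> nat" where "F x = card (S x (y x))"

text \<open>Adjacency of alcoves of displacement at most \<open>c\<close>: multiplying by a simple
  reflection on the right crosses a wall.\<close>

definition R :: "nat \<Rightarrow> (('v \<Rightarrow> 'v) \<times> ('v \<Rightarrow> 'v)) set" where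
  "R c = {(g, g \<circ> s) | g s. g \<in> words \<and> s \<in> Saff \<Phi> cor \<Delta> \<and> F (g a0) \<le> c \<and> F (g (s a0)) \<le> c}"

lemma reg_word: "g \<in> words \<Longrightarrow> reg (g a0)"
  by (rule aff_reg[OF words_aff reg_a0])

lemma reg_y: "reg x \<Longrightarrow> reg (y x)"
  by (rule aff_reg[OF aff_y])

lemma S_y_cong:
  assumes "reg x" "reg x'" "S x x' = {}"
  shows "S x (y x) = S x' (y x')"
proof -
  have "S (y x) (y x') = {}" using assms(3) by (simp add: S_aff[OF aff_y])
  then show ?thesis
    using S_cong(1)[OF assms] S_cong(2)[OF reg_y[OF assms(1)] reg_y[OF assms(2)]] by simp
qed

lemma F_cong: "reg x \<Longrightarrow> reg x' \<Longrightarrow> S x x' = {} \<Longrightarrow> F x = F x'"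
  unfolding F_def by (simp only: S_y_cong)

lemma F_inv: "F x = card (S x (inv y x))"
proof -
  have "card (S (inv y x) (inv y (y x))) = F x" unfolding F_def by (rule card_S_aff[OF aff_inv[OF aff_y]])
  then show ?thesis using card_S_sym[of x "inv y x"] aff_y by simp
qed

text \<open>The crossed wall separates \<open>x\<close> from \<open>h x\<close>, so
  \<open>x'\<close> is one step along a geodesic from \<open>x\<close> to \<open>h x\<close>. The
  step gains 1, and moving \<open>h x\<close> to \<open>h x'\<close> costs 1. It serves for
  \<open>y\<close> and, through \<open>F_inv\<close>, for its inverse.\<close>

lemma cross_toward:
  assumes h: "aff h" and x: "reg x" "reg x'" and a: "S x x' = {a}" and p: "0 < a (h x)"
  shows "card (S x' (h x')) \<le> card (S x (h x))"
proof -
  have "a \<in> S x x'" using a by simp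
  then have "a \<in> S x (h x)" using p by (simp add: S_def)
  then have "card (S x (h x)) = 1 + card (S x' (h x))" using S_split(3)[OF x, of "h x"] a by simp
  moreover have "card (S x' (h x')) \<le> card (S x' (h x)) + card (S (h x) (h x'))"
    by (rule S_triangle[OF aff_reg[OF h x(1)]])
  moreover have "card (S (h x) (h x')) = 1" using card_S_aff[OF h] a by simp
  ultimately show ?thesis by simp
qed

text \<open>The points \<open>x\<close> and \<open>x'\<close> differ in sign only at
  \<open>a\<close> and its negative. As \<open>a\<close> is constant on orbits, neither
  \<open>b\<close> nor \<open>b \<circ> y\<close> is one of these when \<open>b\<close> separates
  \<open>x'\<close> from \<open>y x'\<close>, so every such \<open>b\<close> also separates
  \<open>x\<close> from \<open>y x\<close>.\<close>

lemma cross_fixed: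
  assumes x: "reg x" "reg x'" and a: "S x x' = {a}" and fx: "a \<circ> y = a"
  shows "F x' \<le> F x"
proof -
  have aS: "a \<in> AR" "a x < 0" "0 < a x'" using a by (auto simp: S_def)
  have afx: "a (y v) = a v" for v using fun_cong[OF fx, of v] by simp
  have same: "b x < 0 \<longleftrightarrow> b x' < 0" "0 < b x \<longleftrightarrow> 0 < b x'"
    if b: "b \<in> AR" "b \<noteq> a" "b \<noteq> (\<lambda>v. - a v)" for b
  proof -
    have "b \<notin> S x x'" using a b by simp
    moreover have "(\<lambda>v. - b v) \<notin> S x x'"
    proof
      assume "(\<lambda>v. - b v) \<in> S x x'"
      then have "(\<lambda>v. - b v) = a" using a by simp
      then have "b v = - a v" for v by (metis add.inverse_inverse)
      then have "b = (\<lambda>v. - a v)" by (rule ext)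
      then show False using b(3) by contradiction
    qed
    moreover have "b x \<noteq> 0" "b x' \<noteq> 0" using regD[OF x(1) b(1)] regD[OF x(2) b(1)] by auto
    ultimately show "b x < 0 \<longleftrightarrow> b x' < 0" "0 < b x \<longleftrightarrow> 0 < b x'"
      using b(1) AR_neg[OF b(1)] unfolding S_def by auto
  qed
  have "S x' (y x') \<subseteq> S x (y x)"
  proof
    fix b assume "b \<in> S x' (y x')"
    then have b: "b \<in> AR" "b x' < 0" "0 < b (y x')" by (auto simp: S_def)
    have "b \<noteq> a" using b aS afx by auto
    moreover have "b \<noteq> (\<lambda>v. - a v)" using b aS afx by auto
    moreover have "b \<circ> y \<noteq> a"
    proof
      assume "b \<circ> y = a"
      then have "b (y x') = a x'" "b (y (inv y x')) = a (inv y x')" by (simp_all add: fun_eq_iff)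
      moreover have "a (inv y x') = a x'" using afx[of "inv y x'"] aff_y by simp
      ultimately show False using b aS aff_y by simp
    qed
    moreover have "b \<circ> y \<noteq> (\<lambda>v. - a v)"
    proof
      assume "b \<circ> y = (\<lambda>v. - a v)"
      then have "b (y x') = - a x'" by (simp add: fun_eq_iff)
      then show False using b aS by simp
    qed
    ultimately have "b x < 0" "0 < (b \<circ> y) x"
      using same[OF b(1)] same[OF aff_AR[OF aff_y b(1)]] b by simp_all
    then show "b \<in> S x (y x)" using b(1) by (simp add: S_def)
  qed
  then show ?thesis unfolding F_def by (rule card_mono[OF finite_S])
qed

lemma sym_R: "sym (R c)"
proof (rule symI)
  fix g h assume "(g, h) \<in> R c"
  then obtain s where s: "h = g \<circ> s" "g \<in> words" "s \<in> Saff \<Phi> cor \<Delta>" "F (g a0) \<le> c" "F (g (s a0)) \<le> c"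
    unfolding R_def by blast
  have g: "g = h \<circ> s" unfolding s(1) using Saff_involution[OF s(3)] by (simp add: comp_assoc)
  then have "F (h (s a0)) \<le> c" using s(4) by (simp add: fun_eq_iff)
  moreover have "h \<in> words" unfolding s(1) by (intro words_comp words_Saff s)
  moreover have "F (h a0) \<le> c" using s(1,5) by simp
  ultimately show "(h, g) \<in> R c" unfolding R_def using g s(3) by blast
qed

lemma R_sym: "(g, h) \<in> (R c)\<^sup>* \<Longrightarrow> (h, g) \<in> (R c)\<^sup>*"
  using sym_rtrancl[OF sym_R] by (rule symD)

text \<open>The induction shared by both connectedness arguments. The gallery crosses only
  hyperplanes separating its ends, and this confinement is handed to \<open>step\<close>, where the
  bound on \<open>F\<close> has to be verified.\<close>

lemma minimal_gallery:
  assumes g: "g \<in> words" "F (g a0) \<le> c" and h: "h \<in> words"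
    and step: "\<And>k s a. k \<in> words \<Longrightarrow> s \<in> Saff \<Phi> cor \<Delta> \<Longrightarrow> S (g a0) (k a0) \<subseteq> S (g a0) (h a0) \<Longrightarrow>
      S (g a0) (k (s a0)) \<subseteq> S (g a0) (h a0) \<Longrightarrow>
      S (k a0) (k (s a0)) = {a} \<Longrightarrow> a \<in> S (g a0) (h a0) \<Longrightarrow> F (k a0) \<le> c \<Longrightarrow> F (k (s a0)) \<le> c"
  shows "(g, h) \<in> (R c)\<^sup>* \<and> F (h a0) \<le> c"
proof -
  have "(g, h) \<in> (R c)\<^sup>* \<and> F (h a0) \<le> c"
    if "card (S (k a0) (h a0)) = m" "k \<in> words" "S (g a0) (k a0) \<subseteq> S (g a0) (h a0)" "F (k a0) \<le> c"
      "(g, k) \<in> (R c)\<^sup>*" for m k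
    using that
  proof (induction m arbitrary: k rule: less_induct)
    case (less m)
    note k = less.prems
    show ?case
    proof (cases "S (k a0) (h a0) = {}")
      case True
      then have "k = h" by (rule words_unique[OF k(2) h])
      then show ?thesis using k(4,5) by simp
    next
      case False
      then obtain s b where s: "s \<in> Saff \<Phi> cor \<Delta>" "b \<in> S (k a0) (h a0)" "S (k a0) (k (s a0)) = {b}"
        using gallery_step[OF words_aff[OF k(2)] reg_word[OF h]] by blast
      have ks: "k \<circ> s \<in> words" by (intro words_comp words_Saff k(2) s(1))
      have rks: "reg (k (s a0))" using reg_word[OF ks] by simp
      note sp = S_split[OF reg_word[OF g(1)] reg_word[OF k(2)] k(3)]
      have bS: "b \<in> S (g a0) (h a0)" using sp(1) s(2) by blast
      have "S (g a0) (k (s a0)) \<subseteq> S (g a0) (k a0) \<union> S (k a0) (k (s a0))"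
        using regD[OF reg_word[OF k(2)]] by (force simp: S_def)
      also have "\<dots> \<subseteq> S (g a0) (h a0)" unfolding s(3) using k(3) bS by simp
      finally have sub: "S (g a0) (k (s a0)) \<subseteq> S (g a0) (h a0)" .
      have Fks: "F (k (s a0)) \<le> c" by (rule step[OF k(2) s(1) k(3) sub s(3) bS k(4)])
      have "card (S (k a0) (h a0)) = 1 + card (S (k (s a0)) (h a0))"
        using S_split(3)[OF reg_word[OF k(2)] rks, of "h a0"] s by simp
      then have lt: "card (S ((k \<circ> s) a0) (h a0)) < m" using k(1) by simp
      have "(k, k \<circ> s) \<in> R c" unfolding R_def using k(2,4) s(1) Fks by blast
      then have gks: "(g, k \<circ> s) \<in> (R c)\<^sup>*" using k(5) by (rule rtrancl_into_rtrancl[rotated])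
      show ?thesis by (rule less.IH[OF lt refl ks _ _ gks]) (use sub Fks in simp_all)
    qed
  qed
  moreover have "S (g a0) (g a0) \<subseteq> S (g a0) (h a0)" by (auto simp: S_def)
  ultimately show ?thesis using g by blast
qed

text \<open>Cyclic shift: \<open>d(x', y x') \<le> d(x', y x) + d(y x, y x') = d(x', y x) + d(x, x') = d(x, y x)\<close>.\<close>

lemma geodesic_F:
  assumes x: "reg x" "reg x'" and sub: "S x x' \<subseteq> S x (y x)"
  shows "F x' \<le> F x"
proof -
  have "F x' \<le> card (S x' (y x)) + card (S (y x) (y x'))"
    unfolding F_def by (rule S_triangle[OF reg_y[OF x(1)]])
  also have "card (S (y x) (y x')) = card (S x x')" by (rule card_S_aff[OF aff_y])
  finally show ?thesis unfolding F_def using S_split(3)[OF x sub] by simp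
qed

lemma geodesic_connected:
  assumes g: "g \<in> words" "F (g a0) \<le> c" and h: "h \<in> words" and sub: "S (g a0) (h a0) \<subseteq> S (g a0) (y (g a0))"
  shows "(g, h) \<in> (R c)\<^sup>* \<and> F (h a0) \<le> c"
proof (rule minimal_gallery[OF g h])
  fix k s a
  assume k: "k \<in> words" "s \<in> Saff \<Phi> cor \<Delta>" "S (g a0) (k (s a0)) \<subseteq> S (g a0) (h a0)"
  have "reg (k (s a0))" using reg_word[OF words_comp[OF k(1) words_Saff[OF k(2)]]] by simp
  then have "F (k (s a0)) \<le> F (g a0)" using k(3) sub by (intro geodesic_F reg_word[OF g(1)]) auto
  then show "F (k (s a0)) \<le> c" using g(2) by simp
qed

lemma word_of: 
  assumes "reg x"
  obtains g where "g \<in> words" "S (g a0) x = {}"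
  using reach_alcove[OF assms] unfolding words_def by blast

lemma S_T: "S x (T x) \<subseteq> S x (y x)"
proof
  fix a assume "a \<in> S x (T x)"
  then have a: "a \<in> AR" "a x < 0" "0 < a (T x)" by (auto simp: S_def)
  have "a (T x) = (1 - 1 / 3) * a x + (1 / 3) * a (y x)" unfolding T_convex by (rule AR_affine[OF a(1)])
  then have "0 < a (y x)" using a(2,3) by simp
  then show "a \<in> S x (y x)" using a by (simp add: S_def)
qed

lemma S_subst_word:
  assumes "g \<in> words" "h \<in> words" "reg x" "reg x'" "S (g a0) x = {}" "S (h a0) x' = {}"
  shows "S (g a0) (h a0) = S x x'" "S (g a0) (y (g a0)) = S x (y x)" "F (g a0) = F x"
proof -
  have "S (g a0) (h a0) = S x (h a0)" by (rule S_cong(1)[OF reg_word[OF assms(1)] assms(3,5)])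
  also have "\<dots> = S x x'" by (rule S_cong(2)[OF reg_word[OF assms(2)] assms(4,6)])
  finally show "S (g a0) (h a0) = S x x'" .
  show e: "S (g a0) (y (g a0)) = S x (y x)" by (rule S_y_cong[OF reg_word[OF assms(1)] assms(3,5)])
  show "F (g a0) = F x" unfolding F_def e ..
qed

text \<open>Since \<open>T x\<close> lies on the segment from \<open>x\<close> to
  \<open>y x\<close>, its alcove lies on a geodesic (\<open>S_T\<close>), so the cyclic shift bound
  applies at each iteration.\<close>

lemma flow_connected:
  assumes reg: "\<And>k. reg ((T ^^ k) x)" and g: "g \<in> words" "S (g a0) x = {}" "F (g a0) \<le> c"
    and h: "h \<in> words" "S (h a0) ((T ^^ m) x) = {}"
  shows "(g, h) \<in> (R c)\<^sup>* \<and> F (h a0) \<le> c"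
  using h
proof (induction m arbitrary: h)
  case 0
  then have "S (g a0) (h a0) = {}"
    using S_subst_word(1)[OF g(1) _ reg[of 0] reg[of 0], of h] g(2) by (simp add: S_def)
  then have "g = h" by (rule words_unique[OF g(1) 0(1)])
  then show ?case using g(3) by simp
next
  case (Suc m)
  obtain k where k: "k \<in> words" "S (k a0) ((T ^^ m) x) = {}" by (rule word_of[OF reg[of m]])
  note IH = Suc.IH[OF k]
  note s = S_subst_word[OF k(1) Suc.prems(1) reg[of m] reg[of "Suc m"] k(2) Suc.prems(2)]
  have "S (k a0) (h a0) \<subseteq> S (k a0) (y (k a0))" unfolding s using S_T[of "(T ^^ m) x"] by simp
  then have "(k, h) \<in> (R c)\<^sup>* \<and> F (h a0) \<le> c"
    using IH by (intro geodesic_connected[OF k(1) _ Suc.prems(1)]) auto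
  then show ?case using IH by (auto intro: rtrancl_trans)
qed

text \<open>Several hyperplanes may be met at once, at the point \<open>u\<close> with the least
  parameter \<rho>. The gallery past \<open>u\<close> crosses only hyperplanes through
  \<open>u\<close>, so harmlessness at this one point controls all its steps; the rest of the
  segment is left to induction.\<close>

lemma segment_connected:
  assumes "reg x" "reg x'" and "\<And>s a. s \<in> {0..1} \<Longrightarrow> a \<in> AR \<Longrightarrow> harmless a ((1 - s) *\<^sub>R x + s *\<^sub>R x')"
    and "g \<in> words" "S (g a0) x = {}" "F (g a0) \<le> c" "h \<in> words" "S (h a0) x' = {}"
  shows "(g, h) \<in> (R c)\<^sup>* \<and> F (h a0) \<le> c"
  using assms
proof (induction "card (S x x')" arbitrary: x g rule: less_induct)
  case less
  note x = less.prems(1,2) and harm = less.prems(3) and g = less.prems(4-6) and h = less.prems(7,8)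
  show ?case
  proof (cases "S x x' = {}")
    case True
    then have "S (g a0) (h a0) = {}" using S_subst_word(1)[OF g(1) h(1) x g(2) h(2)] by simp
    then have "g = h" by (rule words_unique[OF g(1) h(1)])
    then show ?thesis using g(3) by simp
  next
    case False
    define r where "r a = - a x / (a x' - a x)" for a :: "'v \<Rightarrow> real"
    define \<rho> where "\<rho> = Min (r ` S x x')"
    have fin: "finite (r ` S x x')" "r ` S x x' \<noteq> {}" using finite_S False by auto
    have rmin: "\<rho> \<le> r a" if "a \<in> S x x'" for a unfolding \<rho>_def using fin that by (intro Min_le) auto
    have r01: "0 < r a" "r a < 1" if "a \<in> S x x'" for a
      using that by (auto simp: r_def S_def field_simps)
    have val: "a ((1 - s) *\<^sub>R x + s *\<^sub>R x') = (a x' - a x) * (s - r a)" if "a \<in> S x x'" for a s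
    proof -
      have "a x' - a x \<noteq> 0" "a \<in> AR" using that by (auto simp: S_def)
      then have "(a x' - a x) * r a = - a x" by (simp add: r_def)
      then show ?thesis using AR_affine[OF \<open>a \<in> AR\<close>, of s x x'] by (simp add: algebra_simps)
    qed
    have pos: "0 < a x' - a x" if "a \<in> S x x'" for a using that by (auto simp: S_def)
    have "\<rho> \<in> r ` S x x'" unfolding \<rho>_def using fin by (rule Min_in)
    then have \<rho>01: "0 < \<rho>" "\<rho> < 1" using r01 by auto
    define Later where "Later = {q \<in> r ` S x x'. \<rho> < q}"
    \<comment> \<open>Halfway to the next meeting point, or the end of the segment if there is none:
      exactly the hyperplanes met at \<open>u\<close> separate \<open>x\<close> from
      \<open>x1\<close> (\<open>S1\<close>).\<close>
    define \<tau> where "\<tau> = (if Later = {} then 1 else (\<rho> + Min Later) / 2)"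
    have finL: "finite Later" using fin by (simp add: Later_def)
    have Lmin: "\<rho> < Min Later" "Min Later < 1" if "Later \<noteq> {}"
      using Min_in[OF finL that] r01 by (auto simp: Later_def)
    have \<tau>: "\<rho> < \<tau>" "\<tau> \<le> 1" using \<rho>01 Lmin by (cases "Later = {}"; simp add: \<tau>_def)+
    have later: "\<tau> < r a" if "a \<in> S x x'" "r a \<noteq> \<rho>" for a
    proof -
      have "r a \<in> Later" using that rmin[OF that(1)] by (auto simp: Later_def)
      then have "Later \<noteq> {}" "Min Later \<le> r a" using finL by auto
      then show ?thesis using Lmin by (simp add: \<tau>_def)
    qed
    define u where "u = (1 - \<rho>) *\<^sub>R x + \<rho> *\<^sub>R x'"
    define x1 where "x1 = (1 - \<tau>) *\<^sub>R x + \<tau> *\<^sub>R x'"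
    have sep: "a \<in> S x x'" if a: "a \<in> AR" "a x < 0" "0 \<le> a ((1 - s) *\<^sub>R x + s *\<^sub>R x')" "s \<in> {0..1}" for a s
    proof (rule ccontr)
      assume "a \<notin> S x x'"
      then have "a x' < 0" using a(1,2) regD[OF x(2) a(1)] by (force simp: S_def)
      then have "(1 - s) * a x + s * a x' < 0" using a(2,4) by (intro convex_bound_lt) auto
      then show False using a(3) AR_affine[OF a(1), of s x x'] by simp
    qed
    have s\<tau>: "\<tau> \<in> {0..1}" and s\<rho>: "\<rho> \<in> {0..1}" using \<tau> \<rho>01 by auto
    have nz: "a x1 \<noteq> 0" if a: "a \<in> S x x'" for a
      unfolding x1_def val[OF a] using pos[OF a] later[OF a] \<tau>(1) by (cases "r a = \<rho>") auto
    have reg1: "reg x1"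
      unfolding reg_def
    proof
      fix a assume a: "a \<in> AR"
      have "a x \<noteq> 0" by (rule regD[OF x(1) a])
      then consider "a x < 0" | "(\<lambda>v. - a v) x < 0" by fastforce
      then show "a x1 \<noteq> 0"
      proof cases
        case 1
        show ?thesis
        proof
          assume z: "a x1 = 0"
          then have "a \<in> S x x'" using sep[OF a 1 _ s\<tau>] by (simp add: x1_def)
          then show False using nz z by blast
        qed
      next
        case 2
        show ?thesis
        proof
          assume z: "a x1 = 0"
          then have "(\<lambda>v. - a v) \<in> S x x'" using sep[OF AR_neg[OF a] 2 _ s\<tau>] by (simp add: x1_def)
          from nz[OF this] show False using z by simp
        qed
      qed
    qed
    have S1: "S x x1 = {a \<in> S x x'. r a = \<rho>}"
    proof
      show "S x x1 \<subseteq> {a \<in> S x x'. r a = \<rho>}"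
      proof
        fix a assume "a \<in> S x x1"
        then have a: "a \<in> AR" "a x < 0" "0 < a x1" by (auto simp: S_def)
        have aS: "a \<in> S x x'" using sep[OF a(1,2) _ s\<tau>] a(3) by (simp add: x1_def)
        have "0 < (a x' - a x) * (\<tau> - r a)" using a(3) val[OF aS] by (simp add: x1_def)
        then have "r a < \<tau>" using pos[OF aS] by (simp add: zero_less_mult_iff)
        then show "a \<in> {a \<in> S x x'. r a = \<rho>}" using later[OF aS] aS by fastforce
      qed
      show "{a \<in> S x x'. r a = \<rho>} \<subseteq> S x x1"
      proof
        fix a assume "a \<in> {a \<in> S x x'. r a = \<rho>}"
        then have a: "a \<in> S x x'" "r a = \<rho>" by auto
        have "0 < a x1" unfolding x1_def val[OF a(1)] a(2) using pos[OF a(1)] \<tau>(1) by simp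
        then show "a \<in> S x x1" using a(1) by (simp add: S_def)
      qed
    qed
    have sub1: "S x x1 \<subseteq> S x x'" unfolding S1 by blast
    have ne1: "S x x1 \<noteq> {}" using \<open>\<rho> \<in> r ` S x x'\<close> unfolding S1 by auto
    obtain g1 where g1: "g1 \<in> words" "S (g1 a0) x1 = {}" by (rule word_of[OF reg1])
    have gg1: "S (g a0) (g1 a0) = S x x1" by (rule S_subst_word(1)[OF g(1) g1(1) x(1) reg1 g(2) g1(2)])
    have "(g, g1) \<in> (R c)\<^sup>* \<and> F (g1 a0) \<le> c"
    proof (rule minimal_gallery[OF g(1,3) g1(1)])
      fix k s a
      assume k: "k \<in> words" "s \<in> Saff \<Phi> cor \<Delta>" "S (g a0) (k a0) \<subseteq> S (g a0) (g1 a0)"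
        and ks: "S (k a0) (k (s a0)) = {a}" and aS: "a \<in> S (g a0) (g1 a0)" and Fk: "F (k a0) \<le> c"
      have rk: "reg (k a0)" by (rule reg_word[OF k(1)])
      have rks: "reg (k (s a0))" using reg_word[OF words_comp[OF k(1) words_Saff[OF k(2)]]] by simp
      have a: "a \<in> AR" "a (k a0) < 0" using ks by (auto simp: S_def)
      have a': "a \<in> S x x'" "r a = \<rho>" using aS unfolding gg1 S1 by auto
      have au: "a u = 0" unfolding u_def val[OF a'(1)] a'(2) by simp
      text \<open>Alcoves on the way from \<open>x\<close> to \<open>x1\<close> have \<open>u\<close> in their closure.\<close>
      have near: "0 < b (k a0)" if b: "b \<in> AR" "0 < b u" for b
      proof (rule ccontr)
        assume "\<not> 0 < b (k a0)"
        then have bk: "b (k a0) < 0" using regD[OF rk b(1)] by simp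
        have bx: "0 < b x"
        proof (rule ccontr)
          assume "\<not> 0 < b x"
          then have "b x < 0" using regD[OF x(1) b(1)] by simp
          then have bS: "b \<in> S x x'" using sep[OF b(1) _ _ s\<rho>] b(2) by (simp add: u_def)
          have "b u \<le> 0" unfolding u_def val[OF bS]
            using rmin[OF bS] pos[OF bS] by (simp add: mult_nonneg_nonpos)
          then show False using b(2) by simp
        qed
        then have "0 < b (g a0)" using S_empty_sign(2)[OF reg_word[OF g(1)] x(1) g(2) b(1)] by simp
        then have "(\<lambda>v. - b v) \<in> S (g a0) (k a0)" using AR_neg[OF b(1)] bk by (simp add: S_def)
        then have nb: "(\<lambda>v. - b v) \<in> S x x'" "r (\<lambda>v. - b v) = \<rho>" using k(3) unfolding gg1 S1 by auto
        have "- b u = 0" using val[OF nb(1), of \<rho>] unfolding u_def nb(2) by simp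
        then show False using b(2) by simp
      qed
      have nearh: "0 < a (f (k a0))" if "aff f" "0 < a (f u)" for f
        using near[OF aff_AR[OF that(1) a(1)]] that(2) by simp
      from harm[OF s\<rho> a(1)] au
      consider "a (y u) * a (inv y u) < 0" | "a \<circ> y = a" | "a \<circ> y = (\<lambda>v. - a v)"
        unfolding harmless_def u_def by blast
      then have "F (k (s a0)) \<le> F (k a0)"
      proof cases
        case 1
        then consider "0 < a (y u)" | "0 < a (inv y u)" by (auto simp: mult_less_0_iff)
        then show ?thesis
        proof cases
          case 1
          from nearh[OF aff_y this] show ?thesis unfolding F_def by (rule cross_toward[OF aff_y rk rks ks])
        next
          case 2
          from nearh[OF aff_inv[OF aff_y] this] show ?thesis
            unfolding F_inv by (rule cross_toward[OF aff_inv[OF aff_y] rk rks ks])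
        qed
      next
        case 2
        then show ?thesis by (rule cross_fixed[OF rk rks ks])
      next
        case 3
        then have "a (y (k a0)) = - a (k a0)" by (simp add: fun_eq_iff)
        then have "0 < a (y (k a0))" using a(2) by simp
        then show ?thesis unfolding F_def by (rule cross_toward[OF aff_y rk rks ks])
      qed
      then show "F (k (s a0)) \<le> c" using Fk by simp
    qed
    moreover have "(g1, h) \<in> (R c)\<^sup>* \<and> F (h a0) \<le> c"
    proof (rule less.hyps[of x1 g1])
      have "card (S x x') = card (S x x1) + card (S x1 x')" by (rule S_split(3)[OF x(1) reg1 sub1])
      moreover have "0 < card (S x x1)" using ne1 finite_S by (simp add: card_gt_0_iff)
      ultimately show "card (S x1 x') < card (S x x')" by simp
      fix s a assume s: "s \<in> {0..(1::real)}" and a: "a \<in> AR"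
      \<comment> \<open>The remaining segment is a piece of the original one, so harmlessness is
        inherited.\<close>
      have e: "(1 - s) *\<^sub>R x1 + s *\<^sub>R x' = (1 - (\<tau> + s * (1 - \<tau>))) *\<^sub>R x + (\<tau> + s * (1 - \<tau>)) *\<^sub>R x'"
        unfolding x1_def by (simp add: algebra_simps)
      have "0 \<le> \<tau> + s * (1 - \<tau>)" using s s\<tau> by simp
      moreover have "\<tau> + s * (1 - \<tau>) \<le> \<tau> + 1 * (1 - \<tau>)" using s s\<tau> by (intro add_left_mono mult_right_mono) auto
      ultimately have "\<tau> + s * (1 - \<tau>) \<in> {0..1}" by simp
      then show "harmless a ((1 - s) *\<^sub>R x1 + s *\<^sub>R x')" unfolding e by (rule harm[OF _ a])
    qed (use reg1 x g1 h calculation in auto)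
    ultimately show ?thesis by (auto intro: rtrancl_trans)
  qed
qed

section \<open>Generic starting points for the flow\<close>

definition tau :: "'v \<Rightarrow> 'v" where "tau x = (2 / 3) *\<^sub>R x + (1 / 3) *\<^sub>R z x"

lemma linear_tau: "linear tau"
  by (intro linearI)
    (simp_all add: tau_def linear_add[OF linear_z] linear_scale[OF linear_z] scaleR_add_right mult.commute)

text \<open>A vector killed by the linear part of \<open>T\<close> would be an eigenvector of
  \<open>z\<close> for -2, impossible for a map of finite order. Hence preimages of hyperplanes
  under iterates of \<open>T\<close> are again hyperplanes.\<close>

lemma inj_tau: "inj tau"
  unfolding linear_injective_0[OF linear_tau]
proof (intro allI impI)
  fix x assume "tau x = 0"
  then have "3 *\<^sub>R tau x = 0" by simp
  then have "2 *\<^sub>R x + z x = 0" by (simp add: tau_def scaleR_add_right)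
  then have zx: "z x = (- 2) *\<^sub>R x" by (simp add: eq_neg_iff_add_eq_0 add.commute)
  have "(z ^^ i) x = ((- 2) ^ i) *\<^sub>R x" for i
    by (induction i) (simp_all add: linear_scale[OF linear_z] zx)
  then have "x = ((- 2) ^ n) *\<^sub>R x" using z_n by (metis id_apply)
  then have "((- 2) ^ n - 1) *\<^sub>R x = 0" by (simp add: scaleR_diff_left)
  moreover have "(- 2 :: real) ^ n \<noteq> 1"
  proof
    assume "(- 2 :: real) ^ n = 1"
    then have "\<bar>(- 2 :: real) ^ n\<bar> = 1" by simp
    then have "(2 :: real) ^ n = 1" by (simp add: power_abs)
    then show False using n_pos one_less_power[of "2 :: real" n] by simp
  qed
  ultimately show "x = 0" by simp
qed

lemma surj_tau_pow: "surj (tau ^^ k)"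
proof -
  have "surj tau" using linear_tau inj_tau by (rule linear_inj_imp_surj)
  show ?thesis
  proof (induction k)
    case (Suc k)
    show ?case unfolding funpow.simps using Suc \<open>surj tau\<close> by (rule comp_surj)
  qed simp
qed

lemma linear_tau_pow: "linear (tau ^^ k)"
  by (induction k) (auto intro: linear_compose linear_tau simp: linear_id simp del: o_apply id_apply)

lemma T_pow_tau: "(T ^^ k) x = (tau ^^ k) x + (T ^^ k) 0"
proof (induction k)
  case (Suc k)
  have "T (v + w) = tau v + T w" for v w
    by (simp add: T_def tau_def y_app linear_add[OF linear_z] algebra_simps)
  then show ?case using Suc by (metis funpow.simps(2) comp_apply)
qed simp

lemma tau_functional:
  assumes "\<alpha> \<in> \<Phi>"
  shows "linear (\<alpha> \<circ> (tau ^^ k)) \<and> (\<exists>e. (\<alpha> \<circ> (tau ^^ k)) e \<noteq> 0)"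
proof
  obtain e where "\<alpha> e \<noteq> 0" using root_nonzero[OF assms] by blast
  moreover obtain e' where "e = (tau ^^ k) e'" using surj_tau_pow[of k] by (rule surjE)
  ultimately have "(\<alpha> \<circ> (tau ^^ k)) e' \<noteq> 0" by simp
  then show "\<exists>e. (\<alpha> \<circ> (tau ^^ k)) e \<noteq> 0" by blast
  show "linear (\<alpha> \<circ> (tau ^^ k))" by (rule linear_compose[OF linear_tau_pow linear_root[OF assms]])
qed

text \<open>Regularity of all iterates at once excludes only countably many hyperplanes, the
  preimages under powers of \<open>T\<close>; \<open>Q\<close> carries further conditions.\<close>

lemma generic_flow:
  fixes Q :: "(('v \<Rightarrow> real) \<times> real) set"
  assumes "open U" "U \<noteq> {}" "countable Q"
    and Q: "\<And>f c. (f, c) \<in> Q \<Longrightarrow> linear f \<and> (\<exists>e. f e \<noteq> 0)"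
  shows "\<exists>x\<in>U. (\<forall>k. reg ((T ^^ k) x)) \<and> (\<forall>p\<in>Q. fst p x \<noteq> snd p)"
proof -
  define G where "G = (\<lambda>(\<alpha> :: 'v \<Rightarrow> real, l :: int, k :: nat). (\<alpha> \<circ> (tau ^^ k), of_int l - \<alpha> ((T ^^ k) 0)))"
  have "\<exists>x\<in>U. \<forall>p\<in>G ` (\<Phi> \<times> UNIV \<times> UNIV) \<union> Q. fst p x \<noteq> snd p"
  proof (rule generic_point[OF assms(1,2)])
    show "countable (G ` (\<Phi> \<times> UNIV \<times> UNIV) \<union> Q)"
      using finite_roots assms(3)
      by (intro countable_Un countable_image countable_SIGMA) (auto intro: countable_finite)
    fix f and c :: real assume "(f, c) \<in> G ` (\<Phi> \<times> UNIV \<times> UNIV) \<union> Q"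
    then show "linear f \<and> (\<exists>e. f e \<noteq> 0)"
    proof
      assume "(f, c) \<in> G ` (\<Phi> \<times> UNIV \<times> UNIV)"
      then obtain p where p: "(f, c) = G p" "p \<in> \<Phi> \<times> UNIV \<times> UNIV" by (rule imageE)
      obtain \<alpha> l k where pp: "p = (\<alpha>, l, k)" by (cases p)
      have a: "\<alpha> \<in> \<Phi>" and f: "f = \<alpha> \<circ> (tau ^^ k)" using p unfolding pp G_def by simp_all
      show ?thesis unfolding f by (rule tau_functional[OF a])
    qed (rule Q)
  qed
  then obtain x where x: "x \<in> U" and g: "\<And>p. p \<in> G ` (\<Phi> \<times> UNIV \<times> UNIV) \<union> Q \<Longrightarrow> fst p x \<noteq> snd p" by blast
  have "reg ((T ^^ k) x)" for k
    unfolding reg_def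
  proof
    fix a assume "a \<in> AR"
    then obtain \<alpha> l where al: "\<alpha> \<in> \<Phi>" "a = (\<lambda>x. \<alpha> x - of_int l)" by (rule AR_E)
    have "G (\<alpha>, l, k) \<in> G ` (\<Phi> \<times> UNIV \<times> UNIV) \<union> Q" using al(1) by blast
    then have "fst (G (\<alpha>, l, k)) x \<noteq> snd (G (\<alpha>, l, k))" by (rule g)
    then have "\<alpha> ((tau ^^ k) x) \<noteq> of_int l - \<alpha> ((T ^^ k) 0)" by (simp add: G_def)
    then show "a ((T ^^ k) x) \<noteq> 0" unfolding al(2) T_pow_tau[of k x] by (simp add: root_lin[OF al(1)])
  qed
  then show ?thesis using x g by blast
qed

lemma Im_L_linear:
  assumes "van \<alpha>" "2 * j0 \<alpha> < n" "c \<noteq> 0"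
  shows "linear (\<lambda>e. Im (c * L \<alpha> (j0 \<alpha>) e)) \<and> (\<exists>e. Im (c * L \<alpha> (j0 \<alpha>) e) \<noteq> 0)"
proof
  show "linear (\<lambda>e. Im (c * L \<alpha> (j0 \<alpha>) e))"
    by (intro linearI) (simp_all add: linear_L[OF van_root[OF assms(1)]] algebra_simps)
  show "\<exists>e. Im (c * L \<alpha> (j0 \<alpha>) e) \<noteq> 0" by (rule rotation_nonreal[OF assms])
qed

text \<open>The roots for which \<open>harmless_vanishing\<close> asks for genericity.\<close>

definition rots :: "('v \<Rightarrow> real) set" where
  "rots = {\<alpha>. van \<alpha> \<and> 2 * j0 \<alpha> < n}"

lemma finite_rots: "finite rots"
  by (rule finite_subset[OF _ finite_roots]) (auto simp: rots_def van_def)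

lemma open_word_alcove:
  assumes "g \<in> words"
  shows "open (inv g -` alcove \<Phi> \<Delta>)" "inv g -` alcove \<Phi> \<Delta> \<noteq> {}"
    "x \<in> inv g -` alcove \<Phi> \<Delta> \<Longrightarrow> S (g a0) x = {}"
proof -
  have g: "aff g" by (rule words_aff[OF assms])
  obtain w s where w: "lin w" "inv g = (\<lambda>x. w x + s)" using aff_inv[OF g] by (rule affE)
  have "continuous_on UNIV (inv g)"
    unfolding w(2) using linear_continuous_on[OF linear_conv_bounded_linear[THEN iffD1, OF linD(1)[OF w(1)]]]
    by (intro continuous_intros)
  then show "open (inv g -` alcove \<Phi> \<Delta>)" by (rule open_vimage[OF open_alcove])
  have "g a0 \<in> inv g -` alcove \<Phi> \<Delta>" using g a0 by simp
  then show "inv g -` alcove \<Phi> \<Delta> \<noteq> {}" by blast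
  assume "x \<in> inv g -` alcove \<Phi> \<Delta>"
  then have "S a0 (inv g x) = {}" by (intro alcove_same[OF a0]) simp
  then have "S (g a0) (g (inv g x)) = {}" unfolding S_aff[OF g] by simp
  then show "S (g a0) x = {}" using g by simp
qed

text \<open>A nonzero leading coefficient at \<open>x\<close> makes the condition on the other end
  of a segment a proper hyperplane.\<close>

lemma generic_in_word_alcove:
  assumes "g \<in> words"
  obtains x where "S (g a0) x = {}" "\<And>k. reg ((T ^^ k) x)" "\<And>\<alpha>. \<alpha> \<in> rots \<Longrightarrow> L \<alpha> (j0 \<alpha>) (x - pr 0) \<noteq> 0"
proof -
  define Q where "Q = (\<lambda>\<alpha>. (\<lambda>e. Im (1 * L \<alpha> (j0 \<alpha>) e), Im (1 * L \<alpha> (j0 \<alpha>) (pr 0)))) ` rots"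
  have "\<exists>x\<in>inv g -` alcove \<Phi> \<Delta>. (\<forall>k. reg ((T ^^ k) x)) \<and> (\<forall>p\<in>Q. fst p x \<noteq> snd p)"
  proof (rule generic_flow[OF open_word_alcove(1,2)[OF assms]])
    show "countable Q" unfolding Q_def using finite_rots by (simp add: countable_finite)
    fix f c assume "(f, c) \<in> Q"
    then obtain \<alpha> where a: "\<alpha> \<in> rots" "f = (\<lambda>e. Im (1 * L \<alpha> (j0 \<alpha>) e))" unfolding Q_def by auto
    then show "linear f \<and> (\<exists>e. f e \<noteq> 0)"
      unfolding a(2) by (intro Im_L_linear) (simp_all add: rots_def)
  qed
  then obtain x where x: "x \<in> inv g -` alcove \<Phi> \<Delta>" "\<And>k. reg ((T ^^ k) x)" "\<forall>p\<in>Q. fst p x \<noteq> snd p" by blast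
  show ?thesis
  proof (rule that[OF open_word_alcove(3)[OF assms x(1)] x(2)])
    fix \<alpha> assume a: "\<alpha> \<in> rots"
    then have "Im (L \<alpha> (j0 \<alpha>) x) \<noteq> Im (L \<alpha> (j0 \<alpha>) (pr 0))" using x(3) unfolding Q_def by force
    moreover have "\<alpha> \<in> \<Phi>" using a by (simp add: rots_def van_def)
    ultimately show "L \<alpha> (j0 \<alpha>) (x - pr 0) \<noteq> 0" by (auto simp: linear_L(2))
  qed
qed

text \<open>Both alcoves are joined to a third one. The point \<open>w\<close> is merely generic and
  nothing is known about \<open>F\<close> at it; both ends flow for the same time \<open>m\<close>,
  are joined to the alcove of \<open>(T ^^ m) w\<close>, and \<open>segment_connected\<close>
  supplies the bound there.\<close>

theorem sublevel_connected:
  assumes c2: "cond2'" and g: "g \<in> words" "F (g a0) \<le> c" and h: "h \<in> words" "F (h a0) \<le> c"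
  shows "(g, h) \<in> (R c)\<^sup>*"
proof -
  obtain x where x: "S (g a0) x = {}" "\<And>k. reg ((T ^^ k) x)" "\<And>\<alpha>. \<alpha> \<in> rots \<Longrightarrow> L \<alpha> (j0 \<alpha>) (x - pr 0) \<noteq> 0"
    by (rule generic_in_word_alcove[OF g(1)]) blast
  obtain x' where x': "S (h a0) x' = {}" "\<And>k. reg ((T ^^ k) x')" "\<And>\<alpha>. \<alpha> \<in> rots \<Longrightarrow> L \<alpha> (j0 \<alpha>) (x' - pr 0) \<noteq> 0"
    by (rule generic_in_word_alcove[OF h(1)]) blast
  define f where "f v \<alpha> e = Im (cnj (L \<alpha> (j0 \<alpha>) (v - pr 0)) * L \<alpha> (j0 \<alpha>) e)" for v \<alpha> e
  define Q where "Q = (\<lambda>\<alpha>. (f x \<alpha>, f x \<alpha> (pr 0))) ` rots \<union> (\<lambda>\<alpha>. (f x' \<alpha>, f x' \<alpha> (pr 0))) ` rots"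
  have flin: "linear (f v \<alpha>) \<and> (\<exists>e. f v \<alpha> e \<noteq> 0)" if "\<alpha> \<in> rots" "L \<alpha> (j0 \<alpha>) (v - pr 0) \<noteq> 0" for v \<alpha>
    unfolding f_def[abs_def] using that by (intro Im_L_linear) (simp_all add: rots_def)
  have "\<exists>w\<in>UNIV. (\<forall>k. reg ((T ^^ k) w)) \<and> (\<forall>p\<in>Q. fst p w \<noteq> snd p)"
  proof (rule generic_flow)
    show "countable Q" unfolding Q_def using finite_rots by (simp add: countable_finite)
    fix q c assume "(q, c) \<in> Q"
    then obtain \<alpha> v where "\<alpha> \<in> rots" "q = f v \<alpha>" "v = x \<or> v = x'" unfolding Q_def by auto
    then show "linear q \<and> (\<exists>e. q e \<noteq> 0)" using flin x(3) x'(3) by auto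
  qed auto
  then obtain w where w: "\<And>k. reg ((T ^^ k) w)" "\<forall>p\<in>Q. fst p w \<noteq> snd p" by blast
  have gen: "Im (cnj (L \<alpha> (j0 \<alpha>) (v - pr 0)) * L \<alpha> (j0 \<alpha>) (w - pr 0)) \<noteq> 0"
    if a: "van \<alpha>" "2 * j0 \<alpha> < n" and v: "v = x \<or> v = x'" for v \<alpha>
  proof -
    have "\<alpha> \<in> rots" using a by (simp add: rots_def)
    then have "(f v \<alpha>, f v \<alpha> (pr 0)) \<in> Q" using v unfolding Q_def by blast
    then have "f v \<alpha> w \<noteq> f v \<alpha> (pr 0)" using w(2) by (metis fst_conv snd_conv)
    then have "f v \<alpha> w - f v \<alpha> (pr 0) \<noteq> 0" by simp
    moreover have "f v \<alpha> w - f v \<alpha> (pr 0) = f v \<alpha> (w - pr 0)"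
      unfolding f_def linear_L(2)[OF van_root[OF a(1)], of _ w] by (simp add: algebra_simps)
    ultimately show ?thesis by (simp add: f_def)
  qed
  have ev: "\<forall>\<^sub>F m in sequentially. \<forall>s\<in>{0..1}. \<forall>a\<in>AR. harmless a ((1 - s) *\<^sub>R (T ^^ m) v + s *\<^sub>R (T ^^ m) w)"
    if "v = x \<or> v = x'" for v
    by (rule eventually_harmless[OF c2 gen[OF _ _ that]])
  from eventually_happens'[OF sequentially_bot eventually_conj[OF ev[of x] ev[of x']]]
  obtain m where m: "\<forall>s\<in>{0..1}. \<forall>a\<in>AR. harmless a ((1 - s) *\<^sub>R (T ^^ m) x + s *\<^sub>R (T ^^ m) w)"
    "\<forall>s\<in>{0..1}. \<forall>a\<in>AR. harmless a ((1 - s) *\<^sub>R (T ^^ m) x' + s *\<^sub>R (T ^^ m) w)" by blast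
  obtain k where k: "k \<in> words" "S (k a0) ((T ^^ m) w) = {}" by (rule word_of[OF w(1)[of m]])
  have conn: "(g', k) \<in> (R c)\<^sup>*"
    if g': "g' \<in> words" "F (g' a0) \<le> c" "S (g' a0) v = {}" and rv: "\<And>k. reg ((T ^^ k) v)"
      and hv: "\<forall>s\<in>{0..1}. \<forall>a\<in>AR. harmless a ((1 - s) *\<^sub>R (T ^^ m) v + s *\<^sub>R (T ^^ m) w)" for g' v
  proof -
    obtain l where l: "l \<in> words" "S (l a0) ((T ^^ m) v) = {}" by (rule word_of[OF rv[of m]])
    have 1: "(g', l) \<in> (R c)\<^sup>* \<and> F (l a0) \<le> c" by (rule flow_connected[OF rv g'(1,3,2) l])
    have "(l, k) \<in> (R c)\<^sup>* \<and> F (k a0) \<le> c"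
      by (rule segment_connected[OF rv[of m] w(1)[of m] _ l _ k]) (use hv 1 in auto)
    then show ?thesis using 1 by (auto intro: rtrancl_trans)
  qed
  have "(g, k) \<in> (R c)\<^sup>*" by (rule conn[OF g x(1,2) m(1)])
  moreover have "(k, h) \<in> (R c)\<^sup>*" by (rule R_sym[OF conn[OF h x'(1,2) m(2)]])
  ultimately show ?thesis by (rule rtrancl_trans)
qed

end

section \<open>Obstructions to connectedness\<close>

context rdatum
begin

text \<open>An element acting trivially on the simple roots is the identity, so the action on the
  finite set of roots is faithful.\<close>

lemma finite_W0: "finite (W0 \<Phi> cor)"
proof (rule inj_on_finite)
  let ?f = "\<lambda>w. restrict (\<lambda>\<alpha>. \<alpha> \<circ> w) \<Phi>"
  show "inj_on ?f (W0 \<Phi> cor)"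
  proof (rule inj_onI)
    fix v w assume v: "v \<in> W0 \<Phi> cor" and w: "w \<in> W0 \<Phi> cor" and e: "?f v = ?f w"
    note lv = lin_W0[OF v]
    have ew: "\<alpha> \<circ> v = \<alpha> \<circ> w" if "\<alpha> \<in> \<Phi>" for \<alpha> using fun_cong[OF e, of \<alpha>] that by simp
    have "w \<circ> inv v \<in> W0 \<Phi> cor"
      using v w WJ_inv[of \<Phi> v] WJ_comp unfolding W0_eq by blast
    moreover have "pos (j \<circ> (w \<circ> inv v))" if j: "j \<in> \<Delta>" for j
    proof -
      have "j \<circ> (w \<circ> inv v) = (j \<circ> v) \<circ> inv v" using ew[OF simple_root[OF j]] by (simp add: o_assoc)
      also have "\<dots> = j" using lv by (simp add: fun_eq_iff)
      finally show ?thesis using pos_simple[OF j] by simp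
    qed
    ultimately have "w \<circ> inv v = id" by (rule W0_pos_id)
    then have "w \<circ> inv v \<circ> v = v" by simp
    then show "v = w" using lv by (simp add: comp_assoc)
  qed
  show "?f ` W0 \<Phi> cor \<subseteq> \<Phi> \<rightarrow>\<^sub>E \<Phi>" using linD(3)[OF lin_W0] by auto
  show "finite (\<Phi> \<rightarrow>\<^sub>E \<Phi>)" using finite_roots by (intro finite_PiE) auto
qed

text \<open>The sum over the group is fixed by every reflection, and a reflection negates its own
  root.\<close>

lemma W0_invariant_vector:
  assumes "\<beta> \<in> \<Phi>"
  shows "\<beta> (\<Sum>w\<in>W0 \<Phi> cor. w e) = 0"
proof -
  let ?s = "sref cor \<beta>" and ?k = "\<Sum>w\<in>W0 \<Phi> cor. w e"
  have s: "?s \<in> W0 \<Phi> cor" unfolding W0_eq using assms by (rule WJ_sref)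
  have inj: "inj_on (\<lambda>w. ?s \<circ> w) (W0 \<Phi> cor)"
  proof (rule inj_onI)
    fix v w :: "'v \<Rightarrow> 'v" assume "?s \<circ> v = ?s \<circ> w"
    then have "?s \<circ> ?s \<circ> v = ?s \<circ> ?s \<circ> w" by (simp only: comp_assoc)
    then show "v = w" using assms by simp
  qed
  moreover have "(\<lambda>w. ?s \<circ> w) ` W0 \<Phi> cor \<subseteq> W0 \<Phi> cor"
    using s unfolding W0_eq by (auto intro: WJ_comp simp del: o_apply)
  ultimately have im: "(\<lambda>w. ?s \<circ> w) ` W0 \<Phi> cor = W0 \<Phi> cor" by (intro endo_inj_surj finite_W0)
  have "?s ?k = (\<Sum>w\<in>W0 \<Phi> cor. (?s \<circ> w) e)"
    using linear_sum[OF linear_sref[OF assms], of "\<lambda>w. w e" "W0 \<Phi> cor"] by simp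
  also have "\<dots> = (\<Sum>w\<in>(\<lambda>w. ?s \<circ> w) ` W0 \<Phi> cor. w e)" by (simp add: sum.reindex[OF inj])
  also have "\<dots> = ?k" by (simp only: im)
  finally have "\<beta> (?s ?k) = \<beta> ?k" by simp
  then show ?thesis unfolding root_comp_sref[OF assms] using assms by simp
qed

end

context twisted
begin

text \<open>Roots fixed by \<open>z\<close> may be bad although they do not violate condition (2).
  The set is stable under \<open>z\<close>, as counting along the flow requires; fixed roots are set
  apart only in \<open>connected_cond2\<close>.\<close>

definition bad :: "('v \<Rightarrow> real) \<Rightarrow> bool" where
  "bad \<alpha> \<longleftrightarrow> \<alpha> \<in> \<Phi> \<and> \<alpha> nu = 0 \<and> (\<exists>v. z v = v \<and> \<alpha> v \<noteq> 0)"

definition BR :: "('v \<Rightarrow> real) set" where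
  "BR = {a \<in> AR. bad (\<lambda>v. a v - a 0)}"

lemma BR_iff:
  assumes "\<alpha> \<in> \<Phi>"
  shows "(\<lambda>v. \<alpha> v - of_int k) \<in> BR \<longleftrightarrow> bad \<alpha>"
proof -
  have "(\<lambda>v. (\<alpha> v - of_int k) - (\<alpha> 0 - of_int k)) = \<alpha>" by (simp add: root_lin[OF assms])
  then show ?thesis unfolding BR_def using AR_I[OF assms] by simp
qed

lemma bad_z: "\<alpha> \<in> \<Phi> \<Longrightarrow> bad (\<alpha> \<circ> z) \<longleftrightarrow> bad \<alpha>"
  unfolding bad_def using linD(3)[OF lin_z] by (auto simp: z_nu)

lemma BR_y:
  assumes "a \<in> AR"
  shows "a \<circ> y \<in> BR \<longleftrightarrow> a \<in> BR"
proof -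
  obtain \<alpha> k where a: "\<alpha> \<in> \<Phi>" "a = (\<lambda>x. \<alpha> x - of_int k)" using assms by (rule AR_E)
  obtain m where m: "\<alpha> t = of_int m" using t_int[OF a(1)] by (rule Ints_cases)
  have "a \<circ> y = (\<lambda>x. (\<alpha> \<circ> z) x - of_int (k - m))"
    by (simp add: a(2) y_app fun_eq_iff root_lin(1)[OF a(1)] m)
  then have "a \<circ> y \<in> BR \<longleftrightarrow> bad (\<alpha> \<circ> z)" using BR_iff[OF linD(3)[OF lin_z a(1)]] by (simp only:)
  then show ?thesis unfolding bad_z[OF a(1)] a(2) BR_iff[OF a(1)] .
qed

lemma BR_neg: "a \<in> BR \<Longrightarrow> (\<lambda>v. - a v) \<in> BR"
proof -
  assume b: "a \<in> BR"
  then have "a \<in> AR" by (simp add: BR_def)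
  then obtain \<alpha> k where a: "\<alpha> \<in> \<Phi>" "a = (\<lambda>x. \<alpha> x - of_int k)" by (rule AR_E)
  have "bad \<alpha>" using b unfolding a(2) BR_iff[OF a(1)] .
  then have "bad (\<lambda>v. - \<alpha> v)" unfolding bad_def using root_neg(1)[OF a(1)] by auto
  moreover have "(\<lambda>v. - a v) = (\<lambda>v. (\<lambda>v. - \<alpha> v) v - of_int (- k))" by (simp add: a(2))
  ultimately show ?thesis using BR_iff[OF root_neg(1)[OF a(1)], of "- k"] by (simp only:)
qed

text \<open>The cyclic shift argument transports affine roots only by \<open>y\<close>, so its
  inequality holds within each \<open>y\<close>-stable set \<open>X\<close> separately.\<close>

lemma flow_part:
  assumes X: "\<And>a. a \<in> AR \<Longrightarrow> a \<circ> y \<in> X \<longleftrightarrow> a \<in> X" and x: "reg x" "reg (T x)"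
  shows "card (S (T x) (y (T x)) \<inter> X) \<le> card (S x (y x) \<inter> X)"
proof -
  let ?x = "T x"
  have "S ?x (y ?x) \<inter> X \<subseteq> (S ?x (y x) \<inter> X) \<union> (S (y x) (y ?x) \<inter> X)"
    using regD[OF reg_y[OF x(1)]] by (force simp: S_def)
  then have "card (S ?x (y ?x) \<inter> X) \<le> card ((S ?x (y x) \<inter> X) \<union> (S (y x) (y ?x) \<inter> X))"
    using finite_S by (intro card_mono) auto
  also have "\<dots> \<le> card (S ?x (y x) \<inter> X) + card (S (y x) (y ?x) \<inter> X)" by (rule card_Un_le)
  also have "card (S (y x) (y ?x) \<inter> X) = card (S x ?x \<inter> X)"
  proof -
    have "S (y x) (y ?x) \<inter> X = (\<lambda>a. a \<circ> inv y) ` (S x ?x \<inter> X)"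
    proof -
      have "a \<circ> inv y \<in> X \<longleftrightarrow> a \<in> X" if "a \<in> S x ?x" for a
      proof -
        have "a \<in> AR" using that by (simp add: S_def)
        moreover have "a \<circ> inv y \<circ> y = a" using aff_y by (simp add: fun_eq_iff)
        ultimately show ?thesis using X[OF aff_AR[OF aff_inv[OF aff_y]], of a] by simp
      qed
      then show ?thesis unfolding S_aff[OF aff_y] by blast
    qed
    then show ?thesis by (simp add: card_image[OF inj_comp_inv[OF aff_y]])
  qed
  also have "card (S ?x (y x) \<inter> X) + card (S x ?x \<inter> X) = card (S x (y x) \<inter> X)"
  proof -
    note sp = S_split(1,2)[OF x S_T]
    have "S x (y x) \<inter> X = (S ?x (y x) \<inter> X) \<union> (S x ?x \<inter> X)" using sp(1) by blast
    moreover have "(S ?x (y x) \<inter> X) \<inter> (S x ?x \<inter> X) = {}" using sp(2) by blast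
    ultimately show ?thesis using finite_S by (simp add: card_Un_disjoint)
  qed
  finally show ?thesis .
qed

lemma F_parts: "F x = card (S x (y x) \<inter> BR) + card (S x (y x) \<inter> - BR)"
proof -
  have "S x (y x) = (S x (y x) \<inter> BR) \<union> (S x (y x) \<inter> - BR)" by blast
  then have "F x = card ((S x (y x) \<inter> BR) \<union> (S x (y x) \<inter> - BR))" unfolding F_def by (rule arg_cong)
  also have "\<dots> = card (S x (y x) \<inter> BR) + card (S x (y x) \<inter> - BR)"
    using finite_S by (intro card_Un_disjoint) auto
  finally show ?thesis .
qed

text \<open>Neither part of \<open>F\<close>, over bad hyperplanes or over the others, increases
  along the flow; at the minimum their sum cannot decrease, so both stay constant.\<close>

lemma minimal_flow:
  assumes reg: "\<And>k. reg ((T ^^ k) x)" and F: "F x \<le> c" and min: "\<And>v. reg v \<Longrightarrow> c \<le> F v"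
  shows "F ((T ^^ m) x) = c \<and>
    card (S ((T ^^ m) x) (y ((T ^^ m) x)) \<inter> BR) = card (S x (y x) \<inter> BR)"
proof (induction m)
  case 0
  have "c \<le> F x" using min[OF reg[of 0]] by simp
  then show ?case using F by simp
next
  case (Suc m)
  let ?u = "(T ^^ m) x"
  have T: "reg ?u" "reg (T ?u)" using reg[of m] reg[of "Suc m"] by simp_all
  have 1: "card (S (T ?u) (y (T ?u)) \<inter> BR) \<le> card (S ?u (y ?u) \<inter> BR)"
    by (rule flow_part[OF BR_y T])
  have 2: "card (S (T ?u) (y (T ?u)) \<inter> - BR) \<le> card (S ?u (y ?u) \<inter> - BR)"
    by (rule flow_part[OF _ T]) (simp add: BR_y)
  have "c \<le> F (T ?u)" by (rule min[OF T(2)])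
  then have "F (T ?u) = c \<and> card (S (T ?u) (y (T ?u)) \<inter> BR) = card (S ?u (y ?u) \<inter> BR)"
    using 1 2 Suc F_parts[of ?u] F_parts[of "T ?u"] by linarith
  then show ?case using Suc by simp
qed

definition prl :: "'v \<Rightarrow> 'v" where "prl v = (1 / real n) *\<^sub>R (\<Sum>i<n. (z ^^ i) v)"

lemma linear_prl: "linear prl"
  by (intro linearI)
    (simp_all add: prl_def linear_add[OF linear_zpow] linear_scale[OF linear_zpow] sum.distrib
      scaleR_add_right scaleR_sum_right mult.commute)

lemma prl_fix: "z v = v \<Longrightarrow> prl v = v"
  using n_pos by (simp add: prl_def zpow_fix sum_constant_scaleR)

lemma pr_prl: "pr x = prl x + pr 0"
proof -
  have "(y ^^ i) x - real i *\<^sub>R nu = (z ^^ i) x + ((y ^^ i) 0 - real i *\<^sub>R nu)" for i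
    using ypow_diff[of i x 0] by (simp add: algebra_simps)
  then have "(\<Sum>i<n. (y ^^ i) x - real i *\<^sub>R nu)
      = (\<Sum>i<n. (z ^^ i) x) + (\<Sum>i<n. (y ^^ i) 0 - real i *\<^sub>R nu)"
    unfolding sum.distrib[symmetric] by (intro sum.cong refl)
  then show ?thesis unfolding pr_def prl_def by (simp only: scaleR_add_right)
qed

text \<open>A bad root is not constant on V_y, so for generic \<open>x\<close> its value at
  \<open>pr x\<close> is not an integer. Its drift is 0 and its oscillation tends to 0, so
  eventually no integer lies between its values at \<open>(T ^^ m) x\<close> and at the image of
  that point. By \<open>minimal_flow\<close> the number of bad separating hyperplanes was 0 from the
  start.\<close>

lemma no_bad_separation:
  assumes g: "g \<in> words" "F (g a0) \<le> c" and min: "\<And>h. h \<in> words \<Longrightarrow> c \<le> F (h a0)"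
  shows "S (g a0) (y (g a0)) \<inter> BR = {}"
proof -
  have min': "c \<le> F v" if "reg v" for v
  proof -
    obtain h where h: "h \<in> words" "S (h a0) v = {}" by (rule word_of[OF \<open>reg v\<close>])
    then show ?thesis using min[OF h(1)] F_cong[OF reg_word[OF h(1)] \<open>reg v\<close> h(2)] by simp
  qed
  define Q where "Q = {\<alpha>. bad \<alpha>}"
  have finQ: "finite Q" by (rule finite_subset[OF _ finite_roots]) (auto simp: Q_def bad_def)
  obtain x where x: "S (g a0) x = {}" "\<And>k. reg ((T ^^ k) x)" and nint: "\<And>\<alpha>. bad \<alpha> \<Longrightarrow> \<alpha> (pr x) \<notin> \<int>"
  proof -
    define G where "G = (\<lambda>(\<alpha> :: 'v \<Rightarrow> real, l :: int). (\<alpha> \<circ> prl, of_int l - \<alpha> (pr 0)))"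
    have "\<exists>x\<in>inv g -` alcove \<Phi> \<Delta>. (\<forall>k. reg ((T ^^ k) x)) \<and> (\<forall>p\<in>G ` (Q \<times> UNIV). fst p x \<noteq> snd p)"
    proof (rule generic_flow[OF open_word_alcove(1,2)[OF g(1)]])
      show "countable (G ` (Q \<times> UNIV))"
        using finQ by (intro countable_image countable_SIGMA) (auto intro: countable_finite)
      fix f and c :: real assume "(f, c) \<in> G ` (Q \<times> UNIV)"
      then obtain p where p: "(f, c) = G p" "p \<in> Q \<times> UNIV" by (rule imageE)
      obtain \<alpha> l where pp: "p = (\<alpha>, l)" by (cases p)
      have b: "bad \<alpha>" and f: "f = \<alpha> \<circ> prl" using p unfolding pp G_def Q_def by simp_all
      then obtain v where a: "\<alpha> \<in> \<Phi>" and v: "z v = v" "\<alpha> v \<noteq> 0" unfolding bad_def by blast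
      have "f v \<noteq> 0" using v(2) by (simp add: f prl_fix[OF v(1)])
      moreover have "linear f" unfolding f by (rule linear_compose[OF linear_prl linear_root[OF a]])
      ultimately show "linear f \<and> (\<exists>e. f e \<noteq> 0)" by blast
    qed
    then obtain x where x: "x \<in> inv g -` alcove \<Phi> \<Delta>" "\<And>k. reg ((T ^^ k) x)"
      and gen: "\<And>p. p \<in> G ` (Q \<times> UNIV) \<Longrightarrow> fst p x \<noteq> snd p" by blast
    show ?thesis
    proof (rule that[OF open_word_alcove(3)[OF g(1) x(1)] x(2)])
      fix \<alpha> assume b: "bad \<alpha>"
      then have a: "\<alpha> \<in> \<Phi>" by (simp add: bad_def)
      show "\<alpha> (pr x) \<notin> \<int>"
      proof
        assume "\<alpha> (pr x) \<in> \<int>"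
        then obtain l where l: "\<alpha> (pr x) = of_int l" by (rule Ints_cases)
        have "G (\<alpha>, l) \<in> G ` (Q \<times> UNIV)" using b by (simp add: Q_def)
        from gen[OF this] show False using l unfolding pr_prl[of x] by (simp add: G_def root_lin[OF a])
      qed
    qed
  qed
  have Fx: "F x \<le> c" using F_cong[OF reg_word[OF g(1)] x(2)[of 0]] x(1) g(2) by simp
  have ev: "\<forall>\<^sub>F m in sequentially. \<forall>\<alpha>\<in>Q. \<forall>k::int.
    \<not> (\<alpha> ((T ^^ m) x) < of_int k \<and> of_int k < \<alpha> (y ((T ^^ m) x)))"
  proof (rule eventually_ball_finite[OF finQ], rule ballI)
    fix \<alpha> assume "\<alpha> \<in> Q"
    then have b: "bad \<alpha>" by (simp add: Q_def)
    have a: "\<alpha> \<in> \<Phi>" "\<alpha> nu = 0" using b by (auto simp: bad_def)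
    obtain \<eta> where eta: "0 < \<eta>" "\<And>k::int. \<bar>real_of_int k - \<alpha> (pr x)\<bar> < \<eta> \<Longrightarrow> real_of_int k = \<alpha> (pr x)"
      using integer_gap[of "\<alpha> (pr x)"] by blast
    have far: "\<not> \<bar>real_of_int k - \<alpha> (pr x)\<bar> < \<eta>" for k :: int
      using eta(2)[of k] nint[OF b] by (metis Ints_of_int)
    show "\<forall>\<^sub>F m in sequentially. \<forall>k::int. \<not> (\<alpha> ((T ^^ m) x) < of_int k \<and> of_int k < \<alpha> (y ((T ^^ m) x)))"
      using eventually_conj[OF osc_small[OF a(1) eta(1), of x 0] osc_small[OF a(1) eta(1), of x 1]]
    proof (rule eventually_mono, intro allI notI)
      fix m and k :: int
      assume o: "\<bar>osc \<alpha> ((T ^^ m) x) 0\<bar> < \<eta> \<and> \<bar>osc \<alpha> ((T ^^ m) x) 1\<bar> < \<eta>"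
        and k: "\<alpha> ((T ^^ m) x) < of_int k \<and> of_int k < \<alpha> (y ((T ^^ m) x))"
      have p: "\<alpha> (pr ((T ^^ m) x)) = \<alpha> (pr x)" unfolding pr_Tpow by (simp add: root_lin[OF a(1)] a(2))
      have "\<alpha> (pr x) + osc \<alpha> ((T ^^ m) x) 0 < of_int k" "of_int k < \<alpha> (pr x) + osc \<alpha> ((T ^^ m) x) 1"
        using k unfolding root_pr[OF a(1), of "(T ^^ m) x"] root_y[OF a(1)] p a(2) by simp_all
      then have "\<bar>real_of_int k - \<alpha> (pr x)\<bar> < \<eta>" using o by linarith
      then show False using far by blast
    qed
  qed
  from eventually_happens'[OF sequentially_bot ev] obtain m where
    m: "\<And>\<alpha> k. \<alpha> \<in> Q \<Longrightarrow> \<not> (\<alpha> ((T ^^ m) x) < of_int k \<and> of_int k < \<alpha> (y ((T ^^ m) x)))" by blast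
  have "S ((T ^^ m) x) (y ((T ^^ m) x)) \<inter> BR = {}"
  proof (rule ccontr)
    assume "S ((T ^^ m) x) (y ((T ^^ m) x)) \<inter> BR \<noteq> {}"
    then obtain b where b: "b \<in> S ((T ^^ m) x) (y ((T ^^ m) x))" "b \<in> BR" by blast
    then have "b \<in> AR" by (simp add: BR_def)
    then obtain \<alpha> k where ak: "\<alpha> \<in> \<Phi>" "b = (\<lambda>x. \<alpha> x - of_int k)" by (rule AR_E)
    have "\<alpha> \<in> Q" using b(2) unfolding ak(2) BR_iff[OF ak(1)] Q_def by simp
    then show False using m[of \<alpha> k] b(1) unfolding ak(2) by (simp add: S_def)
  qed
  then have "card (S x (y x) \<inter> BR) = 0" using minimal_flow[OF x(2) Fx min', of m] by simp
  then have "S x (y x) \<inter> BR = {}" using finite_S[of x "y x"] by simp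
  then show ?thesis using S_y_cong[OF reg_word[OF g(1)] x(2)[of 0]] x(1) by simp
qed

text \<open>Summing a coroot over the powers of \<open>z\<close> gives a fixed vector, at which
  \<alpha> has the value of \<open>l\<close> at that coroot. If \<open>l\<close> killed all coroots
  it would be invariant under the Weyl group; its value at the sum of all \<open>w e\<close> would
  then be a nonzero multiple of \<open>l e\<close>, whereas \<open>W0_invariant_vector\<close> makes
  it 0.\<close>

lemma translation_exists:
  assumes b: "bad \<alpha>"
  obtains q where "z q = q" "(\<lambda>x. x + q) \<in> words" "\<alpha> q \<in> \<int>" "\<alpha> q \<noteq> 0"
proof -
  have a: "\<alpha> \<in> \<Phi>" using b by (simp add: bad_def)
  obtain e where e: "z e = e" "\<alpha> e \<noteq> 0" using b unfolding bad_def by blast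
  define l where "l v = (\<Sum>i<n. \<alpha> ((z ^^ i) v))" for v
  have lin_l: "linear l"
    by (intro linearI) (simp_all add: l_def linear_add[OF linear_zpow] linear_scale[OF linear_zpow]
        root_lin[OF a] sum.distrib sum_distrib_left)
  have "\<exists>\<beta>\<in>\<Phi>. l (cor \<beta>) \<noteq> 0"
  proof (rule ccontr)
    assume "\<not> (\<exists>\<beta>\<in>\<Phi>. l (cor \<beta>) \<noteq> 0)"
    then have l0: "l (cor \<beta>) = 0" if "\<beta> \<in> \<Phi>" for \<beta> using that by blast
    have lw: "l (prodw cor ss v) = l v" if "set ss \<subseteq> \<Phi>" for ss v
      using that
    proof (induction ss)
      case (Cons \<beta> ss)
      then show ?case using l0[of \<beta>] by (simp add: sref_def linear_diff[OF lin_l] linear_scale[OF lin_l])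
    qed simp
    have "l (w e) = l e" if "w \<in> W0 \<Phi> cor" for w
      using that lw unfolding W0_eq WJ_words by auto
    then have "l (\<Sum>w\<in>W0 \<Phi> cor. w e) = real (card (W0 \<Phi> cor)) * l e" by (simp add: linear_sum[OF lin_l])
    moreover have "l (\<Sum>w\<in>W0 \<Phi> cor. w e) = 0"
      unfolding l_def
    proof (intro sum.neutral ballI)
      fix i
      have "\<alpha> \<circ> (z ^^ i) \<in> \<Phi>" by (rule linD(3)[OF lin_power[OF lin_z] a])
      from W0_invariant_vector[OF this, of e] show "\<alpha> ((z ^^ i) (\<Sum>w\<in>W0 \<Phi> cor. w e)) = 0" by simp
    qed
    moreover have "l e = real n * \<alpha> e" by (simp add: l_def zpow_fix[OF e(1)])
    moreover have "card (W0 \<Phi> cor) \<noteq> 0" using finite_W0 WJ_id[of \<Phi>] unfolding W0_eq by auto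
    ultimately show False using e(2) n_pos by simp
  qed
  then obtain \<beta> where be: "\<beta> \<in> \<Phi>" "l (cor \<beta>) \<noteq> 0" by blast
  define q where "q = (\<Sum>i<n. (z ^^ i) (cor \<beta>))"
  have root: "\<beta> \<circ> inv (z ^^ i) \<in> \<Phi>" "(z ^^ i) (cor \<beta>) = cor (\<beta> \<circ> inv (z ^^ i))" for i
    using linD(4)[OF lin_power[OF lin_z] be(1)] lin_cor_inv[OF lin_power[OF lin_z] be(1)] by auto
  show ?thesis
  proof (rule that[of q])
    have "z q = (\<Sum>i<n. (z ^^ Suc i) (cor \<beta>))" unfolding q_def by (simp add: linear_sum[OF linear_z])
    also have "\<dots> = q" unfolding q_def by (rule cyclic_sum) (simp add: z_n)
    finally show "z q = q" .
    have "(\<lambda>x. x + (\<Sum>i<k. (z ^^ i) (cor \<beta>))) \<in> words" for k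
    proof (induction k)
      case 0
      then show ?case using words_id by (simp add: id_def)
    next
      case (Suc k)
      have "(\<lambda>x. x + of_int 1 *\<^sub>R cor (\<beta> \<circ> inv (z ^^ k))) \<circ> (\<lambda>x. x + (\<Sum>i<k. (z ^^ i) (cor \<beta>))) \<in> words"
        by (intro words_comp words_cor_translation root(1) Suc)
      then show ?case unfolding root(2)[symmetric] by (simp add: comp_def add.assoc)
    qed
    then show "(\<lambda>x. x + q) \<in> words" by (simp add: q_def)
    have aq: "\<alpha> q = l (cor \<beta>)" by (simp add: q_def l_def root_sum[OF a])
    then show "\<alpha> q \<noteq> 0" using be(2) by simp
    show "\<alpha> q \<in> \<int>" unfolding q_def root_sum[OF a] root(2) by (intro Ints_sum cartan_int root(1) a)
  qed
qed

text \<open>No bad wall separates a minimal alcove from its image, so a step between minimal alcoves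
  that crosses a bad wall \<open>b\<close> crosses \<open>b \<circ> y\<close> too. A step crosses
  one hyperplane, so \<open>b \<circ> y = b\<close>, which \<open>nofix\<close> excludes. Hence the
  root stays between the same integers along galleries, while translation by \<open>q\<close>
  commutes with \<open>y\<close>, preserves \<open>F\<close> and shifts the root by a nonzero
  integer.\<close>

theorem connected_cond2:
  assumes min: "\<And>h. h \<in> words \<Longrightarrow> c \<le> F (h a0)" and F0: "F a0 \<le> c"
    and conn: "\<And>g. g \<in> words \<Longrightarrow> F (g a0) \<le> c \<Longrightarrow> (id, g) \<in> (R c)\<^sup>*"
  shows "cond2'"
proof (rule ccontr)
  assume "\<not> cond2'"
  then obtain \<alpha> where a: "\<alpha> \<in> \<Phi>" "\<alpha> nu = 0" "\<alpha> \<circ> z \<noteq> \<alpha>" and b: "bad \<alpha>"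
    unfolding cond2'_def bad_def by blast
  have nofix: "b \<circ> y \<noteq> b" if bb: "b = (\<lambda>v. \<alpha> v - of_int k) \<or> b = (\<lambda>v. - (\<alpha> v - of_int k))" for b k
  proof
    assume e: "b \<circ> y = b"
    have "\<alpha> (y v) = \<alpha> v" for v using fun_cong[OF e, of v] bb by auto
    then have e: "\<alpha> (z v) + \<alpha> t = \<alpha> v" for v by (simp add: y_app root_lin[OF a(1)])
    from e[of 0] have "\<alpha> t = 0" by (simp add: linear_0[OF linear_z] root_lin[OF a(1)])
    then have "\<alpha> \<circ> z = \<alpha>" using e by (simp add: fun_eq_iff)
    then show False using a(3) by contradiction
  qed
  have nobad: "S (g a0) (y (g a0)) \<inter> BR = {}" if "g \<in> words" "F (g a0) \<le> c" for g
    by (rule no_bad_separation[of g c, OF that]) (rule min)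
  have cross: False
    if gh: "(g, h) \<in> R c" and bB: "b \<in> BR" and nf: "b \<circ> y \<noteq> b" and s: "b (g a0) < 0" "0 < b (h a0)" for g h b
  proof -
    obtain s where s': "h = g \<circ> s" "g \<in> words" "s \<in> Saff \<Phi> cor \<Delta>" "F (g a0) \<le> c" "F (g (s a0)) \<le> c"
      using gh unfolding R_def by blast
    have hW: "h \<in> words" unfolding s'(1) by (intro words_comp words_Saff s')
    have Fh: "F (h a0) \<le> c" using s'(1,5) by simp
    have bA: "b \<in> AR" using bB by (simp add: BR_def)
    obtain d where d: "d \<in> AR" "s = rf d" "S a0 (s a0) = {d}" using s'(3) by (rule Saff_E)
    have sing: "S (g a0) (h a0) = {d \<circ> inv g}"
      using step_crossing[OF words_aff[OF s'(2)], of s d, OF d(3)] by (simp add: s'(1))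
    have bS: "b \<in> S (g a0) (h a0)" using s bA by (simp add: S_def)
    have "b \<notin> S (g a0) (y (g a0))" using nobad[of g, OF s'(2,4)] bB by blast
    then have 1: "b (y (g a0)) < 0"
      using regD[OF reg_y[OF reg_word[OF s'(2)]] bA] s(1) bA by (simp add: S_def)
    have "(\<lambda>v. - b v) \<notin> S (h a0) (y (h a0))"
      using nobad[of h, OF hW Fh] BR_neg[OF bB] by blast
    then have 2: "0 < b (y (h a0))"
      using regD[OF reg_y[OF reg_word[OF hW]] bA] s(2) AR_neg[OF bA] by (simp add: S_def)
    have "b \<circ> y \<in> S (g a0) (h a0)" using 1 2 aff_AR[OF aff_y bA] by (simp add: S_def)
    then have "b \<circ> y = b" using bS unfolding sing by simp
    then show False using nf by contradiction
  qed
  have sign: "\<alpha> (g a0) - of_int k < 0 \<longleftrightarrow> \<alpha> a0 - of_int k < 0" if "(id, g) \<in> (R c)\<^sup>*" for g k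
    using that
  proof (induction rule: rtrancl_induct)
    case (step g h)
    let ?b = "\<lambda>v. \<alpha> v - real_of_int k"
    have bB: "?b \<in> BR" using BR_iff[OF a(1)] b by blast
    have bA: "?b \<in> AR" by (rule AR_I[OF a(1)])
    obtain s where s': "h = g \<circ> s" "g \<in> words" "s \<in> Saff \<Phi> cor \<Delta>"
      using step(2) unfolding R_def by blast
    have hW: "h \<in> words" unfolding s'(1) by (intro words_comp words_Saff s')
    have nz: "?b (g a0) \<noteq> 0" "?b (h a0) \<noteq> 0" using regD[OF reg_word[OF s'(2)] bA] regD[OF reg_word[OF hW] bA] by simp_all
    have "\<not> (?b (g a0) < 0 \<and> 0 < ?b (h a0))"
      using cross[OF step(2) bB] nofix[of ?b k] by blast
    moreover have "\<not> ((\<lambda>v. - ?b v) (g a0) < 0 \<and> 0 < (\<lambda>v. - ?b v) (h a0))"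
      using cross[OF step(2) BR_neg[OF bB]] nofix[of "\<lambda>v. - ?b v" k] by blast
    ultimately show ?case using nz step(3) by auto
  qed simp
  obtain q where q: "z q = q" "(\<lambda>x. x + q) \<in> words" "\<alpha> q \<in> \<int>" "\<alpha> q \<noteq> 0" by (rule translation_exists[OF b])
  have "F (a0 + q) = F a0"
  proof -
    have "y (a0 + q) = y a0 + q" by (simp add: y_app linear_add[OF linear_z] q(1))
    then show ?thesis unfolding F_def using card_S_aff[OF words_aff[OF q(2)], of a0 "y a0"] by simp
  qed
  then have "(id, \<lambda>x. x + q) \<in> (R c)\<^sup>*" using conn[OF q(2)] F0 by simp
  from sign[OF this] have sg: "\<alpha> a0 + \<alpha> q - of_int k < 0 \<longleftrightarrow> \<alpha> a0 - of_int k < 0" for k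
    by (simp add: root_lin[OF a(1)])
  have nint: "\<alpha> a0 \<noteq> of_int k" for k using regD[OF reg_a0 AR_I[OF a(1), of k]] by simp
  obtain m where m: "\<alpha> q = of_int m" using q(3) by (rule Ints_cases)
  have "m \<noteq> 0" using q(4) m by simp
  \<comment> \<open>The shift is at least 1 in absolute value, so it crosses the integer next to
    \<open>\<alpha> a0\<close> on that side.\<close>
  then consider "1 \<le> m" | "m \<le> -1" by linarith
  then show False
  proof cases
    case 1
    then have "1 \<le> \<alpha> q" using m by simp
    moreover have "\<alpha> a0 < of_int \<lceil>\<alpha> a0\<rceil>" using nint[of "\<lceil>\<alpha> a0\<rceil>"] by linarith
    ultimately show False using sg[of "\<lceil>\<alpha> a0\<rceil>"] by linarith
  next
    case 2
    then have "\<alpha> q \<le> -1" using m by linarith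
    then show False using sg[of "\<lfloor>\<alpha> a0\<rfloor>"] by linarith
  qed
qed

end

section \<open>Paths of simple reflections\<close>

context twisted
begin

lemma conj_seq_pw:
  assumes "set ss \<subseteq> Saff \<Phi> cor \<Delta>"
  shows "conj_seq w ss = inv (pw ss) \<circ> w \<circ> pw ss"
  unfolding inv_pw[OF assms]
proof (induction ss rule: rev_induct)
  case Nil
  then show ?case by (simp add: conj_seq_def)
next
  case (snoc s ss)
  have "conj_seq w (ss @ [s]) = s \<circ> conj_seq w ss \<circ> s" by (simp add: conj_seq_def)
  then show ?case unfolding snoc by (simp add: pw_append comp_assoc)
qed

lemma len_conj:
  assumes "g \<in> words"
  shows "len \<Phi> \<Delta> (inv g \<circ> y \<circ> g) = F (g a0)"
proof -
  note g = words_aff[OF assms]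
  have "len \<Phi> \<Delta> (inv g \<circ> y \<circ> g) = card (S a0 (inv g (y (g a0))))"
    using len_eq[OF aff_comp[OF aff_comp[OF aff_inv[OF g] aff_y] g]] by simp
  also have "\<dots> = card (S (g a0) (g (inv g (y (g a0)))))" by (rule card_S_aff[OF g, symmetric])
  finally show ?thesis using g by (simp add: F_def)
qed

lemma pw_words: "set ss \<subseteq> Saff \<Phi> cor \<Delta> \<Longrightarrow> pw ss \<in> words"
  unfolding words_def by blast

lemma len_conj_seq:
  assumes "set ss \<subseteq> Saff \<Phi> cor \<Delta>"
  shows "len \<Phi> \<Delta> (conj_seq y ss) = F (pw ss a0)"
  unfolding conj_seq_pw[OF assms] by (rule len_conj[OF pw_words[OF assms]])

lemma R_I:
  assumes "g \<in> words" "s \<in> Saff \<Phi> cor \<Delta>" "F (g a0) \<le> c" "F (g (s a0)) \<le> c"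
  shows "(g, g \<circ> s) \<in> R c"
  using assms unfolding R_def by blast

lemma path_connected:
  assumes p: "is_path \<Phi> cor \<Delta> y ss" and c: "F a0 \<le> c"
  shows "(id, pw ss) \<in> (R c)\<^sup>*"
proof -
  have ss: "set ss \<subseteq> Saff \<Phi> cor \<Delta>" using p by (simp add: is_path_def)
  have sub: "set (take i ss) \<subseteq> Saff \<Phi> cor \<Delta>" for i
    by (rule subset_trans[OF set_take_subset ss])
  have "(id, pw (take i ss)) \<in> (R c)\<^sup>* \<and> F (pw (take i ss) a0) \<le> c" if "i \<le> length ss" for i
    using that
  proof (induction i)
    case 0
    show ?case using c by simp
  next
    case (Suc i)
    then have i: "i < length ss" by simp
    note IH = conjunct1[OF Suc.IH[OF less_imp_le[OF i]]] conjunct2[OF Suc.IH[OF less_imp_le[OF i]]]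
    have "len \<Phi> \<Delta> (conj_seq y (take (Suc i) ss)) \<le> len \<Phi> \<Delta> (conj_seq y (take i ss))"
      using p i by (simp add: is_path_def)
    then have Fi: "F (pw (take (Suc i) ss) a0) \<le> c" using IH(2) by (simp add: len_conj_seq[OF sub])
    have t: "pw (take (Suc i) ss) = pw (take i ss) \<circ> ss ! i"
      by (simp add: take_Suc_conv_app_nth[OF i] pw_snoc)
    have "ss ! i \<in> Saff \<Phi> cor \<Delta>" by (rule subsetD[OF ss nth_mem[OF i]])
    moreover have "F (pw (take i ss) ((ss ! i) a0)) \<le> c" using Fi unfolding t by simp
    ultimately have "(pw (take i ss), pw (take (Suc i) ss)) \<in> R c"
      unfolding t by (intro R_I pw_words[OF sub] IH(2))
    from conjI[OF rtrancl_into_rtrancl[OF IH(1) this] Fi] show ?case .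
  qed
  from conjunct1[OF this[OF order_refl]] show ?thesis unfolding take_all[OF order_refl] .
qed

text \<open>As \<open>c\<close> is the minimum of \<open>F\<close>, staying at most \<open>c\<close>
  means staying at \<open>c\<close>, and the lengths do not increase.\<close>

lemma connected_path:
  assumes "(id, g) \<in> (R c)\<^sup>*" and min: "\<And>h. h \<in> words \<Longrightarrow> c \<le> F (h a0)" and c: "F a0 \<le> c"
  shows "\<exists>ss. is_path \<Phi> cor \<Delta> y ss \<and> g = pw ss"
  using assms(1)
proof (induction rule: rtrancl_induct)
  case base
  show ?case by (intro exI[of _ "[]"]) (simp add: is_path_def)
next
  case (step g h)
  obtain ss where ss: "is_path \<Phi> cor \<Delta> y ss" "g = pw ss" using step(3) by blast
  obtain s where s: "h = g \<circ> s" "s \<in> Saff \<Phi> cor \<Delta>" "F (g a0) \<le> c" "F (g (s a0)) \<le> c"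
    using step(2) unfolding R_def by blast
  have sub: "set ss \<subseteq> Saff \<Phi> cor \<Delta>" using ss(1) by (simp add: is_path_def)
  have sub': "set (ss @ [s]) \<subseteq> Saff \<Phi> cor \<Delta>" using sub s(2) by simp
  have h: "h = pw (ss @ [s])" by (simp add: s(1) ss(2) pw_snoc)
  have "F (pw (ss @ [s]) a0) \<le> F (pw ss a0)"
  proof -
    have "c \<le> F (pw ss a0)" by (rule min[OF pw_words[OF sub]])
    moreover have "F (pw (ss @ [s]) a0) \<le> c" using s(4) ss(2) by (simp add: pw_snoc)
    ultimately show ?thesis by simp
  qed
  then have last: "len \<Phi> \<Delta> (conj_seq y (ss @ [s])) \<le> len \<Phi> \<Delta> (conj_seq y ss)"
    by (simp only: len_conj_seq[OF sub] len_conj_seq[OF sub'])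
  have "is_path \<Phi> cor \<Delta> y (ss @ [s])"
    unfolding is_path_def
  proof (intro conjI allI impI sub')
    fix i assume "i < length (ss @ [s])"
    then consider "i < length ss" | "i = length ss" by fastforce
    then show "len \<Phi> \<Delta> (conj_seq y (take (Suc i) (ss @ [s]))) \<le> len \<Phi> \<Delta> (conj_seq y (take i (ss @ [s])))"
    proof cases
      case 1
      then show ?thesis using ss(1) by (simp add: is_path_def)
    next
      case 2
      then show ?thesis using last by simp
    qed
  qed
  then show ?case using h by blast
qed

lemma path_condition_iff:
  assumes Cl: "Cl = {x \<circ> y \<circ> inv x | x. x \<in> words}" and m: "min_length_in \<Phi> \<Delta> Cl y"
  shows "(\<forall>x\<in>Wstab \<Phi> cor \<Delta> y. \<exists>ss. is_path \<Phi> cor \<Delta> y ss \<and> x = foldr (\<circ>) ss id) \<longleftrightarrow> cond2'"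
proof -
  have len_y: "len \<Phi> \<Delta> y = F a0" using len_conj[OF words_id] by (simp add: inv_id)
  have inCl: "inv g \<circ> y \<circ> g \<in> Cl" if g: "g \<in> words" for g
  proof -
    have "inv (inv g) = g" using aff_bij[OF words_aff[OF g]] by (rule inv_inv_eq)
    then have "inv g \<circ> y \<circ> g = inv g \<circ> y \<circ> inv (inv g)" by simp
    then show ?thesis unfolding Cl using words_inv[OF g] by blast
  qed
  have m': "F a0 \<le> F (h a0)" if h: "h \<in> words" for h
  proof -
    have "len \<Phi> \<Delta> y \<le> len \<Phi> \<Delta> (inv h \<circ> y \<circ> h)" using m inCl[OF h] by (simp only: min_length_in_def)
    then show ?thesis unfolding len_y len_conj[OF h] .
  qed
  have stab: "x \<in> Wstab \<Phi> cor \<Delta> y \<longleftrightarrow> x \<in> words \<and> F (x a0) = F a0" for x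
    unfolding Wstab_def Waff_words using len_conj len_y by auto
  show ?thesis unfolding pw_def[symmetric]
  proof
    assume p: "\<forall>x\<in>Wstab \<Phi> cor \<Delta> y. \<exists>ss. is_path \<Phi> cor \<Delta> y ss \<and> x = pw ss"
    show cond2'
    proof (rule connected_cond2[of "F a0"])
      fix g assume g: "g \<in> words" "F (g a0) \<le> F a0"
      then have "g \<in> Wstab \<Phi> cor \<Delta> y" unfolding stab using m'[OF g(1)] by simp
      then obtain ss where ss: "is_path \<Phi> cor \<Delta> y ss" "g = pw ss" using p by blast
      show "(id, g) \<in> (R (F a0))\<^sup>*" unfolding ss(2) by (rule path_connected[OF ss(1) order_refl])
    qed (use m' in auto)
  next
    assume c2: cond2'
    show "\<forall>x\<in>Wstab \<Phi> cor \<Delta> y. \<exists>ss. is_path \<Phi> cor \<Delta> y ss \<and> x = pw ss"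
    proof
      fix x assume "x \<in> Wstab \<Phi> cor \<Delta> y"
      then have x: "x \<in> words" "F (x a0) \<le> F a0" unfolding stab by auto
      have "(id, x) \<in> (R (F a0))\<^sup>*" by (rule sublevel_connected[OF c2 words_id _ x]) simp
      then show "\<exists>ss. is_path \<Phi> cor \<Delta> y ss \<and> x = pw ss" using m' by (intro connected_path) auto
    qed
  qed
qed

section \<open>Equivalence of condition (2) with its linear form\<close>

lemma fin_y: "fin y = z"
  by (simp add: fin_def y_app fun_eq_iff linear_0[OF linear_z])

lemma Vy_shift: "p \<in> Vy y \<Longrightarrow> p + v \<in> Vy y \<longleftrightarrow> z v = v"
  unfolding Vy_def newton_y y_app mem_Collect_eq linear_add[OF linear_z]
  by (auto simp: algebra_simps) (metis add_left_cancel add.assoc add.commute)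

text \<open>V_y is a translate of V^z. If \<alpha> does not vanish on V^z, then V_y meets \<alpha> =
  0, and reflecting a point of V_y off this hyperplane shows that the coroot lies in V^z. If
  \<alpha> vanishes on V^z, it is constant on V_y, and a hyperplane meeting V_y contains it.\<close>

lemma cond2_iff: "cond2 \<Phi> cor y \<longleftrightarrow> cond2'"
proof
  assume c: "cond2 \<Phi> cor y"
  show "cond2'"
    unfolding cond2'_def
  proof (intro ballI impI)
    fix \<alpha> assume a: "\<alpha> \<in> \<Phi>" "\<alpha> nu = 0"
    show "\<alpha> \<circ> z = \<alpha> \<or> (\<forall>v. z v = v \<longrightarrow> \<alpha> v = 0)"
    proof (rule disjCI)
      assume "\<not> (\<forall>v. z v = v \<longrightarrow> \<alpha> v = 0)"
      then obtain v where v: "z v = v" "\<alpha> v \<noteq> 0" by blast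
      define p where "p = pr 0 + (- \<alpha> (pr 0) / \<alpha> v) *\<^sub>R v"
      have "pr 0 \<in> Vy y" by (simp add: Vy_def newton_y y_pr)
      moreover have "z ((- \<alpha> (pr 0) / \<alpha> v) *\<^sub>R v) = (- \<alpha> (pr 0) / \<alpha> v) *\<^sub>R v"
        by (simp only: linear_scale[OF linear_z] v(1))
      ultimately have pV: "p \<in> Vy y" unfolding p_def using Vy_shift by blast
      have ap: "\<alpha> p = 0" using v(2) by (simp add: p_def root_lin[OF a(1)])
      then have "p \<in> hyp \<alpha> 0 \<inter> Vy y" using pV by (simp add: hyp_def)
      then have im: "aref cor \<alpha> 0 ` Vy y = Vy y"
        using c a unfolding cond2_def newton_y by blast
      have "p + v \<in> Vy y" using Vy_shift[OF pV] v(1) by simp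
      then have "aref cor \<alpha> 0 (p + v) \<in> Vy y" using im by blast
      moreover have "aref cor \<alpha> 0 (p + v) = p + (v - \<alpha> v *\<^sub>R cor \<alpha>)"
        by (simp add: aref_def root_lin[OF a(1)] ap algebra_simps)
      ultimately have "z (v - \<alpha> v *\<^sub>R cor \<alpha>) = v - \<alpha> v *\<^sub>R cor \<alpha>" using Vy_shift[OF pV] by simp
      then have "\<alpha> v *\<^sub>R z (cor \<alpha>) = \<alpha> v *\<^sub>R cor \<alpha>"
        by (simp add: linear_diff[OF linear_z] linear_scale[OF linear_z] v(1))
      then have "z (cor \<alpha>) = cor \<alpha>" using v(2) by simp
      then show "\<alpha> \<circ> z = \<alpha>" using lin_fix_cor[OF lin_z a(1)] by simp
    qed
  qed
next
  assume c: "cond2'"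
  show "cond2 \<Phi> cor y"
    unfolding cond2_def newton_y
  proof (intro ballI allI impI)
    fix \<alpha> and k :: int assume a: "\<alpha> \<in> \<Phi>" "\<alpha> nu = 0" and ne: "hyp \<alpha> k \<inter> Vy y \<noteq> {}"
    have inv: "aref cor \<alpha> k (aref cor \<alpha> k v) = v" for v
      using rf_rf[OF AR_I[OF a(1)], of k v] rf_AR[OF a(1)] by simp
    have sub: "aref cor \<alpha> k v \<in> Vy y" if v: "v \<in> Vy y" for v
    proof -
      have "\<alpha> \<circ> z = \<alpha> \<or> (\<forall>v. z v = v \<longrightarrow> \<alpha> v = 0)" using c a unfolding cond2'_def by blast
      then show ?thesis
      proof
        assume "\<alpha> \<circ> z = \<alpha>"
        then have "z (cor \<alpha>) = cor \<alpha>" using lin_fix_cor[OF lin_z a(1)] by simp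
        then have "z (- (\<alpha> v - of_int k) *\<^sub>R cor \<alpha>) = - (\<alpha> v - of_int k) *\<^sub>R cor \<alpha>"
          by (simp only: linear_scale[OF linear_z])
        then have "v + - (\<alpha> v - of_int k) *\<^sub>R cor \<alpha> \<in> Vy y" using Vy_shift[OF v] by blast
        then show ?thesis by (simp add: aref_def algebra_simps)
      next
        assume van: "\<forall>v. z v = v \<longrightarrow> \<alpha> v = 0"
        obtain p where p: "p \<in> hyp \<alpha> k" "p \<in> Vy y" using ne by blast
        have "p + (v - p) \<in> Vy y" using v by simp
        then have "z (v - p) = v - p" using Vy_shift[OF p(2)] by blast
        then have "\<alpha> (v - p) = 0" using van by blast
        then have "\<alpha> v = of_int k" using p(1) by (simp add: hyp_def root_lin[OF a(1)])
        then show ?thesis using v by (simp add: aref_def)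
      qed
    qed
    show "aref cor \<alpha> k ` Vy y = Vy y"
    proof
      show "aref cor \<alpha> k ` Vy y \<subseteq> Vy y" using sub by blast
      show "Vy y \<subseteq> aref cor \<alpha> k ` Vy y"
      proof
        fix v assume "v \<in> Vy y"
        then have "aref cor \<alpha> k v \<in> Vy y" by (rule sub)
        then show "v \<in> aref cor \<alpha> k ` Vy y" by (rule image_eqI[of _ _ "aref cor \<alpha> k v", rotated]) (simp add: inv)
      qed
    qed
  qed
qed

end

section \<open>Weakly elliptic elements\<close>

lemma finite_order:
  assumes "finite G" "bij f" "\<And>i. f ^^ i \<in> G"
  shows "\<exists>m>0. f ^^ m = id"
proof -
  have "\<not> inj (\<lambda>i. f ^^ i)"
  proof
    assume "inj (\<lambda>i. f ^^ i)"
    then have "infinite (range (\<lambda>i. f ^^ i))" by (rule range_inj_infinite)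
    moreover have "range (\<lambda>i. f ^^ i) \<subseteq> G" using assms(3) by blast
    ultimately show False using assms(1) finite_subset by blast
  qed
  then obtain i j where "i \<noteq> j" "f ^^ i = f ^^ j" unfolding inj_def by blast
  then obtain i j where ij: "i < j" "f ^^ i = f ^^ j" by (metis linorder_neqE_nat)
  have "f ^^ j = f ^^ i \<circ> f ^^ (j - i)" using ij(1) by (simp flip: funpow_add)
  then have "(f ^^ i) ((f ^^ (j - i)) x) = (f ^^ i) x" for x using ij(2) by (simp add: fun_eq_iff)
  moreover have "inj (f ^^ i)" using assms(2) bij_is_inj inj_fn by blast
  ultimately have "f ^^ (j - i) = id" by (auto simp: fun_eq_iff dest: injD)
  then show ?thesis using ij(1) by (intro exI[of _ "j - i"]) simp
qed

context rdatum
begin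

text \<open>Condition (2) in terms of the finite part and the Newton point alone, which conjugation
  changes only through its linear part.\<close>

definition c2 :: "('v \<Rightarrow> 'v) \<Rightarrow> 'v \<Rightarrow> bool" where
  "c2 z v \<longleftrightarrow> (\<forall>\<alpha>\<in>\<Phi>. \<alpha> v = 0 \<longrightarrow> \<alpha> \<circ> z = \<alpha> \<or> (\<forall>e. z e = e \<longrightarrow> \<alpha> e = 0))"

lemma c2_conj:
  assumes u: "lin u" and c: "c2 z v"
  shows "c2 (u \<circ> z \<circ> inv u) (u v)"
  unfolding c2_def
proof (intro ballI impI)
  fix \<alpha> assume a: "\<alpha> \<in> \<Phi>" "\<alpha> (u v) = 0"
  have b: "\<alpha> \<circ> u \<in> \<Phi>" by (rule linD(3)[OF u a(1)])
  have "(\<alpha> \<circ> u) v = 0" using a(2) by simp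
  then have "(\<alpha> \<circ> u) \<circ> z = \<alpha> \<circ> u \<or> (\<forall>e. z e = e \<longrightarrow> (\<alpha> \<circ> u) e = 0)"
    using c b unfolding c2_def by blast
  then show "\<alpha> \<circ> (u \<circ> z \<circ> inv u) = \<alpha> \<or> (\<forall>e. (u \<circ> z \<circ> inv u) e = e \<longrightarrow> \<alpha> e = 0)"
  proof
    assume "(\<alpha> \<circ> u) \<circ> z = \<alpha> \<circ> u"
    then have "(\<alpha> \<circ> u) \<circ> z \<circ> inv u = \<alpha> \<circ> u \<circ> inv u" by simp
    then have "\<alpha> \<circ> (u \<circ> z \<circ> inv u) = \<alpha>" using u by (simp add: comp_assoc)
    then show ?thesis ..
  next
    assume van: "\<forall>e. z e = e \<longrightarrow> (\<alpha> \<circ> u) e = 0"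
    have "\<alpha> e = 0" if e: "(u \<circ> z \<circ> inv u) e = e" for e
    proof -
      have "z (inv u e) = inv u (u (z (inv u e)))" using u by simp
      also have "\<dots> = inv u e" using e by simp
      finally have "(\<alpha> \<circ> u) (inv u e) = 0" using van by blast
      then show ?thesis using u by simp
    qed
    then show ?thesis by blast
  qed
qed

lemma prodw_conj:
  assumes "lin s" "set ss \<subseteq> \<Phi>"
  shows "s \<circ> prodw cor ss = prodw cor (map (\<lambda>\<beta>. \<beta> \<circ> inv s) ss) \<circ> s"
  using assms(2)
proof (induction ss)
  case (Cons \<beta> ss)
  have b: "\<beta> \<circ> inv s \<in> \<Phi>" using Cons.prems by (intro linD(4)[OF assms(1)]) simp
  have "\<beta> \<circ> inv s \<circ> s = \<beta>" using assms(1) by (simp add: comp_assoc)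
  then have e: "s \<circ> sref cor \<beta> = sref cor (\<beta> \<circ> inv s) \<circ> s" using lin_conj_sref[OF assms(1) b] by simp
  have "s \<circ> prodw cor (\<beta> # ss) = (s \<circ> sref cor \<beta>) \<circ> prodw cor ss" by (simp add: comp_assoc)
  also have "\<dots> = sref cor (\<beta> \<circ> inv s) \<circ> (s \<circ> prodw cor ss)" unfolding e by (simp only: comp_assoc)
  also have "s \<circ> prodw cor ss = prodw cor (map (\<lambda>\<beta>. \<beta> \<circ> inv s) ss) \<circ> s"
    by (rule Cons.IH) (use Cons.prems in simp)
  finally show ?case by (simp only: list.map prodw_Cons comp_assoc)
qed simp

lemma WJ_conj:
  assumes "lin s" "J \<subseteq> \<Phi>" "\<And>j. j \<in> J \<Longrightarrow> j \<circ> inv s \<in> J" "w \<in> WJ cor J"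
  shows "\<exists>w'\<in>WJ cor J. s \<circ> w = w' \<circ> s"
proof -
  obtain ss where ss: "w = prodw cor ss" "set ss \<subseteq> J" using assms(4) unfolding WJ_words by blast
  have "prodw cor (map (\<lambda>\<beta>. \<beta> \<circ> inv s) ss) \<in> WJ cor J"
    unfolding WJ_words using ss(2) assms(3)
    by (intro CollectI exI[of _ "map (\<lambda>\<beta>. \<beta> \<circ> inv s) ss"]) auto
  then show ?thesis using prodw_conj[OF assms(1), of ss] ss assms(2) by (metis subset_trans)
qed

text \<open>The map \<open>s\<close> normalizes the finite Weyl group, so the \<open>N\<close>-th
  power of \<open>w \<circ> s\<close> lies in it.\<close>

lemma twisted_finite_order:
  assumes s: "lin s" "s ^^ N = id" "0 < N" and w: "w \<in> W0 \<Phi> cor"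
  shows "\<exists>m>0. (w \<circ> s) ^^ m = id"
proof -
  have pow: "\<exists>v\<in>W0 \<Phi> cor. (w \<circ> s) ^^ i = v \<circ> s ^^ i" for i
  proof (induction i)
    case 0
    show ?case using WJ_id unfolding W0_eq by (intro bexI[of _ id]) simp_all
  next
    case (Suc i)
    then obtain v where v: "v \<in> WJ cor \<Phi>" "(w \<circ> s) ^^ i = v \<circ> s ^^ i" unfolding W0_eq by blast
    obtain v' where v': "v' \<in> WJ cor \<Phi>" "s \<circ> v = v' \<circ> s"
      using WJ_conj[OF s(1) subset_refl linD(4)[OF s(1)] v(1)] by blast
    have "(w \<circ> s) ^^ Suc i = w \<circ> (s \<circ> v) \<circ> s ^^ i" by (simp add: v(2) comp_assoc)
    also have "\<dots> = (w \<circ> v') \<circ> s ^^ Suc i" unfolding v'(2) by (simp add: comp_assoc)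
    finally show ?case using WJ_comp[OF _ v'(1), of w] w unfolding W0_eq by blast
  qed
  from pow[of N] obtain v where v: "v \<in> WJ cor \<Phi>" "(w \<circ> s) ^^ N = v" unfolding W0_eq s(2) by auto
  have "v ^^ i \<in> W0 \<Phi> cor" for i
    unfolding W0_eq by (induction i) (auto intro: WJ_id WJ_comp v(1) simp del: o_apply id_apply)
  moreover have "bij v" using v(1) by (intro linD(2) lin_WJ[OF subset_refl])
  ultimately obtain m where m: "0 < m" "v ^^ m = id" using finite_order[OF finite_W0] by blast
  have "(w \<circ> s) ^^ (N * m) = id" using m(2) v(2) by (simp flip: funpow_mult)
  then show ?thesis using m(1) s(3) by (intro exI[of _ "N * m"]) simp
qed

end

locale sigma = rdatum \<Phi> cor P \<Delta>
  for \<Phi> :: "(('v::euclidean_space) \<Rightarrow> real) set" and cor :: "('v \<Rightarrow> real) \<Rightarrow> 'v" and P \<Delta> +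
  fixes \<sigma> :: "'v \<Rightarrow> 'v" and N :: nat and \<nu> :: 'v and J :: "('v \<Rightarrow> real) set"
  assumes aut: "diagram_aut \<Phi> cor P \<Delta> \<sigma>" and N: "0 < N" "\<sigma> ^^ N = id"
    and dom: "\<And>j. j \<in> \<Delta> \<Longrightarrow> 0 \<le> j \<nu>" and \<sigma>\<nu>: "\<sigma> \<nu> = \<nu>" and J: "J = {j \<in> \<Delta>. j \<nu> = 0}"
begin

lemma lin_\<sigma>: "lin \<sigma>"
  by (rule diagram_autD(1)[OF aut])

lemma J_simple: "J \<subseteq> \<Delta>"
  using J by blast

lemma J_roots: "J \<subseteq> \<Phi>"
  using J_simple simple_root by blast

lemma J_\<sigma>: "j \<in> J \<Longrightarrow> j \<circ> \<sigma> \<in> J" "j \<in> J \<Longrightarrow> j \<circ> inv \<sigma> \<in> J"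
proof -
  have "inv \<sigma> \<nu> = inv \<sigma> (\<sigma> \<nu>)" by (simp only: \<sigma>\<nu>)
  then have i: "inv \<sigma> \<nu> = \<nu>" using lin_\<sigma> by simp
  show "j \<in> J \<Longrightarrow> j \<circ> \<sigma> \<in> J" using diagram_autD(2)[OF aut, of j] by (simp add: J \<sigma>\<nu>)
  show "j \<in> J \<Longrightarrow> j \<circ> inv \<sigma> \<in> J" using diagram_autD(3)[OF aut, of j] by (simp add: J i)
qed

lemma WJ_fix_\<nu>: "w \<in> WJ cor J \<Longrightarrow> w \<nu> = \<nu>"
  unfolding WJ_words using prodw_fix[of _ \<nu>] J by blast

definition K :: "('v \<Rightarrow> 'v) \<Rightarrow> ('v \<Rightarrow> real) set" where
  "K w = (\<Union>i. ract (\<sigma> ^^ i) ` supp cor J w)"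

lemma \<sigma>pow_simple: "j \<in> \<Delta> \<Longrightarrow> j \<circ> (\<sigma> ^^ i) \<in> \<Delta>"
proof (induction i)
  case (Suc i)
  have "(j \<circ> \<sigma> ^^ i) \<circ> \<sigma> \<in> \<Delta>" by (intro diagram_autD(2)[OF aut] Suc.IH Suc.prems)
  then show ?case by (simp only: comp_assoc funpow_Suc_right)
qed simp

text \<open>\<open>tsupp\<close> runs over all decompositions, and the exponent of \<sigma> is not
  unique. The factor \<open>w\<close> is: the quotient of two candidates is a power of \<sigma>
  times \<open>inv \<sigma>\<close>, so it permutes the simple roots, and an element of W_J doing so
  is the identity.\<close>

lemma tsupp_eq:
  assumes w: "w \<in> WJ cor J"
  shows "tsupp cor J \<sigma> (w \<circ> \<sigma>) = K w"
proof -
  have uniq: "w' = w" if w': "w' \<in> WJ cor J" "w \<circ> \<sigma> = w' \<circ> \<sigma> ^^ m" for w' m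
  proof -
    have lw': "lin w'" by (rule lin_WJ[OF J_roots w'(1)])
    define u where "u = inv w' \<circ> w"
    have u: "u \<in> WJ cor J" unfolding u_def by (intro WJ_comp WJ_inv J_roots w w')
    have "u \<circ> \<sigma> = inv w' \<circ> (w' \<circ> \<sigma> ^^ m)" unfolding u_def w'(2)[symmetric] by (simp only: comp_assoc)
    also have "\<dots> = \<sigma> ^^ m" using lw' by (simp add: o_assoc)
    finally have "u \<circ> \<sigma> \<circ> inv \<sigma> = \<sigma> ^^ m \<circ> inv \<sigma>" by simp
    then have ue: "u = \<sigma> ^^ m \<circ> inv \<sigma>" using lin_\<sigma> by (simp add: comp_assoc)
    have "u = id"
    proof (rule WJ_pos_id[OF J_simple u])
      fix j assume "j \<in> J"
      then have "j \<circ> \<sigma> ^^ m \<circ> inv \<sigma> \<in> \<Delta>" using J_simple by (intro diagram_autD(3)[OF aut] \<sigma>pow_simple) blast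
      then show "pos (j \<circ> u)" unfolding ue by (intro pos_simple) (simp only: comp_assoc)
    qed
    then have "w' \<circ> (inv w' \<circ> w) = w'" by (simp add: u_def)
    then show ?thesis using lw' by (simp add: o_assoc)
  qed
  have "{(\<Union>i. ract (\<sigma> ^^ i) ` supp cor J w') |w' m. w' \<in> WJ cor J \<and> w \<circ> \<sigma> = w' \<circ> \<sigma> ^^ m} = {K w}"
  proof (intro equalityI subsetI)
    fix X assume "X \<in> {(\<Union>i. ract (\<sigma> ^^ i) ` supp cor J w') |w' m. w' \<in> WJ cor J \<and> w \<circ> \<sigma> = w' \<circ> \<sigma> ^^ m}"
    then obtain w' m where X: "X = (\<Union>i. ract (\<sigma> ^^ i) ` supp cor J w')" and "w' \<in> WJ cor J" "w \<circ> \<sigma> = w' \<circ> \<sigma> ^^ m"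
      by blast
    then have "w' = w" by (intro uniq)
    then show "X \<in> {K w}" using X by (simp add: K_def)
  next
    fix X assume "X \<in> {K w}"
    then have "X = (\<Union>i. ract (\<sigma> ^^ i) ` supp cor J w)" by (simp add: K_def)
    moreover have "w \<circ> \<sigma> = w \<circ> \<sigma> ^^ 1" by simp
    ultimately show "X \<in> {(\<Union>i. ract (\<sigma> ^^ i) ` supp cor J w') |w' m. w' \<in> WJ cor J \<and> w \<circ> \<sigma> = w' \<circ> \<sigma> ^^ m}"
      using w by blast
  qed
  then show ?thesis unfolding tsupp_def by simp
qed

lemma K_subset:
  assumes X: "supp cor J w \<subseteq> X" "\<And>j. j \<in> X \<Longrightarrow> j \<circ> inv \<sigma> \<in> X"
  shows "K w \<subseteq> X"
proof -
  have "ract (\<sigma> ^^ i) j \<in> X" if "j \<in> X" for i j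
  proof (induction i)
    case 0
    show ?case using that by (simp add: ract_def inv_id)
  next
    case (Suc i)
    have "inv (\<sigma> ^^ Suc i) = inv (\<sigma> ^^ i) \<circ> inv \<sigma>"
      unfolding funpow.simps by (rule o_inv_distrib[OF linD(2)[OF lin_\<sigma>] linD(2)[OF lin_power[OF lin_\<sigma>]]])
    then have "ract (\<sigma> ^^ Suc i) j = ract (\<sigma> ^^ i) j \<circ> inv \<sigma>" by (simp add: ract_def comp_assoc)
    then show ?case using X(2)[OF Suc] by (simp only:)
  qed
  then show ?thesis unfolding K_def using X(1) by blast
qed

lemma supp_K: "supp cor J w \<subseteq> K w"
proof
  fix j assume "j \<in> supp cor J w"
  moreover have "ract (\<sigma> ^^ 0) j = j" by (simp add: ract_def inv_id)
  ultimately show "j \<in> K w" unfolding K_def by (metis UNIV_I UN_iff imageI)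
qed

lemma supp_J: "supp cor J w \<subseteq> J"
  unfolding supp_def reduced_word_def by blast

lemma K_J: "K w \<subseteq> J"
  by (rule K_subset[OF supp_J J_\<sigma>(2)])

lemma K_inv_\<sigma>: "j \<in> K w \<Longrightarrow> j \<circ> inv \<sigma> \<in> K w"
proof -
  assume "j \<in> K w"
  then obtain i k where k: "k \<in> supp cor J w" "j = ract (\<sigma> ^^ i) k" unfolding K_def by blast
  have "inv (\<sigma> ^^ Suc i) = inv (\<sigma> ^^ i) \<circ> inv \<sigma>"
    unfolding funpow.simps by (rule o_inv_distrib[OF linD(2)[OF lin_\<sigma>] linD(2)[OF lin_power[OF lin_\<sigma>]]])
  then have "j \<circ> inv \<sigma> = ract (\<sigma> ^^ Suc i) k" unfolding k(2) by (simp add: ract_def comp_assoc)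
  then show ?thesis unfolding K_def using k(1) by blast
qed

text \<open>As \<open>inv \<sigma>\<close> has finite order, \<sigma> is one of its powers, and
  \<open>K_inv_\<sigma>\<close> can be iterated.\<close>

lemma K_\<sigma>: "j \<in> K w \<Longrightarrow> j \<circ> \<sigma> \<in> K w"
proof -
  assume j: "j \<in> K w"
  have "j \<circ> (inv \<sigma>) ^^ i \<in> K w" for i
  proof (induction i)
    case (Suc i)
    have "j \<circ> (inv \<sigma>) ^^ Suc i = j \<circ> (inv \<sigma>) ^^ i \<circ> inv \<sigma>"
      by (simp only: comp_assoc funpow_Suc_right)
    then show ?case using K_inv_\<sigma>[OF Suc] by (simp only:)
  qed (use j in simp)
  moreover have "(inv \<sigma>) ^^ (N - 1) = \<sigma>"
  proof -
    have c: "(inv \<sigma>) ^^ i \<circ> \<sigma> ^^ i = id" for i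
    proof (induction i)
      case (Suc i)
      have "(inv \<sigma>) ^^ Suc i \<circ> \<sigma> ^^ Suc i = (inv \<sigma>) ^^ i \<circ> (inv \<sigma> \<circ> \<sigma>) \<circ> \<sigma> ^^ i"
        unfolding funpow_Suc_right[of i "inv \<sigma>"] funpow.simps(2)[of i \<sigma>] by (simp only: comp_assoc)
      also have "\<dots> = id" unfolding lin_cancel(4)[OF lin_\<sigma>] comp_id by (rule Suc)
      finally show ?case .
    qed simp
    have "\<sigma> ^^ (N - 1) \<circ> \<sigma> = id" using N by (metis Suc_diff_1 funpow_Suc_right)
    then have "(inv \<sigma>) ^^ (N - 1) \<circ> (\<sigma> ^^ (N - 1) \<circ> \<sigma>) = (inv \<sigma>) ^^ (N - 1)" by simp
    then show ?thesis using c[of "N - 1"] by (simp add: o_assoc)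
  qed
  ultimately show ?thesis by metis
qed

lemma WJ_K:
  assumes "w \<in> WJ cor J"
  shows "w \<in> WJ cor (K w)"
proof -
  obtain ss where ss: "reduced_word cor J w ss" using reduced_word_exists[OF assms] by blast
  then have "set ss \<subseteq> supp cor J w" unfolding supp_def by blast
  then have "set ss \<subseteq> K w" using supp_K by blast
  moreover have "w = prodw cor ss" using ss by (simp add: reduced_word_def)
  ultimately show ?thesis unfolding WJ_words by blast
qed

text \<open>\<sigma> permutes \<open>J\<close>, so \<open>\<sigma> v\<close> is
  \<open>J\<close>-dominant like \<open>v\<close>, and \<open>dominant_conj\<close> applies to
  \<open>w\<close> carrying one to the other: they agree and all letters of \<open>w\<close> kill
  them. The simple roots killing a \<sigma>-fixed vector form a \<sigma>-stable set.\<close>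

lemma K_of_fixed:
  assumes w: "w \<in> WJ cor J" and v: "\<And>j. j \<in> J \<Longrightarrow> 0 \<le> j v" and fx: "w (\<sigma> v) = v"
  shows "\<sigma> v = v" "K w \<subseteq> {j \<in> J. j v = 0}"
proof -
  have sv: "0 \<le> j (\<sigma> v)" if "j \<in> J" for j using v[OF J_\<sigma>(1)[OF that]] by simp
  have red: "w (\<sigma> v) = \<sigma> v \<and> (\<forall>j\<in>set ss. j (\<sigma> v) = 0)" if "reduced_word cor J w ss" for ss
    by (rule dominant_conj[OF J_simple that]) (use sv v fx in auto)
  obtain ss where "reduced_word cor J w ss" using reduced_word_exists[OF w] by blast
  from red[OF this] show s: "\<sigma> v = v" using fx by simp
  have "inv \<sigma> v = inv \<sigma> (\<sigma> v)" by (simp only: s)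
  then have i: "inv \<sigma> v = v" using lin_\<sigma> by simp
  show "K w \<subseteq> {j \<in> J. j v = 0}"
  proof (rule K_subset)
    show "supp cor J w \<subseteq> {j \<in> J. j v = 0}"
      using red supp_J[of w] unfolding supp_def s by blast
    show "j \<circ> inv \<sigma> \<in> {j \<in> J. j v = 0}" if "j \<in> {j \<in> J. j v = 0}" for j
      using that J_\<sigma>(2)[of j] by (simp add: i)
  qed
qed

lemma conj_form:
  assumes "w \<in> WJ cor J" "x \<in> WJ cor J"
  obtains w' where "w' \<in> WJ cor J" "x \<circ> (w \<circ> \<sigma>) \<circ> inv x = w' \<circ> \<sigma>"
proof -
  obtain v where v: "v \<in> WJ cor J" "\<sigma> \<circ> inv x = v \<circ> \<sigma>"
    using WJ_conj[OF lin_\<sigma> J_roots J_\<sigma>(2) WJ_inv[OF J_roots assms(2)]] by blast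
  have "x \<circ> (w \<circ> \<sigma>) \<circ> inv x = x \<circ> w \<circ> (\<sigma> \<circ> inv x)" by (simp only: comp_assoc)
  also have "\<dots> = (x \<circ> w \<circ> v) \<circ> \<sigma>" unfolding v(2) by (simp only: comp_assoc)
  finally show ?thesis using that[of "x \<circ> w \<circ> v"] WJ_comp[OF WJ_comp[OF assms(2,1)] v(1)] by blast
qed

text \<open>A reflection in \<open>X\<close> fixes a vector killed by \<open>X\<close>; one in
  \<open>J - X\<close> does not change the values of the roots in \<open>X\<close>, by
  orthogonality.\<close>

lemma ker_stable:
  assumes X: "X \<subseteq> J" and orth: "\<And>i k. i \<in> J - X \<Longrightarrow> k \<in> X \<Longrightarrow> k (cor i) = 0"
    and u: "u \<in> WJ cor J" and v: "\<And>k. k \<in> X \<Longrightarrow> k v = 0"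
  shows "k \<in> X \<Longrightarrow> k (u v) = 0"
proof -
  have "\<forall>k\<in>X. k (prodw cor ss v) = 0" if "set ss \<subseteq> J" for ss
    using that
  proof (induction ss)
    case (Cons i ss)
    then have IH: "\<forall>k\<in>X. k (prodw cor ss v) = 0" and i: "i \<in> J" by simp_all
    show ?case
    proof
      fix k assume k: "k \<in> X"
      then have kP: "k \<in> \<Phi>" using X J_roots by blast
      have "k (prodw cor (i # ss) v) = k (prodw cor ss v) - i (prodw cor ss v) * k (cor i)"
        unfolding prodw_Cons comp_apply by (rule root_comp_sref[OF kP])
      moreover have "k (prodw cor ss v) = 0" using IH k by blast
      moreover have "i (prodw cor ss v) = 0 \<or> k (cor i) = 0" using IH orth[of i k] i k by blast
      ultimately show "k (prodw cor (i # ss) v) = 0" by auto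
    qed
  qed (use v in simp)
  then show "k \<in> X \<Longrightarrow> k (u v) = 0" using u unfolding WJ_words by blast
qed

text \<open>The root has coordinates of one sign and all simple roots are nonnegative at \<nu>, so
  vanishing there forces every term to vanish.\<close>

lemma root_support:
  assumes a: "\<alpha> \<in> \<Phi>" "\<alpha> \<nu> = 0" and i: "i \<in> \<Delta> - J"
  shows "\<alpha> (om i) = 0"
proof -
  have s: "(\<Sum>j\<in>\<Delta>. \<alpha> (om j) * j \<nu>) = 0" using root_om[OF a(1), of \<nu>] a(2) by simp
  have "\<alpha> (om i) * i \<nu> = 0"
  proof (cases "pos \<alpha>")
    case True
    have "\<forall>j\<in>\<Delta>. 0 \<le> \<alpha> (om j) * j \<nu>" using True dom by (simp add: pos_def)
    then show ?thesis
      using s i finite_simple sum_nonneg_eq_0_iff[of \<Delta> "\<lambda>j. \<alpha> (om j) * j \<nu>"] by blast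
  next
    case False
    then have n: "pos (\<lambda>x. - \<alpha> x)" using pos_or_neg[OF a(1)] by blast
    have "\<forall>j\<in>\<Delta>. 0 \<le> - \<alpha> (om j) * j \<nu>"
    proof
      fix j assume j: "j \<in> \<Delta>"
      then have "0 \<le> - \<alpha> (om j)" using n by (simp add: pos_def)
      then show "0 \<le> - \<alpha> (om j) * j \<nu>" using dom[OF j] by (rule mult_nonneg_nonneg)
    qed
    moreover have "(\<Sum>j\<in>\<Delta>. - \<alpha> (om j) * j \<nu>) = 0" using s by (simp add: sum_negf)
    ultimately have "- \<alpha> (om i) * i \<nu> = 0"
      using i finite_simple sum_nonneg_eq_0_iff[of \<Delta> "\<lambda>j. - \<alpha> (om j) * j \<nu>"] by blast
    then show ?thesis by simp
  qed
  moreover have "i \<nu> \<noteq> 0" using i J by blast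
  ultimately show ?thesis by simp
qed

text \<open>Given a fixed vector \<open>v\<close> not killed by \<alpha>, conjugate so that it
  becomes \<open>J\<close>-dominant; the support \<open>X\<close> of the conjugate \<open>z'\<close>
  then kills it. The conjugate root \<beta> is in the W_J-orbit of a simple root \<open>i\<close>,
  either in \<open>X\<close> or in the orthogonal set \<open>J - X\<close>. In the first case
  \<beta> would kill the fixed vector; in the second it is fixed by \<open>z'\<close>.\<close>

lemma weakly_elliptic_c2:
  assumes w: "w \<in> WJ cor J" and we: "weakly_elliptic cor J \<sigma> (w \<circ> \<sigma>)"
  shows "c2 (w \<circ> \<sigma>) \<nu>"
  unfolding c2_def
proof (intro ballI impI disjCI)
  let ?z = "w \<circ> \<sigma>"
  fix \<alpha> assume a: "\<alpha> \<in> \<Phi>" "\<alpha> \<nu> = 0" and "\<not> (\<forall>e. ?z e = e \<longrightarrow> \<alpha> e = 0)"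
  then obtain v where v: "?z v = v" "\<alpha> v \<noteq> 0" by blast
  obtain x where x: "x \<in> WJ cor J" and xd: "\<And>j. j \<in> J \<Longrightarrow> 0 \<le> j (x v)"
    using dominant_exists[OF J_simple, of v] by blast
  have lx: "lin x" by (rule lin_WJ[OF J_roots x])
  obtain w' where w': "w' \<in> WJ cor J" "x \<circ> ?z \<circ> inv x = w' \<circ> \<sigma>" by (rule conj_form[OF w x])
  define z' where "z' = w' \<circ> \<sigma>"
  have zz: "z' = x \<circ> ?z \<circ> inv x" using w'(2) by (simp add: z'_def)
  define X where "X = K w'"
  have wex: "union_of_components cor J X" "\<And>i. i \<in> J - X \<Longrightarrow> z' \<circ> sref cor i = sref cor i \<circ> z'"
  proof -
    have "union_of_components cor J (tsupp cor J \<sigma> (x \<circ> ?z \<circ> inv x)) \<and>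
      (\<forall>\<alpha>\<in>J - tsupp cor J \<sigma> (x \<circ> ?z \<circ> inv x). x \<circ> ?z \<circ> inv x \<circ> sref cor \<alpha> = sref cor \<alpha> \<circ> (x \<circ> ?z \<circ> inv x))"
      using we x unfolding weakly_elliptic_def Let_def by blast
    then show "union_of_components cor J X" "\<And>i. i \<in> J - X \<Longrightarrow> z' \<circ> sref cor i = sref cor i \<circ> z'"
      unfolding w'(2) tsupp_eq[OF w'(1)] X_def z'_def by blast+
  qed
  have z'v: "w' (\<sigma> (x v)) = x v" using v(1) lx fun_cong[OF w'(2), of "x v"] by simp
  have Kf: "K w' \<subseteq> {j \<in> J. j (x v) = 0}"
    by (rule K_of_fixed(2)[OF w'(1), of "x v"]) (fact xd, fact z'v)
  have orth: "k (cor i) = 0" "i (cor k) = 0" if "i \<in> J - X" "k \<in> X" for i k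
  proof -
    have kJ: "k \<in> J" using that K_J X_def by blast
    show "k (cor i) = 0"
    proof (rule ccontr)
      assume "k (cor i) \<noteq> 0"
      then have "(k, i) \<in> dyn_edge cor J" using that kJ unfolding dyn_edge_def by auto
      then have "i \<in> X" using wex(1) that(2) unfolding union_of_components_def by blast
      then show False using that(1) by blast
    qed
    then show "i (cor k) = 0" using cartan_zero_sym[of i k] that(1) kJ J_roots by blast
  qed
  define \<beta> where "\<beta> = \<alpha> \<circ> inv x"
  have b: "\<beta> \<in> \<Phi>" unfolding \<beta>_def by (rule linD(4)[OF lx a(1)])
  have bv: "\<beta> (x v) \<noteq> 0" using v(2) lx by (simp add: \<beta>_def)
  have "\<beta> (om i) = 0" if "i \<in> \<Delta> - J" for i
    using root_support[OF a that] WJ_om[OF J_simple WJ_inv[OF J_roots x], of i] that by (simp add: \<beta>_def)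
  from root_conj_simple[OF J_simple b this]
  obtain u where u: "u \<in> WJ cor J" "\<beta> \<circ> u \<in> J" by blast
  define i where "i = \<beta> \<circ> u"
  have lu: "lin u" by (rule lin_WJ[OF J_roots u(1)])
  have iu: "inv u \<in> WJ cor J" by (rule WJ_inv[OF J_roots u(1)])
  have bi: "\<beta> p = i (inv u p)" for p using lu by (simp add: i_def)
  have "i \<notin> X"
  proof
    assume iX: "i \<in> X"
    have "i (inv u (x v)) = 0"
    proof (rule ker_stable[OF _ _ iu _ iX])
      show "X \<subseteq> J" using K_J X_def by blast
      show "k (x v) = 0" if "k \<in> X" for k using Kf that unfolding X_def by blast
    qed (rule orth(1))
    then show False using bv bi by simp
  qed
  then have iJ: "i \<in> J - X" using u(2) by (simp add: i_def)
  \<comment> \<open>Commuting with the reflection makes \<open>k \<circ> z'\<close> a multiple of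
    \<open>k\<close>. On the other hand the letters of \<open>w'\<close> lie in \<open>X\<close> and
    do not change \<open>k\<close>, so \<open>k \<circ> z'\<close> is
    \<open>k \<circ> \<sigma>\<close>, a simple root. Evaluation at \<open>om j\<close> shows that
    these two simple roots coincide.\<close>
  have fixd: "k (z' p) = k p" if k: "k \<in> J - X" for k p
  proof -
    have kP: "k \<in> \<Phi>" and kD: "k \<in> \<Delta>" using k J_roots J_simple by blast+
    have kw: "k (prodw cor ss q) = k q" if "set ss \<subseteq> X" for ss q
      using that
    proof (induction ss)
      case (Cons m ss)
      then show ?case using orth(2)[OF k, of m] by (simp add: root_comp_sref[OF kP])
    qed simp
    have "w' \<in> WJ cor X" unfolding X_def by (rule WJ_K[OF w'(1)])
    then have kz: "k (z' q) = (k \<circ> \<sigma>) q" for q unfolding WJ_words z'_def using kw by auto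
    define j where "j = k \<circ> \<sigma>"
    have jD: "j \<in> \<Delta>" unfolding j_def by (rule diagram_autD(2)[OF aut kD])
    have lz': "linear z'"
      using linD(1)[OF lin_comp[OF lin_WJ[OF J_roots w'(1)] lin_\<sigma>]] by (simp add: z'_def)
    have "2 * k (z' q) = k q * k (z' (cor k))" for q
    proof -
      have "z' (sref cor k q) = sref cor k (z' q)" using fun_cong[OF wex(2)[OF k], of q] by simp
      then have "z' q - k q *\<^sub>R z' (cor k) = z' q - k (z' q) *\<^sub>R cor k"
        by (simp add: sref_def linear_diff[OF lz'] linear_scale[OF lz'])
      then have "k q *\<^sub>R z' (cor k) = k (z' q) *\<^sub>R cor k" by simp
      then have "k (k q *\<^sub>R z' (cor k)) = k (k (z' q) *\<^sub>R cor k)" by simp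
      then show ?thesis using kP by (simp add: root_lin[OF kP])
    qed
    from this[of "om j"] have "2 * j (om j) = k (om j) * k (z' (cor k))" by (simp add: kz j_def)
    then have "k (om j) \<noteq> 0" using simple_om[OF jD, of j] by auto
    then have "k = j" using simple_om[OF kD, of j] by (auto split: if_splits)
    then have "(k \<circ> \<sigma>) p = k p" unfolding j_def by (rule fun_cong[OF sym])
    then show ?thesis by (simp only: kz)
  qed
  \<comment> \<open>The vector \<open>z' p - p\<close> is killed by \<open>J - X\<close>; this
    persists under W_J by \<open>ker_stable\<close> with the roles of \<open>X\<close> and
    \<open>J - X\<close> exchanged.\<close>
  have "\<beta> (z' p - p) = 0" for p
  proof -
    have "i (inv u (z' p - p)) = 0"
    proof (rule ker_stable[OF _ _ iu _ iJ])
      show "k (cor m) = 0" if "m \<in> J - (J - X)" "k \<in> J - X" for m k using orth(2)[of k m] that by blast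
      show "k (z' p - p) = 0" if "k \<in> J - X" for k
      proof -
        have "k \<in> \<Phi>" using that J_roots by blast
        then show ?thesis using fixd[OF that, of p] by (simp add: root_lin)
      qed
    qed blast
    then show ?thesis using bi by simp
  qed
  then have bz: "\<beta> (z' p) = \<beta> p" for p by (simp add: root_lin[OF b])
  show "\<alpha> \<circ> ?z = \<alpha>"
  proof
    fix p
    have "z' (x p) = x (?z p)" using lx by (simp add: zz)
    then show "(\<alpha> \<circ> ?z) p = \<alpha> p" using bz[of "x p"] lx by (simp add: \<beta>_def)
  qed
qed

text \<open>Condition (2) makes \<open>J\<close> the union of \<open>J1\<close>, fixed by
  \<open>z\<close>, and \<open>J2\<close>, vanishing on its fixed space. The two are orthogonal
  because the coroots of \<open>J1\<close> are fixed vectors. The support turns out to be exactly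
  \<open>J2\<close>; each inclusion is tested on a fixed vector obtained by summing over a
  cycle.\<close>

lemma c2_components:
  assumes w: "w \<in> WJ cor J" and c: "c2 (w \<circ> \<sigma>) \<nu>" and m: "0 < m" "(w \<circ> \<sigma>) ^^ m = id"
  shows "union_of_components cor J (K w) \<and>
    (\<forall>i\<in>J - K w. (w \<circ> \<sigma>) \<circ> sref cor i = sref cor i \<circ> (w \<circ> \<sigma>))"
proof -
  define z where "z = w \<circ> \<sigma>"
  have lz: "lin z" unfolding z_def by (intro lin_comp lin_WJ[OF J_roots w] lin_\<sigma>)
  define J1 where "J1 = {j \<in> J. j \<circ> z = j}"
  define J2 where "J2 = {j \<in> J. \<forall>e. z e = e \<longrightarrow> j e = 0}"
  have J12: "j \<in> J1 \<or> j \<in> J2" if "j \<in> J" for j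
  proof -
    have "j \<in> \<Phi>" "j \<nu> = 0" using that J J_roots by blast+
    then have "j \<circ> z = j \<or> (\<forall>e. z e = e \<longrightarrow> j e = 0)" using c unfolding c2_def z_def by blast
    then show ?thesis using that by (simp add: J1_def J2_def)
  qed
  have cor1: "z (cor j) = cor j" if "j \<in> J1" for j
  proof -
    have "j \<in> \<Phi>" "j \<circ> z = j" using that J_roots by (auto simp: J1_def)
    then show ?thesis using lin_fix_cor[OF lz] by blast
  qed
  have orth: "k (cor j) = 0" if "j \<in> J1" "k \<in> J2" for j k
    using cor1[OF that(1)] that(2) by (simp add: J2_def)
  have K2: "K w \<subseteq> J2"
  proof -
    \<comment> \<open>Summing over the powers of \<open>z\<close> gives a fixed vector with value
      \<open>m\<close> on \<open>J1\<close> and, being fixed, 0 on \<open>J2\<close>. It is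
      \<open>J\<close>-dominant, so the support kills it and avoids \<open>J1\<close>.\<close>
    obtain v0 where v0: "\<forall>i\<in>\<Delta>. i v0 = (if i \<in> J1 then 1 else 0)"
      using simple_dual[of "\<lambda>i. if i \<in> J1 then 1 else 0"] by blast
    define v where "v = (\<Sum>i<m. (z ^^ i) v0)"
    have "z v = v"
    proof -
      have "z v + (z ^^ 0) v0 = (\<Sum>i<Suc m. (z ^^ i) v0)"
        unfolding v_def linear_sum[OF linD(1)[OF lz]] by (simp add: sum.lessThan_Suc_shift del: sum.lessThan_Suc)
      also have "\<dots> = v + (z ^^ m) v0" by (simp add: v_def)
      finally show ?thesis using m(2) by (simp add: z_def)
    qed
    have v1: "j v = real m" if j: "j \<in> J1" for j
    proof -
      have jP: "j \<in> \<Phi>" and jD: "j \<in> \<Delta>" using j J_roots J_simple by (auto simp: J1_def)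
      have "j \<circ> z = j" using j by (simp add: J1_def)
      have jz: "j (z p) = j p" for p using fun_cong[OF \<open>j \<circ> z = j\<close>, of p] by simp
      have "j ((z ^^ i) v0) = 1" for i
      proof (induction i)
        case 0
        show ?case using bspec[OF v0 jD] j by simp
      next
        case (Suc i)
        then show ?case by (simp add: jz)
      qed
      then show ?thesis by (simp add: v_def root_sum[OF jP])
    qed
    have v2: "j v = 0" if "j \<in> J2" for j using that \<open>z v = v\<close> by (simp add: J2_def)
    have "0 \<le> j v" if "j \<in> J" for j using J12[OF that] v1[of j] v2[of j] by auto
    moreover have "w (\<sigma> v) = v" using \<open>z v = v\<close> by (simp add: z_def)
    ultimately have "K w \<subseteq> {j \<in> J. j v = 0}" by (rule K_of_fixed(2)[OF w])
    then show ?thesis using J12 v1 m(1) by fastforce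
  qed
  moreover have "J2 \<subseteq> K w"
  proof
    fix j assume j: "j \<in> J2"
    show "j \<in> K w"
    proof (rule ccontr)
      assume nj: "j \<notin> K w"
      \<comment> \<open>As \<open>K w\<close> is \<sigma>-stable, the sum over the powers of
        \<sigma> still vanishes on \<open>K w\<close> and is positive on the other simple roots.
        Both \<sigma> and \<open>w\<close> fix it, so every root of \<open>J2\<close> has to vanish
        on it.\<close>
      obtain v0 where v0: "\<forall>i\<in>\<Delta>. i v0 = (if i \<in> K w then 0 else 1)"
        using simple_dual[of "\<lambda>i. if i \<in> K w then 0 else 1"] by blast
      define v where "v = (\<Sum>i<N. (\<sigma> ^^ i) v0)"
      have sv: "\<sigma> v = v"
      proof -
        have "\<sigma> v + (\<sigma> ^^ 0) v0 = (\<Sum>i<Suc N. (\<sigma> ^^ i) v0)"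
          unfolding v_def linear_sum[OF linD(1)[OF lin_\<sigma>]] by (simp add: sum.lessThan_Suc_shift del: sum.lessThan_Suc)
        also have "\<dots> = v + (\<sigma> ^^ N) v0" by (simp add: v_def)
        finally show ?thesis using N(2) by simp
      qed
      have mem: "k \<circ> \<sigma> ^^ i \<in> K w \<longleftrightarrow> k \<in> K w" for k i
      proof (induction i)
        case (Suc i)
        have "k \<circ> \<sigma> ^^ Suc i = (k \<circ> \<sigma> ^^ i) \<circ> \<sigma>"
          by (simp add: comp_assoc funpow_Suc_right del: funpow.simps)
        moreover have "l \<circ> \<sigma> \<in> K w \<longleftrightarrow> l \<in> K w" for l
        proof
          assume "l \<circ> \<sigma> \<in> K w"
          then have "l \<circ> \<sigma> \<circ> inv \<sigma> \<in> K w" by (rule K_inv_\<sigma>)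
          then show "l \<in> K w" using lin_\<sigma> by (simp add: comp_assoc)
        qed (rule K_\<sigma>)
        ultimately show ?case using Suc by (simp only:)
      qed simp
      have val: "k v = (if k \<in> K w then 0 else real N)" if k: "k \<in> \<Delta>" for k
      proof -
        have "k ((\<sigma> ^^ i) v0) = (if k \<in> K w then 0 else 1)" for i
          using v0 \<sigma>pow_simple[OF k, of i] mem[of k i] by (metis comp_apply)
        then show ?thesis by (simp add: v_def root_sum[OF simple_root[OF k]])
      qed
      have "w v = v"
      proof -
        obtain ss where "w = prodw cor ss" "set ss \<subseteq> K w" using WJ_K[OF w] unfolding WJ_words by blast
        moreover have "k v = 0" if "k \<in> K w" for k
          using val[of k] that K_J[of w] J_simple by auto
        ultimately show ?thesis using prodw_fix[of ss v] by blast
      qed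
      then have "z v = v" by (simp add: z_def sv)
      then have "j v = 0" using j by (simp add: J2_def)
      moreover have "j v = real N" using val[of j] nj j J_simple by (auto simp: J2_def)
      ultimately show False using N(1) by simp
    qed
  qed
  ultimately have KJ2: "K w = J2" by blast
  have "b \<in> J2" if "(a, b) \<in> (dyn_edge cor J)\<^sup>*" "a \<in> J2" for a b
    using that
  proof (induction rule: rtrancl_induct)
    case (step b d)
    then have "b \<in> J2" "d \<in> J" "b (cor d) \<noteq> 0" by (auto simp: dyn_edge_def)
    then show ?case using J12[of d] orth[of d b] by blast
  qed
  then have "union_of_components cor J (K w)"
    unfolding union_of_components_def KJ2 by (auto simp: J2_def)
  moreover have "z \<circ> sref cor i = sref cor i \<circ> z" if "i \<in> J - K w" for i
  proof -
    have "i \<in> J1" using that J12 unfolding KJ2 by blast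
    then have "i \<circ> z = i" "i \<in> \<Phi>" using J_roots by (auto simp: J1_def)
    then show ?thesis using lin_conj_sref[OF lz, of i] by simp
  qed
  ultimately show ?thesis unfolding z_def by blast
qed

text \<open>W_J fixes \<nu>, so the condition passes to every conjugate, which again has the form
  \<open>w' \<circ> \<sigma>\<close> with the same period.\<close>

lemma c2_weakly_elliptic:
  assumes w: "w \<in> WJ cor J" and c: "c2 (w \<circ> \<sigma>) \<nu>" and m: "0 < m" "(w \<circ> \<sigma>) ^^ m = id"
  shows "weakly_elliptic cor J \<sigma> (w \<circ> \<sigma>)"
  unfolding weakly_elliptic_def Let_def
proof (intro conjI ballI)
  let ?z = "w \<circ> \<sigma>"
  have "?z = w \<circ> \<sigma> ^^ 1" by simp
  then show "?z \<in> WJsig cor J \<sigma>" unfolding WJsig_def using w by blast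
  fix x assume x: "x \<in> WJ cor J"
  have lx: "lin x" by (rule lin_WJ[OF J_roots x])
  obtain w' where w': "w' \<in> WJ cor J" "x \<circ> ?z \<circ> inv x = w' \<circ> \<sigma>" by (rule conj_form[OF w x])
  have "c2 (x \<circ> ?z \<circ> inv x) (x \<nu>)" by (rule c2_conj[OF lx c])
  then have c': "c2 (w' \<circ> \<sigma>) \<nu>" unfolding w'(2) WJ_fix_\<nu>[OF x] .
  have "(x \<circ> ?z \<circ> inv x) ^^ i = x \<circ> ?z ^^ i \<circ> inv x" for i
  proof (induction i)
    case 0
    show ?case using lx by simp
  next
    case (Suc i)
    have "(x \<circ> ?z \<circ> inv x) ^^ Suc i = x \<circ> ?z \<circ> (inv x \<circ> x) \<circ> ?z ^^ i \<circ> inv x"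
      unfolding funpow.simps Suc by (simp only: comp_assoc)
    also have "\<dots> = x \<circ> ?z ^^ Suc i \<circ> inv x"
      unfolding lin_cancel(4)[OF lx] comp_id funpow.simps by (simp only: comp_assoc)
    finally show ?case .
  qed
  then have "(w' \<circ> \<sigma>) ^^ m = id" unfolding w'(2)[symmetric] using m(2) lx by simp
  from c2_components[OF w'(1) c' m(1) this]
  show "union_of_components cor J (tsupp cor J \<sigma> (x \<circ> ?z \<circ> inv x))"
    "\<And>\<alpha>. \<alpha> \<in> J - tsupp cor J \<sigma> (x \<circ> ?z \<circ> inv x) \<Longrightarrow>
      x \<circ> ?z \<circ> inv x \<circ> sref cor \<alpha> = sref cor \<alpha> \<circ> (x \<circ> ?z \<circ> inv x)"
    unfolding w'(2) tsupp_eq[OF w'(1)] by blast+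
qed

end

section \<open>Conjugacy classes\<close>

context twisted
begin

lemma cond2_c2: "cond2 \<Phi> cor y \<longleftrightarrow> c2 (fin y) (newton y)"
  unfolding cond2_iff fin_y newton_y cond2'_def c2_def ..

lemma path_condition_cond2:
  assumes "Cl = {x \<circ> y \<circ> inv x | x. x \<in> words}" "min_length_in \<Phi> \<Delta> Cl y"
  shows "(\<forall>x\<in>Wstab \<Phi> cor \<Delta> y. \<exists>ss. is_path \<Phi> cor \<Delta> y ss \<and> x = foldr (\<circ>) ss id) \<longleftrightarrow> cond2 \<Phi> cor y"
  unfolding cond2_iff by (rule path_condition_iff[OF assms])

lemma conj_fin_newton:
  assumes u: "lin u" and x: "x = (\<lambda>v. u v + q)"
  shows "fin (x \<circ> y \<circ> inv x) = u \<circ> fin y \<circ> inv u" "newton (x \<circ> y \<circ> inv x) = u (newton y)"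
proof -
  note lu = linD(1)[OF u] and li = linD(1)[OF lin_inv[OF u]]
  have ix: "inv x = (\<lambda>v. inv u (v - q))"
    by (rule inv_unique_comp) (use u in \<open>simp_all add: x fun_eq_iff\<close>)
  show "fin (x \<circ> y \<circ> inv x) = u \<circ> fin y \<circ> inv u"
  proof
    fix v
    have "fin (x \<circ> y \<circ> inv x) v = u (y (inv u (v - q))) - u (y (inv u (0 - q)))"
      unfolding fin_def ix comp_apply by (simp add: x)
    also have "\<dots> = u (z (inv u (v - q) - inv u (0 - q)))"
      by (simp add: y_app linear_diff[OF lu, symmetric] linear_diff[OF linear_z])
    also have "inv u (v - q) - inv u (0 - q) = inv u v" by (simp add: linear_diff[OF li, symmetric])
    also have "u (z (inv u v)) = (u \<circ> fin y \<circ> inv u) v" by (simp add: fin_y)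
    finally show "fin (x \<circ> y \<circ> inv x) v = (u \<circ> fin y \<circ> inv u) v" .
  qed
  have c: "inv x \<circ> x = id" "x \<circ> inv x = id" unfolding ix using u by (simp_all add: x fun_eq_iff)
  have pow: "(x \<circ> y \<circ> inv x) ^^ i = x \<circ> y ^^ i \<circ> inv x" for i
  proof (induction i)
    case 0
    show ?case unfolding funpow_0 comp_id funpow.simps using c(2) by simp
  next
    case (Suc i)
    have "(x \<circ> y \<circ> inv x) ^^ Suc i = x \<circ> y \<circ> (inv x \<circ> x) \<circ> y ^^ i \<circ> inv x"
      unfolding funpow.simps Suc by (simp only: comp_assoc)
    also have "\<dots> = x \<circ> y ^^ Suc i \<circ> inv x" unfolding c comp_id funpow.simps by (simp only: comp_assoc)
    finally show ?case .
  qed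
  have "(x \<circ> y \<circ> inv x) ^^ n = (\<lambda>v. v + real n *\<^sub>R u nu)"
  proof
    fix v
    have "x (inv x v + real n *\<^sub>R nu) = x (inv x v) + real n *\<^sub>R u nu"
      by (simp add: x linear_add[OF lu] linear_scale[OF lu])
    then show "((x \<circ> y \<circ> inv x) ^^ n) v = v + real n *\<^sub>R u nu"
      unfolding pow using fun_cong[OF c(2), of v] by (simp add: y_n)
  qed
  from newton_eq[OF n_pos this] show "newton (x \<circ> y \<circ> inv x) = u (newton y)"
    using n_pos by (simp add: newton_y)
qed

end

theorem theorem4p10:
  fixes \<Phi> :: "(('v::euclidean_space) \<Rightarrow> real) set"
    and cor :: "('v \<Rightarrow> real) \<Rightarrow> 'v"
    and P :: "'v set"
    and \<Delta> :: "('v \<Rightarrow> real) set"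
    and \<Omega> :: "('v \<Rightarrow> 'v) set"
    and \<sigma> :: "'v \<Rightarrow> 'v"
    and Cl :: "('v \<Rightarrow> 'v) set"
  assumes "root_datum \<Phi> cor P \<Delta>"
    and "omega_group \<Phi> cor P \<Delta> \<Omega>"
    and "\<exists>y0\<in>Wt \<Phi> cor P \<Omega>. Cl = {x \<circ> y0 \<circ> inv x | x. x \<in> Waff \<Phi> cor}"
    and "\<sigma> \<in> \<Omega>"
    and "Cl \<subseteq> {y \<circ> \<sigma> | y. y \<in> WG \<Phi> cor P}"
  shows "(nice \<Phi> cor \<Delta> Cl \<longleftrightarrow> (\<exists>y\<in>Cl. cond2 \<Phi> cor y))
       \<and> (nice \<Phi> cor \<Delta> Cl \<longleftrightarrow> (\<forall>y\<in>Cl. cond2 \<Phi> cor y))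
       \<and> (nice \<Phi> cor \<Delta> Cl \<longleftrightarrow> (\<exists>y\<in>Cl. newton y = nuO \<Phi> cor \<Delta> Cl \<and>
              weakly_elliptic cor (JO \<Phi> cor \<Delta> Cl) \<sigma> (fin y)))
       \<and> (nice \<Phi> cor \<Delta> Cl \<longleftrightarrow> (\<forall>y\<in>Cl. newton y = nuO \<Phi> cor \<Delta> Cl \<longrightarrow>
              weakly_elliptic cor (JO \<Phi> cor \<Delta> Cl) \<sigma> (fin y)))"
proof -
  interpret rdatum \<Phi> cor P \<Delta> by unfold_locales (rule assms(1))
  have aut: "diagram_aut \<Phi> cor P \<Delta> \<sigma>" and \<Omega>: "finite \<Omega>" "id \<in> \<Omega>" "\<And>\<tau>. \<tau> \<in> \<Omega> \<Longrightarrow> \<sigma> \<circ> \<tau> \<in> \<Omega>"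
    using assms(2,4) unfolding omega_group_def by blast+
  have l\<sigma>: "lin \<sigma>" by (rule diagram_autD(1)[OF aut])
  have "\<sigma> ^^ i \<in> \<Omega>" for i by (induction i) (auto intro: \<Omega>(2,3) simp del: o_apply id_apply)
  then obtain N where N: "0 < N" "\<sigma> ^^ N = id" using finite_order[OF \<Omega>(1) linD(2)[OF l\<sigma>]] by blast
  obtain y0 where y0: "Cl = {x \<circ> y0 \<circ> inv x | x. x \<in> words}" using assms(3) unfolding Waff_words by blast
  \<comment> \<open>\<open>nice\<close> provides its own element of minimal length, so any element
    of the class must be able to serve as base point.\<close>
  have cls: "Cl = {x \<circ> y \<circ> inv x | x. x \<in> words}" if "y \<in> Cl" for y
  proof -
    obtain g where g: "g \<in> words" "y = g \<circ> y0 \<circ> inv g" using \<open>y \<in> Cl\<close> unfolding y0 by blast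
    note bg = aff_bij[OF words_aff[OF g(1)]]
    have gg: "inv g \<circ> g = id" "g \<circ> inv g = id" using words_aff[OF g(1)] by simp_all
    show ?thesis
    proof (intro equalityI subsetI)
      fix v assume "v \<in> Cl"
      then obtain x where x: "x \<in> words" "v = x \<circ> y0 \<circ> inv x" unfolding y0 by blast
      have "inv (x \<circ> inv g) = g \<circ> inv x"
        using o_inv_distrib[OF aff_bij[OF words_aff[OF x(1)]] bij_imp_bij_inv[OF bg]] inv_inv_eq[OF bg] by simp
      then have "(x \<circ> inv g) \<circ> y \<circ> inv (x \<circ> inv g) = x \<circ> (inv g \<circ> g) \<circ> y0 \<circ> (inv g \<circ> g) \<circ> inv x"
        unfolding g(2) by (simp only: comp_assoc)
      also have "\<dots> = v" unfolding gg comp_id x(2) ..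
      finally show "v \<in> {x \<circ> y \<circ> inv x | x. x \<in> words}"
        using words_comp[OF x(1) words_inv[OF g(1)]] by blast
    next
      fix v assume "v \<in> {x \<circ> y \<circ> inv x | x. x \<in> words}"
      then obtain x where x: "x \<in> words" "v = x \<circ> y \<circ> inv x" by blast
      have "inv (x \<circ> g) = inv g \<circ> inv x" by (rule o_inv_distrib[OF aff_bij[OF words_aff[OF x(1)]] bg])
      then have "v = (x \<circ> g) \<circ> y0 \<circ> inv (x \<circ> g)" unfolding x(2) g(2) by (simp only: comp_assoc)
      then show "v \<in> Cl" unfolding y0 using words_comp[OF x(1) g(1)] by blast
    qed
  qed
  have elem: "\<exists>w t n. w \<in> W0 \<Phi> cor \<and> twisted \<Phi> cor P \<Delta> (w \<circ> \<sigma>) t n \<and> y = twisted.y (w \<circ> \<sigma>) t" if y: "y \<in> Cl" for y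
  proof -
    obtain g where g: "g \<in> WG \<Phi> cor P" "y = g \<circ> \<sigma>" using y assms(5) by blast
    obtain w t where w: "w \<in> W0 \<Phi> cor" "t \<in> P" "g = (\<lambda>x. w x + t)" using g(1) unfolding WG_def by blast
    obtain n where n: "0 < n" "(w \<circ> \<sigma>) ^^ n = id" using twisted_finite_order[OF l\<sigma> N(2,1) w(1)] by blast
    have "twisted \<Phi> cor P \<Delta> (w \<circ> \<sigma>) t n"
      by unfold_locales (use n root_P_int[OF _ w(2)] lin_comp[OF lin_W0[OF w(1)] l\<sigma>] in auto)
    then have "y = twisted.y (w \<circ> \<sigma>) t" unfolding g(2) w(3) by (simp add: twisted.y_def fun_eq_iff)
    then show ?thesis using w(1) \<open>twisted \<Phi> cor P \<Delta> (w \<circ> \<sigma>) t n\<close> by blast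
  qed
  have conj: "\<exists>u\<in>W0 \<Phi> cor. fin y' = u \<circ> fin y \<circ> inv u \<and> newton y' = u (newton y)" if y: "y \<in> Cl" "y' \<in> Cl" for y y'
  proof -
    obtain x where x: "x \<in> Waff \<Phi> cor" "y' = x \<circ> y \<circ> inv x" using y(2) unfolding cls[OF y(1)] Waff_words by blast
    obtain u q where u: "x = (\<lambda>v. u v + q)" "u \<in> W0 \<Phi> cor" using x(1) unfolding Waff_def by blast
    obtain w t n where w: "twisted \<Phi> cor P \<Delta> (w \<circ> \<sigma>) t n" "y = twisted.y (w \<circ> \<sigma>) t" using elem[OF y(1)] by blast
    show ?thesis
      using twisted.conj_fin_newton[OF w(1) lin_W0[OF u(2)] u(1)] u(2) unfolding x(2) w(2) by blast
  qed
  have c2y: "cond2 \<Phi> cor y \<longleftrightarrow> c2 (fin y) (newton y)" if "y \<in> Cl" for y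
    using elem[OF that] twisted.cond2_c2 by blast
  have imp: "cond2 \<Phi> cor y'" if y: "y \<in> Cl" "y' \<in> Cl" and c: "cond2 \<Phi> cor y" for y y'
  proof -
    obtain u where u: "u \<in> W0 \<Phi> cor" "fin y' = u \<circ> fin y \<circ> inv u" "newton y' = u (newton y)"
      using conj[OF y] by blast
    show ?thesis unfolding c2y[OF y(2)] u(2,3)
      by (rule c2_conj[OF lin_W0[OF u(1)]]) (use c c2y[OF y(1)] in blast)
  qed
  have nice: "nice \<Phi> cor \<Delta> Cl \<longleftrightarrow> cond2 \<Phi> cor y" if y: "y \<in> Cl" for y
  proof -
    have path: "(\<forall>x\<in>Wstab \<Phi> cor \<Delta> v. \<exists>ss. is_path \<Phi> cor \<Delta> v ss \<and> x = foldr (\<circ>) ss id) \<longleftrightarrow> cond2 \<Phi> cor v"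
      if v: "min_length_in \<Phi> \<Delta> Cl v" for v
    proof -
      have vC: "v \<in> Cl" using v by (simp add: min_length_in_def)
      obtain w t n where w: "twisted \<Phi> cor P \<Delta> (w \<circ> \<sigma>) t n" "v = twisted.y (w \<circ> \<sigma>) t" using elem[OF vC] by blast
      show ?thesis
        using twisted.path_condition_cond2[OF w(1), of Cl] cls[OF vC] v unfolding w(2) by blast
    qed
    show ?thesis
    proof
      assume "nice \<Phi> cor \<Delta> Cl"
      then obtain v where v: "min_length_in \<Phi> \<Delta> Cl v"
        "\<forall>x\<in>Wstab \<Phi> cor \<Delta> v. \<exists>ss. is_path \<Phi> cor \<Delta> v ss \<and> x = foldr (\<circ>) ss id" unfolding nice_def by blast
      have "v \<in> Cl" using v(1) by (simp add: min_length_in_def)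
      then show "cond2 \<Phi> cor y" using path[OF v(1)] v(2) imp[OF _ y] by blast
    next
      assume c: "cond2 \<Phi> cor y"
      obtain v where v: "min_length_in \<Phi> \<Delta> Cl v"
        using ex_has_least_nat[of "\<lambda>v. v \<in> Cl" y "len \<Phi> \<Delta>"] y unfolding min_length_in_def by blast
      then have "v \<in> Cl" by (simp add: min_length_in_def)
      then have "cond2 \<Phi> cor v" using imp[OF y _ c] by blast
      then show "nice \<Phi> cor \<Delta> Cl" unfolding nice_def using v path[OF v] by blast
    qed
  qed
  have inWaff: "u \<in> words" if "u \<in> W0 \<Phi> cor" for u
  proof -
    have "u = (\<lambda>x. u x + 0)" by simp
    then show ?thesis unfolding Waff_words[symmetric] Waff_def using that Qlat_zero by blast
  qed
  obtain y1 where y1: "y1 \<in> Cl" using y0 words_id by blast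
  obtain u1 where u1: "u1 \<in> W0 \<Phi> cor" "\<forall>j\<in>\<Delta>. 0 \<le> j (u1 (newton y1))"
    using dominant_exists[OF subset_refl, of "newton y1"] unfolding W0_simple by blast
  have nuO: "nuO \<Phi> cor \<Delta> Cl = u1 (newton y1)"
    unfolding nuO_def
  proof (rule the_equality)
    show "(\<forall>\<alpha>\<in>\<Delta>. 0 \<le> \<alpha> (u1 (newton y1))) \<and> (\<exists>y\<in>Cl. \<exists>w\<in>W0 \<Phi> cor. u1 (newton y1) = w (newton y))"
      using u1 y1 by blast
    fix v assume "(\<forall>\<alpha>\<in>\<Delta>. 0 \<le> \<alpha> v) \<and> (\<exists>y\<in>Cl. \<exists>w\<in>W0 \<Phi> cor. v = w (newton y))"
    then obtain y w where v: "\<forall>\<alpha>\<in>\<Delta>. 0 \<le> \<alpha> v" "y \<in> Cl" "w \<in> W0 \<Phi> cor" "v = w (newton y)" by blast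
    obtain u where u: "u \<in> W0 \<Phi> cor" "newton y = u (newton y1)" using conj[OF y1 v(2)] by blast
    \<comment> \<open>Two dominant vectors in one orbit of the Weyl group coincide by
      \<open>dominant_conj\<close>; this is the uniqueness behind \<open>nuO\<close>.\<close>
    define g where "g = w \<circ> u \<circ> inv u1"
    have g: "g \<in> WJ cor \<Delta>"
      using v(3) u(1) u1(1) WJ_comp WJ_inv[OF simple_subset] unfolding g_def W0_simple by blast
    have gv: "g (u1 (newton y1)) = v" using lin_W0[OF u1(1)] by (simp add: g_def v(4) u(2))
    obtain ss where "reduced_word cor \<Delta> g ss" using reduced_word_exists[OF g] by blast
    then have "g (u1 (newton y1)) = u1 (newton y1) \<and> (\<forall>j\<in>set ss. j (u1 (newton y1)) = 0)"
      by (rule dominant_conj[OF subset_refl]) (use u1(2) v(1) gv in auto)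
    then show "v = u1 (newton y1)" using gv by simp
  qed
  define \<nu> where "\<nu> = nuO \<Phi> cor \<Delta> Cl"
  have dom: "0 \<le> j \<nu>" if "j \<in> \<Delta>" for j using u1(2) that unfolding \<nu>_def nuO by blast
  define J where "J = JO \<Phi> cor \<Delta> Cl"
  have J: "J = {j \<in> \<Delta>. j \<nu> = 0}" by (simp add: J_def JO_def \<nu>_def)
  \<comment> \<open>Conjugating by \<open>u1\<close> makes the Newton point dominant without leaving
    the class, so the two quantified forms of (3) agree.\<close>
  have ex: "\<exists>y\<in>Cl. newton y = \<nu>"
  proof -
    have "u1 \<circ> y1 \<circ> inv u1 \<in> Cl" unfolding cls[OF y1] using inWaff[OF u1(1)] by blast
    moreover obtain w t n where w: "twisted \<Phi> cor P \<Delta> (w \<circ> \<sigma>) t n" "y1 = twisted.y (w \<circ> \<sigma>) t" using elem[OF y1] by blast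
    have "newton (u1 \<circ> y1 \<circ> inv u1) = u1 (newton y1)"
      unfolding w(2) by (rule twisted.conj_fin_newton(2)[OF w(1) lin_W0[OF u1(1)], of _ 0]) simp
    ultimately show ?thesis unfolding \<nu>_def nuO by blast
  qed
  have we: "weakly_elliptic cor J \<sigma> (fin y) \<longleftrightarrow> cond2 \<Phi> cor y" if y: "y \<in> Cl" "newton y = \<nu>" for y
  proof -
    obtain w t n where w: "w \<in> W0 \<Phi> cor" "twisted \<Phi> cor P \<Delta> (w \<circ> \<sigma>) t n" "y = twisted.y (w \<circ> \<sigma>) t"
      using elem[OF y(1)] by blast
    interpret tw: twisted \<Phi> cor P \<Delta> "w \<circ> \<sigma>" t n by (rule w(2))
    have \<nu>: "tw.nu = \<nu>" using y(2) unfolding w(3) tw.newton_y .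
    \<comment> \<open>The map \<open>w \<circ> \<sigma>\<close> fixes \<nu>, and
      \<open>\<sigma> \<nu>\<close> is dominant as well; \<open>dominant_conj\<close> then yields
      \<open>\<sigma> \<nu> = \<nu>\<close> and puts all letters of a reduced word of
      \<open>w\<close> into \<open>J\<close>.\<close>
    have fx: "w (\<sigma> \<nu>) = \<nu>" using tw.z_nu unfolding \<nu> by simp
    have sd: "0 \<le> j (\<sigma> \<nu>)" if "j \<in> \<Delta>" for j using dom[OF diagram_autD(2)[OF aut that]] by simp
    obtain ss where ss: "reduced_word cor \<Delta> w ss" using reduced_word_exists w(1) unfolding W0_simple by blast
    then have r: "w (\<sigma> \<nu>) = \<sigma> \<nu> \<and> (\<forall>j\<in>set ss. j (\<sigma> \<nu>) = 0)"
      by (rule dominant_conj[OF subset_refl]) (use sd dom fx in auto)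
    then have s\<nu>: "\<sigma> \<nu> = \<nu>" using fx by simp
    have "set ss \<subseteq> J" using ss r unfolding J s\<nu> reduced_word_def by blast
    moreover have "w = prodw cor ss" using ss by (simp add: reduced_word_def)
    ultimately have wJ: "w \<in> WJ cor J" unfolding WJ_words by blast
    interpret sg: sigma \<Phi> cor P \<Delta> \<sigma> N \<nu> J by unfold_locales (fact aut N dom s\<nu> J)+
    have "weakly_elliptic cor J \<sigma> (w \<circ> \<sigma>) \<longleftrightarrow> c2 (w \<circ> \<sigma>) \<nu>"
      using sg.weakly_elliptic_c2[OF wJ] sg.c2_weakly_elliptic[OF wJ _ tw.n_pos tw.z_n] by blast
    then show ?thesis unfolding c2y[OF y(1)] y(2) unfolding w(3) tw.fin_y .
  qed
  show ?thesis
    unfolding \<nu>_def[symmetric] J_def[symmetric]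
  proof (intro conjI)
    show "nice \<Phi> cor \<Delta> Cl \<longleftrightarrow> (\<exists>y\<in>Cl. cond2 \<Phi> cor y)" using nice y1 by blast
    show "nice \<Phi> cor \<Delta> Cl \<longleftrightarrow> (\<forall>y\<in>Cl. cond2 \<Phi> cor y)" using nice y1 by blast
    show "nice \<Phi> cor \<Delta> Cl \<longleftrightarrow> (\<exists>y\<in>Cl. newton y = \<nu> \<and> weakly_elliptic cor J \<sigma> (fin y))"
      using nice we ex by blast
    show "nice \<Phi> cor \<Delta> Cl \<longleftrightarrow> (\<forall>y\<in>Cl. newton y = \<nu> \<longrightarrow> weakly_elliptic cor J \<sigma> (fin y))"
      using nice we ex by blast
  qed
qed

end
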